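(* Let $q$ be a prime power, $n\ge 2$, and let $\mathcal{L}$ be a non-empty set of lines of $\mathrm{PG}(n,q)$. Then $\mathcal{L}$ is the line set of a naturally embedded split Cayley hexagon $\mathbf{H}(q)$ in $\mathrm{PG}(6,q)$ if and only if $\mathcal{L}$ satisfies all of the following: (Pt) every point of $\mathrm{PG}(n,q)$ is incident with either $0$ or $q+1$ elements of $\mathcal{L}$; (Pl) every plane of $\mathrm{PG}(n,q)$ contains either $0$, $1$ or $q+1$ elements of $\mathcal{L}$; (Sd) every solid ($3$-dimensional subspace) of $\mathrm{PG}(n,q)$ contains either $0$, $1$, $q+1$ or $2q+1$ elements of $\mathcal{L}$; (Hp') every $5$-dimensional subspace of $\mathrm{PG}(n,q)$ contains at most $q^4-q^3+3q^2+2q$ elements of $\mathcal{L}$; (To) $|\mathcal{L}|\le q^5+q^4+q^3+q^2+q+1$.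
   Context: A line is said to be contained in (incident with) a subspace if it is a subset of it. The natural embedding of the split Cayley hexagon $\mathbf{H}(q)$ in $\mathrm{PG}(6,q)$ with homogeneous coordinates $(x_0,\dots,x_6)$: its points are the points of the parabolic quadric $\mathbf{Q}(6,q)$ given by $x_0x_4+x_1x_5+x_2x_6=x_3^2$, and its lines are those lines of $\mathbf{Q}(6,q)$ whose Grassmann coordinates $p_{ij}=x_iy_j-x_jy_i$ (for a line spanned by points $x,y$) satisfy $p_{12}=p_{34}$, $p_{54}=p_{32}$, $p_{20}=p_{35}$, $p_{65}=p_{30}$, $p_{01}=p_{36}$, $p_{46}=p_{31}$. "$\mathcal{L}$ is the line set of a naturally embedded split Cayley hexagon in $\mathrm{PG}(6,q)$" means that $\mathcal{L}$ spans a $6$-dimensional subspace of $\mathrm{PG}(n,q)$ and, up to a projectivity, $\mathcal{L}$ is exactly the line set of this natural embedding of $\mathbf{H}(q)$. *)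

theory Defs
  imports Complex_Main "HOL-Library.Function_Algebras"
begin

text \<open>Vectors of F^(n+1) are functions nat => F vanishing beyond index n.
  Projective subspaces of PG(n,q) of projective dimension k are linear
  subspaces of F^(n+1) of (vector) dimension k+1; q = CARD(F).\<close>

definition scl :: "'a::field \<Rightarrow> (nat \<Rightarrow> 'a) \<Rightarrow> (nat \<Rightarrow> 'a)" where
  "scl c v = (\<lambda>i. c * v i)"

definition pvec :: "nat \<Rightarrow> (nat \<Rightarrow> 'a::field) set" where
  "pvec n = {v. \<forall>i>n. v i = 0}"

definition psub :: "nat \<Rightarrow> nat \<Rightarrow> (nat \<Rightarrow> 'a::field) set set" where
  "psub n k = {W. W \<subseteq> pvec n \<and> module.subspace scl W \<and> vector_space.dim scl W = k + 1}"

abbreviation "points n \<equiv> psub n 0"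
abbreviation "lines n \<equiv> psub n 1"
abbreviation "planes n \<equiv> psub n 2"
abbreviation "solids n \<equiv> psub n 3"

definition gr :: "(nat \<Rightarrow> 'a::field) \<Rightarrow> (nat \<Rightarrow> 'a) \<Rightarrow> nat \<Rightarrow> nat \<Rightarrow> 'a" where
  "gr x y i j = x i * y j - x j * y i"

definition quad :: "(nat \<Rightarrow> 'a::field) \<Rightarrow> bool" where
  "quad x \<longleftrightarrow> x 0 * x 4 + x 1 * x 5 + x 2 * x 6 = x 3 ^ 2"

definition hex_lines :: "(nat \<Rightarrow> 'a::field) set set" where
  "hex_lines = {L. L \<in> lines 6 \<and> (\<forall>v\<in>L. quad v) \<and>
     (\<exists>x y. L = module.span scl {x, y} \<and>
        gr x y 1 2 = gr x y 3 4 \<and> gr x y 5 4 = gr x y 3 2 \<and>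
        gr x y 2 0 = gr x y 3 5 \<and> gr x y 6 5 = gr x y 3 0 \<and>
        gr x y 0 1 = gr x y 3 6 \<and> gr x y 4 6 = gr x y 3 1)}"

definition emb :: "nat \<Rightarrow> (nat \<Rightarrow> nat \<Rightarrow> 'a::field) \<Rightarrow> (nat \<Rightarrow> 'a) \<Rightarrow> (nat \<Rightarrow> 'a)" where
  "emb n A v = (\<lambda>i. if i \<le> n then (\<Sum>j\<le>6. A i j * v j) else 0)"

text \<open>L is the line set of a naturally embedded H(q) in a PG(6,q) inside PG(n,q):
  L spans a 6-dimensional (projective) subspace and is the image of the
  H(q) line set under a projectivity from PG(6,q) onto that subspace.\<close>
definition is_natural_hexagon :: "nat \<Rightarrow> (nat \<Rightarrow> 'a::field) set set \<Rightarrow> bool" where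
  "is_natural_hexagon n L \<longleftrightarrow>
     module.span scl (\<Union>L) \<in> psub n 6 \<and>
     (\<exists>A. inj_on (emb n A) (pvec 6) \<and> L = (\<lambda>M. emb n A ` M) ` hex_lines)"

end

theory Submission
  imports Defs "HOL-Library.Cardinality" "HOL-Library.FuncSet"
begin

text \<open>
Suppose the five conditions hold. By (Pt), (Pl) and (Sd) the lines through a point form a planar
pencil and no solid contains three pencils, which excludes triangles and quadrangles. If there were a
pentagon, its span would be a four-dimensional projective subspace; counting its lines once through
its solids (a variance inequality), once against the total (To), and once modulo q leaves two
extremal cases, and these contradict (Hp') in a five-dimensional subspace through an outer point.
So the lines form a generalized hexagon of order (q,q). Counting in hyperplanes then gives
projective dimension six, and the points not opposite a given point fill a hyperplane. Two opposite
points determine a hyperplane whose hexagon points lie in two disjoint planes in duality; reguli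
between these planes give dual bases, and points outside the hyperplane fix the
remaining scalars, so that all lines satisfy the standard equations.

Conversely, automorphisms of the standard model are transitive on singular points, so each condition
only has to be checked at the first base point.
\<close>

section \<open>Subspaces of a finite coordinate space\<close>

text \<open>The set \<open>CU U\<close> of points whose whole pencil lies in a subspace
  \<open>U\<close> carries most of the argument. Two lines through a point span its pencil, so a
  point on a line of \<open>U\<close> has either one or all \<open>q + 1\<close> of its lines in
  \<open>U\<close>; \<open>flags_U\<close> and \<open>total_ge\<close> turn these two types into
  numerical relations.

  In a hyperplane of a hexagon \<open>CU H\<close> is closed under projection: it is a subhexagon of
  order (s,q) or lies in a ball. Since a hyperplane meets every line, \<open>total_ge\<close>
  becomes an equality, and the resulting polynomial in s leaves s = 1. A thin subhexagon is a
  doubled projective plane, hence the two planes in duality.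

  Against a pentagon, the variance inequality is a quadratic condition on the number of lines in its
  span. It fails between the lower bound forced by the pentagon and the upper bound forced by (To),
  apart from two values at the top. Its right side grows with the defects of the degrees in
  \<open>CU U\<close> from \<open>q + 1\<close>, so the least degree governs the cases. The bound in
  (Hp') is exceeded by the lines at points within two steps of an outer point, even if q^2 lines
  miss the span.\<close>

interpretation V: vector_space scl
 by unfold_locales (auto simp: scl_def fun_eq_iff algebra_simps)

text \<open>Vector dimension \<open>k\<close>, one more than the projective dimension, is recorded
  through the cardinality \<open>q^k\<close>; dimension arguments then reduce to counting.\<close>

definition sub :: "(nat => 'a::{field,finite}) set => nat => bool" where
 "sub W k \<longleftrightarrow> V.subspace W & card W = CARD('a) ^ k"

definition ssum :: "(nat => 'a::field) set => (nat => 'a) set => (nat => 'a) set" (infixl "\<oplus>" 65) where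
 "A \<oplus> B = {a + b |a b. a : A & b : B}"

text \<open>One representative for each projective point: the vector whose first nonzero coordinate
  is 1. Points can then be counted as elements of a finite set of vectors instead of as
  one-dimensional subspaces.\<close>

definition NV :: "(nat => 'a::field) set" where
 "NV = {v. EX i. v i = 1 & (ALL j<i. v j = 0)}"

lemma card_field_ge_2: "CARD('a::{field,finite}) >= 2"
proof -
 have "card {0::'a, 1} <= CARD('a)" by (intro card_mono) auto
 thus ?thesis by simp
qed

lemma card_field_gt_1 [simp]: "Suc 0 < CARD('a::{field,finite})"
 using card_field_ge_2[where 'a='a] by linarith

lemma sub_subspace: "sub W k ==> V.subspace W"
 by (simp add: sub_def)

lemma sub_card: "sub (W :: (nat => 'a::{field,finite}) set) k ==> card W = CARD('a) ^ k"
 by (simp add: sub_def)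

lemma sub_finite: "sub W k ==> finite W"
 unfolding sub_def using card_field_ge_2 by (metis card_ge_0_finite not_gr_zero power_not_zero not_numeral_le_zero)

lemma sub_dim:
 fixes W :: "(nat => 'a::{field,finite}) set"
 assumes "V.subspace W" "finite W"
 shows "sub W (V.dim W)"
proof -
 obtain B where B: "B \<subseteq> W" "V.independent B" "W \<subseteq> V.span B" "card B = V.dim W"
  using V.basis_exists by blast
 have fB: "finite B" using B(1) assms(2) finite_subset by blast
 have WB: "W = V.span B" using B assms(1) V.span_minimal by blast
 let ?f = "%u. \<Sum>v\<in>B. scl (u v) v"
 have "V.span B = ?f ` (B \<rightarrow>\<^sub>E (UNIV :: 'a set))"
 proof -
  \<comment> \<open>Coefficient functions are restricted to \<open>B\<close>, so that functions
    agreeing on \<open>B\<close> are not counted twice.\<close>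
  have "?f u : ?f ` (B \<rightarrow>\<^sub>E (UNIV :: 'a set))" for u
   by (intro image_eqI[of _ _ "restrict u B"]) (auto intro!: sum.cong)
  thus ?thesis unfolding V.span_finite[OF fB] by auto
 qed
 moreover have "inj_on ?f (B \<rightarrow>\<^sub>E (UNIV :: 'a set))"
 proof (rule inj_onI)
  fix u w assume uw: "u : B \<rightarrow>\<^sub>E (UNIV :: 'a set)" "w : B \<rightarrow>\<^sub>E (UNIV :: 'a set)" "?f u = ?f w"
  have "(\<Sum>v\<in>B. scl (u v - w v) v) = 0"
   using uw(3) by (simp add: V.scale_left_diff_distrib sum_subtractf)
  hence "ALL v:B. u v - w v = 0"
   using V.independentD[OF B(2) fB subset_refl, of "%v. u v - w v"] by blast
  thus "u = w" by (intro PiE_ext[OF uw(1,2)]) (metis eq_iff_diff_eq_0)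
 qed
 ultimately have "card W = card (B \<rightarrow>\<^sub>E (UNIV :: 'a set))" unfolding WB by (simp only: card_image)
 also have "... = CARD('a) ^ card B" using fB by (simp add: card_PiE)
 finally show ?thesis using assms(1) B(4) by (auto simp: sub_def)
qed

lemma sub_exists:
 fixes W :: "(nat => 'a::{field,finite}) set"
 shows "V.subspace W ==> finite W ==> EX k. sub W k"
 using sub_dim by blast

lemma sub_unique:
 fixes W :: "(nat => 'a::{field,finite}) set"
 shows "sub W j ==> sub W k ==> j = k"
 by (auto simp: sub_def)

lemma finite_pvec: "finite (pvec n :: (nat => 'a::{field,finite}) set)"
proof -
 have "pvec n \<subseteq> {f. f ` {..n} \<subseteq> (UNIV::'a set) & (ALL x. x ~: {..n} --> f x = 0)}"
  by (auto simp: pvec_def)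
 thus ?thesis using finite_set_of_finite_funs[of "{..n}" "UNIV::'a set" 0]
  by (rule_tac finite_subset) (auto simp: image_subset_iff)
qed

lemma subspace_pvec: "V.subspace (pvec n)"
 by (auto simp: V.subspace_def pvec_def scl_def)

lemma psub_iff:
 fixes W :: "(nat => 'a::{field,finite}) set"
 shows "W : psub n k \<longleftrightarrow> W \<subseteq> pvec n & sub W (Suc k)"
proof -
 have "sub W (Suc k) \<longleftrightarrow> V.subspace W & V.dim W = Suc k" if "W \<subseteq> pvec n"
  using that finite_pvec finite_subset sub_dim sub_unique sub_subspace by metis
 thus ?thesis by (auto simp: psub_def)
qed

lemma subspace_scl: "V.subspace W ==> c ~= 0 ==> scl c x : W \<longleftrightarrow> x : W"
 by (metis V.scale_one V.scale_scale V.subspace_scale field_class.field_inverse)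

lemma NV_nonzero: "x : NV ==> x ~= 0"
 by (auto simp: NV_def)

lemma zero_notin_NV [simp]: "0 ~: NV"
 by (auto simp: NV_def)

lemma NV_exists:
 assumes "v ~= 0" obtains c where "c ~= 0" "scl c v : NV"
proof -
 obtain i where i: "v i ~= 0" using assms by (auto simp: fun_eq_iff)
 define k where "k = (LEAST i. v i ~= 0)"
 have k: "v k ~= 0" "ALL j<k. v j = 0" unfolding k_def using LeastI[of "%i. v i ~= 0" i, OF i] not_less_Least[of _ "%i. v i ~= 0"] by blast+
 show ?thesis by (rule that[of "inverse (v k)"]) (use k in \<open>auto simp: NV_def scl_def intro!: exI[of _ k]\<close>)
qed

lemma NV_unique: assumes "x : NV" "scl c x : NV" shows "c = 1"
proof -
 obtain i where i: "x i = 1" "ALL j<i. x j = 0" using assms(1) by (auto simp: NV_def)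
 obtain k where k: "c * x k = 1" "ALL j<k. c * x j = 0" using assms(2) by (auto simp: NV_def scl_def)
 have "i = k"
 proof (rule linorder_cases[of i k])
  assume "i < k" thus ?thesis using i k by (metis mult_cancel_left1 mult_zero_left zero_neq_one)
 next
  assume "k < i" thus ?thesis using i k by auto
 qed
 thus ?thesis using i k by auto
qed

lemma NV_inj: assumes "x : NV" "y : NV" "scl c x = scl d y" "c ~= 0" shows "x = y" "c = d"
proof -
 have d: "d ~= 0" using assms NV_nonzero[OF assms(1)] by auto
 have "y = scl (c / d) x"
  using arg_cong[OF assms(3), of "scl (1/d)"] d by simp
 thus "x = y" using NV_unique[OF assms(1), of "c/d"] assms(2) by simp
 thus "c = d" using assms(3) NV_nonzero[OF assms(2)] by simp
qed

lemma card_NV: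
 fixes W :: "(nat => 'a::{field,finite}) set"
 assumes "V.subspace W" "finite W"
 shows "card (W Int NV) * (CARD('a) - 1) = card W - 1"
proof -
 have "bij_betw (%(x,c). scl c x) ((W Int NV) \<times> (UNIV - {0})) (W - {0})"
 proof (rule bij_betw_imageI)
  show "inj_on (%(x,c). scl c x) ((W Int NV) \<times> (UNIV - {0}))"
   by (auto intro!: inj_onI dest: NV_inj)
  show "(%(x,c). scl c x) ` ((W Int NV) \<times> (UNIV - {0})) = W - {0}"
  proof (intro equalityI subsetI)
   fix v assume v: "v : W - {0}"
   then obtain c where c: "c ~= 0" "scl c v : NV" using NV_exists by blast
   have "v = (%(x,c). scl c x) (scl c v, 1 / c)" using c by simp
   moreover have "scl c v : W" using v assms(1) V.subspace_scale by blast
   ultimately show "v : (%(x,c). scl c x) ` ((W Int NV) \<times> (UNIV - {0}))"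
    using c by (intro image_eqI[of _ _ "(scl c v, 1/c)"]) auto
  qed (use assms V.subspace_scale NV_nonzero in fastforce)
 qed
 hence "card ((W Int NV) \<times> (UNIV - {0::'a})) = card (W - {0})" by (rule bij_betw_same_card)
 thus ?thesis using assms V.subspace_0[OF assms(1)] by (simp add: card_cartesian_product)
qed

lemma sub_NV: "sub (W :: (nat => 'a::{field,finite}) set) k ==> card (W Int NV) * (CARD('a) - 1) = CARD('a)^k - 1"
 using card_NV sub_subspace sub_finite sub_card by metis

text \<open>Division by \<open>q - 1\<close> is done in the integers, where the geometric sum
  formula holds without truncated subtraction.\<close>

lemma geom_cancel:
 assumes "(x::nat) * (q - 1) = q ^ k - 1" "q >= 2"
 shows "x = (\<Sum>i<k. q ^ i)"
proof -
 have "int (q ^ k - 1) = (int q - 1) * (\<Sum>i<k. int q ^ i)"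
  using assms(2) power_diff_1_eq[of "int q" k] by (simp add: of_nat_diff)
 hence "int x * (int q - 1) = (\<Sum>i<k. int q ^ i) * (int q - 1)"
  using assms(2) arg_cong[OF assms(1), of int] by (simp add: of_nat_diff mult.commute)
 hence "int x = (\<Sum>i<k. int q ^ i)" using assms(2) by simp
 thus ?thesis by (metis (mono_tags, lifting) of_nat_eq_iff of_nat_power of_nat_sum sum.cong)
qed

lemma card_sub_NV: "sub (W :: (nat => 'a::{field,finite}) set) k ==> card (W Int NV) = (\<Sum>i<k. CARD('a) ^ i)"
 using sub_NV geom_cancel card_field_ge_2 by metis

lemma ssum_subspace: "V.subspace A ==> V.subspace B ==> V.subspace (A \<oplus> B)"
 unfolding ssum_def using V.subspace_sums by blast

lemma ssum_upper1: "V.subspace B ==> A \<subseteq> A \<oplus> B"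
 unfolding ssum_def using V.subspace_0 by (metis (mono_tags, lifting) add.right_neutral mem_Collect_eq subsetI)

lemma ssum_upper2: "V.subspace A ==> B \<subseteq> A \<oplus> B"
 unfolding ssum_def using V.subspace_0 by (metis (mono_tags, lifting) add.left_neutral mem_Collect_eq subsetI)

lemma ssum_least: "V.subspace W ==> A \<subseteq> W ==> B \<subseteq> W ==> A \<oplus> B \<subseteq> W"
 unfolding ssum_def using V.subspace_add by blast

lemma ssum_subset_iff: "V.subspace A ==> V.subspace B ==> V.subspace W ==> A \<oplus> B \<subseteq> W \<longleftrightarrow> A \<subseteq> W & B \<subseteq> W"
 using ssum_least[of W A B] ssum_upper1[of B A] ssum_upper2[of A B] by auto

lemma span_subset_iff: "V.subspace W ==> V.span {x} \<subseteq> W \<longleftrightarrow> x : W"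
 using V.span_minimal[of "{x}" W] V.span_base[of x "{x}"] by auto

lemma ssumI: "a : A ==> b : B ==> a + b : A \<oplus> B"
 by (auto simp: ssum_def)

lemma ssumE: assumes "x : A \<oplus> B" obtains a b where "a : A" "b : B" "x = a + b"
 using assms by (auto simp: ssum_def)

lemma ssum_commute: "A \<oplus> B = B \<oplus> A"
 by (auto simp: ssum_def) (metis add.commute)+

text \<open>Addition maps pairs onto the sum, and the fibre over \<open>a + b\<close> is
  parametrised by the intersection: \<open>w\<close> corresponds to
  \<open>(a + w, b - w)\<close>.\<close>

lemma card_ssum:
 assumes "V.subspace A" "V.subspace B" "finite A" "finite B"
 shows "card (A \<oplus> B) * card (A Int B) = card A * card B"
proof -
 have "card (A \<times> B) = (\<Sum>x\<in>A \<oplus> B. card {p : A \<times> B. fst p + snd p = x})"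
 proof -
  have "A \<oplus> B = (%p. fst p + snd p) ` (A \<times> B)" by (auto simp: ssum_def image_def)
  thus ?thesis using sum.group[of "A \<times> B" "A \<oplus> B" "%p. fst p + snd p" "%_. 1::nat"] assms(3,4) by simp
 qed
 also have "... = (\<Sum>x\<in>A \<oplus> B. card (A Int B))"
 proof (rule sum.cong[OF refl])
  fix x assume "x : A \<oplus> B"
  then obtain a b where ab: "a : A" "b : B" "x = a + b" by (rule ssumE)
  have "bij_betw (%w. (a + w, b - w)) (A Int B) {p : A \<times> B. fst p + snd p = x}"
  proof (rule bij_betw_imageI)
   show "inj_on (%w. (a + w, b - w)) (A Int B)" by (auto intro: inj_onI)
   show "(%w. (a + w, b - w)) ` (A Int B) = {p : A \<times> B. fst p + snd p = x}"
   proof (intro equalityI subsetI)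
    fix p assume p: "p : {p : A \<times> B. fst p + snd p = x}"
    hence "fst p + snd p = a + b" using ab by simp
    hence "fst p = a + (b - snd p)" by (simp add: eq_diff_eq add_diff_eq)
    hence "fst p - a = b - snd p" by simp
    hence "fst p - a : A" "b - snd p : B" "fst p - a = b - snd p"
     using p ab V.subspace_diff[OF assms(1), of "fst p" a] V.subspace_diff[OF assms(2), of b "snd p"] by auto
    moreover have "p = (a + (fst p - a), b - (b - snd p))" by (simp add: prod_eq_iff)
    hence "p = (a + (fst p - a), b - (fst p - a))" using calculation(3) by metis
    ultimately show "p : (%w. (a + w, b - w)) ` (A Int B)" by (intro image_eqI[of _ _ "fst p - a"]) auto
   next
    fix p assume "p : (%w. (a + w, b - w)) ` (A Int B)"
    then obtain w where w: "w : A" "w : B" "p = (a + w, b - w)" by blast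
    thus "p : {p : A \<times> B. fst p + snd p = x}"
     using ab V.subspace_add[OF assms(1), of a w] V.subspace_diff[OF assms(2), of b w] by simp
   qed
  qed
  from bij_betw_same_card[OF this] show "card {p : A \<times> B. fst p + snd p = x} = card (A Int B)" by simp
 qed
 finally show ?thesis by (simp add: card_cartesian_product)
qed

lemma sub_mono: "sub (A :: (nat => 'a::{field,finite}) set) a ==> sub B b ==> A \<subseteq> B ==> a <= b"
 using card_mono[OF sub_finite, of B b A] sub_card[of A a] sub_card[of B b]
 by (simp add: power_increasing_iff)

lemma sub_eq: "sub (A :: (nat => 'a::{field,finite}) set) a ==> sub B b ==> A \<subseteq> B ==> b <= a ==> A = B"
 using card_seteq[OF sub_finite, of B b A] sub_card[of A a] sub_card[of B b]
 by (simp add: power_increasing_iff)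

text \<open>Grassmann's dimension formula, read off from the exponents in
  \<open>card_ssum\<close>.\<close>

lemma sub_Int:
 fixes A :: "(nat => 'a::{field,finite}) set"
 assumes "sub A a" "sub B b"
 obtains c where "sub (A Int B) c" "sub (A \<oplus> B) (a + b - c)" "c <= a" "c <= b"
proof -
 obtain c where c: "sub (A Int B) c"
  using sub_exists V.subspace_inter sub_subspace sub_finite assms by (metis finite_Int)
 have ca: "c <= a" "c <= b" using sub_mono[OF c assms(1)] sub_mono[OF c assms(2)] by auto
 have "card (A \<oplus> B) * CARD('a) ^ c = CARD('a) ^ (a + b)"
  using card_ssum[of A B] assms c by (simp add: sub_def sub_finite[OF assms(1)] sub_finite[OF assms(2)] power_add)
 also have "... = CARD('a) ^ (a + b - c) * CARD('a) ^ c" using ca by (simp add: power_add[symmetric])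
 finally have "card (A \<oplus> B) = CARD('a) ^ (a + b - c)" by simp
 hence "sub (A \<oplus> B) (a + b - c)" using ssum_subspace assms by (auto simp: sub_def)
 thus ?thesis using that c ca by blast
qed

lemma sub_Int_ge:
 fixes A :: "(nat => 'a::{field,finite}) set"
 assumes "sub A a" "sub B b" "sub W w" "A \<subseteq> W" "B \<subseteq> W"
 obtains c where "sub (A Int B) c" "a + b <= w + c"
proof -
 obtain c where c: "sub (A Int B) c" "sub (A \<oplus> B) (a + b - c)" using sub_Int[OF assms(1,2)] by metis
 have "a + b - c <= w" using sub_mono[OF c(2) assms(3)] ssum_least[OF sub_subspace[OF assms(3)] assms(4,5)] by simp
 thus ?thesis using that c by auto
qed

lemma sub_span1: "x ~= 0 ==> sub (V.span {x :: nat => 'a::{field,finite}}) 1"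
 unfolding sub_def V.span_singleton
 using card_image[of "%k. scl k x" UNIV] V.span_singleton[of x] V.subspace_span[of "{x}"]
 by (auto simp: inj_on_def)

lemma sub_1_eq: assumes "sub (W :: (nat => 'a::{field,finite}) set) 1" "x : W" "x ~= 0" shows "W = V.span {x}"
 using sub_eq[OF sub_span1[OF assms(3)] assms(1)] V.span_minimal[of "{x}" W] assms sub_subspace by auto

lemma sub_insert:
 fixes W :: "(nat => 'a::{field,finite}) set"
 assumes "sub W k" "x ~: W" shows "sub (W \<oplus> V.span {x}) (Suc k)"
proof -
 have x0: "x ~= 0" using assms V.subspace_0[OF sub_subspace] by auto
 obtain c where c: "sub (W Int V.span {x}) c" "sub (W \<oplus> V.span {x}) (k + 1 - c)" "c <= 1"
  using sub_Int[OF assms(1) sub_span1[OF x0]] by metis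
 have "c = 0"
 proof (rule ccontr)
  assume "c ~= 0" hence "c = 1" using c by simp
  hence "W Int V.span {x} = V.span {x}" using c sub_eq[OF _ sub_span1[OF x0]] by (metis inf_le2 order_refl)
  thus False using assms(2) V.span_base[of x "{x}"] by auto
 qed
 thus ?thesis using c by simp
qed

lemma sub_0: "sub W 0 ==> W = {0}"
 by (metis V.subspace_0 card_1_singletonE power_0 singletonD sub_def)

lemma sub_0_zero: "sub {0 :: nat => 'a::{field,finite}} 0"
 by (simp add: sub_def)

lemma sub_point:
 assumes "sub (W :: (nat => 'a::{field,finite}) set) k" "k >= 1" obtains x where "x : W" "x : NV"
proof -
 have "W ~= {0}"
 proof
  assume "W = {0}" hence "k = 0" using assms(1) sub_0_zero sub_unique by blast
  thus False using assms(2) by simp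
 qed
 then obtain v where v: "v : W" "v ~= 0" using V.subspace_0[OF sub_subspace[OF assms(1)]] by auto
 obtain c where "c ~= 0" "scl c v : NV" using NV_exists[OF v(2)] .
 thus ?thesis using that v V.subspace_scale[OF sub_subspace[OF assms(1)]] by blast
qed

lemma span_scl: "c ~= 0 ==> V.span {scl c x} = V.span {x}"
 unfolding V.span_eq using V.span_base[of x "{x}"] V.span_base[of "scl c x" "{scl c x}"]
 by (simp add: V.span_scale subspace_scl[OF V.subspace_span])

lemma NV_in_span1: assumes "x : NV" "y : NV" "y : V.span {x}" shows "y = x"
proof -
 obtain k where "y = scl k x" using assms(3) by (auto simp: V.span_singleton)
 thus ?thesis using NV_unique[of x k] assms by auto
qed

lemma sub_point2:
 assumes "sub (W :: (nat => 'a::{field,finite}) set) k" "k >= 2" "p : NV"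
 obtains x where "x : W" "x : NV" "x ~= p"
proof -
 have "~ W \<subseteq> V.span {p}" using sub_mono[OF assms(1) sub_span1[OF NV_nonzero[OF assms(3)]]] assms(2) by auto
 then obtain v where v: "v : W" "v ~: V.span {p}" by auto
 hence "v ~= 0" using V.span_zero by auto
 then obtain c where c: "c ~= 0" "scl c v : NV" using NV_exists by blast
 have "scl c v ~= p"
 proof
  assume "scl c v = p"
  hence "v : V.span {p}" using span_scl[OF c(1), of v] V.span_base[of v "{v}"] by auto
  thus False using v by simp
 qed
 thus ?thesis using that c v V.subspace_scale[OF sub_subspace[OF assms(1)]] by blast
qed

lemma two_points_ge2:
 assumes "sub (W :: (nat => 'a::{field,finite}) set) k" "x : W" "y : W" "x : NV" "y : NV" "x ~= y"
 shows "k >= 2"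
proof -
 have "y ~: V.span {x}" using NV_in_span1 assms by blast
 hence "sub (V.span {x} \<oplus> V.span {y}) 2" using sub_insert[OF sub_span1[OF NV_nonzero[OF assms(4)]]] by (simp add: numeral_2_eq_2)
 moreover have "V.span {x} \<oplus> V.span {y} \<subseteq> W"
  using assms sub_subspace by (intro ssum_least V.span_minimal) auto
 ultimately show ?thesis using sub_mono[OF _ assms(1)] by blast
qed

lemma line_eq:
 assumes "sub (l :: (nat => 'a::{field,finite}) set) 2" "sub m 2" "x : l" "y : l" "x : m" "y : m" "x : NV" "y : NV" "x ~= y"
 shows "l = m"
proof -
 obtain c where c: "sub (l Int m) c" using sub_Int[OF assms(1,2)] by metis
 have "c >= 2" using two_points_ge2[OF c] assms by auto
 thus ?thesis using sub_eq[OF c assms(1)] sub_eq[OF c assms(2)] by auto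
qed

lemma line_sub:
 assumes "sub (l :: (nat => 'a::{field,finite}) set) 2" "V.subspace W" "x : l" "y : l" "x : W" "y : W" "x : NV" "y : NV" "x ~= y"
 shows "l \<subseteq> W"
proof -
 obtain c where c: "sub (l Int W) c"
  using sub_exists[of "l Int W"] V.subspace_inter assms(1,2) sub_subspace sub_finite by blast
 have "c >= 2" using two_points_ge2[OF c] assms by auto
 thus ?thesis using sub_eq[OF c assms(1)] by auto
qed

lemma span2: "x : NV ==> y : NV ==> x ~= y ==> sub (V.span {x, y :: nat => 'a::{field,finite}}) 2"
proof -
 assume a: "x : NV" "y : NV" "x ~= y"
 hence "sub (V.span {x} \<oplus> V.span {y}) 2" using sub_insert[OF sub_span1[OF NV_nonzero[OF a(1)]]] NV_in_span1 by (metis numeral_2_eq_2 One_nat_def)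
 moreover have "V.span {x} \<oplus> V.span {y} = V.span {x, y}"
  using V.span_Un[of "{x}" "{y}"] by (simp add: ssum_def insert_commute)
 ultimately show ?thesis by simp
qed

text \<open>Used with \<open>u\<close> one below the dimension of \<open>U\<close>, so that its
  members are the hyperplanes of \<open>U\<close> through \<open>A\<close>; \<open>A = {0}\<close>
  gives all of them.\<close>

definition hyps :: "(nat => 'a::{field,finite}) set => nat => (nat => 'a) set => (nat => 'a) set set" where
 "hyps U u A = {S. sub S u & A \<subseteq> S & S \<subseteq> U}"

lemma finite_hyps: "finite U ==> finite (hyps U u A)"
 by (rule finite_subset[of _ "Pow U"]) (auto simp: hyps_def)

text \<open>Induction on the codimension of \<open>A\<close>, by counting pairs of a hyperplane
  \<open>S\<close> and a vector of \<open>S - A\<close> twice: the hyperplanes that contain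
  \<open>A\<close> and \<open>x\<close> are those through the larger space
  \<open>A \<oplus> V.span {x}\<close>.\<close>

lemma card_hyps:
 fixes U :: "(nat => 'a::{field,finite}) set"
 assumes "sub U (Suc u)" "sub A a" "A \<subseteq> U" "a <= u"
 shows "card (hyps U u A) = (\<Sum>i<Suc u - a. CARD('a) ^ i)"
proof -
 let ?q = "CARD('a)"
 have main: "card (hyps U u A) * (?q - 1) = ?q ^ (Suc u - a) - 1"
  using assms(2-4)
 proof (induction "u - a" arbitrary: a A)
  case 0
  hence au: "a = u" by simp
  have "hyps U u A = {A}" using 0 au sub_eq[of A u _ u] by (auto simp: hyps_def)
  thus ?case using au by simp
 next
  case (Suc k)
  let ?h = "card (hyps U u A)"
  have fU: "finite U" using assms(1) sub_finite by blast
  have fin: "finite (hyps U u A)" using finite_hyps[OF fU] .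
  have inner: "card (hyps U u (A \<oplus> V.span {x})) * (?q - 1) = ?q ^ (Suc u - Suc a) - 1"
   if "x : U - A" for x
  proof -
   have s: "sub (A \<oplus> V.span {x}) (Suc a)" using sub_insert[OF Suc.prems(1)] that by blast
   have "A \<oplus> V.span {x} \<subseteq> U"
    using that Suc.prems assms(1) sub_subspace by (intro ssum_least V.span_minimal) auto
   thus ?thesis using Suc.hyps(1)[of "Suc a" "A \<oplus> V.span {x}"] s Suc.hyps(2) by auto
  qed
  have eq: "{S : hyps U u A. x : S} = hyps U u (A \<oplus> V.span {x})" if "x : U - A" for x
  proof -
   have "A \<oplus> V.span {x} \<subseteq> S \<longleftrightarrow> A \<subseteq> S & x : S" if "sub S u" for S
    using ssum_subset_iff[OF sub_subspace[OF Suc.prems(1)] V.subspace_span sub_subspace[OF that]]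
     span_subset_iff[OF sub_subspace[OF that]] by simp
   thus ?thesis by (auto simp: hyps_def)
  qed
  have "?h * (?q ^ u - ?q ^ a) = (\<Sum>S\<in>hyps U u A. card (S - A))"
  proof -
   have "card (S - A) = ?q ^ u - ?q ^ a" if "S : hyps U u A" for S
    using that Suc.prems(1) by (auto simp: hyps_def card_Diff_subset sub_finite sub_card)
   thus ?thesis by simp
  qed
  also have "... = (\<Sum>S\<in>hyps U u A. \<Sum>x\<in>U - A. if x : S then 1 else 0)"
  proof (rule sum.cong[OF refl])
   fix S assume "S : hyps U u A"
   hence "S - A = {x : U - A. x : S}" by (auto simp: hyps_def)
   thus "card (S - A) = (\<Sum>x\<in>U - A. if x : S then 1 else 0)"
    using fU by (simp add: sum.If_cases Int_def)
  qed
  also have "... = (\<Sum>x\<in>U - A. \<Sum>S\<in>hyps U u A. if x : S then 1 else 0)" by (rule sum.swap)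
  also have "... = (\<Sum>x\<in>U - A. card (hyps U u (A \<oplus> V.span {x})))"
   using eq fin by (intro sum.cong refl) (simp add: sum.If_cases Int_def)
  finally have "?h * (?q ^ u - ?q ^ a) * (?q - 1) = (\<Sum>x\<in>U - A. card (hyps U u (A \<oplus> V.span {x})) * (?q - 1))"
   by (simp add: sum_distrib_right)
  also have "... = card (U - A) * (?q ^ (u - a) - 1)" using inner by simp
  also have "card (U - A) = ?q ^ Suc u - ?q ^ a"
   using assms(1) Suc.prems by (simp add: card_Diff_subset sub_finite sub_card)
  finally have e: "?h * (?q ^ u - ?q ^ a) * (?q - 1) = (?q ^ Suc u - ?q ^ a) * (?q ^ (u - a) - 1)" .
  have pu: "?q ^ u = ?q ^ a * ?q ^ (u - a)" "?q ^ Suc u = ?q ^ a * ?q ^ (Suc u - a)"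
   using Suc.prems(3) by (simp_all only: power_add[symmetric]) simp_all
  have "?q ^ a * (?q ^ (u - a) - 1) * (?h * (?q - 1)) = ?q ^ a * (?q ^ (u - a) - 1) * (?q ^ (Suc u - a) - 1)"
  proof -
   have "?q ^ u - ?q ^ a = ?q ^ a * (?q ^ (u - a) - 1)" "?q ^ Suc u - ?q ^ a = ?q ^ a * (?q ^ (Suc u - a) - 1)"
    unfolding pu by (simp_all add: right_diff_distrib')
   thus ?thesis using e by (simp only: mult.assoc mult.commute mult.left_commute)
  qed
  moreover have "?q ^ a * (?q ^ (u - a) - 1) ~= 0"
  proof -
   have "?q ^ (u - a) > 1" using Suc.hyps(2) by (metis Suc_neq_Zero card_field_gt_1 One_nat_def one_less_power neq0_conv)
   thus ?thesis by auto
  qed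
  ultimately show ?case by (metis mult_left_cancel)
 qed
 show ?thesis by (rule geom_cancel[OF main card_field_ge_2])
qed

lemma hyps_exists:
 fixes U :: "(nat => 'a::{field,finite}) set"
 assumes "sub U (Suc u)" "sub A a" "A \<subseteq> U" "a <= u"
 obtains S where "sub S u" "A \<subseteq> S" "S \<subseteq> U"
proof -
 have "card (hyps U u A) ~= 0"
  using card_hyps[OF assms] assms(4) by (simp add: Suc_diff_le sum.lessThan_Suc_shift del: sum.lessThan_Suc)
 hence "hyps U u A ~= {}" by auto
 thus ?thesis using that by (auto simp: hyps_def)
qed

section \<open>Line sets whose pencils are planar\<close>

text \<open>The consequences of (Pt), (Pl) and (Sd) on which the geometry rests. Both the given set
  and the standard line set are shown to satisfy them, so the theory below serves both directions of
  the theorem.\<close>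

locale flat =
 fixes L :: "(nat => 'a::{field,finite}) set set" and q :: nat
 assumes q_card: "q = CARD('a)"
  and finite_L: "finite L"
  and L_nonempty: "L ~= {}"
  and line_sub2: "l : L ==> sub l 2"
  and degree: "x : NV ==> l : L ==> x : l ==> card {l : L. x : l} = q + 1"
  and pencil: "x : NV ==> l : L ==> x : l ==> sub (\<Union>{l : L. x : l}) 3"
  and pencil_lines: "x : NV ==> l : L ==> x : l ==> m : L ==> m \<subseteq> \<Union>{l : L. x : l} ==> x : m"
  and three_pencils: "sub S 4 ==> x : NV ==> y : NV ==> z : NV ==> x : \<Union>L ==> y : \<Union>L ==> z : \<Union>L ==>
   \<Union>{l : L. x : l} \<subseteq> S ==> \<Union>{l : L. y : l} \<subseteq> S ==> \<Union>{l : L. z : l} \<subseteq> S ==> x = y | x = z | y = z"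
begin

definition P where "P = {x : NV. EX l:L. x : l}"
definition Pi where "Pi x = \<Union>{l : L. x : l}"
definition Ln where "Ln x = {l : L. x : l}"
definition col where "col x y \<longleftrightarrow> (EX l:L. x : l & y : l)"
definition nbr where "nbr x = {y : P. y ~= x & col x y}"
text \<open>Points that are interior to \<open>U\<close>. Together with \<open>BU U\<close> they
  exhaust the points on lines of \<open>U\<close>, see \<open>LU_degree\<close>.\<close>

definition CU where "CU U = {x : P. Pi x \<subseteq> U}"
definition LU where "LU U = {l : L. l \<subseteq> U}"
definition Lux where "Lux U x = {l : LU U. x : l}"
definition BU where "BU U = {x : P. card (Lux U x) = 1}"

lemma q_ge2: "q >= 2" using card_field_ge_2 q_card by metis

lemma P_NV: "x : P ==> x : NV" by (simp add: P_def)
lemma P_nonzero: "x : P ==> x ~= 0" using P_NV NV_nonzero by blast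
lemma LP: "l : L ==> x : l ==> x : NV ==> x : P" by (auto simp: P_def)

lemma line_finite: "l : L ==> finite l" using line_sub2 sub_finite by blast
lemma line_subspace: "l : L ==> V.subspace l" using line_sub2 sub_subspace by blast

lemma finite_P: "finite P"
proof -
 have "P \<subseteq> \<Union>L" by (auto simp: P_def)
 thus ?thesis using finite_L line_finite finite_subset by blast
qed

lemma line_card: "l : L ==> card (l Int NV) = q + 1"
 using card_sub_NV[OF line_sub2] q_card by (simp add: numeral_2_eq_2)

lemma Pi_sub: "x : P ==> sub (Pi x) 3"
 unfolding Pi_def P_def using pencil by blast

lemma Pi_subspace: "x : P ==> V.subspace (Pi x)" using Pi_sub sub_subspace by blast

lemma Pi_finite: "x : P ==> finite (Pi x)" using Pi_sub sub_finite by blast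

lemma Pi_card: "x : P ==> card (Pi x Int NV) = q^2 + q + 1"
 using card_sub_NV[OF Pi_sub] q_card by (simp add: numeral_3_eq_3 power2_eq_square)

lemma Ln_card: "x : P ==> card (Ln x) = q + 1"
 unfolding Ln_def P_def using degree by blast

lemma Ln_finite: "finite (Ln x)" using finite_L by (simp add: Ln_def)

lemma col_sym: "col x y ==> col y x" by (auto simp: col_def)
lemma col_refl: "x : P ==> col x x" by (auto simp: col_def P_def)
lemma colI: "l : L ==> x : l ==> y : l ==> col x y" by (auto simp: col_def)
lemma mem_Pi: "y : Pi x \<longleftrightarrow> col x y" by (auto simp: Pi_def col_def)
lemma Pi_self: "x : P ==> x : Pi x" using mem_Pi col_refl by blast
lemma Pi_P: "y : Pi x ==> y : NV ==> y : P" by (auto simp: Pi_def P_def)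
lemma Ln_Pi: "l : L ==> x : l ==> l \<subseteq> Pi x" by (auto simp: Pi_def)

lemma line_unique: "l : L ==> m : L ==> x : P ==> y : P ==> x ~= y ==> x : l ==> y : l ==> x : m ==> y : m ==> l = m"
 using line_eq[of l m x y] line_sub2 P_NV by blast

lemma line_subset: "l : L ==> V.subspace W ==> x : P ==> y : P ==> x ~= y ==> x : l ==> y : l ==> x : W ==> y : W ==> l \<subseteq> W"
 using line_sub[of l W x y] line_sub2 P_NV by blast

lemma Pi_lines: "x : P ==> m : L ==> m \<subseteq> Pi x ==> x : m"
 unfolding Pi_def P_def using pencil_lines by blast

lemma Pi_eq_sum:
 assumes "x : P" "l : L" "m : L" "l ~= m" "x : l" "x : m"
 shows "Pi x = l \<oplus> m"
proof -
 obtain c where c: "sub (l Int m) c" "sub (l \<oplus> m) (2 + 2 - c)" "c <= 2"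
  using sub_Int[OF line_sub2[OF assms(2)] line_sub2[OF assms(3)]] by metis
 have "c ~= 0" using sub_0 c(1) assms P_nonzero by auto
 moreover have "c ~= 2" using c(1) sub_eq[of "l Int m" 2 l 2] sub_eq[of "l Int m" 2 m 2] line_sub2 assms by blast
 ultimately have "c = 1" using c(3) by simp
 hence s: "sub (l \<oplus> m) 3" using c(2) by (simp add: numeral_3_eq_3)
 have "l \<oplus> m \<subseteq> Pi x" using ssum_least[OF Pi_subspace[OF assms(1)]] Ln_Pi assms by blast
 thus ?thesis using sub_eq[OF s Pi_sub[OF assms(1)]] by simp
qed

lemma Pi_subset:
 assumes "x : P" "l : L" "m : L" "l ~= m" "x : l" "x : m" "V.subspace W" "l \<subseteq> W" "m \<subseteq> W"
 shows "Pi x \<subseteq> W"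
 using Pi_eq_sum[OF assms(1-6)] ssum_least[OF assms(7-9)] by simp

lemma two_lines: assumes "x : P" obtains l m where "l : L" "m : L" "l ~= m" "x : l" "x : m"
proof -
 have "card (Ln x) >= 2" using Ln_card[OF assms] q_ge2 by simp
 then obtain l m where "l : Ln x" "m : Ln x" "l ~= m"
  by (metis card_le_Suc0_iff_eq Ln_finite not_less_eq_eq numeral_2_eq_2)
 thus ?thesis using that by (auto simp: Ln_def)
qed

lemma other_line: assumes "x : P" "finite A" "card A <= q" obtains l where "l : L" "x : l" "l ~: A"
proof -
 have "~ Ln x \<subseteq> A" using card_mono[OF assms(2), of "Ln x"] Ln_card[OF assms(1)] assms(3) by auto
 thus ?thesis using that by (auto simp: Ln_def)
qed

lemma other_point: assumes "l : L" "finite A" "card A <= q" obtains x where "x : P" "x : l" "x ~: A"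
proof -
 have "~ l Int NV \<subseteq> A" using card_mono[OF assms(2), of "l Int NV"] line_card[OF assms(1)] assms(3) by auto
 thus ?thesis using that LP[OF assms(1)] by auto
qed

lemma Pi_inj: assumes "x : P" "y : P" "Pi x \<subseteq> Pi y" shows "x = y"
proof (rule ccontr)
 assume n: "x ~= y"
 obtain l m where lm: "l : L" "m : L" "l ~= m" "x : l" "x : m" using two_lines[OF assms(1)] .
 have "y : l" "y : m" using Pi_lines[OF assms(2)] lm Ln_Pi assms(3) by blast+
 thus False using line_unique[OF lm(1,2) assms(1,2) n] lm by blast
qed

lemma three_Pi: assumes "sub S 4" "x : P" "y : P" "z : P" "Pi x \<subseteq> S" "Pi y \<subseteq> S" "Pi z \<subseteq> S"
 shows "x = y | x = z | y = z"
 using three_pencils[OF assms(1), of x y z] assms unfolding P_def Pi_def by blast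

text \<open>The line through \<open>y\<close> and \<open>z\<close> has two points in the plane
  \<open>Pi x\<close>, hence lies in it, and the only lines of \<open>L\<close> in that plane are
  those through \<open>x\<close>.\<close>

lemma triangle:
 assumes "x : P" "y : P" "z : P" "col x y" "col x z" "col y z" "y ~= z"
 shows "EX l:L. x : l & y : l & z : l"
proof -
 obtain m where m: "m : L" "y : m" "z : m" using assms(6) by (auto simp: col_def)
 have "m \<subseteq> Pi x" using line_subset[OF m(1) Pi_subspace[OF assms(1)] assms(2,3,7) m(2,3)] assms(4,5) mem_Pi by blast
 thus ?thesis using Pi_lines[OF assms(1) m(1)] m by blast
qed

lemma common_nbr_unique:
 assumes "x : P" "y : P" "w : P" "w' : P" "~ col x y" "col x w" "col y w" "col x w'" "col y w'"
 shows "w = w'"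
proof (rule ccontr)
 assume n: "w ~= w'"
 obtain c where c: "sub (Pi x Int Pi y) c" "sub (Pi x \<oplus> Pi y) (3 + 3 - c)" "c <= 3"
  using sub_Int[OF Pi_sub[OF assms(1)] Pi_sub[OF assms(2)]] by metis
 have xy: "x ~= y" using assms col_refl by auto
 have "c >= 2" using two_points_ge2[OF c(1), of w w'] assms n P_NV mem_Pi by blast
 moreover have "c ~= 3"
 proof
  assume "c = 3"
  hence "Pi x Int Pi y = Pi x" using sub_eq[OF c(1) Pi_sub[OF assms(1)]] by auto
  thus False using Pi_inj[OF assms(1,2)] xy by blast
 qed
 ultimately have "c = 2" using c(3) by simp
 hence s: "sub (Pi x \<oplus> Pi y) 4" using c(2) by simp
 have up: "Pi x \<subseteq> Pi x \<oplus> Pi y" "Pi y \<subseteq> Pi x \<oplus> Pi y"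
  using ssum_upper1 ssum_upper2 Pi_subspace assms(1,2) by blast+
 obtain l m where lm: "l : L" "x : l" "w : l" "m : L" "y : m" "w : m" using assms(6,7) by (auto simp: col_def)
 have "l ~= m" using lm assms(5) colI by blast
 hence "Pi w \<subseteq> Pi x \<oplus> Pi y"
  using Pi_subset[OF assms(3) lm(1,4) _ lm(3,6) sub_subspace[OF s]] Ln_Pi[OF lm(1,2)] Ln_Pi[OF lm(4,5)] up by blast
 hence "w = x | w = y" using three_Pi[OF s assms(1,2,3) up] xy by blast
 thus False using assms col_sym by blast
qed

lemma nbr_card: "x : P ==> card (nbr x) = q^2 + q"
proof -
 assume x: "x : P"
 have "nbr x = (Pi x Int NV) - {x}" using mem_Pi Pi_P P_NV by (auto simp: nbr_def)
 thus ?thesis using Pi_card[OF x] Pi_self[OF x] P_NV[OF x] Pi_finite[OF x] by simp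
qed

lemma nbr_finite: "finite (nbr x)" using finite_P by (simp add: nbr_def)

lemma card_P: "card P = card L"
proof -
 have "card P * (q + 1) = (\<Sum>x\<in>P. \<Sum>l\<in>L. if x : l then 1 else 0)"
  using Ln_card finite_L by (simp add: sum.If_cases Ln_def Int_def)
 also have "... = (\<Sum>l\<in>L. \<Sum>x\<in>P. if x : l then 1 else 0)" by (rule sum.swap)
 also have "... = (\<Sum>l\<in>L. q + 1)"
 proof (rule sum.cong[OF refl])
  fix l assume l: "l : L"
  have "{x : P. x : l} = l Int NV" using l LP P_NV by auto
  thus "(\<Sum>x\<in>P. if x : l then 1 else 0) = q + 1"
   using line_card[OF l] finite_P by (simp add: sum.If_cases Int_def)
 qed
 finally have "card P * (q + 1) = card L * (q + 1)" by simp
 thus ?thesis using q_ge2 by (metis add_is_0 mult_right_cancel one_neq_zero)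
qed

section \<open>Lines and points inside a subspace\<close>

lemma LU_L: "l : LU U ==> l : L" by (simp add: LU_def)
lemma LU_finite: "finite (LU U)" using finite_L by (simp add: LU_def)
lemma CU_P: "x : CU U ==> x : P" by (simp add: CU_def)
lemma CU_finite: "finite (CU U)" using finite_P by (simp add: CU_def)
lemma BU_finite: "finite (BU U)" using finite_P by (simp add: BU_def)
lemma CU_mem: "x : CU U ==> x : U" using Pi_self by (auto simp: CU_def)

lemma CU_lines: "x : CU U ==> Lux U x = Ln x"
 by (auto simp: CU_def LU_def Ln_def Pi_def Lux_def)

lemma Lux_iff: "l : Lux U x \<longleftrightarrow> l : LU U & x : l" by (simp add: Lux_def)

lemma CU_line: "x : CU U ==> l : L ==> x : l ==> l : LU U"
 by (auto simp: CU_def LU_def Pi_def)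

lemma CU_I:
 assumes "x : P" "l : LU U" "m : LU U" "l ~= m" "x : l" "x : m" "V.subspace U"
 shows "x : CU U"
 using Pi_subset[OF assms(1) _ _ assms(4-7)] assms by (auto simp: CU_def LU_def)

text \<open>Two lines of \<open>U\<close> through \<open>x\<close> already span \<open>Pi x\<close>,
  so there is nothing between one line and all \<open>q + 1\<close>.\<close>

lemma LU_degree:
 assumes "x : P" "l : LU U" "x : l" "V.subspace U"
 shows "x : CU U | x : BU U" "~ (x : CU U & x : BU U)"
proof -
 show "x : CU U | x : BU U"
 proof (cases "EX m:LU U. x : m & m ~= l")
  case True thus ?thesis using CU_I[OF assms(1,2) _ _ assms(3) _ assms(4)] by blast
 next
  case False
  have "m = l" if "m : Lux U x" for m using that False unfolding Lux_iff by blast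
  moreover have "l : Lux U x" using assms(2,3) unfolding Lux_iff by blast
  ultimately have "Lux U x = {l}" by blast
  thus ?thesis using assms(1) by (simp add: BU_def)
 qed
 show "~ (x : CU U & x : BU U)" using CU_lines Ln_card[OF assms(1)] q_ge2 by (auto simp: BU_def)
qed

lemma BU_line: assumes "x : BU U" obtains l where "l : LU U" "x : l" "Lux U x = {l}"
proof -
 have "card (Lux U x) = 1" using assms by (simp add: BU_def)
 then obtain l where l: "Lux U x = {l}" by (rule card_1_singletonE)
 hence "l : Lux U x" by simp
 thus ?thesis using that[OF _ _ l] by (simp add: Lux_iff)
qed

lemma BU_mem: "x : BU U ==> x : U & x : P"
 using BU_line[of x U] by (auto simp: LU_def BU_def)

lemma BU_line_unique: assumes "x : BU U" "l : LU U" "x : l" "m : LU U" "x : m" shows "l = m"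
proof -
 obtain k where k: "Lux U x = {k}" using BU_line[OF assms(1)] .
 have "l : Lux U x" "m : Lux U x" using assms by (simp_all add: Lux_iff)
 thus ?thesis unfolding k by simp
qed

text \<open>Incident pairs within \<open>U\<close>: every line contributes \<open>q + 1\<close>, a
  point contributes 1 or \<open>q + 1\<close> according to its type.\<close>

lemma flags_U:
 assumes "V.subspace U"
 shows "card (LU U) * (q + 1) = card (BU U) + (q + 1) * card (CU U)"
proof -
 have "card (LU U) * (q + 1) = (\<Sum>l\<in>LU U. \<Sum>x\<in>P. if x : l then 1 else 0)"
 proof -
  have "(\<Sum>x\<in>P. if x : l then 1 else 0) = q + 1" if l: "l : LU U" for l
  proof -
   have "{x : P. x : l} = l Int NV" using LU_L[OF l] LP P_NV by auto
   thus ?thesis using line_card[OF LU_L[OF l]] finite_P by (simp add: sum.If_cases Int_def)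
  qed
  thus ?thesis by simp
 qed
 also have "... = (\<Sum>x\<in>P. \<Sum>l\<in>LU U. if x : l then 1 else 0)" by (rule sum.swap)
 also have "... = (\<Sum>x\<in>P. (if x : BU U then 1 else 0) + (if x : CU U then q + 1 else 0))"
 proof (rule sum.cong[OF refl])
  fix x assume x: "x : P"
  have s: "(\<Sum>l\<in>LU U. if x : l then 1 else 0) = card (Lux U x)"
   using LU_finite by (simp add: sum.If_cases Int_def Lux_def)
  show "(\<Sum>l\<in>LU U. if x : l then 1 else 0) = (if x : BU U then 1 else 0) + (if x : CU U then q + 1 else 0)"
  proof (cases "EX l:LU U. x : l")
   case True
   then obtain l where l: "l : LU U" "x : l" by blast
   show ?thesis
   proof (cases "x : CU U")
    case True thus ?thesis using LU_degree[OF x l assms] s CU_lines Ln_card[OF x] by simp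
   next
    case False hence "x : BU U" using LU_degree[OF x l assms] by blast
    thus ?thesis using False s by (simp add: BU_def)
   qed
  next
   case False
   hence e: "Lux U x = {}" by (auto simp: Lux_def)
   moreover have "x ~: CU U"
   proof
    assume "x : CU U"
    hence "Ln x = {}" using e CU_lines[of x U] by simp
    thus False using Ln_card[OF x] by simp
   qed
   moreover have "x ~: BU U" using e by (simp add: BU_def)
   ultimately show ?thesis using s by simp
  qed
 qed
 also have "... = card (BU U) + (q + 1) * card (CU U)"
 proof -
  have "P Int BU U = BU U" "P Int CU U = CU U" by (auto simp: BU_def CU_def)
  thus ?thesis using finite_P by (simp add: sum.distrib sum.If_cases Int_def[symmetric])
 qed
 finally show ?thesis .
qed

lemma line_meets_once:
 assumes "l : L" "~ l \<subseteq> U" "V.subspace U" "x : P" "y : P" "x : l" "y : l" "x : U" "y : U"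
 shows "x = y"
 using line_subset[OF assms(1,3,4,5)] assms by blast

text \<open>A line outside \<open>U\<close> has at most one point in \<open>U\<close>, so these
  lines are counted without repetition by their points in \<open>BU U\<close>.\<close>

definition hit where "hit U = {l : L. ~ l \<subseteq> U & (EX x:BU U. x : l)}"

lemma hit_card: assumes "V.subspace U" shows "card (hit U) = q * card (BU U)"
proof -
 have u: "hit U = (\<Union>x\<in>BU U. {l : Ln x. ~ l \<subseteq> U})" by (auto simp: hit_def Ln_def)
 have "card (hit U) = (\<Sum>x\<in>BU U. card {l : Ln x. ~ l \<subseteq> U})"
  unfolding u
 proof (rule card_UN_disjoint[OF BU_finite])
  show "ALL x:BU U. finite {l : Ln x. ~ l \<subseteq> U}" using Ln_finite by auto
  show "ALL x:BU U. ALL y:BU U. x ~= y --> {l : Ln x. ~ l \<subseteq> U} Int {l : Ln y. ~ l \<subseteq> U} = {}"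
  proof (intro ballI impI)
   fix x y assume xy: "x : BU U" "y : BU U" "x ~= y"
   have "False" if "l : L" "x : l" "y : l" "~ l \<subseteq> U" for l
    using line_meets_once[OF that(1,4) assms, of x y] BU_mem xy that by simp
   thus "{l : Ln x. ~ l \<subseteq> U} Int {l : Ln y. ~ l \<subseteq> U} = {}" unfolding Ln_def by blast
  qed
 qed
 also have "... = (\<Sum>x\<in>BU U. q)"
 proof (rule sum.cong[OF refl])
  fix x assume x: "x : BU U"
  have "{l : Ln x. ~ l \<subseteq> U} = Ln x - Lux U x" by (auto simp: Ln_def LU_def Lux_def)
  moreover have "Lux U x \<subseteq> Ln x" by (auto simp: Ln_def LU_def Lux_def)
  ultimately have "card {l : Ln x. ~ l \<subseteq> U} = card (Ln x) - card (Lux U x)"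
   using card_Diff_subset[of "Lux U x" "Ln x"] finite_subset[OF _ Ln_finite] by simp
  thus "card {l : Ln x. ~ l \<subseteq> U} = q" using x Ln_card BU_mem[OF x] by (simp add: BU_def)
 qed
 finally show ?thesis by simp
qed

text \<open>The lines inside \<open>U\<close> and the \<open>q\<close> further lines at each point
  of \<open>BU U\<close> are pairwise distinct. Through this lemma the bound (To) limits the lines
  inside a subspace.\<close>

lemma total_ge: assumes "V.subspace U"
 shows "card (LU U) + q * card (BU U) <= card L"
proof -
 have "card (LU U Un hit U) = card (LU U) + q * card (BU U)"
  using hit_card[OF assms] by (subst card_Un_disjoint) (use finite_L LU_finite in \<open>auto simp: hit_def LU_def\<close>)
 moreover have "LU U Un hit U \<subseteq> L" by (auto simp: hit_def LU_def)
 ultimately show ?thesis using card_mono[OF finite_L] by metis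
qed

lemma adj_solid:
 assumes "x : P" "y : nbr x" shows "sub (Pi x \<oplus> Pi y) 4"
proof -
 have y: "y : P" "y ~= x" "col x y" using assms by (auto simp: nbr_def)
 obtain c where c: "sub (Pi x Int Pi y) c" "sub (Pi x \<oplus> Pi y) (3 + 3 - c)" "c <= 3"
  using sub_Int[OF Pi_sub[OF assms(1)] Pi_sub[OF y(1)]] by metis
 have "x : Pi x Int Pi y" "y : Pi x Int Pi y" using y assms Pi_self mem_Pi col_sym by auto
 hence "c >= 2" using two_points_ge2[OF c(1), of x y] assms y P_NV by auto
 moreover have "c ~= 3"
 proof
  assume "c = 3"
  hence "Pi x Int Pi y = Pi x" using sub_eq[OF c(1) Pi_sub[OF assms(1)]] by auto
  thus False using Pi_inj[OF assms(1) y(1)] y by blast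
 qed
 ultimately have "c = 2" using c(3) by simp
 thus ?thesis using c(2) by simp
qed

text \<open>For every neighbour \<open>y\<close> in \<open>CU U\<close> the solid
  \<open>Pi x \<oplus> Pi y\<close> lies in \<open>U\<close>. These solids differ for different
  \<open>y\<close>, since no solid has three pencils, and any two of them share only
  \<open>Pi x\<close>. The set \<open>U - Pi x\<close> has room for
  \<open>(q^5 - q^3) / (q^4 - q^3) = q + 1\<close> of them.\<close>

lemma D_bound:
 assumes "sub U k" "k <= 5" "x : CU U"
 shows "card (nbr x Int CU U) <= q + 1"
proof -
 have x: "x : P" using assms(3) CU_P by blast
 have px: "Pi x \<subseteq> U" using assms(3) by (simp add: CU_def)
 let ?S = "%y. Pi x \<oplus> Pi y - Pi x"
 have inS: "Pi x \<subseteq> Pi x \<oplus> Pi y" "Pi y \<subseteq> Pi x \<oplus> Pi y" if "y : nbr x" for y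
  using that ssum_upper1[OF Pi_subspace[of y], of "Pi x"] ssum_upper2[OF Pi_subspace[OF x], of "Pi y"] by (simp_all add: nbr_def)
 have S4: "sub (Pi x \<oplus> Pi y) 4" if "y : nbr x" for y using adj_solid[OF x that] .
 have cS: "card (?S y) = q^4 - q^3" if y: "y : nbr x" for y
 proof -
  have "card (?S y) = card (Pi x \<oplus> Pi y) - card (Pi x)"
   using card_Diff_subset[OF Pi_finite[OF x] inS(1)[OF y]] .
  thus ?thesis using sub_card[OF S4[OF y]] sub_card[OF Pi_sub[OF x]] q_card by simp
 qed
 have disj: "?S y Int ?S z = {}" if yz: "y : nbr x" "z : nbr x" "y ~= z" for y z
 proof (rule ccontr)
  assume "?S y Int ?S z ~= {}"
  then obtain v where v: "v : Pi x \<oplus> Pi y" "v : Pi x \<oplus> Pi z" "v ~: Pi x" by auto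
  have "sub (Pi x \<oplus> V.span {v}) 4" using sub_insert[OF Pi_sub[OF x] v(3)] by (simp add: eval_nat_numeral)
  moreover have "Pi x \<oplus> V.span {v} \<subseteq> Pi x \<oplus> Pi w" if "w : nbr x" "v : Pi x \<oplus> Pi w" for w
   using ssum_subset_iff[OF Pi_subspace[OF x] V.subspace_span sub_subspace[OF S4[OF that(1)]]]
    span_subset_iff[OF sub_subspace[OF S4[OF that(1)]]] inS[OF that(1)] that by simp
  ultimately have "Pi x \<oplus> V.span {v} = Pi x \<oplus> Pi w" if "w : nbr x" "v : Pi x \<oplus> Pi w" for w
   using sub_eq[OF _ S4[OF that(1)]] that by blast
  hence "Pi x \<oplus> Pi y = Pi x \<oplus> Pi z" using v yz by metis
  hence "Pi z \<subseteq> Pi x \<oplus> Pi y" using inS(2)[OF yz(2)] by simp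
  thus False using three_Pi[OF S4[OF yz(1)], of x y z] inS[OF yz(1)] x yz by (auto simp: nbr_def)
 qed
 have "(\<Union>y\<in>nbr x Int CU U. ?S y) \<subseteq> U - Pi x"
  using ssum_least[OF sub_subspace[OF assms(1)] px] by (auto simp: CU_def)
 hence "card (\<Union>y\<in>nbr x Int CU U. ?S y) <= card (U - Pi x)"
  using card_mono sub_finite[OF assms(1)] by (metis finite_Diff)
 moreover have "card (\<Union>y\<in>nbr x Int CU U. ?S y) = (\<Sum>y\<in>nbr x Int CU U. card (?S y))"
 proof (rule card_UN_disjoint)
  show "finite (nbr x Int CU U)" using nbr_finite by simp
  show "ALL y:nbr x Int CU U. finite (?S y)" using S4 sub_finite by blast
  show "ALL y:nbr x Int CU U. ALL z:nbr x Int CU U. y ~= z --> ?S y Int ?S z = {}" using disj by blast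
 qed
 moreover have "card (U - Pi x) <= q^5 - q^3"
 proof -
  have "card (U - Pi x) = q^k - q^3"
   using card_Diff_subset[OF Pi_finite[OF x] px] sub_card[OF assms(1)] sub_card[OF Pi_sub[OF x]] q_card by simp
  moreover have "q^k <= q^5" using assms(2) q_ge2 by (simp add: power_increasing)
  ultimately show ?thesis by simp
 qed
 ultimately have le: "card (nbr x Int CU U) * (q^4 - q^3) <= q^5 - q^3" using cS by simp
 have "q^5 - q^3 = (q + 1) * (q^4 - q^3)"
 proof -
  have "int (q^5 - q^3) = int ((q + 1) * (q^4 - q^3))"
   using q_ge2 power_increasing[of 3 5 q] power_increasing[of 3 4 q]
   by (simp add: of_nat_diff algebra_simps eval_nat_numeral)
  thus ?thesis using of_nat_eq_iff by blast
 qed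
 hence "card (nbr x Int CU U) * (q^4 - q^3) <= (q + 1) * (q^4 - q^3)" using le by presburger
 moreover have "q^4 - q^3 > 0" using q_ge2 power_strict_increasing[of 3 4 q] by simp
 ultimately show ?thesis using mult_le_cancel2 by blast
qed

end

section \<open>Generalized hexagons\<close>

lemma card_by_rel:
 assumes "finite A" "finite Y" "!!a. a : A ==> EX! y. y : Y & R a y"
 shows "card A = (\<Sum>y\<in>Y. card {a : A. R a y})"
proof -
 have "A = (\<Union>y\<in>Y. {a : A. R a y})" using assms(3) by blast
 hence "card A = card (\<Union>y\<in>Y. {a : A. R a y})" by simp
 also have "... = (\<Sum>y\<in>Y. card {a : A. R a y})"
 proof (rule card_UN_disjoint[OF assms(2)])
  show "ALL y:Y. finite {a : A. R a y}" using assms(1) by simp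
  show "ALL y:Y. ALL j:Y. y ~= j --> {a : A. R a y} Int {a : A. R a j} = {}" using assms(3) by blast
 qed
 finally show ?thesis .
qed

text \<open>Distance at most two in the collinearity graph; equality and collinearity of points are
  included. Thus \<open>opp\<close> is the largest distance in a generalized hexagon.\<close>

definition (in flat) d2 where "d2 x y \<longleftrightarrow> (EX w:P. col x w & col w y)"
definition (in flat) opp where "opp x y \<longleftrightarrow> ~ d2 x y"
definition (in flat) VV where "VV = V.span (\<Union>L)"

text \<open>The hypothesis \<open>no_pentagon\<close> gives uniqueness of the point of a line
  nearest to \<open>x\<close> when the distance is two. Existence is not assumed: the bound
  \<open>total\<close> forces it by counting in \<open>far_card_eq\<close>.\<close>

locale hexagon = flat +
 assumes no_pentagon: "x : P ==> m : L ==> (!!u. u : P ==> u : m ==> ~ col x u) ==>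
   y : P ==> z : P ==> y : m ==> z : m ==> d2 x y ==> d2 x z ==> y = z"
  and total: "card L <= (q^3 + 1) * (q^2 + q + 1)"
begin

lemma d2_sym: "d2 x y ==> d2 y x" by (auto simp: d2_def intro: col_sym)
lemma opp_sym: "opp x y ==> opp y x" using d2_sym by (auto simp: opp_def)
lemma col_d2: "x : P ==> col x y ==> d2 x y" using col_refl by (auto simp: d2_def)
lemma d2I: "w : P ==> col x w ==> col w y ==> d2 x y" by (auto simp: d2_def)

definition S2 where "S2 x = {z : P. ~ col x z & d2 x z}"
definition near where "near x = {l : L. x ~: l & (EX y:P. y : l & col x y)}"
definition far where "far x = {l : L. ~ (EX y:P. y : l & col x y)}"

lemma S2_finite: "finite (S2 x)" using finite_P by (simp add: S2_def)
lemma near_finite: "finite (near x)" using finite_L by (simp add: near_def)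
lemma far_finite: "finite (far x)" using finite_L by (simp add: far_def)

lemma L_split: assumes "x : P" shows "L = Ln x Un near x Un far x" "Ln x Int near x = {}" "(Ln x Un near x) Int far x = {}"
 using assms col_refl by (auto simp: Ln_def near_def far_def)

lemma near_foot: assumes "x : P" "l : near x" shows "EX! y. y : nbr x & y : l"
proof -
 obtain y where y: "y : P" "y : l" "col x y" "l : L" "x ~: l" using assms by (auto simp: near_def)
 have "y' = y" if y': "y' : nbr x" "y' : l" for y'
 proof (rule ccontr)
  assume n: "y' ~= y"
  have y'P: "y' : P" "col x y'" using y' by (auto simp: nbr_def)
  obtain m where m: "m : L" "x : m" "y' : m" "y : m"
   using triangle[OF assms(1) y'P(1) y(1) y'P(2) y(3) colI[OF y(4) y'(2) y(2)] n] by blast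
  thus False using line_unique[OF y(4) m(1) y'P(1) y(1) n y'(2) y(2) m(3,4)] y by blast
 qed
 moreover have "y : nbr x" using y by (auto simp: nbr_def)
 ultimately show ?thesis using y by blast
qed

lemma near_at: assumes "x : P" "y : nbr x" shows "{l : near x. y : l} = Ln y - Ln x" "card (Ln y - Ln x) = q"
proof -
 have y: "y : P" "y ~= x" "col x y" using assms by (auto simp: nbr_def)
 show "{l : near x. y : l} = Ln y - Ln x" using y by (auto simp: near_def Ln_def)
 obtain m where m: "m : L" "x : m" "y : m" using y(3) by (auto simp: col_def)
 have "l = m" if "l : Ln y" "l : Ln x" for l
  using line_unique[OF _ m(1) assms(1) y(1)] that m y unfolding Ln_def by blast
 moreover have "m : Ln y Int Ln x" using m by (simp add: Ln_def)
 ultimately have "Ln y Int Ln x = {m}" by blast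
 thus "card (Ln y - Ln x) = q" using card_Diff_subset_Int[of "Ln y" "Ln x"] Ln_finite Ln_card[OF y(1)] by simp
qed

lemma near_card: assumes "x : P" shows "card (near x) = q * (q^2 + q)"
proof -
 have "card (near x) = (\<Sum>y\<in>nbr x. card {l : near x. y : l})"
  by (rule card_by_rel[OF near_finite nbr_finite near_foot[OF assms]])
 also have "... = (\<Sum>y\<in>nbr x. q)" using near_at[OF assms] by (intro sum.cong) auto
 finally show ?thesis using nbr_card[OF assms] by simp
qed

lemma S2_near: assumes "x : P" "z : S2 x" shows "EX! l. l : near x & z : l"
proof -
 have z: "z : P" "~ col x z" "d2 x z" using assms by (auto simp: S2_def)
 obtain w where w: "w : P" "col x w" "col w z" using z(3) by (auto simp: d2_def)
 obtain l where l: "l : L" "w : l" "z : l" using w(3) by (auto simp: col_def)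
 have "l : near x" using l w z colI by (auto simp: near_def)
 moreover have "l' = l" if l': "l' : near x" "z : l'" for l'
 proof -
  obtain w' where w': "w' : P" "w' : l'" "col x w'" "l' : L" using l' by (auto simp: near_def)
  have "w' = w" using common_nbr_unique[OF assms(1) z(1) w'(1) w(1) z(2)] w' w l' colI col_sym by blast
  moreover have "w ~= z" using w z by auto
  ultimately show "l' = l" using line_unique[OF w'(4) l(1) w(1) z(1)] w' l l' by blast
 qed
 ultimately show ?thesis using l by blast
qed

lemma near_points: assumes "x : P" "l : near x" "z : P" "z : l" shows "z : S2 x \<longleftrightarrow> z ~: nbr x"
proof -
 obtain y where y: "y : P" "y : l" "col x y" "l : L" "x ~: l" using assms by (auto simp: near_def)
 have "d2 x z" using d2I[OF y(1,3)] colI[OF y(4,2) assms(4)] by blast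
 thus ?thesis using assms y by (auto simp: S2_def nbr_def)
qed

lemma S2_card: assumes "x : P" shows "card (S2 x) = q * q * (q^2 + q)"
proof -
 have "card (S2 x) = (\<Sum>l\<in>near x. card {z : S2 x. z : l})"
  by (rule card_by_rel[OF S2_finite near_finite S2_near[OF assms]])
 also have "... = (\<Sum>l\<in>near x. q)"
 proof (rule sum.cong[OF refl])
  fix l assume l: "l : near x"
  hence lL: "l : L" by (simp add: near_def)
  obtain y where y: "y : nbr x" "y : l" "!!y'. y' : nbr x ==> y' : l ==> y' = y" using near_foot[OF assms l] by blast
  have yP: "y : P" using y(1) by (simp add: nbr_def)
  have "z : S2 x & z : l \<longleftrightarrow> z : l Int NV - {y}" for z
  proof (cases "z : P & z : l")
   case True thus ?thesis using near_points[OF assms l, of z] y P_NV by blast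
  next
   case False thus ?thesis using LP[OF lL] unfolding S2_def by blast
  qed
  hence "{z : S2 x. z : l} = l Int NV - {y}" by blast
  thus "card {z : S2 x. z : l} = q" using line_card[OF lL] y(2) P_NV[OF yP] line_finite[OF lL] by simp
 qed
 finally show ?thesis using near_card[OF assms] by simp
qed

lemma far_at: assumes "x : P" "z : S2 x" shows "card {l : far x. z : l} = q"
proof -
 have z: "z : P" "~ col x z" using assms by (auto simp: S2_def)
 obtain l where l: "l : near x" "z : l" "!!l'. l' : near x ==> z : l' ==> l' = l" using S2_near[OF assms] by blast
 have "{l : far x. z : l} = Ln z - {l}"
 proof (intro equalityI subsetI)
  fix m assume "m : Ln z - {l}"
  hence m: "m : L" "z : m" "m ~= l" by (auto simp: Ln_def)
  hence "x ~: m" "m ~: near x" using z colI l by blast+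
  thus "m : {l : far x. z : l}" using m by (auto simp: far_def near_def)
 next
  fix m assume "m : {l : far x. z : l}"
  thus "m : Ln z - {l}" using l(1) unfolding Ln_def far_def near_def by blast
 qed
 moreover have "l : Ln z" using l(1,2) unfolding Ln_def near_def by blast
 ultimately show ?thesis using Ln_card[OF z(1)] Ln_finite by simp
qed

lemma far_unique: assumes "x : P" "l : far x" "z : P" "z' : P" "z : l" "z' : l" "d2 x z" "d2 x z'" shows "z = z'"
 using no_pentagon[OF assms(1) _ _ assms(3-8)] assms(2) by (auto simp: far_def)

text \<open>Counting outwards from \<open>x\<close>, the lines through \<open>x\<close>, the near
  lines and those far lines that have a point at distance two already reach the upper bound on
  \<open>card L\<close>. Hence the bound is attained and no far line is left without such a
  point.\<close>

lemma far_card_eq: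
 assumes "x : P"
 shows "card L = (q^3 + 1) * (q^2 + q + 1)" "!!l. l : far x ==> EX z:S2 x. z : l"
proof -
 define F where "F = {l : far x. EX z:S2 x. z : l}"
 have FF: "F \<subseteq> far x" by (auto simp: F_def)
 have "card F = (\<Sum>z\<in>S2 x. card {l : F. z : l})"
 proof (rule card_by_rel[OF _ S2_finite])
  show "finite F" using FF far_finite finite_subset by blast
  fix l assume l: "l : F"
  then obtain z where "z : S2 x" "z : l" by (auto simp: F_def)
  moreover have "z' = z''" if "z' : S2 x" "z' : l" "z'' : S2 x" "z'' : l" for z' z''
   using far_unique[OF assms _ _ _ that(2,4)] that l by (auto simp: F_def S2_def)
  ultimately show "EX! z. z : S2 x & z : l" by blast
 qed
 also have "... = (\<Sum>z\<in>S2 x. q)"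
 proof (rule sum.cong[OF refl])
  fix z assume z: "z : S2 x"
  have "{l : F. z : l} = {l : far x. z : l}" using z by (auto simp: F_def)
  thus "card {l : F. z : l} = q" using far_at[OF assms z] by simp
 qed
 finally have cF: "card F = q * q * (q^2 + q) * q" using S2_card[OF assms] by simp
 have "card L = card (Ln x Un near x) + card (far x)"
  using L_split[OF assms] card_Un_disjoint[of "Ln x Un near x" "far x"] Ln_finite near_finite far_finite by simp
 moreover have "card (Ln x Un near x) = q + 1 + q * (q^2 + q)"
  using L_split(2)[OF assms] card_Un_disjoint[of "Ln x" "near x"] Ln_finite near_finite Ln_card[OF assms] near_card[OF assms] by simp
 ultimately have cL: "card L = q + 1 + q * (q^2 + q) + card (far x)" by simp
 have id: "(q^3 + 1) * (q^2 + q + 1) = q + 1 + q * (q^2 + q) + q * q * (q^2 + q) * q" by algebra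
 have "card (far x) <= card F" using total cL cF id by linarith
 hence "F = far x" using card_seteq[OF far_finite FF] by simp
 thus "card L = (q^3 + 1) * (q^2 + q + 1)" using cL cF id by simp
 show "EX z:S2 x. z : l" if "l : far x" for l using that \<open>F = far x\<close> by (auto simp: F_def)
qed

lemma P_nonempty: obtains x where "x : P"
proof -
 obtain l where "l : L" using L_nonempty by blast
 thus ?thesis using other_point[of l "{}"] that by auto
qed

lemma L_card: "card L = (q^3 + 1) * (q^2 + q + 1)"
 using P_nonempty far_card_eq(1) by metis

lemma proj_exists: assumes "x : P" "l : L" obtains y where "y : P" "y : l" "d2 x y"
proof (cases "l : far x")
 case True
 then obtain z where "z : S2 x" "z : l" using far_card_eq(2)[OF assms(1)] by blast
 thus ?thesis using that by (auto simp: S2_def)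
next
 case False
 then obtain y where "y : P" "y : l" "col x y" using assms by (auto simp: far_def)
 thus ?thesis using that col_d2 assms(1) by blast
qed

lemma two_d2: assumes "x : P" "l : L" "y : P" "z : P" "y : l" "z : l" "y ~= z" "d2 x y" "d2 x z"
 obtains w where "w : P" "w : l" "col x w"
 using no_pentagon[OF assms(1,2) _ assms(3-6,8,9)] assms(7) that by blast

section \<open>Hyperplane sections of a generalized hexagon\<close>

definition hyper where "hyper H \<longleftrightarrow> (EX k. sub VV (Suc k) & sub H k & H \<subseteq> VV)"

lemma VV_L: "l : L ==> l \<subseteq> VV" unfolding VV_def using V.span_superset[of "\<Union>L"] by blast
lemma VV_P: "x : P ==> x : VV" using VV_L by (auto simp: P_def)
lemma VV_Pi: "x : P ==> Pi x \<subseteq> VV" using VV_L by (auto simp: Pi_def)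
lemma VV_subspace: "V.subspace VV" by (simp add: VV_def)

lemma hyper_subspace: "hyper H ==> V.subspace H" by (auto simp: hyper_def sub_subspace)

lemma hyper_not_all: assumes "hyper H" shows "EX l:L. ~ l \<subseteq> H"
proof (rule ccontr)
 assume "~ (EX l:L. ~ l \<subseteq> H)"
 hence "VV \<subseteq> H" unfolding VV_def using V.span_minimal[of "\<Union>L" H] hyper_subspace[OF assms] by blast
 thus False using assms sub_mono by (fastforce simp: hyper_def)
qed

lemma hyper_meets: assumes "hyper H" "l : L" obtains y where "y : P" "y : l" "y : H"
proof -
 obtain k where k: "sub VV (Suc k)" "sub H k" "H \<subseteq> VV" using assms by (auto simp: hyper_def)
 obtain c where c: "sub (l Int H) c" "2 + k <= Suc k + c"
  using sub_Int_ge[OF line_sub2[OF assms(2)] k(2,1) VV_L[OF assms(2)] k(3)] .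
 obtain y where "y : l Int H" "y : NV" using sub_point[OF c(1)] c(2) by auto
 thus ?thesis using that LP[OF assms(2)] by blast
qed

lemma hyper_line: assumes "hyper H" "x : P" "x : H" obtains l where "l : LU H" "x : l"
proof -
 obtain k where k: "sub VV (Suc k)" "sub H k" "H \<subseteq> VV" using assms by (auto simp: hyper_def)
 obtain c where c: "sub (Pi x Int H) c" "3 + k <= Suc k + c"
  using sub_Int_ge[OF Pi_sub[OF assms(2)] k(2,1) VV_Pi[OF assms(2)] k(3)] .
 obtain y where y: "y : Pi x Int H" "y : NV" "y ~= x" using sub_point2[OF c(1) _ P_NV[OF assms(2)]] c(2) by auto
 obtain l where l: "l : L" "x : l" "y : l" using y mem_Pi by (auto simp: col_def)
 have "l \<subseteq> H" using line_subset[OF l(1) sub_subspace[OF k(2)] assms(2) LP[OF l(1,3) y(2)]] y l assms by blast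
 thus ?thesis using that l by (auto simp: LU_def)
qed

lemma hyper_LU: assumes "hyper H" "x : P" shows "x : H \<longleftrightarrow> x : CU H | x : BU H"
 using hyper_line[OF assms] LU_degree(1)[OF assms(2) _ _ hyper_subspace[OF assms(1)]] CU_mem BU_mem by blast

text \<open>Equality in \<open>total_ge\<close>: a hyperplane meets every line, and a line not
  inside it cannot meet it in a point of \<open>CU H\<close>.\<close>

lemma hyper_total: assumes "hyper H" shows "card L = card (LU H) + q * card (BU H)"
proof -
 have "L = LU H Un hit H"
 proof (intro equalityI subsetI)
  fix l assume l: "l : L"
  show "l : LU H Un hit H"
  proof (cases "l \<subseteq> H")
   case False
   obtain y where y: "y : P" "y : l" "y : H" using hyper_meets[OF assms l] .
   have "y ~: CU H" using CU_line[OF _ l y(2)] False by (auto simp: LU_def)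
   thus ?thesis using hyper_LU[OF assms y(1)] y l False by (auto simp: hit_def)
  qed (use l in \<open>auto simp: LU_def\<close>)
 qed (auto simp: LU_def hit_def)
 moreover have "LU H Int hit H = {}" by (auto simp: LU_def hit_def)
 ultimately have "card L = card (LU H) + card (hit H)"
  using card_Un_disjoint[of "LU H" "hit H"] finite_L by (metis finite_Un)
 thus ?thesis using hit_card[OF hyper_subspace[OF assms]] by simp
qed

text \<open>In this lemma and the next two, a point on a shortest path from \<open>CU H\<close> to
  another point of \<open>CU H\<close> or to a line of \<open>H\<close> acquires two different lines
  in \<open>H\<close>, which puts it into \<open>CU H\<close>. So \<open>CU H\<close> is closed
  under projection onto lines of \<open>H\<close>.\<close>

lemma conv_mid: assumes "V.subspace H" "x : CU H" "y : CU H" "~ col x y" "w : P" "col x w" "col w y"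
 shows "w : CU H"
proof -
 obtain l where l: "l : L" "x : l" "w : l" using assms(6) by (auto simp: col_def)
 obtain m where m: "m : L" "w : m" "y : m" using assms(7) by (auto simp: col_def)
 have "l ~= m" using l m assms(4) colI by blast
 thus ?thesis using CU_I[OF assms(5) CU_line[OF assms(2) l(1,2)] CU_line[OF assms(3) m(1,3)] _ l(3) m(2) assms(1)] by blast
qed

lemma conv_near: assumes "V.subspace H" "x : CU H" "l : LU H" "x ~: l" "y : P" "y : l" "col x y"
 shows "y : CU H"
proof -
 obtain m where m: "m : L" "x : m" "y : m" using assms(7) by (auto simp: col_def)
 show ?thesis using CU_I[OF assms(5) CU_line[OF assms(2) m(1,2)] assms(3) _ m(3) assms(6,1)] m assms by blast
qed

lemma conv_far: assumes "V.subspace H" "x : CU H" "l : LU H" "l : far x" "y : P" "y : l" "d2 x y"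
 shows "y : CU H" "!!w. w : P ==> col x w ==> col w y ==> w : CU H"
proof -
 have xP: "x : P" using assms CU_P by blast
 obtain w where w: "w : P" "col x w" "col w y" using assms(7) by (auto simp: d2_def)
 have nc: "~ col x y" "w ~: l" using assms w by (auto simp: far_def)
 obtain m where m: "m : L" "x : m" "w : m" using w(2) by (auto simp: col_def)
 obtain k where k: "k : L" "w : k" "y : k" using w(3) by (auto simp: col_def)
 have wH: "w : H" using CU_line[OF assms(2) m(1,2)] m by (auto simp: LU_def)
 have yH: "y : H" using assms by (auto simp: LU_def)
 have "w ~= y" using nc assms by blast
 hence kH: "k : LU H" using line_subset[OF k(1) assms(1) w(1) assms(5)] k wH yH by (auto simp: LU_def)
 show y: "y : CU H" using CU_I[OF assms(5) kH assms(3) _ k(3) assms(6,1)] k nc by blast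
 show "w : CU H" if "w : P" "col x w" "col w y" for w using conv_mid[OF assms(1,2) y nc(1) that] .
qed

lemma line_has_C: assumes "V.subspace H" "x : CU H" "l : LU H" obtains y where "y : CU H" "y : l" "d2 x y"
proof -
 have xP: "x : P" and lL: "l : L" using assms CU_P LU_L by auto
 consider "x : l" | "x ~: l" "EX y:P. y : l & col x y" | "l : far x" using lL by (auto simp: far_def)
 thus ?thesis
 proof cases
  case 1 thus ?thesis using that assms col_d2[OF xP col_refl[OF xP]] by blast
 next
  case 2
  then obtain y where y: "y : P" "y : l" "col x y" by blast
  thus ?thesis using that[OF conv_near[OF assms 2(1) y] y(2)] col_d2[OF xP] by blast
 next
  case 3
  obtain y where y: "y : P" "y : l" "d2 x y" using proj_exists[OF xP lL] .
  thus ?thesis using that[OF conv_far(1)[OF assms 3 y] y(2,3)] by blast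
 qed
qed

definition oppl where "oppl l m \<longleftrightarrow> (ALL x:P. ALL y:P. x : l --> y : m --> ~ col x y)"

lemma oppl_sym: "oppl l m ==> oppl m l" using col_sym by (auto simp: oppl_def)

lemma oppl_far: "oppl l m ==> m : L ==> x : P ==> x : l ==> m : far x" by (auto simp: oppl_def far_def)

text \<open>Projection from one of two opposite lines to the other is injective, and
  \<open>conv_far\<close> keeps it within \<open>CU H\<close>.\<close>

lemma oppl_card_le: assumes "V.subspace H" "l : LU H" "m : LU H" "oppl l m"
 shows "card (l Int CU H) <= card (m Int CU H)"
proof -
 have lm: "l : L" "m : L" using assms LU_L by auto
 define f where "f x = (SOME y. y : P & y : m & d2 x y)" for x
 have f: "f x : P" "f x : m" "d2 x (f x)" if "x : P" for x
 proof -
  have "EX y. y : P & y : m & d2 x y" using proj_exists[OF that lm(2)] by blast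
  from someI_ex[OF this] show "f x : P" "f x : m" "d2 x (f x)" unfolding f_def by blast+
 qed
 show ?thesis
 proof (rule card_inj_on_le[of f])
  show "finite (m Int CU H)" using CU_finite by blast
  show "f ` (l Int CU H) \<subseteq> m Int CU H"
  proof
   fix y assume "y : f ` (l Int CU H)"
   then obtain x where x: "x : l" "x : CU H" "y = f x" by blast
   thus "y : m Int CU H" using conv_far(1)[OF assms(1) x(2) assms(3) oppl_far[OF assms(4) lm(2) CU_P[OF x(2)] x(1)]] f[OF CU_P[OF x(2)]] by simp
  qed
  show "inj_on f (l Int CU H)"
  proof (rule inj_onI)
   fix x x' assume x: "x : l Int CU H" "x' : l Int CU H" "f x = f x'"
   have xP: "x : P" "x' : P" using x CU_P by auto
   have "l : far (f x)" using oppl_far[OF oppl_sym[OF assms(4)] lm(1) f(1,2)[OF xP(1)]] .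
   thus "x = x'" using far_unique[OF f(1)[OF xP(1)] _ xP] x f[OF xP(1)] f[OF xP(2)] d2_sym by auto
  qed
 qed
qed

lemma oppl_card: "V.subspace H ==> l : LU H ==> m : LU H ==> oppl l m ==> card (l Int CU H) = card (m Int CU H)"
 using oppl_card_le[of H l m] oppl_card_le[of H m l] oppl_sym by (simp add: le_antisym)

text \<open>The exception \<open>k\<close> is the first line on the path from \<open>y\<close> to
  its projection \<open>z\<close> on \<open>l\<close>: a point of another line through
  \<open>y\<close> that is collinear with a point of \<open>l\<close> would give a second path from
  \<open>y\<close> to \<open>z\<close>.\<close>

lemma one_not_oppl: assumes "x : P" "y : P" "opp x y" "l : L" "x : l"
 obtains k where "!!m. m : L ==> y : m ==> m ~= k ==> oppl l m"
proof -
 obtain z where z: "z : P" "z : l" "d2 y z" using proj_exists[OF assms(2,4)] .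
 obtain w where w: "w : P" "col y w" "col w z" using z(3) by (auto simp: d2_def)
 obtain k where k: "k : L" "y : k" "w : k" using w(2) by (auto simp: col_def)
 have far: "l : far y"
  using assms(3,4,5) colI[OF assms(4) assms(5)] d2I opp_sym[OF assms(3)] col_sym unfolding far_def opp_def by blast
 have nyz: "~ col y z" using far z by (auto simp: far_def)
 have "oppl l m" if m: "m : L" "y : m" "m ~= k" for m
  unfolding oppl_def
 proof (intro ballI impI notI)
  fix v u assume vu: "v : P" "u : P" "v : l" "u : m" "col v u"
  have yu: "col y u" using colI[OF m(1,2) vu(4)] .
  have "d2 y v" using d2I[OF vu(2) yu] col_sym vu by blast
  hence vz: "v = z" using far_unique[OF assms(2) far vu(1) z(1) vu(3) z(2) _ z(3)] by blast
  have "u = w" using common_nbr_unique[OF assms(2) z(1) vu(2) w(1) nyz yu _ w(2)] vu(5) vz w(3) col_sym by blast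
  moreover have "w ~= y" using w nyz by auto
  ultimately have "m = k" using line_unique[OF m(1) k(1) w(1) assms(2)] vu m k by blast
  thus False using m by blast
 qed
 thus ?thesis using that by blast
qed

lemma common_oppl: assumes "x : P" "y : P" "opp x y" "l : L" "x : l" "l' : L" "x : l'"
 obtains m where "m : L" "y : m" "oppl l m" "oppl l' m"
proof -
 obtain k where k: "!!m. m : L ==> y : m ==> m ~= k ==> oppl l m" using one_not_oppl[OF assms(1-5)] by blast
 obtain k' where k': "!!m. m : L ==> y : m ==> m ~= k' ==> oppl l' m" using one_not_oppl[OF assms(1-3,6,7)] by blast
 have "card {k, k'} <= q" using q_ge2 by (simp add: card_insert_if)
 then obtain m where "m : L" "y : m" "m ~: {k, k'}" using other_line[OF assms(2), of "{k,k'}"] by blast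
 thus ?thesis using that k k' by blast
qed

text \<open>Any two lines through \<open>x\<close> have a common opposite line through
  \<open>y\<close>, so \<open>oppl_card\<close> makes their point counts equal. The value is at
  least 2 because the projection of \<open>y\<close> onto a line through \<open>x\<close> differs
  from \<open>x\<close>.\<close>

lemma opp_order: assumes "V.subspace H" "x : CU H" "y : CU H" "opp x y"
 obtains k where "k >= 2" "!!l. l : L ==> x : l ==> card (l Int CU H) = k" "!!l. l : L ==> y : l ==> card (l Int CU H) = k"
proof -
 have xy: "x : P" "y : P" using assms CU_P by auto
 have eqx: "card (l Int CU H) = card (l' Int CU H)" if l: "l : L" "x : l" "l' : L" "x : l'" for l l'
 proof -
  obtain m where "m : L" "y : m" "oppl l m" "oppl l' m" using common_oppl[OF xy assms(4) l] .
  thus ?thesis using oppl_card[OF assms(1)] CU_line[OF assms(2) l(1,2)] CU_line[OF assms(2) l(3,4)] CU_line[OF assms(3)] by metis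
 qed
 obtain l0 where l0: "l0 : L" "x : l0" using two_lines[OF xy(1)] by metis
 have "card (m Int CU H) = card (l0 Int CU H)" if m: "m : L" "y : m" for m
 proof -
  obtain l where "l : L" "x : l" "oppl m l" using common_oppl[OF xy(2,1) opp_sym[OF assms(4)] m m] by metis
  thus ?thesis using oppl_card[OF assms(1) CU_line[OF assms(3) m]] CU_line[OF assms(2)] eqx[OF l0] by metis
 qed
 moreover have "card (l0 Int CU H) >= 2"
 proof -
  obtain z where z: "z : CU H" "z : l0" "d2 y z" using line_has_C[OF assms(1,3) CU_line[OF assms(2) l0]] .
  have "z ~= x" using z assms(4) d2_sym by (auto simp: opp_def)
  hence "card {x, z} = 2" by simp
  moreover have "card {x, z} <= card (l0 Int CU H)" using z l0 assms CU_finite by (intro card_mono) auto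
  ultimately show ?thesis by simp
 qed
 ultimately show ?thesis using that[of "card (l0 Int CU H)"] eqx[OF _ _ l0] by blast
qed

lemma opp_spread: assumes "V.subspace H" "x : CU H" "y : CU H" "opp x y" "z : CU H" "z : nbr x"
 obtains u where "u : CU H" "opp z u"
proof -
 have xy: "x : P" "y : P" "z : P" using assms CU_P by auto
 obtain l where l: "l : L" "x : l" "z : l" using assms(6) by (auto simp: nbr_def col_def)
 obtain m where m: "m : L" "y : m" "oppl l m" using common_oppl[OF xy(1,2) assms(4) l(1,2) l(1,2)] by metis
 obtain k where "k >= 2" "card (m Int CU H) = k" using opp_order[OF assms(1-4)] m by metis
 hence "~ card (m Int CU H) <= Suc 0" by simp
 then obtain u v where uv: "u : m" "u : CU H" "v : m" "v : CU H" "u ~= v"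
  using card_le_Suc0_iff_eq[of "m Int CU H"] CU_finite by auto
 have "~ (d2 z u & d2 z v)"
  using far_unique[OF xy(3) oppl_far[OF m(3,1) xy(3) l(3)] CU_P[OF uv(2)] CU_P[OF uv(4)] uv(1,3)] uv(5) by blast
 thus ?thesis using that uv by (auto simp: opp_def)
qed

text \<open>One opposite pair makes \<open>CU H\<close>, with the lines of \<open>H\<close>, a
  subhexagon of order \<open>(k - 1, q)\<close>. The auxiliary property \<open>G\<close> passes from
  a point to its neighbours in \<open>CU H\<close>; a point of \<open>CU H\<close> is either
  opposite \<open>x0\<close> or joined to it by a path that convexity keeps in
  \<open>CU H\<close>.\<close>

lemma opp_all: assumes "V.subspace H" "x0 : CU H" "y0 : CU H" "opp x0 y0"
 obtains k where "k >= 2" "!!l. l : LU H ==> card (l Int CU H) = k" "!!z. z : CU H ==> EX u:CU H. opp z u"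
proof -
 obtain k where k: "k >= 2" "!!l. l : L ==> x0 : l ==> card (l Int CU H) = k" using opp_order[OF assms] by metis
 define G where "G z \<longleftrightarrow> z : CU H & (EX u:CU H. opp z u) & (ALL l:L. z : l --> card (l Int CU H) = k)" for z
 have G0: "G x0" using assms k unfolding G_def by blast
 have Gn: "G z" if g: "G x" "z : CU H" "z : nbr x" for x z
 proof -
  obtain y where y: "y : CU H" "opp x y" using g(1) unfolding G_def by blast
  have x: "x : CU H" using g by (simp add: G_def)
  obtain u where u: "u : CU H" "opp z u" using opp_spread[OF assms(1) x y g(2,3)] .
  obtain k' where k': "!!l. l : L ==> z : l ==> card (l Int CU H) = k'" using opp_order[OF assms(1) g(2) u] by metis
  obtain l where l: "l : L" "x : l" "z : l" using g(3) by (auto simp: nbr_def col_def)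
  have "k' = k" using k'[OF l(1,3)] g(1) l by (auto simp: G_def)
  thus ?thesis using g u k' unfolding G_def by blast
 qed
 have Gall: "G z" if z: "z : CU H" for z
 proof (cases "opp x0 z")
  case True
  obtain k' where k': "!!l. l : L ==> x0 : l ==> card (l Int CU H) = k'" "!!l. l : L ==> z : l ==> card (l Int CU H) = k'"
   using opp_order[OF assms(1,2) z True] by metis
  obtain l where "l : L" "x0 : l" using two_lines[OF CU_P[OF assms(2)]] by metis
  hence "k' = k" using k k' by metis
  thus ?thesis unfolding G_def using z True opp_sym assms(2) k' by blast
 next
  case False
  then obtain w where w: "w : P" "col x0 w" "col w z" by (auto simp: opp_def d2_def)
  show ?thesis
  proof (cases "col x0 z")
   case True
   thus ?thesis using Gn[OF G0 z] G0 CU_P[OF z] by (cases "z = x0") (auto simp: nbr_def)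
  next
   case nc: False
   have wC: "w : CU H" using conv_mid[OF assms(1,2) z nc w] .
   have "w : nbr x0" "z : nbr w" using w nc CU_P[OF z] by (auto simp: nbr_def)
   thus ?thesis using Gn[OF Gn[OF G0 wC] z] by blast
  qed
 qed
 have "card (l Int CU H) = k" if l: "l : LU H" for l
 proof -
  obtain y where "y : CU H" "y : l" using line_has_C[OF assms(1,2) l] .
  thus ?thesis using Gall LU_L[OF l] by (auto simp: G_def)
 qed
 thus ?thesis using that[OF k(1)] Gall by (auto simp: G_def)
qed

lemma LU_near_at: assumes "V.subspace H" "x : CU H" "y : nbr x"
 shows "card {l : LU H Int near x. y : l} = (if y : CU H then q else 0)"
proof (cases "y : CU H")
 case True
 have "{l : LU H Int near x. y : l} = {l : near x. y : l}"
  using CU_line[OF True] unfolding near_def by blast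
 thus ?thesis using near_at[OF CU_P[OF assms(2)] assms(3)] True by simp
next
 case False
 have e: "{l : LU H Int near x. y : l} = {}"
  using conv_near[OF assms(1,2) _ _ _ _ ] False assms(3) unfolding near_def nbr_def by blast
 show ?thesis unfolding e using False by simp
qed

lemma LU_far_at: assumes "V.subspace H" "x : CU H" "z : S2 x"
 shows "card {l : LU H Int far x. z : l} = (if z : CU H then q else 0)"
proof (cases "z : CU H")
 case True
 have "{l : LU H Int far x. z : l} = {l : far x. z : l}"
  using CU_line[OF True] unfolding far_def by blast
 thus ?thesis using far_at[OF CU_P[OF assms(2)] assms(3)] True by simp
next
 case False
 have e: "{l : LU H Int far x. z : l} = {}"
  using conv_far(1)[OF assms(1,2)] False assms(3) unfolding S2_def by blast
 show ?thesis unfolding e using False by simp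
qed

lemma far_foot: assumes "x : P" "l : far x" shows "EX! z. z : S2 x & z : l"
proof -
 obtain z where "z : S2 x" "z : l" using far_card_eq(2)[OF assms] by blast
 moreover have "z' = z''" if "z' : S2 x" "z' : l" "z'' : S2 x" "z'' : l" for z' z''
  using far_unique[OF assms _ _ that(2,4)] that by (auto simp: S2_def)
 ultimately show ?thesis by blast
qed

lemma LU_count: assumes "V.subspace H" "x : CU H"
 shows "card (LU H) = q + 1 + q * card (nbr x Int CU H) + q * card (S2 x Int CU H)"
  "card (LU H Int near x) = q * card (nbr x Int CU H)"
proof -
 have xP: "x : P" using assms CU_P by blast
 have s: "LU H = (Ln x Un (LU H Int near x)) Un (LU H Int far x)"
  using L_split(1)[OF xP] CU_line[OF assms(2)] unfolding LU_def Ln_def by blast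
 have d: "Ln x Int (LU H Int near x) = {}" "(Ln x Un (LU H Int near x)) Int (LU H Int far x) = {}"
  using L_split(2,3)[OF xP] by blast+
 have fin: "finite (Ln x)" "finite (LU H Int near x)" "finite (LU H Int far x)"
  using Ln_finite near_finite far_finite by auto
 have "card (LU H) = card (Ln x Un (LU H Int near x)) + card (LU H Int far x)"
  by (subst s) (rule card_Un_disjoint[OF _ fin(3) d(2)], use fin in simp)
 also have "card (Ln x Un (LU H Int near x)) = card (Ln x) + card (LU H Int near x)"
  by (rule card_Un_disjoint[OF fin(1,2) d(1)])
 also have n: "card (LU H Int near x) = q * card (nbr x Int CU H)"
 proof -
  have "card (LU H Int near x) = (\<Sum>y\<in>nbr x. card {l : LU H Int near x. y : l})"
   by (rule card_by_rel[OF fin(2) nbr_finite]) (use near_foot[OF xP] in blast)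
  also have "... = (\<Sum>y\<in>nbr x. if y : CU H then q else 0)" by (rule sum.cong[OF refl LU_near_at[OF assms]])
  finally show ?thesis using nbr_finite by (simp add: sum.If_cases Int_def)
 qed
 also have f: "card (LU H Int far x) = q * card (S2 x Int CU H)"
 proof -
  have "card (LU H Int far x) = (\<Sum>y\<in>S2 x. card {l : LU H Int far x. y : l})"
   by (rule card_by_rel[OF fin(3) S2_finite]) (use far_foot[OF xP] in blast)
  also have "... = (\<Sum>y\<in>S2 x. if y : CU H then q else 0)" by (rule sum.cong[OF refl LU_far_at[OF assms]])
  finally show ?thesis using S2_finite by (simp add: sum.If_cases Int_def)
 qed
 finally show "card (LU H) = q + 1 + q * card (nbr x Int CU H) + q * card (S2 x Int CU H)"
  using Ln_card[OF xP] by simp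
 show "card (LU H Int near x) = q * card (nbr x Int CU H)" by (rule n)
qed

text \<open>The usual counts by distance from \<open>x\<close> in a hexagon with
  \<open>s + 1\<close> points on a line and \<open>q + 1\<close> lines on a point.\<close>

lemma order_counts: assumes "V.subspace H" "x : CU H" "!!l. l : LU H ==> card (l Int CU H) = Suc s"
 shows "card (nbr x Int CU H) = (q + 1) * s" "card (S2 x Int CU H) = q * (q + 1) * s * s"
  "card (LU H) = (q + 1) * (1 + q * s + q * q * s * s)"
proof -
 have xP: "x : P" using assms CU_P by blast
 have "card (nbr x Int CU H) = (\<Sum>l\<in>Ln x. card {y : nbr x Int CU H. y : l})"
 proof (rule card_by_rel[OF _ Ln_finite])
  show "finite (nbr x Int CU H)" using nbr_finite by simp
  fix y assume "y : nbr x Int CU H"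
  hence y: "y : P" "y ~= x" "col x y" by (auto simp: nbr_def)
  then obtain l where l: "l : L" "x : l" "y : l" by (auto simp: col_def)
  have "l' = l" if "l' : Ln x" "y : l'" for l'
   using line_unique[OF _ l(1) xP y(1)] that l y unfolding Ln_def by blast
  thus "EX! l. l : Ln x & y : l" using l unfolding Ln_def by blast
 qed
 also have "... = (\<Sum>l\<in>Ln x. s)"
 proof (rule sum.cong[OF refl])
  fix l assume l: "l : Ln x"
  hence lL: "l : L" "x : l" by (auto simp: Ln_def)
  have "{y : nbr x Int CU H. y : l} = (l Int CU H) - {x}"
   using lL CU_P colI[OF lL] unfolding nbr_def by blast
  thus "card {y : nbr x Int CU H. y : l} = s"
   using assms(3)[OF CU_line[OF assms(2) lL]] lL(2) assms(2) CU_finite[of H] by simp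
 qed
 finally show n: "card (nbr x Int CU H) = (q + 1) * s" using Ln_card[OF xP] by simp
 have "card (S2 x Int CU H) = (\<Sum>l\<in>LU H Int near x. card {z : S2 x Int CU H. z : l})"
 proof (rule card_by_rel)
  show "finite (S2 x Int CU H)" "finite (LU H Int near x)" using S2_finite near_finite by auto
  fix z assume z: "z : S2 x Int CU H"
  then obtain l where l: "l : near x" "z : l" "!!l'. l' : near x ==> z : l' ==> l' = l" using S2_near[OF xP, of z] by blast
  have "l : LU H" using CU_line[of z H l] z l unfolding near_def by blast
  thus "EX! l. l : LU H Int near x & z : l" using l by blast
 qed
 also have "... = (\<Sum>l\<in>LU H Int near x. s)"
 proof (rule sum.cong[OF refl])
  fix l assume l: "l : LU H Int near x"
  obtain y where y: "y : nbr x" "y : l" "!!y'. y' : nbr x ==> y' : l ==> y' = y" using near_foot[OF xP, of l] l by blast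
  have yC: "y : CU H" using conv_near[OF assms(1,2), of l y] l y unfolding near_def nbr_def by blast
  have "z : S2 x Int CU H & z : l \<longleftrightarrow> z : (l Int CU H) - {y}" for z
  proof (cases "z : CU H & z : l")
   case True thus ?thesis using near_points[OF xP, of l z] l y CU_P by blast
  qed blast
  hence "{z : S2 x Int CU H. z : l} = (l Int CU H) - {y}" by blast
  thus "card {z : S2 x Int CU H. z : l} = s"
   using assms(3)[of l] l y(2) yC CU_finite[of H] by simp
 qed
 finally show S: "card (S2 x Int CU H) = q * (q + 1) * s * s" using LU_count(2)[OF assms(1,2)] n by (simp add: algebra_simps)
 show "card (LU H) = (q + 1) * (1 + q * s + q * q * s * s)" using LU_count(1)[OF assms(1,2)] n S by (simp add: algebra_simps)
qed

lemma order_BU: assumes "V.subspace H" "!!l. l : LU H ==> card (l Int CU H) = Suc s"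
 shows "card (CU H) * (q + 1) = card (LU H) * Suc s" "card (BU H) = card (LU H) * (q - s)"
proof -
 have "card (CU H) * (q + 1) = (\<Sum>x\<in>CU H. \<Sum>l\<in>LU H. if x : l then 1 else 0)"
 proof -
  have "(\<Sum>l\<in>LU H. if x : l then 1 else 0) = q + 1" if "x : CU H" for x
  proof -
   have "{l : LU H. x : l} = Ln x" using CU_lines[OF that] by (simp add: Lux_def)
   thus ?thesis using LU_finite[of H] Ln_card[OF CU_P[OF that]] by (simp add: sum.If_cases Int_def)
  qed
  thus ?thesis by simp
 qed
 also have "... = (\<Sum>l\<in>LU H. \<Sum>x\<in>CU H. if x : l then 1 else 0)" by (rule sum.swap)
 also have "... = (\<Sum>l\<in>LU H. Suc s)"
  using assms(2) CU_finite[of H] by (intro sum.cong) (auto simp: sum.If_cases Int_def conj_commute)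
 finally show c: "card (CU H) * (q + 1) = card (LU H) * Suc s" by simp
 show "card (BU H) = card (LU H) * (q - s)"
 proof (cases "LU H = {}")
  case False
  then obtain l where l: "l : LU H" by blast
  have "Suc s <= q + 1"
   using assms(2)[OF l] line_card[OF LU_L[OF l]] card_mono[of "l Int NV" "l Int CU H"] line_finite[OF LU_L[OF l]] CU_P P_NV by fastforce
  hence "card (LU H) * (q + 1) = card (LU H) * (q - s) + card (LU H) * Suc s" by (simp add: algebra_simps diff_mult_distrib2 flip: add_mult_distrib2)
  thus ?thesis using flags_U[OF assms(1)] c by (simp add: mult.commute)
 next
  case True
  hence "BU H = {}" using BU_line by blast
  thus ?thesis using True by simp
 qed
qed

text \<open>With the counts for order \<open>(s, q)\<close>, the equality \<open>hyper_total\<close>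
  becomes a polynomial identity whose factors leave only 1 and \<open>q\<close> for
  \<open>s\<close>; the value \<open>q\<close> would place every line in the hyperplane.\<close>

lemma thin:
 assumes "hyper H" "x : CU H" "y : CU H" "opp x y"
 shows "!!l. l : LU H ==> card (l Int CU H) = 2"
  "card (LU H) = (q + 1) * (q^2 + q + 1)" "card (CU H) = 2 * (q^2 + q + 1)"
  "card (S2 x Int CU H) = q^2 + q" "card (nbr x Int CU H) = q + 1"
proof -
 have sH: "V.subspace H" using hyper_subspace[OF assms(1)] .
 obtain k where k: "k >= 2" "!!l. l : LU H ==> card (l Int CU H) = k" using opp_all[OF sH assms(2-4)] by metis
 define s where "s = k - 1"
 have ks: "!!l. l : LU H ==> card (l Int CU H) = Suc s" "s >= 1" using k by (auto simp: s_def)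
 note oc = order_counts[OF sH assms(2) ks(1)] and ob = order_BU[OF sH ks(1)]
 obtain l where l: "l : LU H" using CU_line[OF assms(2)] two_lines[OF CU_P[OF assms(2)]] by metis
 have sq: "s <= q"
  using ks(1)[OF l] line_card[OF LU_L[OF l]] card_mono[of "l Int NV" "l Int CU H"] line_finite[OF LU_L[OF l]] CU_P P_NV by fastforce
 have "(q^3 + 1) * (q^2 + q + 1) = card (LU H) * (1 + q * (q - s))"
  using hyper_total[OF assms(1)] L_card ob(2) by (simp add: algebra_simps)
 hence e: "(int q^3 + 1) * (int q^2 + int q + 1) = (int q + 1) * (1 + int q * int s + int q * int q * int s * int s) * (1 + int q * (int q - int s))"
  using oc(3) sq by (simp flip: of_nat_mult of_nat_add of_nat_diff of_nat_power of_nat_Suc of_nat_1) (metis of_nat_eq_iff)?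
 have "(int q + 1) * int q^2 * ((int s - 1) * (int s + 1) * (int q - int s)) = 0" using e by algebra
 hence "int s = 1 | int q = int s" using q_ge2 ks(2) by auto
 hence s1: "s = 1"
 proof
  assume "int q = int s"
  hence "card (BU H) = 0" using ob(2) by simp
  hence "card (LU H) = card L" using hyper_total[OF assms(1)] by simp
  hence "LU H = L" using card_subset_eq[OF finite_L] by (auto simp: LU_def)
  hence "ALL l:L. l \<subseteq> H" by (auto simp: LU_def)
  thus ?thesis using hyper_not_all[OF assms(1)] by blast
 qed simp
 show "card (l Int CU H) = 2" if "l : LU H" for l using ks(1)[OF that] s1 by simp
 show m: "card (LU H) = (q + 1) * (q^2 + q + 1)" using oc(3) s1 by (simp add: algebra_simps power2_eq_square)
 have "card (CU H) * (q + 1) = (q + 1) * (q^2 + q + 1) * Suc 1" using ob(1) unfolding m s1 .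
 hence "card (CU H) * (q + 1) = 2 * (q^2 + q + 1) * (q + 1)" by (simp only: Suc_1 mult.commute mult.left_commute mult.assoc)
 thus "card (CU H) = 2 * (q^2 + q + 1)" by (metis add_is_0 mult_right_cancel one_neq_zero)
 show "card (S2 x Int CU H) = q^2 + q" "card (nbr x Int CU H) = q + 1" using oc(1,2) s1 by (simp_all add: power2_eq_square)
qed

text \<open>If all of \<open>CU H\<close> is pairwise collinear, any of its points serves. Otherwise
  the centre is the common neighbour \<open>x\<close> of two noncollinear points \<open>y\<close>
  and \<open>z\<close>. A point not collinear with \<open>x\<close> would be collinear with a point
  of each of the lines \<open>l\<close> and \<open>m\<close>; its common neighbour with
  \<open>x\<close> being unique, these lines would share a second point.\<close>

lemma star:
 assumes "V.subspace H" "!!x y. x : CU H ==> y : CU H ==> d2 x y" "CU H ~= {}"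
 obtains z where "z : P" "CU H \<subseteq> insert z (nbr z)"
proof (cases "EX y:CU H. EX z:CU H. ~ col y z")
 case False
 obtain z where z: "z : CU H" using assms(3) by blast
 have "CU H \<subseteq> insert z (nbr z)" using False z CU_P unfolding nbr_def by blast
 thus ?thesis using that CU_P[OF z] by blast
next
 case True
 then obtain y z where yz: "y : CU H" "z : CU H" "~ col y z" by blast
 obtain x where x: "x : P" "col y x" "col x z" using assms(2)[OF yz(1,2)] by (auto simp: d2_def)
 have xC: "x : CU H" using conv_mid[OF assms(1) yz x] .
 obtain l where l: "l : L" "x : l" "y : l" using x(2) by (auto simp: col_def)
 obtain m where m: "m : L" "x : m" "z : m" using x(3) by (auto simp: col_def)
 have lm: "l ~= m" using l m yz(3) colI by blast
 have "col x w" if w: "w : CU H" for w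
 proof (rule ccontr)
  assume nc: "~ col x w"
  have wP: "w : P" and yP: "y : P" "z : P" using w yz CU_P by auto
  have "x ~= y" "x ~= z" using x yz by auto
  then obtain u where u: "u : P" "u : l" "col w u" using two_d2[OF wP l(1) x(1) yP(1) l(2,3)] assms(2) w xC yz by blast
  obtain v where v: "v : P" "v : m" "col w v" using two_d2[OF wP m(1) x(1) yP(2) m(2,3)] assms(2) w xC yz \<open>x ~= z\<close> by blast
  have "u = v" using common_nbr_unique[OF x(1) wP u(1) v(1) nc colI[OF l(1,2) u(2)] u(3) colI[OF m(1,2) v(2)] v(3)] .
  moreover have "u ~= x" using u nc col_sym by blast
  ultimately show False using line_unique[OF l(1) m(1) x(1) u(1)] l m u v lm by blast
 qed
 hence "CU H \<subseteq> insert x (nbr x)" using CU_P unfolding nbr_def by blast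
 thus ?thesis using that x(1) by blast
qed

text \<open>Elimination of \<open>card (BU H)\<close> from \<open>flags_U\<close> and
  \<open>hyper_total\<close>.\<close>

lemma hyper_eq: assumes "hyper H"
 shows "(q^2 + q + 1) * card (LU H) = (q^3 + 1) * (q^2 + q + 1) + q * (q + 1) * card (CU H)"
proof -
 have "card (LU H) * (q + 1) = card (BU H) + (q + 1) * card (CU H)" using flags_U[OF hyper_subspace[OF assms]] .
 moreover have "(q^3 + 1) * (q^2 + q + 1) = card (LU H) + q * card (BU H)" using hyper_total[OF assms] L_card by simp
 ultimately show ?thesis by algebra
qed

lemma ball_card: assumes "z : P" shows "card (insert z (nbr z)) = q^2 + q + 1"
 using nbr_card[OF assms] nbr_finite[of z] by (simp add: nbr_def)

text \<open>Either \<open>CU H\<close> is thin or it lies in a ball, so it has at most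
  \<open>2 * (q^2 + q + 1)\<close> points, and \<open>hyper_eq\<close> translates this to lines. It
  supplies (Hp') for the standard hexagon, with room to spare.\<close>

lemma hyper_bound: assumes "hyper H" shows "card (LU H) <= q^3 + 2 * q^2 + 2 * q + 1"
proof -
 have sH: "V.subspace H" using hyper_subspace[OF assms] .
 have c: "card (CU H) <= 2 * (q^2 + q + 1)"
 proof (cases "EX x:CU H. EX y:CU H. opp x y")
  case True thus ?thesis using thin(3)[OF assms] by auto
 next
  case False
  show ?thesis
  proof (cases "CU H = {}")
   case ne: False
   obtain z where z: "z : P" "CU H \<subseteq> insert z (nbr z)" using star[OF sH _ ne] False unfolding opp_def by blast
   thus ?thesis using card_mono[OF _ z(2)] nbr_finite ball_card[OF z(1)] by simp
  qed simp
 qed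
 have "(q^2 + q + 1) * card (LU H) <= (q^3 + 1) * (q^2 + q + 1) + q * (q + 1) * (2 * (q^2 + q + 1))"
  using hyper_eq[OF assms] mult_le_mono2[OF c, of "q * (q + 1)"] by linarith
 also have "... = (q^2 + q + 1) * (q^3 + 2 * q^2 + 2 * q + 1)" by algebra
 finally have "0 < q^2 + q + 1 --> card (LU H) <= q^3 + 2 * q^2 + 2 * q + 1" by (simp only: mult_le_cancel1 simp_thms)
 thus ?thesis by simp
qed

end

section \<open>The dimension of the space spanned by a hexagon\<close>

lemma finite_span:
 fixes B :: "(nat => 'a::{field,finite}) set"
 assumes "finite B" shows "finite (V.span B)"
proof -
 let ?f = "%u. \<Sum>v\<in>B. scl (u v) v"
 have "?f u : ?f ` (B \<rightarrow>\<^sub>E (UNIV :: 'a set))" for u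
  by (intro image_eqI[of _ _ "restrict u B"]) (auto intro!: sum.cong)
 hence "V.span B \<subseteq> ?f ` (B \<rightarrow>\<^sub>E (UNIV :: 'a set))" unfolding V.span_finite[OF assms] by blast
 moreover have "finite (?f ` (B \<rightarrow>\<^sub>E (UNIV :: 'a set)))" by (intro finite_imageI finite_PiE assms finite)
 ultimately show ?thesis by (rule finite_subset)
qed

context hexagon
begin

lemma VV_finite: "finite VV"
 unfolding VV_def using finite_L line_finite by (intro finite_span) blast

definition Opp where "Opp x = {y : P. opp x y}"

lemma P_split: assumes "x : P"
 shows "A Int P = (A Int {x}) Un (A Int nbr x) Un (A Int S2 x) Un (A Int Opp x)"
 using assms col_refl[OF assms] col_d2[OF assms] unfolding nbr_def S2_def Opp_def opp_def by blast

lemma P_split_card: assumes "x : P" "A \<subseteq> P"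
 shows "card A = card (A Int {x}) + card (A Int nbr x) + card (A Int S2 x) + card (A Int Opp x)"
proof -
 have fin: "finite (A Int {x})" "finite (A Int nbr x)" "finite (A Int S2 x)" "finite (A Int Opp x)"
  using nbr_finite S2_finite finite_P by (auto simp: Opp_def)
 have d: "(A Int {x}) Int (A Int nbr x) = {}" "((A Int {x}) Un (A Int nbr x)) Int (A Int S2 x) = {}"
  "((A Int {x}) Un (A Int nbr x) Un (A Int S2 x)) Int (A Int Opp x) = {}"
  using assms col_refl[OF assms(1)] col_d2[OF assms(1)] unfolding nbr_def S2_def Opp_def opp_def by blast+
 have "A = (A Int {x}) Un (A Int nbr x) Un (A Int S2 x) Un (A Int Opp x)" using P_split[OF assms(1), of A] assms(2) by blast
 hence "card A = card ((A Int {x}) Un (A Int nbr x) Un (A Int S2 x) Un (A Int Opp x))" by simp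
 also have "... = card ((A Int {x}) Un (A Int nbr x) Un (A Int S2 x)) + card (A Int Opp x)"
  by (rule card_Un_disjoint) (use fin d in auto)
 also have "card ((A Int {x}) Un (A Int nbr x) Un (A Int S2 x)) = card ((A Int {x}) Un (A Int nbr x)) + card (A Int S2 x)"
  by (rule card_Un_disjoint) (use fin d in auto)
 also have "card ((A Int {x}) Un (A Int nbr x)) = card (A Int {x}) + card (A Int nbr x)"
  by (rule card_Un_disjoint) (use fin d in auto)
 finally show ?thesis .
qed

lemma Opp_card: assumes "x : P" shows "card (Opp x) = q^5"
proof -
 have "P Int {x} = {x}" "P Int nbr x = nbr x" "P Int S2 x = S2 x" "P Int Opp x = Opp x"
  using assms by (auto simp: nbr_def S2_def Opp_def)
 hence "card P = 1 + card (nbr x) + card (S2 x) + card (Opp x)" using P_split_card[OF assms subset_refl] by simp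
 hence "(q^3 + 1) * (q^2 + q + 1) = 1 + (q^2 + q) + q * q * (q^2 + q) + card (Opp x)"
  using card_P L_card nbr_card[OF assms] S2_card[OF assms] by simp
 moreover have "(q^3 + 1) * (q^2 + q + 1) = 1 + (q^2 + q) + q * q * (q^2 + q) + q^5" by algebra
 ultimately show ?thesis by simp
qed

lemma opp_disj: assumes "x : P" "y : P" "opp x y" shows "Pi x Int Pi y = {0}" "sub (Pi x \<oplus> Pi y) 6"
proof -
 obtain c where c: "sub (Pi x Int Pi y) c" "sub (Pi x \<oplus> Pi y) (3 + 3 - c)"
  using sub_Int[OF Pi_sub[OF assms(1)] Pi_sub[OF assms(2)]] by metis
 have "c = 0"
 proof (rule ccontr)
  assume "c ~= 0"
  then obtain w where w: "w : Pi x Int Pi y" "w : NV" using sub_point[OF c(1)] by auto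
  have "d2 x y" using d2I[OF Pi_P[of w x] ] w mem_Pi col_sym by blast
  thus False using assms(3) by (simp add: opp_def)
 qed
 thus "Pi x Int Pi y = {0}" "sub (Pi x \<oplus> Pi y) 6" using c sub_0 by auto
qed

lemma opp_CU: assumes "x : P" "y : P" shows "x : CU (Pi x \<oplus> Pi y)" "y : CU (Pi x \<oplus> Pi y)"
 using assms ssum_upper1[OF Pi_subspace[OF assms(2)], of "Pi x"] ssum_upper2[OF Pi_subspace[OF assms(1)], of "Pi y"]
 by (simp_all add: CU_def)

lemma opp_ex: assumes "x : P" obtains y where "y : P" "opp x y"
proof -
 have "card (Opp x) ~= 0" using Opp_card[OF assms] q_ge2 by simp
 hence "Opp x ~= {}" by auto
 thus ?thesis using that unfolding Opp_def by blast
qed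

text \<open>Opposite pencils are disjoint and span dimension 6. If \<open>VV\<close> had dimension 8
  or more, a hyperplane could contain, besides these two pencils, that of a third point
  \<open>p\<close> on a line \<open>l\<close> through \<open>x\<close>. But \<open>l\<close> also
  carries the projection \<open>z\<close> of \<open>y\<close>, and \<open>thin\<close> admits only
  two points of \<open>CU\<close> on a line.\<close>

lemma VV_dim: "sub VV 6 | sub VV 7"
proof -
 obtain k where k: "sub VV k" using sub_exists[OF VV_subspace VV_finite] by blast
 obtain x where x: "x : P" using P_nonempty .
 obtain y where y: "y : P" "opp x y" using opp_ex[OF x] .
 let ?H = "Pi x \<oplus> Pi y"
 have H6: "sub ?H 6" using opp_disj[OF x y] by blast
 have HV: "?H \<subseteq> VV" using ssum_least[OF VV_subspace VV_Pi[OF x] VV_Pi[OF y(1)]] .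
 have k6: "6 <= k" using sub_mono[OF H6 k HV] .
 have "k <= 7"
 proof (rule ccontr)
  assume "~ k <= 7"
  then obtain j where j: "k = Suc j" "7 <= j" by (cases k) auto
  obtain l where l: "l : L" "x : l" using two_lines[OF x] by metis
  have lH: "l : LU ?H" using CU_line[OF opp_CU(1)[OF x y(1)] l] .
  obtain z where z: "z : CU ?H" "z : l" "d2 y z"
   using line_has_C[OF sub_subspace[OF H6] opp_CU(2)[OF x y(1)] lH] .
  have zx: "z ~= x" using z y(2) d2_sym by (auto simp: opp_def)
  obtain p where p: "p : P" "p : l" "p ~: {x, z}" using other_point[OF l(1), of "{x,z}"] q_ge2 zx by auto
  obtain c where c: "sub (?H Int Pi p) c" "sub (?H \<oplus> Pi p) (6 + 3 - c)" using sub_Int[OF H6 Pi_sub[OF p(1)]] by metis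
  have "l \<subseteq> ?H Int Pi p" using lH Ln_Pi[OF l(1) p(2)] by (auto simp: LU_def)
  hence "2 <= c" using sub_mono[OF line_sub2[OF l(1)] c(1)] by blast
  \<comment> \<open>The common line \<open>l\<close> brings the dimension of the sum down to at most
    7.\<close>
  hence c7: "6 + 3 - c <= j" using j by simp
  have WV: "?H \<oplus> Pi p \<subseteq> VV" using ssum_least[OF VV_subspace HV VV_Pi[OF p(1)]] .
  obtain S where S: "sub S j" "?H \<oplus> Pi p \<subseteq> S" "S \<subseteq> VV" using hyps_exists[OF k[unfolded j(1)] c(2) WV c7] .
  have hS: "hyper S" unfolding hyper_def using S k j by blast
  have "?H \<subseteq> S" "Pi p \<subseteq> S"
   using S(2) ssum_upper1[OF Pi_subspace[OF p(1)], of ?H] ssum_upper2[OF sub_subspace[OF H6], of "Pi p"] by blast+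
  hence xS: "x : CU S" "y : CU S" "z : CU S" "p : CU S"
   using opp_CU[OF x y(1)] z(1) p(1) unfolding CU_def by blast+
  have "card (l Int CU S) = 2" using thin(1)[OF hS xS(1,2) y(2)] CU_line[OF xS(1) l] by blast
  moreover have "{x, z, p} \<subseteq> l Int CU S" using xS l z p by blast
  hence "card {x, z, p} <= card (l Int CU S)" using CU_finite[of S] by (intro card_mono) auto
  moreover have "card {x, z, p} = 3" using zx p(3) by auto
  ultimately show False by simp
 qed
 hence "k = 6 | k = 7" using k6 by linarith
 thus ?thesis using k by blast
qed

end

section \<open>Tangent hyperplanes\<close>

locale hex7 = hexagon +
 assumes VV7: "sub VV 7"
begin

lemma hyper_iff: "hyper H \<longleftrightarrow> sub H 6 & H \<subseteq> VV"
proof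
 assume "hyper H"
 then obtain k where k: "sub VV (Suc k)" "sub H k" "H \<subseteq> VV" by (auto simp: hyper_def)
 have "Suc k = 7" using sub_unique[OF k(1) VV7] .
 thus "sub H 6 & H \<subseteq> VV" using k by simp
next
 assume "sub H 6 & H \<subseteq> VV"
 thus "hyper H" unfolding hyper_def using VV7 by (intro exI[of _ 6]) simp
qed

text \<open>The tangent hyperplane at \<open>v\<close>, which is seen to be a hyperplane only in
  \<open>T_hyper\<close>. The argument may be any vector, so that later it can be a linear
  combination that is not in normal form.\<close>

definition T where "T v = V.span (\<Union>y\<in>{y : P. col v y}. Pi y)"

lemma T_sub_VV: "T v \<subseteq> VV"
 unfolding T_def using VV_Pi by (intro V.span_minimal[OF _ VV_subspace]) blast

lemma T_Pi: "y : P ==> col v y ==> Pi y \<subseteq> T v"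
 unfolding T_def using V.span_superset[of "\<Union>y\<in>{y : P. col v y}. Pi y"] by blast

lemma T_subspace: "V.subspace (T v)" by (simp add: T_def)

lemma ball_eq: "x : P ==> {y : P. col x y} = insert x (nbr x)"
 using col_refl unfolding nbr_def by blast

lemma ball_CU_T: "x : P ==> insert x (nbr x) \<subseteq> CU (T x)"
 using T_Pi[of _ x] ball_eq[of x] unfolding CU_def by blast

text \<open>In dimension at most 5, \<open>D_bound\<close> would leave \<open>x\<close> with at most
  \<open>q + 1\<close> neighbours in \<open>CU (T x)\<close>, whereas all \<open>q^2 + q\<close> of
  them are there.\<close>

lemma T_ge6: assumes "x : P" "sub (T x) k" shows "k >= 6"
proof (rule ccontr)
 assume "~ k >= 6"
 hence "card (nbr x Int CU (T x)) <= q + 1" using D_bound[OF assms(2)] ball_CU_T[OF assms(1)] by auto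
 moreover have "nbr x Int CU (T x) = nbr x" using ball_CU_T[OF assms(1)] by blast
 moreover have "2 * q <= q * q" using q_ge2 by (rule mult_le_mono1)
 hence "q + 1 < q^2 + q" using q_ge2 unfolding power2_eq_square by linarith
 ultimately show False using nbr_card[OF assms(1)] by simp
qed

lemma thin_Opp: assumes "hyper H" "x : CU H" "y : CU H" "opp x y" shows "card (CU H Int Opp x) = q^2"
proof -
 have x: "x : P" using assms CU_P by blast
 have "card (CU H) = card (CU H Int {x}) + card (CU H Int nbr x) + card (CU H Int S2 x) + card (CU H Int Opp x)"
  by (rule P_split_card[OF x]) (auto simp: CU_def)
 moreover have "CU H Int {x} = {x}" using assms by blast
 ultimately show ?thesis using thin(3,4,5)[OF assms] by (simp add: Int_commute)
qed

text \<open>By \<open>hyper_eq\<close> the number \<open>q^2 + q + 1\<close> divides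
  \<open>card (CU H)\<close>, and by \<open>star\<close> the set lies in a ball of exactly this
  size; so it is the whole ball.\<close>

lemma ball_hyper:
 assumes "hyper H" "x : CU H" "~ (EX y:CU H. opp x y)"
 obtains z where "z : P" "CU H = insert z (nbr z)" "H = T z"
proof -
 have sH: "V.subspace H" using hyper_subspace[OF assms(1)] .
 have "d2 u v" if "u : CU H" "v : CU H" for u v
  using opp_all[OF sH that] assms(2,3) unfolding opp_def by metis
 then obtain z where z: "z : P" "CU H \<subseteq> insert z (nbr z)" using star[OF sH] assms(2) by blast
 have "card (CU H) <= q^2 + q + 1" using card_mono[OF _ z(2)] nbr_finite ball_card[OF z(1)] by simp
 moreover have "card (CU H) > 0" using assms(2) CU_finite card_gt_0_iff by blast
 moreover have "(q^2 + q + 1) dvd card (CU H)"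
 proof -
  have "(q^2 + q + 1) * (card (LU H) + 0) + card (CU H) = (q^2 + q + 1) * (q^3 + 1 + card (CU H))"
   using hyper_eq[OF assms(1)] by algebra
  thus ?thesis by (metis dvd_add_right_iff dvd_triv_left)
 qed
 ultimately have "card (CU H) = q^2 + q + 1" using dvd_imp_le by (metis le_antisym)
 hence e: "CU H = insert z (nbr z)" using card_subset_eq[OF _ z(2)] nbr_finite ball_card[OF z(1)] by simp
 have "Pi y \<subseteq> H" if "y : P" "col z y" for y
 proof -
  have "y : CU H" using that e ball_eq[OF z(1)] by blast
  thus ?thesis by (simp add: CU_def)
 qed
 hence "(\<Union>y\<in>{y : P. col z y}. Pi y) \<subseteq> H" by blast
 hence TH: "T z \<subseteq> H" unfolding T_def by (rule V.span_minimal[OF _ sH])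
 have H6: "sub H 6" using assms(1) hyper_iff by blast
 obtain k where k: "sub (T z) k" using sub_exists[OF T_subspace finite_subset[OF T_sub_VV VV_finite]] by blast
 have "T z = H" using sub_eq[OF k H6 TH] T_ge6[OF z(1) k] by simp
 thus ?thesis using that z(1) e by blast
qed

text \<open>Hyperplanes through \<open>Pi x\<close> are sorted by whether they contain the pencil of
  a point opposite \<open>x\<close>. The \<open>q^5\<close> opposite points determine one each, and
  a thin one serves \<open>q^2\<close> of them, which makes \<open>q^3\<close>. The remaining
  \<open>q^2 + q + 1\<close> are all of the form \<open>T z\<close> with \<open>z\<close> in the
  ball of \<open>x\<close>; that ball has the same size, so every such \<open>T z\<close> occurs, in
  particular \<open>T x\<close>.\<close>

lemma T_hyper: assumes x: "x : P" shows "hyper (T x)" "CU (T x) = insert x (nbr x)"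
proof -
 let ?A = "hyps VV 6 (Pi x)"
 define A where "A = {H : ?A. EX y:CU H. opp x y}"
 define R where "R = ?A - A"
 have fin: "finite ?A" using finite_hyps[OF VV_finite] .
 have hA: "hyper H" "x : CU H" if "H : ?A" for H
  using that hyper_iff x unfolding hyps_def CU_def by blast+
 have cA: "card ?A = 1 + q + q^2 + q^3"
  using card_hyps[of VV 6 "Pi x" 3] VV7 Pi_sub[OF x] VV_Pi[OF x] q_card
  by (simp add: eval_nat_numeral lessThan_Suc algebra_simps)
 have "card (Opp x) = (\<Sum>H\<in>A. card {y : Opp x. y : CU H})"
 proof (rule card_by_rel)
  show "finite (Opp x)" using finite_P by (simp add: Opp_def)
  show "finite A" using fin by (simp add: A_def)
  fix y assume "y : Opp x"
  hence y: "y : P" "opp x y" by (auto simp: Opp_def)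
  let ?H = "Pi x \<oplus> Pi y"
  have H6: "sub ?H 6" using opp_disj[OF x y] by blast
  have "?H \<subseteq> VV" using ssum_least[OF VV_subspace VV_Pi[OF x] VV_Pi[OF y(1)]] .
  hence "?H : A" using H6 opp_CU[OF x y(1)] y(2) unfolding A_def hyps_def CU_def by blast
  moreover have "H' = ?H" if H': "H' : A" "y : CU H'" for H'
  proof -
   have "sub H' 6" "Pi x \<subseteq> H'" "Pi y \<subseteq> H'" using H' unfolding A_def hyps_def CU_def by blast+
   thus ?thesis using sub_eq[OF H6, of H' 6] ssum_least[OF sub_subspace] by blast
  qed
  ultimately show "EX! H. H : A & y : CU H" using opp_CU(2)[OF x y(1)] by blast
 qed
 also have "... = (\<Sum>H\<in>A. q^2)"
 proof (rule sum.cong[OF refl])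
  fix H assume H: "H : A"
  then obtain y where y: "y : CU H" "opp x y" by (auto simp: A_def)
  have "{y : Opp x. y : CU H} = CU H Int Opp x" by blast
  thus "card {y : Opp x. y : CU H} = q^2" using thin_Opp[OF hA[of H] y] H by (simp add: A_def)
 qed
 finally have "card A * q^2 = q^3 * q^2" using Opp_card[OF x] by (simp add: power_add[symmetric])
 hence "card A = q^3" using q_ge2 by (metis mult_right_cancel power_not_zero not_numeral_le_zero)
 hence cR: "card R = q^2 + q + 1"
  unfolding R_def using card_Diff_subset[of A ?A] fin cA by (simp add: A_def)
 let ?B = "insert x (nbr x)"
 have RB: "R \<subseteq> T ` ?B"
 proof
  fix H assume H: "H : R"
  hence "H : ?A" "~ (EX y:CU H. opp x y)" by (auto simp: R_def A_def)
  then obtain z where z: "z : P" "CU H = insert z (nbr z)" "H = T z" using ball_hyper[OF hA] by blast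
  have "x : insert z (nbr z)" using hA(2)[OF \<open>H : ?A\<close>] z by blast
  hence "z : ?B" using z(1) col_sym unfolding nbr_def by blast
  thus "H : T ` ?B" using z by blast
 qed
 have "card (T ` ?B) <= card R" using cR card_image_le[of ?B T] nbr_finite ball_card[OF x] by simp
 hence "R = T ` ?B" using card_seteq[OF _ RB] nbr_finite by simp
 hence TR: "T x : R" by blast
 hence TA: "T x : ?A" "~ (EX y:CU (T x). opp x y)" by (auto simp: R_def A_def)
 show hT: "hyper (T x)" using hA(1)[OF TA(1)] .
 obtain z where z: "z : P" "CU (T x) = insert z (nbr z)" "T x = T z" using ball_hyper[OF hT hA(2)[OF TA(1)] TA(2)] .
 have s: "?B \<subseteq> insert z (nbr z)" using ball_CU_T[OF x] z by simp
 have "?B = insert z (nbr z)"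
  by (rule card_subset_eq[OF _ s]) (use nbr_finite ball_card[OF x] ball_card[OF z(1)] in simp_all)
 thus "CU (T x) = ?B" using z by simp
qed

text \<open>A point of \<open>T x\<close> is on a line \<open>l\<close> of \<open>T x\<close>. If
  \<open>l\<close> were far from \<open>x\<close>, its point at distance two would be in
  \<open>CU (T x)\<close>, the ball of \<open>x\<close>, and hence collinear with
  \<open>x\<close>.\<close>

lemma T_mem: assumes "x : P" "y : P" shows "y : T x \<longleftrightarrow> d2 x y"
proof
 assume "d2 x y"
 then obtain w where "w : P" "col x w" "col w y" by (auto simp: d2_def)
 thus "y : T x" using T_Pi mem_Pi by blast
next
 assume y: "y : T x"
 obtain l where l: "l : LU (T x)" "y : l" using hyper_line[OF T_hyper(1)[OF assms(1)] assms(2) y] .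
 have xC: "x : CU (T x)" using T_hyper(2)[OF assms(1)] by blast
 have "l ~: far x"
 proof
  assume f: "l : far x"
  obtain z where z: "z : P" "z : l" "d2 x z" using proj_exists[OF assms(1) LU_L[OF l(1)]] .
  have "z : CU (T x)" using conv_far(1)[OF T_subspace xC l(1) f z] .
  hence "z : insert x (nbr x)" using T_hyper(2)[OF assms(1)] by simp
  hence "col x z" using col_refl[OF assms(1)] by (auto simp: nbr_def)
  thus False using f z unfolding far_def by blast
 qed
 then obtain u where u: "u : P" "u : l" "col x u" using LU_L[OF l(1)] unfolding far_def by blast
 thus "d2 x y" using d2I[OF u(1,3)] colI[OF LU_L[OF l(1)] u(2) l(2)] by blast
qed

end

section \<open>Dual pairs of planes and coordinates\<close>

lemma ssum_span_mem: "v : V.span {x} \<oplus> W \<longleftrightarrow> (EX c. EX w:W. v = scl c x + w)"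
 unfolding ssum_def V.span_singleton by blast

lemma subspace_Un_cases:
 assumes "V.subspace M" "V.subspace A" "V.subspace B" "M \<subseteq> A Un B" shows "M \<subseteq> A | M \<subseteq> B"
proof (rule ccontr)
 assume "~ (M \<subseteq> A | M \<subseteq> B)"
 then obtain u v where u: "u : M" "u ~: A" "v : M" "v ~: B" by blast
 have "u : B" "v : A" using u assms(4) by blast+
 have "u + v : A Un B" using V.subspace_add[OF assms(1) u(1,3)] assms(4) by blast
 thus False
 proof
  assume "u + v : A"
  hence "u + v - v : A" using V.subspace_diff[OF assms(2)] \<open>v : A\<close> by blast
  thus False using u by simp
 next
  assume "u + v : B"
  hence "u + v - u : B" using V.subspace_diff[OF assms(3)] \<open>u : B\<close> by blast
  thus False using u by simp
 qed
qed

context hex7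
begin

text \<open>All nonzero multiples of points. Coordinate arguments form linear combinations, which
  leave \<open>NV\<close>; collinearity and distance do not change under nonzero scalars.\<close>

definition X0 where "X0 = \<Union>L - {0}"

lemma col_scl1: "c ~= 0 ==> col (scl c v) w \<longleftrightarrow> col v w"
 unfolding col_def using subspace_scl[OF line_subspace] by blast

lemma col_scl2: "c ~= 0 ==> col v (scl c w) \<longleftrightarrow> col v w"
 unfolding col_def using subspace_scl[OF line_subspace] by blast

lemma d2_scl1: "c ~= 0 ==> d2 (scl c v) w \<longleftrightarrow> d2 v w" unfolding d2_def using col_scl1 by simp
lemma d2_scl2: "c ~= 0 ==> d2 v (scl c w) \<longleftrightarrow> d2 v w" unfolding d2_def using col_scl2 by simp
lemma T_scl: "c ~= 0 ==> T (scl c v) = T v" unfolding T_def using col_scl1 by simp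
lemma Pi_scl: "c ~= 0 ==> Pi (scl c v) = Pi v"
 by (rule set_eqI) (simp add: mem_Pi col_scl1)

lemma P_X0: "x : P ==> x : X0" using P_nonzero unfolding X0_def P_def by blast

lemma rep: assumes "v : X0" obtains c where "c ~= 0" "scl c v : P"
proof -
 obtain l where l: "l : L" "v : l" "v ~= 0" using assms by (auto simp: X0_def)
 obtain c where c: "c ~= 0" "scl c v : NV" using NV_exists[OF l(3)] .
 have "scl c v : l" using l c subspace_scl[OF line_subspace[OF l(1)]] by blast
 thus ?thesis using that c LP[OF l(1)] by blast
qed

lemma PiX: "v : X0 ==> sub (Pi v) 3"
 using rep[of v] Pi_sub Pi_scl by metis

lemma TX: "v : X0 ==> sub (T v) 6"
 using rep[of v] T_hyper(1) hyper_iff T_scl by metis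

lemma T_mem_X: assumes "v : X0" "w : X0" shows "w : T v \<longleftrightarrow> d2 v w"
proof -
 obtain c where c: "c ~= 0" "scl c v : P" using rep[OF assms(1)] .
 obtain d where d: "d ~= 0" "scl d w : P" using rep[OF assms(2)] .
 have "scl d w : T (scl c v) \<longleftrightarrow> d2 (scl c v) (scl d w)" using T_mem[OF c(2) d(2)] .
 thus ?thesis using c d T_scl d2_scl1 d2_scl2 subspace_scl[OF T_subspace] by simp
qed

lemma T_swap: "v : X0 ==> w : X0 ==> w : T v \<longleftrightarrow> v : T w"
 using T_mem_X d2_sym by blast

lemma Pi_X0: "w : Pi v ==> w ~= 0 ==> w : X0" by (auto simp: X0_def Pi_def)
lemma col_X0: "col v w ==> w ~= 0 ==> w : X0" by (auto simp: X0_def col_def)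

lemma X0_VV: "v : X0 ==> v : VV" using VV_L by (auto simp: X0_def)

lemma col_reflX: "v : X0 ==> col v v" by (auto simp: X0_def col_def)

section \<open>Thin hyperplane sections as doubled projective planes\<close>

definition thinp where "thinp H x y \<longleftrightarrow> hyper H & x : CU H & y : CU H & opp x y"

lemma thinp_sym: "thinp H x y ==> thinp H y x" using opp_sym by (auto simp: thinp_def)

text \<open>The witness is \<open>Pi w \<inter> T z\<close> for a point \<open>z\<close> of
  \<open>CU H\<close> opposite \<open>w\<close>: on every line through \<open>w\<close> the second
  point of \<open>CU H\<close> is the projection of \<open>z\<close>.\<close>

lemma N_ex: assumes t: "thinp H x y" and w: "w : CU H"
 shows "EX M. sub M 2 & M \<subseteq> Pi w & w ~: M & M Int NV = nbr w Int CU H"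
proof -
 have h: "hyper H" "V.subspace H" using t hyper_subspace by (auto simp: thinp_def)
 obtain z where z: "z : CU H" "opp w z" using opp_all[OF h(2), of x y] t w unfolding thinp_def by metis
 have wP: "w : P" and zP: "z : P" using w z CU_P by auto
 have T6: "sub (T z) 6" using TX[OF P_X0[OF zP]] .
 have wT: "w ~: T z" using T_mem[OF zP wP] z(2) d2_sym by (auto simp: opp_def)
 obtain c where c: "sub (Pi w Int T z) c" "3 + 6 <= 7 + c"
  using sub_Int_ge[OF Pi_sub[OF wP] T6 VV7 VV_Pi[OF wP] T_sub_VV] .
 have "c ~= 3"
 proof
  assume "c = 3"
  hence "Pi w Int T z = Pi w" using sub_eq[OF c(1) Pi_sub[OF wP]] by auto
  thus False using wT Pi_self[OF wP] by blast
 qed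
 moreover have "c <= 3" using sub_mono[OF c(1) Pi_sub[OF wP]] by blast
 ultimately have s2: "sub (Pi w Int T z) 2" using c by (cases "c = 2") auto
 have key: "p : CU H \<longleftrightarrow> d2 z p" if p: "p : nbr w" for p
 proof -
  have pP: "p : P" "p ~= w" "col w p" using p by (auto simp: nbr_def)
  obtain l where l: "l : L" "w : l" "p : l" using pP(3) by (auto simp: col_def)
  have lH: "l : LU H" using CU_line[OF w l(1,2)] .
  obtain u where u: "u : CU H" "u : l" "d2 z u" using line_has_C[OF h(2) z(1) lH] .
  have uw: "u ~= w" using u z(2) d2_sym by (auto simp: opp_def)
  have "card (l Int CU H) = 2" using thin(1)[OF h(1), of x y] t lH unfolding thinp_def by blast
  hence "l Int CU H = {w, u}"
   using card_seteq[of "l Int CU H" "{w, u}"] w u l uw CU_finite[of H] by auto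
  hence 1: "p : CU H ==> p = u" using l pP by blast
  have 2: "d2 z p ==> p = u"
  proof (rule ccontr)
   assume d: "d2 z p" and n: "p ~= u"
   obtain v where v: "v : P" "v : l" "col z v" using two_d2[OF zP l(1) pP(1) CU_P[OF u(1)] l(3) u(2) n d u(3)] .
   have "d2 w z" using d2I[OF v(1) colI[OF l(1,2) v(2)] col_sym[OF v(3)]] .
   thus False using z(2) by (simp add: opp_def)
  qed
  show ?thesis using 1 2 u by blast
 qed
 have "(Pi w Int T z) Int NV = nbr w Int CU H"
 proof (intro equalityI subsetI)
  fix p assume p: "p : (Pi w Int T z) Int NV"
  have pP: "p : P" using Pi_P p by blast
  have "p : nbr w" using p pP wT mem_Pi unfolding nbr_def by blast
  thus "p : nbr w Int CU H" using key T_mem[OF zP pP] p by blast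
 next
  fix p assume p: "p : nbr w Int CU H"
  hence pP: "p : P" "col w p" by (auto simp: nbr_def)
  thus "p : (Pi w Int T z) Int NV" using p key T_mem[OF zP pP(1)] mem_Pi P_NV by blast
 qed
 thus ?thesis using s2 wT by (intro exI[of _ "Pi w Int T z"]) blast
qed

definition N where "N H w = (SOME M. sub M 2 & M \<subseteq> Pi w & w ~: M & M Int NV = nbr w Int CU H)"

lemma N_props: assumes "thinp H x y" "w : CU H"
 shows "sub (N H w) 2" "N H w \<subseteq> Pi w" "w ~: N H w" "N H w Int NV = nbr w Int CU H"
 using someI_ex[OF N_ex[OF assms]] unfolding N_def by blast+

text \<open>The plane holding the class of \<open>x\<close> in the doubled projective plane. It is
  spanned by \<open>x\<close> and the line formed by the neighbours of the opposite point
  \<open>y\<close> in \<open>CU H\<close>, which are at distance two from \<open>x\<close>.\<close>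

definition E where "E H x y = V.span {x} \<oplus> N H y"

lemma thin_d2: assumes t: "thinp H x y" and a: "a : nbr y" "a : CU H" shows "d2 x a" "~ col x a"
proof -
 have h: "hyper H" "V.subspace H" "x : CU H" "y : CU H" "opp x y" using t hyper_subspace by (auto simp: thinp_def)
 have aP: "a : P" "a ~= y" "col y a" using a by (auto simp: nbr_def)
 obtain l where l: "l : L" "y : l" "a : l" using aP(3) by (auto simp: col_def)
 have lH: "l : LU H" using CU_line[OF h(4) l(1,2)] .
 obtain u where u: "u : CU H" "u : l" "d2 x u" using line_has_C[OF h(2,3) lH] .
 have uw: "u ~= y" using u h by (auto simp: opp_def)
 have "card (l Int CU H) = 2" using thin(1)[OF h(1,3-5) lH] .
 hence "l Int CU H = {y, u}" using card_seteq[of "l Int CU H" "{y, u}"] h u l uw CU_finite[of H] by auto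
 hence "a = u" using a l aP by blast
 thus "d2 x a" using u by simp
 show "~ col x a" using d2I[OF aP(1) _ col_sym[OF aP(3)]] h(5) by (auto simp: opp_def)
qed

lemma E_sub: assumes t: "thinp H x y" shows "sub (E H x y) 3"
proof -
 have h: "x : CU H" "y : CU H" "opp x y" using t by (auto simp: thinp_def)
 note n = N_props[OF t h(2)]
 have xP: "x : P" using h CU_P by blast
 have "x ~: N H y"
 proof
  assume "x : N H y"
  hence "x : nbr y" using n(4) P_NV[OF xP] by blast
  hence "col x y" using col_sym by (auto simp: nbr_def)
  thus False using h(3) col_d2[OF xP] by (auto simp: opp_def)
 qed
 thus ?thesis unfolding E_def using sub_insert[OF n(1), of x] by (simp add: ssum_commute eval_nat_numeral)
qed

lemma Pi_N: assumes t: "thinp H x y" and w: "w : CU H" shows "Pi w = V.span {w} \<oplus> N H w"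
proof -
 note n = N_props[OF t w]
 have wP: "w : P" using w CU_P by blast
 have s: "sub (V.span {w} \<oplus> N H w) 3" using sub_insert[OF n(1,3)] by (simp add: ssum_commute eval_nat_numeral)
 have "V.span {w} \<oplus> N H w \<subseteq> Pi w"
  using ssum_least[OF Pi_subspace[OF wP]] span_subset_iff[OF Pi_subspace[OF wP]] Pi_self[OF wP] n(2) by blast
 thus ?thesis using sub_eq[OF s Pi_sub[OF wP]] by simp
qed

lemma thin_H: assumes t: "thinp H x y" shows "H = Pi x \<oplus> Pi y"
proof -
 have h: "hyper H" "x : CU H" "y : CU H" "opp x y" using t by (auto simp: thinp_def)
 have H6: "sub H 6" using h(1) hyper_iff by blast
 have "Pi x \<oplus> Pi y \<subseteq> H" using ssum_least[OF sub_subspace[OF H6]] h unfolding CU_def by blast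
 thus ?thesis using sub_eq[OF opp_disj(2)[OF CU_P[OF h(2)] CU_P[OF h(3)] h(4)] H6] by simp
qed

lemma E_sum: assumes t: "thinp H x y" shows "E H x y \<oplus> E H y x = H" "E H x y Int E H y x = {0}"
proof -
 have h: "hyper H" "x : CU H" "y : CU H" "opp x y" using t by (auto simp: thinp_def)
 have H6: "sub H 6" using h(1) hyper_iff by blast
 have sx: "V.subspace (N H x)" "V.subspace (N H y)" using N_props(1)[OF t h(2)] N_props(1)[OF t h(3)] sub_subspace by auto
 have sE: "V.subspace (E H x y)" "V.subspace (E H y x)" using E_sub[OF t] E_sub[OF thinp_sym[OF t]] sub_subspace by auto
 obtain c where c: "sub (E H x y Int E H y x) c" "sub (E H x y \<oplus> E H y x) (3 + 3 - c)"
  using sub_Int[OF E_sub[OF t] E_sub[OF thinp_sym[OF t]]] by metis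
 have up: "V.span {x} \<subseteq> E H x y" "N H y \<subseteq> E H x y" "V.span {y} \<subseteq> E H y x" "N H x \<subseteq> E H y x"
  unfolding E_def using ssum_upper1 ssum_upper2 sx V.subspace_span by blast+
 have up2: "E H x y \<subseteq> E H x y \<oplus> E H y x" "E H y x \<subseteq> E H x y \<oplus> E H y x" using ssum_upper1 ssum_upper2 sE by blast+
 have "Pi x \<subseteq> E H x y \<oplus> E H y x" "Pi y \<subseteq> E H x y \<oplus> E H y x"
  unfolding Pi_N[OF t h(2)] Pi_N[OF t h(3)]
  by (intro ssum_least[OF sub_subspace[OF c(2)]] subset_trans[OF up(1) up2(1)] subset_trans[OF up(2) up2(1)]
    subset_trans[OF up(3) up2(2)] subset_trans[OF up(4) up2(2)])+
 hence HE: "H \<subseteq> E H x y \<oplus> E H y x" unfolding thin_H[OF t] using ssum_least[OF sub_subspace[OF c(2)]] by (metis thin_H[OF t])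
 have "6 <= 3 + 3 - c" using sub_mono[OF H6 c(2) HE] .
 hence c0: "c = 0" by simp
 thus "E H x y Int E H y x = {0}" using c sub_0 by blast
 show "E H x y \<oplus> E H y x = H" using sub_eq[OF H6 c(2) HE] by simp
qed

text \<open>A general point of the plane is \<open>scl c x + a\<close> with \<open>a\<close> on
  \<open>N H y\<close>. The common neighbour \<open>f\<close> of \<open>x\<close> and
  \<open>a\<close> is in \<open>CU H\<close>, and its line \<open>N H f\<close> contains
  \<open>x\<close> and \<open>a\<close>, hence the point.\<close>

lemma E_CU: assumes t: "thinp H x y" and p: "p : E H x y" "p : NV"
 shows "p : CU H & (EX f:CU H. f : E H y x & f : nbr p)"
proof -
 have h: "hyper H" "V.subspace H" "x : CU H" "y : CU H" "opp x y" using t hyper_subspace by (auto simp: thinp_def)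
 have xP: "x : P" "y : P" using h CU_P by auto
 note nx = N_props[OF t h(3)] and ny = N_props[OF t h(4)]
 have up: "y : E H y x" "N H x \<subseteq> E H y x"
  unfolding E_def using ssum_upper1[of "N H x" "V.span {y}"] ssum_upper2[of "V.span {y}" "N H x"] sub_subspace[OF nx(1)] V.span_base[of y "{y}"] by auto
 obtain c a where ca: "p = scl c x + a" "a : N H y" using p(1) unfolding E_def ssum_span_mem by blast
 show ?thesis
 proof (cases "a = 0")
  case True
  hence "scl c x : NV" using ca p by simp
  hence px: "p = x" using NV_unique[OF P_NV[OF xP(1)], of c] ca True by simp
  obtain f where f: "f : N H x" "f : NV" using sub_point[OF nx(1)] by auto
  thus ?thesis using px h nx(4) up by blast
 next
  case a0: False
  obtain d where d: "d ~= 0" "scl d a : NV" using NV_exists[OF a0] .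
  have daN: "scl d a : N H y" using ca(2) d subspace_scl[OF sub_subspace[OF ny(1)]] by blast
  hence da: "scl d a : nbr y" "scl d a : CU H" using d ny(4) by blast+
  have daP: "scl d a : P" using da CU_P by blast
  show ?thesis
  proof (cases "c = 0")
   case True
   have "p = scl d a" using ca True d NV_inj(1)[OF p(2) d(2), of 1 "1/d"] by simp
   moreover have "y : nbr (scl d a)" using da xP col_sym unfolding nbr_def by blast
   ultimately show ?thesis using da h up by blast
  next
   case c0: False
   note td = thin_d2[OF t da]
   obtain f where f: "f : P" "col x f" "col f (scl d a)" using td(1) by (auto simp: d2_def)
   have fC: "f : CU H" using conv_mid[OF h(2,3) da(2) td(2) f] .
   have fx: "f ~= x" "f ~= scl d a" using f td(2) by auto
   have "x : nbr f Int CU H" "scl d a : nbr f Int CU H" using f fx xP daP da h col_sym unfolding nbr_def by blast+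
   note nf = N_props[OF t fC]
   have s: "V.subspace (N H f)" using sub_subspace[OF nf(1)] .
   have "x : N H f" "scl d a : N H f" using nf(4) \<open>x : nbr f Int CU H\<close> \<open>scl d a : nbr f Int CU H\<close> by blast+
   hence "x : N H f" "a : N H f" using subspace_scl[OF s d(1)] by blast+
   hence "p : N H f" using ca(1) V.subspace_add[OF s] V.subspace_scale[OF s] by blast
   hence pf: "p : nbr f" "p : CU H" using nf(4) p(2) by blast+
   have "f : nbr x" using f fx unfolding nbr_def by blast
   hence "f : N H x" using nx(4) fC by blast
   moreover have "f : nbr p" using pf f(1) col_sym unfolding nbr_def by blast
   ultimately show ?thesis using pf fC up by blast
  qed
 qed
qed

text \<open>Both planes consist of points of \<open>CU H\<close>, and together they have
  \<open>2 * (q^2 + q + 1)\<close> points, which is all that \<open>thin\<close> admits.\<close>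

lemma CU_E: assumes t: "thinp H x y" shows "CU H = (E H x y Un E H y x) Int NV"
proof -
 have h: "hyper H" "x : CU H" "y : CU H" "opp x y" using t by (auto simp: thinp_def)
 have s: "(E H x y Un E H y x) Int NV \<subseteq> CU H" using E_CU[OF t] E_CU[OF thinp_sym[OF t]] by blast
 have c3: "card (E H x y Int NV) = q^2 + q + 1" "card (E H y x Int NV) = q^2 + q + 1"
  using card_sub_NV[OF E_sub[OF t]] card_sub_NV[OF E_sub[OF thinp_sym[OF t]]] q_card
  by (simp_all add: eval_nat_numeral)
 have fin: "finite (E H x y Int NV)" "finite (E H y x Int NV)" using sub_finite[OF E_sub[OF t]] sub_finite[OF E_sub[OF thinp_sym[OF t]]] by auto
 have "(E H x y Int NV) Int (E H y x Int NV) = {}"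
 proof (rule equals0I)
  fix v assume v: "v : (E H x y Int NV) Int (E H y x Int NV)"
  hence "v : E H x y Int E H y x" by blast
  thus False using E_sum(2)[OF t] v zero_notin_NV by simp
 qed
 hence "card ((E H x y Int NV) Un (E H y x Int NV)) = 2 * (q^2 + q + 1)" using card_Un_disjoint[OF fin] c3 by simp
 hence "card ((E H x y Un E H y x) Int NV) = card (CU H)" using thin(3)[OF h] by (simp add: Int_Un_distrib2)
 thus ?thesis using card_subset_eq[OF CU_finite s] by simp
qed

text \<open>\<open>N H p\<close> is covered by the two planes, so it lies in one of them, and the
  neighbour \<open>f\<close> from \<open>E_CU\<close> decides which.\<close>

lemma N_E: assumes t: "thinp H x y" and p: "p : E H x y" "p : NV" shows "N H p \<subseteq> E H y x"
proof -
 have pC: "p : CU H" using E_CU[OF t p] by blast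
 note n = N_props[OF t pC]
 have sE: "V.subspace (E H x y)" "V.subspace (E H y x)" using E_sub[OF t] E_sub[OF thinp_sym[OF t]] sub_subspace by auto
 obtain f where f: "f : CU H" "f : E H y x" "f : nbr p" using E_CU[OF t p] by blast
 have fN: "f : N H p" using n(4) f by blast
 have fE: "f ~: E H x y" using E_sum(2)[OF t] f P_nonzero[OF CU_P[OF f(1)]] by blast
 have "N H p \<subseteq> E H x y Un E H y x"
 proof
  fix v assume v: "v : N H p"
  show "v : E H x y Un E H y x"
  proof (cases "v = 0")
   case False
   then obtain c where c: "c ~= 0" "scl c v : NV" using NV_exists by blast
   have "scl c v : N H p" using v subspace_scl[OF sub_subspace[OF n(1)] c(1)] by blast
   hence "scl c v : CU H" using c n(4) by blast
   hence "scl c v : E H x y Un E H y x" using CU_E[OF t] by blast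
   thus ?thesis using subspace_scl[OF sE(1) c(1)] subspace_scl[OF sE(2) c(1)] by blast
  qed (use V.subspace_0[OF sE(1)] in simp)
 qed
 thus ?thesis using subspace_Un_cases[OF sub_subspace[OF n(1)] sE] fN fE by blast
qed

end

lemma scl_in_span: "scl c a : V.span {a}" by (simp add: V.span_scale V.span_base)

lemma sub_span_pair:
 fixes a :: "nat => 'a::{field,finite}"
 assumes "a ~= 0" "b ~: V.span {a}" shows "sub (V.span {a} \<oplus> V.span {b}) 2"
 using sub_insert[OF sub_span1[OF assms(1)] assms(2)] by (simp add: eval_nat_numeral)

lemma span_pair_mem: "v : V.span {a} \<oplus> V.span {b} \<longleftrightarrow> (EX c d. v = scl c a + scl d b)"
 unfolding ssum_def V.span_singleton by blast

lemma sub2_eq_pair: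
 fixes a :: "nat => 'a::{field,finite}"
 assumes "sub M 2" "a : M" "b : M" "a ~= 0" "b ~: V.span {a}"
 shows "M = V.span {a} \<oplus> V.span {b}"
proof -
 have "V.span {a} \<oplus> V.span {b} \<subseteq> M"
  using ssum_least[OF sub_subspace[OF assms(1)]] span_subset_iff[OF sub_subspace[OF assms(1)]] assms by blast
 thus ?thesis using sub_eq[OF sub_span_pair[OF assms(4,5)] assms(1)] by simp
qed

lemma notin_span_imp: assumes "b ~: V.span {a}" shows "scl c a + scl d b = 0 ==> c = 0 | a = 0" "scl c a + scl d b = 0 ==> d = 0"
proof -
 show d: "d = 0" if e: "scl c a + scl d b = 0"
 proof (rule ccontr)
  assume d: "d ~= 0"
  have "scl d b = scl (-c) a" using e by (simp add: eq_neg_iff_add_eq_0 add.commute)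
  hence "scl d b : V.span {a}" using scl_in_span[of "-c" a] by (simp only:)
  thus False using subspace_scl[OF V.subspace_span d] assms by blast
 qed
 show "c = 0 | a = 0" if e: "scl c a + scl d b = 0" using d[OF e] e by simp
qed

text \<open>The assumptions are symmetric in the two planes, so \<open>swap\<close> transfers each
  statement from \<open>A\<close> to \<open>B\<close>. \<open>NA_ex\<close> and \<open>NB_ex\<close>
  express the duality: the neighbours of a point of one plane form a line of the other.\<close>

locale dualpair = hex7 +
 fixes H A B
 assumes hyperH: "hyper H"
  and A3: "sub A 3" and B3: "sub B 3" and AB0: "A Int B = {0}" and ABH: "A \<oplus> B = H"
  and CUH: "CU H = (A Un B) Int NV"
  and NA_ex: "p : A ==> p : NV ==> EX M. sub M 2 & M \<subseteq> B & M Int NV = nbr p Int CU H"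
  and NB_ex: "p : B ==> p : NV ==> EX M. sub M 2 & M \<subseteq> A & M Int NV = nbr p Int CU H"
  and two_C: "l : LU H ==> card (l Int CU H) = 2"
begin

lemma swap: "dualpair L q H B A"
 by unfold_locales (use hyperH A3 B3 AB0 ABH CUH NA_ex NB_ex two_C ssum_commute[of A B] in \<open>simp_all add: Int_commute Un_commute\<close>)

lemma sA: "V.subspace A" and sB: "V.subspace B" and sH: "V.subspace H"
 using A3 B3 hyperH sub_subspace hyper_subspace by blast+

lemma H6: "sub H 6" using hyperH hyper_iff by blast

lemma AH: "A \<subseteq> H" and BH: "B \<subseteq> H"
 using ssum_upper1[OF sB, of A] ssum_upper2[OF sA, of B] ABH by blast+

lemma A_rep: assumes "a : A" "a ~= 0" obtains c where "c ~= 0" "scl c a : A" "scl c a : CU H" "scl c a : P" "scl c a : NV"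
proof -
 obtain c where c: "c ~= 0" "scl c a : NV" using NV_exists[OF assms(2)] .
 have "scl c a : A" using assms c subspace_scl[OF sA] by blast
 moreover have "scl c a : CU H" using c calculation CUH by blast
 ultimately show ?thesis using that c CU_P by blast
qed

lemma A_X0: "a : A ==> a ~= 0 ==> a : X0"
proof -
 assume a: "a : A" "a ~= 0"
 obtain c where c: "c ~= 0" "scl c a : P" using A_rep[OF a] by metis
 obtain l where l: "l : L" "scl c a : l" using c(2) by (auto simp: P_def)
 have "a : l" using subspace_scl[OF line_subspace[OF l(1)] c(1)] l(2) by blast
 thus ?thesis using l(1) a(2) unfolding X0_def by blast
qed

text \<open>The line of \<open>B\<close> dual to the point \<open>a\<close>; zero is added to make
  it a subspace.\<close>

definition NB where "NB a = {b : B. b = 0 | col a b}"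
definition NA where "NA b = {a : A. a = 0 | col a b}"

lemma NB_sub: assumes "a : A" "a ~= 0" shows "sub (NB a) 2"
proof -
 obtain c where c: "c ~= 0" "scl c a : A" "scl c a : CU H" "scl c a : P" "scl c a : NV" using A_rep[OF assms] .
 obtain M where M: "sub M 2" "M \<subseteq> B" "M Int NV = nbr (scl c a) Int CU H" using NA_ex[OF c(2,5)] by blast
 have "b : M \<longleftrightarrow> b : NB a" for b
 proof (cases "b = 0")
  case True thus ?thesis using V.subspace_0[OF sub_subspace[OF M(1)]] V.subspace_0[OF sB] by (simp add: NB_def)
 next
  case False
  then obtain d where d: "d ~= 0" "scl d b : NV" using NV_exists by blast
  have "b : M \<longleftrightarrow> scl d b : M" using subspace_scl[OF sub_subspace[OF M(1)] d(1)] by blast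
  also have "... \<longleftrightarrow> scl d b : nbr (scl c a) Int CU H" using M(3) d by blast
  also have "... \<longleftrightarrow> scl d b : B & col (scl c a) (scl d b)"
  proof
   assume r: "scl d b : nbr (scl c a) Int CU H"
   hence "scl d b : B" using M(2,3) by blast
   thus "scl d b : B & col (scl c a) (scl d b)" using r by (simp add: nbr_def)
  next
   assume r: "scl d b : B & col (scl c a) (scl d b)"
   have "scl d b : CU H" using r d CUH by blast
   moreover have "scl d b ~= scl c a" using r c(2) AB0 d zero_notin_NV by (metis IntI singletonD)
   ultimately show "scl d b : nbr (scl c a) Int CU H" using r CU_P unfolding nbr_def by blast
  qed
  also have "... \<longleftrightarrow> b : NB a"
   using subspace_scl[OF sB d(1)] col_scl1[OF c(1)] col_scl2[OF d(1)] False by (simp add: NB_def)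
  finally show ?thesis .
 qed
 hence "M = NB a" by blast
 thus ?thesis using M by simp
qed

lemma NB_mem: "b : B ==> b ~= 0 ==> b : NB a \<longleftrightarrow> col a b" by (simp add: NB_def)
lemma NA_mem: "a : A ==> a ~= 0 ==> a : NA b \<longleftrightarrow> col a b" by (simp add: NA_def)
lemma NB_B: "NB a \<subseteq> B" by (auto simp: NB_def)
lemma NA_A: "NA b \<subseteq> A" by (auto simp: NA_def)

lemma AA_col: assumes "a : A" "a' : A" "a ~= 0" "a' ~= 0" "col a a'" shows "a' : V.span {a}"
proof -
 obtain c where c: "c ~= 0" "scl c a : A" "scl c a : CU H" "scl c a : P" "scl c a : NV" using A_rep[OF assms(1,3)] .
 obtain d where d: "d ~= 0" "scl d a' : A" "scl d a' : CU H" "scl d a' : P" "scl d a' : NV" using A_rep[OF assms(2,4)] .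
 obtain M where M: "sub M 2" "M \<subseteq> B" "M Int NV = nbr (scl c a) Int CU H" using NA_ex[OF c(2,5)] by blast
 have "scl d a' = scl c a"
 proof (rule ccontr)
  assume n: "scl d a' ~= scl c a"
  have "scl d a' : nbr (scl c a) Int CU H" using n d c assms(5) col_scl1 col_scl2 unfolding nbr_def by simp
  hence "scl d a' : B" using M by blast
  hence "scl d a' : A Int B" using d by blast
  thus False using AB0 d(5) zero_notin_NV by (metis singletonD)
 qed
 hence "scl d a' : V.span {a}" using scl_in_span[of c a] by (simp only:)
 thus ?thesis using subspace_scl[OF V.subspace_span d(1)] by blast
qed

text \<open>Two lines of the plane \<open>B\<close> meet, so points of \<open>A\<close> are never
  opposite to each other.\<close>

lemma NB_Int: assumes "a : A" "a' : A" "a ~= 0" "a' ~= 0" obtains b where "b : B" "b ~= 0" "col a b" "col a' b" "b : P"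
proof -
 obtain c where c: "sub (NB a Int NB a') c" "2 + 2 <= 3 + c"
  using sub_Int_ge[OF NB_sub[OF assms(1,3)] NB_sub[OF assms(2,4)] B3 NB_B NB_B] .
 obtain b where b: "b : NB a Int NB a'" "b : NV" using sub_point[OF c(1)] c(2) by auto
 have b0: "b ~= 0" using b NV_nonzero by blast
 have "b : B" "col a b" "col a' b" using b b0 unfolding NB_def by blast+
 moreover have "b : P" using b \<open>b : B\<close> CUH CU_P by blast
 ultimately show ?thesis using that b0 by blast
qed

lemma AA_d2: assumes "a : A" "a' : A" "a ~= 0" "a' ~= 0" shows "d2 a a'"
 using NB_Int[OF assms] d2I col_sym by metis

lemma NB_Int_unique: assumes "a : A" "a' : A" "a ~= 0" "a' ~: V.span {a}" "b : NB a" "b : NB a'" "b' : NB a" "b' : NB a'" "b ~= 0"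
 shows "b' : V.span {b}"
proof (cases "b' = 0")
 case True thus ?thesis using V.span_zero by simp
next
 case False
 have a'0: "a' ~= 0" using assms(4) V.span_zero by blast
 obtain c where c: "c ~= 0" "scl c a : A" "scl c a : CU H" "scl c a : P" "scl c a : NV" using A_rep[OF assms(1,3)] .
 obtain d where d: "d ~= 0" "scl d a' : A" "scl d a' : CU H" "scl d a' : P" "scl d a' : NV" using A_rep[OF assms(2) a'0] .
 obtain e where e: "e ~= 0" "scl e b : P" using rep[OF dualpair.A_X0[OF swap _ assms(9)]] assms(5) NB_B by blast
 obtain f where f: "f ~= 0" "scl f b' : P" using rep[OF dualpair.A_X0[OF swap _ False]] assms(7) NB_B by blast
 have cols: "col a b" "col a' b" "col a b'" "col a' b'" using assms False unfolding NB_def by blast+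
 have nc: "~ col (scl c a) (scl d a')" using AA_col[OF assms(1,2,3) a'0] assms(4) col_scl1[OF c(1)] col_scl2[OF d(1)] by blast
 have "scl e b = scl f b'"
  by (rule common_nbr_unique[OF c(4) d(4) e(2) f(2) nc]) (use cols c(1) d(1) e(1) f(1) in \<open>simp_all add: col_scl1 col_scl2\<close>)
 hence "scl f b' : V.span {b}" by (metis V.span_base V.span_scale singletonI)
 thus ?thesis using subspace_scl[OF V.subspace_span f(1)] by blast
qed

text \<open>A common neighbour of noncollinear \<open>a\<close> and \<open>b\<close> would be in
  \<open>CU H\<close> by convexity, hence in \<open>A\<close> or \<open>B\<close>; but distinct
  points of one plane are never collinear.\<close>

lemma opp_AB: assumes "a : A" "b : B" "a ~= 0" "b ~= 0" "d2 a b" shows "col a b"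
proof (rule ccontr)
 assume nc: "~ col a b"
 obtain c where c: "c ~= 0" "scl c a : A" "scl c a : CU H" "scl c a : P" "scl c a : NV" using A_rep[OF assms(1,3)] .
 obtain d where d: "d ~= 0" "scl d b : B" "scl d b : CU H" "scl d b : P" "scl d b : NV" using dualpair.A_rep[OF swap assms(2,4)] .
 obtain u where u: "u : P" "col a u" "col u b" using assms(5) by (auto simp: d2_def)
 have uC: "u : CU H" using conv_mid[OF sH c(3) d(3) _ u(1)] nc u c(1) d(1) by (simp add: col_scl1 col_scl2)
 have u0: "u ~= 0" using P_nonzero[OF u(1)] .
 have "u : A | u : B" using uC CUH by blast
 thus False
 proof
  assume "u : A"
  hence "u : V.span {a}" using AA_col[OF assms(1) _ assms(3) u0 u(2)] by blast
  then obtain k where k: "u = scl k a" by (auto simp: V.span_singleton)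
  hence "k ~= 0" using u0 by auto
  thus False using u(3) k col_scl1 nc by simp
 next
  assume "u : B"
  hence "u : V.span {b}" using dualpair.AA_col[OF swap assms(2) _ assms(4) u0 col_sym[OF u(3)]] by blast
  then obtain k where k: "u = scl k b" by (auto simp: V.span_singleton)
  hence "k ~= 0" using u0 by auto
  thus False using u(2) k col_scl2 nc by simp
 qed
qed

lemma H_line: assumes "l : LU H"
 obtains a b where "a : A" "b : B" "a ~= 0" "b ~= 0" "a : l" "b : l" "a : P" "b : P" "l Int CU H = {a, b}" "l = V.span {a} \<oplus> V.span {b}" "col a b"
proof -
 have lL: "l : L" using assms LU_L by blast
 obtain u v where uv: "l Int CU H = {u, v}" "u ~= v" using two_C[OF assms] by (auto simp: card_2_iff)
 hence m: "u : l" "v : l" "u : CU H" "v : CU H" by blast+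
 hence uvP: "u : P" "v : P" using CU_P by blast+
 have c: "col u v" "col v u" using colI[OF lL] m by blast+
 have nz: "u ~= 0" "v ~= 0" using P_nonzero uvP by blast+
 have ns: "v ~: V.span {u}" "u ~: V.span {v}" using NV_in_span1[of u v] NV_in_span1[of v u] uvP P_NV uv(2) by blast+
 have "u : A | u : B" "v : A | v : B" using m CUH by blast+
 moreover have "~ (u : A & v : A)" using AA_col[OF _ _ nz c(1)] ns by blast
 moreover have "~ (u : B & v : B)" using dualpair.AA_col[OF swap _ _ nz c(1)] ns by blast
 ultimately consider "u : A" "v : B" | "v : A" "u : B" by blast
 thus ?thesis
 proof cases
  case 1 thus ?thesis using that[of u v] m uvP nz uv c sub2_eq_pair[OF line_sub2[OF lL] m(1,2) nz(1) ns(1)] by blast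
 next
  case 2 thus ?thesis using that[of v u] m uvP nz uv c sub2_eq_pair[OF line_sub2[OF lL] m(2,1) nz(2) ns(2)] by blast
 qed
qed

lemma AB_cancel: assumes "a : A" "a' : A" "b : B" "b' : B" "a + b = a' + b'" shows "a = a'" "b = b'"
proof -
 have "a = a' + (b' - b)" using assms(5) by (simp add: eq_diff_eq add_diff_eq)
 hence "a - a' = b' - b" by simp
 moreover have "a - a' : A" "b' - b : B" using V.subspace_diff[OF sA assms(1,2)] V.subspace_diff[OF sB assms(4,3)] by blast+
 ultimately have "a - a' : A Int B" by simp
 hence "a - a' = 0" using AB0 by blast
 thus "a = a'" by simp
 thus "b = b'" using assms(5) by simp
qed

lemma A_T: assumes "a : A" "a ~= 0" shows "A \<subseteq> T a" "!!b. b : B ==> b : T a \<longleftrightarrow> b : NB a"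
proof -
 show "A \<subseteq> T a"
 proof
  fix a' assume a': "a' : A"
  show "a' : T a"
  proof (cases "a' = 0")
   case True thus ?thesis using V.subspace_0[OF T_subspace] by simp
  next
   case False thus ?thesis using T_mem_X[OF A_X0[OF assms] A_X0[OF a' False]] AA_d2[OF assms(1) a' assms(2) False] by blast
  qed
 qed
 show "b : T a \<longleftrightarrow> b : NB a" if b: "b : B" for b
 proof (cases "b = 0")
  case True thus ?thesis using V.subspace_0[OF T_subspace] b by (simp add: NB_def)
 next
  case False
  have "b : T a \<longleftrightarrow> d2 a b" using T_mem_X[OF A_X0[OF assms] dualpair.A_X0[OF swap b False]] .
  also have "... \<longleftrightarrow> col a b"
  proof
   assume "col a b"
   obtain d where d: "d ~= 0" "scl d b : P" using dualpair.A_rep[OF swap b False] by metis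
   show "d2 a b" using d2I[OF d(2)] \<open>col a b\<close> col_scl2[OF d(1)] col_scl1[OF d(1)] col_reflX[OF dualpair.A_X0[OF swap b False]] by blast
  qed (rule opp_AB[OF assms(1) b assms(2) False])
  finally show ?thesis using NB_mem[OF b False] by simp
 qed
qed

text \<open>The lines \<open>l\<close> through \<open>a\<close>, \<open>b\<close> and
  \<open>l'\<close> through \<open>a'\<close>, \<open>b'\<close> are opposite. The point
  \<open>a + b\<close> of \<open>l\<close> and its projection on \<open>l'\<close> have a common
  neighbour \<open>v\<close> outside \<open>H\<close>, and \<open>T v\<close> contains both lines,
  hence \<open>NA w\<close> and \<open>NB z\<close>. Every line joining these two meets the fixed
  line \<open>Pi v \<inter> H\<close>, which makes the correspondence between them linear, with
  slope \<open>g\<close>. The point \<open>v\<close> is kept in the conclusion because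
  \<open>half_e\<close> needs such outer points.\<close>

lemma regulus:
 assumes w: "w : B" "w ~= 0" and z: "z : A" "z ~= 0" and nwz: "~ col z w"
  and a: "a : A" "a' : A" "a ~= 0" "a' ~: V.span {a}" "col a w" "col a' w"
  and b: "b : B" "b' : B" "b ~= 0" "b' ~= 0" "col z b" "col z b'" "col a b" "col a' b'"
 shows "EX g v. g ~= 0 & (ALL t. col (a + scl t a') (b + scl (t * g) b')) & v : P & v ~: H & (ALL u:NA w. u : T v) & (ALL u:NB z. u : T v)"
proof -
 have a'0: "a' ~= 0" using a(4) V.span_zero by blast
 have X: "a : X0" "a' : X0" "b : X0" "b' : X0" using A_X0 dualpair.A_X0[OF swap] a b a'0 by blast+
 obtain l where l: "l : L" "a : l" "b : l" using b(7) by (auto simp: col_def)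
 obtain l' where l': "l' : L" "a' : l'" "b' : l'" using b(8) by (auto simp: col_def)
 obtain ca where ca: "ca ~= 0" "scl ca a : A" "scl ca a : CU H" "scl ca a : P" "scl ca a : NV" using A_rep[OF a(1,3)] .
 obtain ca' where ca': "ca' ~= 0" "scl ca' a' : A" "scl ca' a' : CU H" "scl ca' a' : P" "scl ca' a' : NV" using A_rep[OF a(2) a'0] .
 obtain cb where cb: "cb ~= 0" "scl cb b : B" "scl cb b : CU H" "scl cb b : P" "scl cb b : NV" using dualpair.A_rep[OF swap b(1,3)] .
 obtain cb' where cb': "cb' ~= 0" "scl cb' b' : B" "scl cb' b' : CU H" "scl cb' b' : P" "scl cb' b' : NV" using dualpair.A_rep[OF swap b(2,4)] .
 have inl: "scl ca a : l" "scl cb b : l" "scl ca' a' : l'" "scl cb' b' : l'"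
  using l l' subspace_scl[OF line_subspace] ca(1) cb(1) ca'(1) cb'(1) by blast+
 have lH: "l : LU H" "l' : LU H" using CU_line[OF ca(3) l(1) inl(1)] CU_line[OF ca'(3) l'(1) inl(3)] .
 have bns: "b' ~: V.span {b}"
 proof
  assume "b' : V.span {b}"
  then obtain k where k: "b' = scl k b" by (auto simp: V.span_singleton)
  hence k0: "k ~= 0" using b(4) by auto
  hence ab: "col a' b" using b(8) k col_scl2 by blast
  have "w : NB a" "w : NB a'" "b : NB a" "b : NB a'" using w a b ab unfolding NB_def by blast+
  hence "b : V.span {w}" using NB_Int_unique[OF a(1,2,3,4)] w(2) by blast
  then obtain j where j: "b = scl j w" by (auto simp: V.span_singleton)
  hence "j ~= 0" using b(3) by auto
  thus False using b(5) j col_scl2 nwz by blast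
 qed
 have wx: "w ~: m" if m: "m : L" "u : m" "u : B" "u ~= 0" "col z u" for m u
 proof
  assume "w : m"
  hence "w : V.span {u}" using dualpair.AA_col[OF swap m(3) w(1) m(4) w(2) colI[OF m(1,2)]] by blast
  then obtain k where k: "w = scl k u" by (auto simp: V.span_singleton)
  hence "k ~= 0" using w(2) by auto
  thus False using m(5) k col_scl2 nwz by blast
 qed
 have zx: "z ~: m" if m: "m : L" "u : m" "u : A" "u ~= 0" "col u w" for m u
 proof
  assume "z : m"
  hence "z : V.span {u}" using AA_col[OF m(3) z(1) m(4) z(2) colI[OF m(1,2)]] by blast
  then obtain k where k: "z = scl k u" by (auto simp: V.span_singleton)
  hence "k ~= 0" using z(2) by auto
  thus False using m(5) k col_scl1 nwz by blast
 qed
 have wl: "w ~: l" "w ~: l'" "z ~: l" "z ~: l'"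
  using wx[OF l(1,3) b(1,3,5)] wx[OF l'(1,3) b(2,4,6)] zx[OF l(1,2) a(1,3,5)] zx[OF l'(1,2) a(2) a'0 a(6)] .
 have farx: "m : far u" if u: "u : P" "u' : P" "~ col u u'" "c : P" "col u c" "col u' c" "m : L" "u' : m" "c ~: m" for u u' c m
  unfolding far_def
 proof (simp add: u(7), intro ballI impI notI)
  fix p assume p: "p : P" "p : m" "col u p"
  have "p = c" using common_nbr_unique[OF u(1,2) p(1) u(4,3) p(3) colI[OF u(7,8) p(2)] u(5,6)] .
  thus False using p u by blast
 qed
 obtain cw where cw: "cw ~= 0" "scl cw w : P" using dualpair.A_rep[OF swap w] by metis
 obtain cz where cz: "cz ~= 0" "scl cz z : P" using A_rep[OF z] by metis
 have wl2: "scl cw w ~: l" "scl cw w ~: l'" "scl cz z ~: l" "scl cz z ~: l'"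
  using wl subspace_scl[OF line_subspace] l(1) l'(1) cw(1) cz(1) by blast+
 have ncaa: "~ col (scl ca a) (scl ca' a')" "~ col (scl cb b) (scl cb' b')"
  using AA_col[OF a(1,2,3) a'0] a(4) dualpair.AA_col[OF swap b(1,2,3,4)] bns col_scl1[OF ca(1)] col_scl2[OF ca'(1)] col_scl1[OF cb(1)] col_scl2[OF cb'(1)] by blast+
 have cc: "col (scl ca a) (scl cw w)" "col (scl ca' a') (scl cw w)" "col (scl cb b) (scl cz z)" "col (scl cb' b') (scl cz z)"
  using a b ca(1) ca'(1) cb(1) cb'(1) cw(1) cz(1) col_sym by (simp_all add: col_scl1 col_scl2)
 have far: "l' : far (scl ca a)" "l : far (scl ca' a')" "l' : far (scl cb b)" "l : far (scl cb' b')"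
  using farx[OF ca(4) ca'(4) ncaa(1) cw(2) cc(1,2) l'(1) inl(3) wl2(2)]
   farx[OF ca'(4) ca(4) _ cw(2) cc(2,1) l(1) inl(1) wl2(1)] ncaa(1)
   farx[OF cb(4) cb'(4) ncaa(2) cz(2) cc(3,4) l'(1) inl(4) wl2(4)]
   farx[OF cb'(4) cb(4) _ cz(2) cc(4,3) l(1) inl(2) wl2(3)] ncaa(2) col_sym by blast+
 have daa: "d2 (scl ca a) (scl ca' a')" "d2 (scl cb b) (scl cb' b')"
  using d2I[OF cw(2) cc(1) col_sym[OF cc(2)]] d2I[OF cz(2) cc(3) col_sym[OF cc(4)]] .
 \<comment> \<open>A point of \<open>l\<close> collinear with some \<open>u'\<close> on
   \<open>l'\<close> would force \<open>u'\<close> to be the projection of \<open>a\<close> on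
   \<open>l'\<close>, that is the point of \<open>a'\<close>, while \<open>l\<close> is far from
   that point.\<close>
 have opl: "oppl l l'"
  unfolding oppl_def
 proof (intro ballI impI notI)
  fix u u' assume u: "u : P" "u' : P" "u : l" "u' : l'" "col u u'"
  have "d2 (scl ca a) u'" using d2I[OF u(1) colI[OF l(1) inl(1) u(3)] u(5)] .
  hence "u' = scl ca' a'" using far_unique[OF ca(4) far(1) u(2) ca'(4) u(4) inl(3) _ daa(1)] by blast
  hence "col (scl ca' a') u" using u(5) col_sym by blast
  thus False using far(2) u unfolding far_def by blast
 qed
 let ?r = "a + b"
 have rl: "?r : l" using V.subspace_add[OF line_subspace[OF l(1)] l(2,3)] .
 have r0: "?r ~= 0" using AB_cancel[of a 0 b 0] a b V.subspace_0[OF sA] V.subspace_0[OF sB] by auto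
 obtain cr where cr: "cr ~= 0" "scl cr ?r : NV" using NV_exists[OF r0] .
 have crl: "scl cr ?r : l" using rl subspace_scl[OF line_subspace[OF l(1)] cr(1)] by blast
 have crP: "scl cr ?r : P" using LP[OF l(1) crl cr(2)] .
 have cr_eq: "scl cr ?r = scl cr a + scl cr b" by (simp add: V.scale_right_distrib)
 have rA: "scl cr ?r ~: A"
 proof
  assume "scl cr ?r : A"
  moreover have "scl cr a + scl cr b = scl cr ?r + 0" using cr_eq by (simp only: add_0_right)
  ultimately have "scl cr b = 0" using AB_cancel(2)[OF V.subspace_scale[OF sA a(1)] _ V.subspace_scale[OF sB b(1)] V.subspace_0[OF sB]] by blast
  thus False using b(3) cr(1) by simp
 qed
 have rB: "scl cr ?r ~: B"
 proof
  assume "scl cr ?r : B"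
  moreover have "scl cr a + scl cr b = 0 + scl cr ?r" using cr_eq by (simp only: add_0_left)
  ultimately have "scl cr a = 0" using AB_cancel(1)[OF V.subspace_scale[OF sA a(1)] V.subspace_0[OF sA] V.subspace_scale[OF sB b(1)]] by blast
  thus False using a(3) cr(1) by simp
 qed
 obtain r' where r': "r' : P" "r' : l'" "d2 (scl cr ?r) r'" using proj_exists[OF crP l'(1)] .
 obtain v where v: "v : P" "col (scl cr ?r) v" "col v r'" using r'(3) by (auto simp: d2_def)
 have r'n: "r' ~= scl ca' a'" "r' ~= scl cb' b'"
 proof -
  show "r' ~= scl ca' a'"
  proof
   assume e: "r' = scl ca' a'"
   have "scl cr ?r = scl ca a"
    using far_unique[OF ca'(4) far(2) crP ca(4) crl inl(1)] r'(3) e daa(1) d2_sym by blast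
   thus False using rA ca(2) by simp
  qed
  show "r' ~= scl cb' b'"
  proof
   assume e: "r' = scl cb' b'"
   have "scl cr ?r = scl cb b"
    using far_unique[OF cb'(4) far(4) crP cb(4) crl inl(2)] r'(3) e daa(2) d2_sym by blast
   thus False using rB cb(2) by simp
  qed
 qed
 have ab's: "b' ~: V.span {a'}"
 proof
  assume "b' : V.span {a'}"
  hence "b' : A" using span_subset_iff[OF sA, of a'] a(2) by blast
  thus False using b(2,4) AB0 by blast
 qed
 have l'pair: "l' = V.span {a'} \<oplus> V.span {b'}" using sub2_eq_pair[OF line_sub2[OF l'(1)] l'(2,3) a'0 ab's] .
 then obtain al be where r'e: "r' = scl al a' + scl be b'" using r'(2) span_pair_mem[of r' a' b'] by blast
 have al0: "al ~= 0"
 proof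
  assume "al = 0"
  hence e: "r' = scl be b'" using r'e by simp
  have "be ~= 0" using e P_nonzero[OF r'(1)] by auto
  thus False using NV_inj(1)[of r' "scl cb' b'" "cb' / be" 1] e P_NV[OF r'(1)] cb'(1,5) r'n(2) by simp
 qed
 have be0: "be ~= 0"
 proof
  assume "be = 0"
  hence e: "r' = scl al a'" using r'e by simp
  thus False using NV_inj(1)[of r' "scl ca' a'" "ca' / al" 1] P_NV[OF r'(1)] ca'(1,5) r'n(1) al0 by simp
 qed
 \<comment> \<open>The slope of the projection \<open>r'\<close> of \<open>a + b\<close> with
   respect to \<open>a'\<close> and \<open>b'\<close>. Neither coefficient vanishes because
   \<open>a + b\<close> is in neither plane.\<close>
 define g where "g = be / al"
 define rr where "rr = a' + scl g b'"
 have g0: "g ~= 0" using al0 be0 by (simp add: g_def)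
 have rr: "r' = scl al rr" using r'e al0 by (simp add: rr_def g_def V.scale_right_distrib)
 have vr: "col v ?r" "col v rr" using v cr(1) al0 rr col_sym by (simp_all add: col_scl1 col_scl2)
 \<comment> \<open>Otherwise the line from \<open>a + b\<close> to \<open>v\<close> would be a
   second line of \<open>H\<close> through a point that is not in \<open>CU H\<close>.\<close>
 have vH: "v ~: H"
 proof
  assume vH: "v : H"
  obtain m where m: "m : L" "scl cr ?r : m" "v : m" using v(2) by (auto simp: col_def)
  have crH: "scl cr ?r : H" using crl lH(1) by (auto simp: LU_def)
  have nv: "v ~= scl cr ?r" using v(3) opl crP r' crl unfolding oppl_def by blast
  hence "m : LU H" using line_subset[OF m(1) sH crP v(1)] m vH crH by (auto simp: LU_def)
  moreover have "scl cr ?r ~: CU H" using CUH rA rB by blast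
  hence "scl cr ?r : BU H" using LU_degree(1)[OF crP lH(1) crl sH] by blast
  ultimately have "m = l" using BU_line_unique lH(1) crl m by blast
  thus False using opl v(1,3) r' m(3) unfolding oppl_def by blast
 qed
 have lT: "m \<subseteq> T v" if m: "m : L" "p : P" "p : m" "col v p" for m p
  using T_Pi[OF m(2,4)] Ln_Pi[OF m(1,3)] by blast
 have lTv: "l \<subseteq> T v" "l' \<subseteq> T v" using lT[OF l(1) crP crl col_sym[OF v(2)]] lT[OF l'(1) r'(1,2) v(3)] .
 have abT: "a : T v" "b : T v" "a' : T v" "b' : T v" using lTv l l' by blast+
 have NAw: "NA w = V.span {a} \<oplus> V.span {a'}"
 proof (rule sub2_eq_pair[OF _ _ _ a(3,4)])
  have "NA w = dualpair.NB L A w" unfolding NA_def dualpair.NB_def[OF swap] using col_sym by blast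
  thus "sub (NA w) 2" using dualpair.NB_sub[OF swap w] by simp
  show "a : NA w" "a' : NA w" using a by (auto simp: NA_def)
 qed
 have NBz: "NB z = V.span {b} \<oplus> V.span {b'}"
  by (rule sub2_eq_pair[OF NB_sub[OF z] _ _ b(3) bns]) (use b in \<open>auto simp: NB_def\<close>)
 have NwT: "NA w \<subseteq> T v" "NB z \<subseteq> T v"
  unfolding NAw NBz using ssum_least[OF T_subspace] span_subset_iff[OF T_subspace] abT by blast+
 obtain k where k: "sub (Pi v Int H) k" using sub_Int[OF Pi_sub[OF v(1)] H6] by metis
 have k2: "k <= 2"
 proof (rule ccontr)
  assume "~ k <= 2"
  hence "Pi v Int H = Pi v" using sub_eq[OF k Pi_sub[OF v(1)]] by simp
  thus False using vH Pi_self[OF v(1)] by blast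
 qed
 have rrl: "rr : l'" using rr r'(2) al0 subspace_scl[OF line_subspace[OF l'(1)]] by blast
 have rrns: "rr ~: V.span {?r}"
 proof
  assume "rr : V.span {?r}"
  hence "rr : l" using span_subset_iff[OF line_subspace[OF l(1)]] rl by blast
  hence "r' : l" using rr V.subspace_scale[OF line_subspace[OF l(1)]] by blast
  thus False using opl r' col_refl[OF r'(1)] unfolding oppl_def by blast
 qed
 have inPi: "?r : Pi v Int H" "rr : Pi v Int H" using vr mem_Pi rl rrl lH by (auto simp: LU_def)
 have "2 <= k" using sub_mono[OF sub_span_pair[OF r0 rrns] k] ssum_least[OF sub_subspace[OF k]] span_subset_iff[OF sub_subspace[OF k]] inPi by blast
 hence kk: "sub (Pi v Int H) 2" using k k2 by (metis le_antisym)
 have PvH: "Pi v Int H = V.span {?r} \<oplus> V.span {rr}" using sub2_eq_pair[OF kk inPi r0 rrns] .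
 have main: "col (a + scl t a') (b + scl (t * g) b')" for t
 proof -
  let ?a = "a + scl t a'"
  have aA: "?a : A" using V.subspace_add[OF sA a(1)] V.subspace_scale[OF sA a(2)] by blast
  have a0: "?a ~= 0" using notin_span_imp(1)[OF a(4), of 1 t] a(3) by auto
  have aw: "?a : NA w" unfolding NAw span_pair_mem by (metis V.scale_one)
  obtain bb where bb: "bb : B" "bb ~= 0" "col ?a bb" "col z bb" using NB_Int[OF aA z(1) a0 z(2)] by metis
  obtain l2 where l2: "l2 : L" "?a : l2" "bb : l2" using bb(3) by (auto simp: col_def)
  have bbns: "bb ~: V.span {?a}"
  proof
   assume "bb : V.span {?a}"
   hence "bb : A" using span_subset_iff[OF sA, of ?a] aA by blast
   thus False using bb AB0 by blast
  qed
  have l2p: "l2 = V.span {?a} \<oplus> V.span {bb}" using sub2_eq_pair[OF line_sub2[OF l2(1)] l2(2,3) a0 bbns] .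
  have "bb : NB z" using bb by (simp add: NB_def)
  hence "?a : T v" "bb : T v" using aw NwT by blast+
  hence l2T: "l2 \<subseteq> T v" unfolding l2p using ssum_least[OF T_subspace] span_subset_iff[OF T_subspace] by blast
  obtain u1 where u1: "u1 : P" "u1 : l2" using other_point[OF l2(1), of "{}"] by auto
  obtain u2 where u2: "u2 : P" "u2 : l2" "u2 ~= u1" using other_point[OF l2(1), of "{u1}"] q_ge2 by auto
  obtain s where s: "s : P" "s : l2" "col v s"
   using two_d2[OF v(1) l2(1) u1(1) u2(1) u1(2) u2(2) u2(3)[symmetric]] T_mem[OF v(1) u1(1)] T_mem[OF v(1) u2(1)] l2T u1 u2 by blast
  obtain sg ta where sl: "s = scl sg ?a + scl ta bb" using s(2) l2p span_pair_mem[of s ?a bb] by blast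
  have "s : Pi v Int H"
  proof -
   have "l2 \<subseteq> H" unfolding l2p using ssum_least[OF sH] span_subset_iff[OF sH] aA bb(1) AH BH by blast
   thus ?thesis using s mem_Pi by blast
  qed
  then obtain al2 be2 where sr: "s = scl al2 ?r + scl be2 rr" using PvH span_pair_mem[of s ?r rr] by blast
  have "s = (scl al2 a + scl be2 a') + (scl al2 b + scl (be2 * g) b')"
   unfolding sr rr_def by (simp add: V.scale_right_distrib algebra_simps)
  hence eq: "(scl al2 a + scl be2 a') + (scl al2 b + scl (be2 * g) b') = scl sg ?a + scl ta bb" using sl by (simp only:)
  have mA: "scl al2 a + scl be2 a' : A" by (intro V.subspace_add[OF sA] V.subspace_scale[OF sA] a(1,2))
  have mB: "scl al2 b + scl (be2 * g) b' : B" by (intro V.subspace_add[OF sB] V.subspace_scale[OF sB] b(1,2))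
  note e = AB_cancel[OF mA V.subspace_scale[OF sA aA] mB V.subspace_scale[OF sB bb(1)] eq]
  have "scl (al2 - sg) a + scl (be2 - sg * t) a' = 0"
   using e(1) by (simp add: V.scale_right_distrib V.scale_left_diff_distrib algebra_simps)
  hence as: "al2 = sg" "be2 = sg * t" using notin_span_imp[OF a(4), of "al2 - sg" "be2 - sg * t"] a(3) by auto
  have sg0: "sg ~= 0"
  proof
   assume "sg = 0"
   hence "s = 0" using sr as by simp
   thus False using P_nonzero[OF s(1)] by blast
  qed
  have e2: "scl ta bb = scl sg (b + scl (t * g) b')" using e(2) as by (simp add: V.scale_right_distrib mult.assoc)
  have "b + scl (t * g) b' ~= 0" using notin_span_imp(1)[OF bns, of 1 "t * g"] b(3) by auto
  hence "ta ~= 0" using e2 sg0 by (metis V.scale_eq_0_iff)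
  hence "col ?a (scl ta bb)" using bb(3) col_scl2 by blast
  hence "col ?a (scl sg (b + scl (t * g) b'))" using e2 by simp
  thus ?thesis using col_scl2[OF sg0] by blast
 qed
 show ?thesis using g0 main v(1) vH NwT by blast
qed

end

context hex7 begin

lemma dualpair_exists: obtains H A B where "dualpair L q H A B"
proof -
 obtain x where x: "x : P" using P_nonempty .
 obtain y where y: "y : P" "opp x y" using opp_ex[OF x] .
 let ?H = "Pi x \<oplus> Pi y"
 have "sub ?H 6" "?H \<subseteq> VV" using opp_disj[OF x y] ssum_least[OF VV_subspace VV_Pi[OF x] VV_Pi[OF y(1)]] by blast+
 hence t: "thinp ?H x y" unfolding thinp_def using hyper_iff opp_CU[OF x y(1)] y(2) by blast
 have h: "hyper ?H" "x : CU ?H" "y : CU ?H" using t by (auto simp: thinp_def)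
 have "dualpair L q ?H (E ?H x y) (E ?H y x)"
 proof unfold_locales
  show "hyper ?H" using h by blast
  show "sub (E ?H x y) 3" "sub (E ?H y x) 3" using E_sub[OF t] E_sub[OF thinp_sym[OF t]] .
  show "E ?H x y Int E ?H y x = {0}" "E ?H x y \<oplus> E ?H y x = ?H" using E_sum[OF t] by blast+
  show "CU ?H = (E ?H x y Un E ?H y x) Int NV" using CU_E[OF t] .
  show "EX M. sub M 2 & M \<subseteq> E ?H y x & M Int NV = nbr p Int CU ?H" if "p : E ?H x y" "p : NV" for p
   using N_props[OF t, of p] N_E[OF t that] E_CU[OF t that] by blast
  show "EX M. sub M 2 & M \<subseteq> E ?H x y & M Int NV = nbr p Int CU ?H" if "p : E ?H y x" "p : NV" for p
   using N_props[OF t, of p] N_E[OF thinp_sym[OF t] that] E_CU[OF thinp_sym[OF t] that] by blast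
  show "card (l Int CU ?H) = 2" if "l : LU ?H" for l using thin(1)[OF h y(2) that] .
 qed
 thus ?thesis using that by blast
qed

end

section \<open>Dual bases of the two planes\<close>

definition lc :: "(nat => 'a::field) => (nat => 'a) => (nat => 'a) => 'a => 'a => 'a => (nat => 'a)" where
 "lc u v w a b c = scl a u + scl b v + scl c w"

lemma lc_apply: "lc u v w a b c i = a * u i + b * v i + c * w i"
 by (simp add: lc_def scl_def)

lemma lc_add: "lc u v w a b c + lc u v w a' b' c' = lc u v w (a + a') (b + b') (c + c')"
 by (rule ext) (simp add: lc_apply algebra_simps)

lemma lc_scl: "scl k (lc u v w a b c) = lc u v w (k * a) (k * b) (k * c)"
 by (rule ext) (simp add: lc_apply scl_def algebra_simps)

lemma lc_diff: "lc u v w a b c - lc u v w a' b' c' = lc u v w (a - a') (b - b') (c - c')"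
 by (rule ext) (simp add: lc_apply algebra_simps)

lemma lc_0 [simp]: "lc u v w 0 0 0 = 0"
 by (rule ext) (simp add: lc_apply)

lemma lc_mem: "V.subspace W ==> u : W ==> v : W ==> w : W ==> lc u v w a b c : W"
 unfolding lc_def by (intro V.subspace_add V.subspace_scale) auto

definition basis3 where
 "basis3 W u v w \<longleftrightarrow> u : W & v : W & w : W & (ALL x:W. EX a b c. x = lc u v w a b c) &
   (ALL a b c. lc u v w a b c = 0 --> a = 0 & b = 0 & c = 0)"

lemma basis3I:
 fixes u :: "nat => 'a::{field,finite}"
 assumes "sub W 3" "u : W" "v : W" "w : W" "u ~= 0" "v ~: V.span {u}" "w ~: V.span {u} \<oplus> V.span {v}"
 shows "basis3 W u v w"
proof -
 have s3: "sub (V.span {u} \<oplus> V.span {v} \<oplus> V.span {w}) 3"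
  using sub_insert[OF sub_span_pair[OF assms(5,6)] assms(7)] by (simp add: eval_nat_numeral)
 have "V.span {u} \<oplus> V.span {v} \<oplus> V.span {w} \<subseteq> W"
  by (intro ssum_least[OF sub_subspace[OF assms(1)]]) (use span_subset_iff[OF sub_subspace[OF assms(1)]] assms in auto)
 hence W: "W = V.span {u} \<oplus> V.span {v} \<oplus> V.span {w}" using sub_eq[OF s3 assms(1)] by simp
 have "EX a b c. x = lc u v w a b c" if "x : W" for x
 proof -
  have "x : V.span {u} \<oplus> V.span {v} \<oplus> V.span {w}" using that W by simp
  then obtain p r where p: "p : V.span {u} \<oplus> V.span {v}" "r : V.span {w}" "x = p + r" by (rule ssumE)
  obtain a b where "p = scl a u + scl b v" using p(1) unfolding span_pair_mem by blast
  moreover obtain c where "r = scl c w" using p(2) by (auto simp: V.span_singleton)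
  ultimately show ?thesis using p unfolding lc_def by blast
 qed
 moreover have "a = 0 & b = 0 & c = 0" if z: "lc u v w a b c = 0" for a b c
 proof -
  have c: "c = 0"
  proof (rule ccontr)
   assume c: "c ~= 0"
   have "(scl a u + scl b v) + scl c w = 0" using z by (simp only: lc_def)
   hence "scl c w = - (scl a u + scl b v)" by (metis add.commute eq_neg_iff_add_eq_0)
   also have "... = scl (-a) u + scl (-b) v" by simp
   finally have "scl c w : V.span {u} \<oplus> V.span {v}" unfolding span_pair_mem by blast
   thus False using assms(7) subspace_scl[OF sub_subspace[OF sub_span_pair[OF assms(5,6)]] c] by blast
  qed
  hence "scl a u + scl b v = 0" using z by (simp add: lc_def)
  thus ?thesis using notin_span_imp[OF assms(6), of a b] assms(5) c by auto
 qed
 ultimately show ?thesis unfolding basis3_def using assms by blast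
qed

lemma basis3_subset:
 assumes "basis3 W u v w" "V.subspace S" "u : S" "v : S" "w : S" shows "W \<subseteq> S"
proof
 fix x assume "x : W"
 then obtain a b c where "x = lc u v w a b c" using assms(1) unfolding basis3_def by blast
 thus "x : S" using lc_mem[OF assms(2-5)] by simp
qed

lemma basis3_ex:
 fixes W :: "(nat => 'a::{field,finite}) set"
 assumes "sub W 3" obtains u v w where "u : W" "v : W" "w : W" "u ~= 0" "v ~: V.span {u}" "w ~: V.span {u} \<oplus> V.span {v}"
proof -
 obtain u where u: "u : W" "u ~= 0" using sub_point[OF assms] NV_nonzero by (metis one_le_numeral)
 have "~ W \<subseteq> V.span {u}" using sub_mono[OF assms sub_span1[OF u(2)]] by auto
 then obtain v where v: "v : W" "v ~: V.span {u}" by blast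
 have "~ W \<subseteq> V.span {u} \<oplus> V.span {v}" using sub_mono[OF assms sub_span_pair[OF u(2) v(2)]] by auto
 then obtain w where "w : W" "w ~: V.span {u} \<oplus> V.span {v}" by blast
 thus ?thesis using that u v by blast
qed

text \<open>Writes a vector orthogonal to \<open>(a, b, c)\<close> as a combination of
  \<open>(-b, a, 0)\<close> and \<open>(-c, 0, a)\<close>, with coefficients \<open>y / a\<close>
  and \<open>z / a\<close>; only the first coordinate needs a computation.\<close>

lemma dot_solve:
 fixes a :: "'a::field"
 assumes "a ~= 0" "a * x + b * y + c * z = 0" shows "x = y / a * (- b) + z / a * (- c)"
proof -
 have "a * x = - (b * y) - c * z" using assms(2) by algebra
 hence "x = (- (b * y) - c * z) / a" using assms(1) by (metis nonzero_mult_div_cancel_left)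
 also have "... = y / a * (- b) + z / a * (- c)" by (simp add: diff_divide_distrib mult.commute)
 finally show ?thesis .
qed

context dualpair
begin

lemma NA_swap: "dualpair.NB L A b = NA b"
 unfolding NA_def dualpair.NB_def[OF swap] using col_sym by blast

lemma NA_sub: "b : B ==> b ~= 0 ==> sub (NA b) 2"
 using dualpair.NB_sub[OF swap] NA_swap by simp

lemma NA_subspace: "b : B ==> b ~= 0 ==> V.subspace (NA b)" using NA_sub sub_subspace by blast
lemma NB_subspace: "a : A ==> a ~= 0 ==> V.subspace (NB a)" using NB_sub sub_subspace by blast

text \<open>Dual bases: collinearity between the planes becomes the vanishing of the dot product of
  coordinates.\<close>

definition frame where
 "frame f0 f1 f2 g0 g1 g2 \<longleftrightarrow> basis3 A f0 f1 f2 & basis3 B g0 g1 g2 &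
  (ALL a b c x y z. lc f0 f1 f2 a b c ~= 0 --> (lc g0 g1 g2 x y z : NB (lc f0 f1 f2 a b c) \<longleftrightarrow> a * x + b * y + c * z = 0))"

text \<open>Each \<open>g\<close> is a common neighbour of the two \<open>f\<close> with the other
  indices. Reguli for two pairs of indices fix the scales of \<open>g1\<close> and \<open>g0\<close>
  relative to \<open>g2\<close>. The third regulus brings a scalar \<open>k2\<close> that can no
  longer be adjusted; it must be -1, since otherwise \<open>f0 + f1 + f2\<close> would be collinear
  with all of \<open>B\<close>.\<close>

lemma frame_exists: obtains f0 f1 f2 g0 g1 g2 where "frame f0 f1 f2 g0 g1 g2"
proof -
 obtain f0 f1 f2 where f: "f0 : A" "f1 : A" "f2 : A" "f0 ~= 0" "f1 ~: V.span {f0}" "f2 ~: V.span {f0} \<oplus> V.span {f1}"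
  using basis3_ex[OF A3] .
 have bf: "basis3 A f0 f1 f2" using basis3I[OF A3 f] .
 have fz: "lc f0 f1 f2 a b c = 0 ==> a = 0 & b = 0 & c = 0" for a b c using bf unfolding basis3_def by blast
 have f0': "f1 ~= 0" "f2 ~= 0" using fz[of 0 1 0] fz[of 0 0 1] by (auto simp: lc_def)
 have ns: "f2 ~: V.span {f0}" "f2 ~: V.span {f1}"
 proof -
  show "f2 ~: V.span {f0}"
  proof
   assume "f2 : V.span {f0}"
   then obtain k where "f2 = scl k f0" by (auto simp: V.span_singleton)
   thus False using fz[of k 0 "-1"] by (simp add: lc_def)
  qed
  show "f2 ~: V.span {f1}"
  proof
   assume "f2 : V.span {f1}"
   then obtain k where "f2 = scl k f1" by (auto simp: V.span_singleton)
   thus False using fz[of 0 k "-1"] by (simp add: lc_def)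
  qed
 qed
 obtain g2 where g2: "g2 : B" "g2 ~= 0" "col f0 g2" "col f1 g2" using NB_Int[OF f(1,2,4) f0'(1)] .
 obtain g1 where g1: "g1 : B" "g1 ~= 0" "col f0 g1" "col f2 g1" using NB_Int[OF f(1,3,4) f0'(2)] .
 obtain g0 where g0: "g0 : B" "g0 ~= 0" "col f1 g0" "col f2 g0" using NB_Int[OF f(2,3) f0'] .
 have not3: "~ (col f0 g & col f1 g & col f2 g)" if g: "g : B" "g ~= 0" for g
 proof
  assume c: "col f0 g & col f1 g & col f2 g"
  have s: "V.subspace (NA g)" using NA_subspace[OF g] .
  have "f0 : NA g" "f1 : NA g" "f2 : NA g" using c f by (auto simp: NA_def)
  hence "A \<subseteq> NA g" by (rule basis3_subset[OF bf s])
  thus False using sub_mono[OF A3 NA_sub[OF g]] by simp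
 qed
 have n0: "~ col f0 g0" "~ col f1 g1" "~ col f2 g2" using not3 g0 g1 g2 by blast+
 have reg1: "EX g v. g ~= 0 & (ALL t. col (f1 + scl t f2) (g2 + scl (t * g) g1)) & v : P & v ~: H & (ALL u:NA g0. u : T v) & (ALL u:NB f0. u : T v)"
  by (rule regulus[OF g0(1,2) f(1,4) n0(1) f(2,3) f0'(1) ns(2) g0(3,4) g2(1) g1(1) g2(2) g1(2) g2(3) g1(3) g2(4) g1(4)])
 then obtain k1 where k1: "k1 ~= 0" "!!t. col (f1 + scl t f2) (g2 + scl (t * k1) g1)" by blast
 have reg2: "EX g v. g ~= 0 & (ALL t. col (f0 + scl t f2) (g2 + scl (t * g) g0)) & v : P & v ~: H & (ALL u:NA g1. u : T v) & (ALL u:NB f1. u : T v)"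
  by (rule regulus[OF g1(1,2) f(2) f0'(1) n0(2) f(1,3,4) ns(1) g1(3,4) g2(1) g0(1) g2(2) g0(2) g2(4) g0(3) g2(3) g0(4)])
 then obtain k0 where k0: "k0 ~= 0" "!!t. col (f0 + scl t f2) (g2 + scl (t * k0) g0)" by blast
 \<comment> \<open>With this sign the regulus relation pairs \<open>(0, 1, t)\<close> with
   \<open>(0, -t, 1)\<close>, two vectors with dot product zero.\<close>
 define G1 where "G1 = scl (-k1) g1"
 define G0 where "G0 = scl (-k0) g0"
 have G1: "G1 : B" "G1 ~= 0" "col f0 G1" "col f2 G1" "~ col f1 G1"
  unfolding G1_def using g1 n0(2) V.subspace_scale[OF sB g1(1)] col_scl2[of "-k1" _ g1] k1(1) by (simp_all only: neg_equal_0_iff_equal V.scale_eq_0_iff simp_thms)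
 have G0: "G0 : B" "G0 ~= 0" "col f1 G0" "col f2 G0" "~ col f0 G0"
  unfolding G0_def using g0 n0(1) V.subspace_scale[OF sB g0(1)] col_scl2[of "-k0" _ g0] k0(1) by (simp_all only: neg_equal_0_iff_equal V.scale_eq_0_iff simp_thms)
 have k1': "col (f1 + scl t f2) (g2 + scl (t * - 1) G1)" for t using k1(2)[of t] by (simp add: G1_def)
 have k0': "col (f0 + scl t f2) (g2 + scl (t * - 1) G0)" for t using k0(2)[of t] by (simp add: G0_def)
 have reg3: "EX g v. g ~= 0 & (ALL t. col (f0 + scl t f1) (G1 + scl (t * g) G0)) & v : P & v ~: H & (ALL u:NA g2. u : T v) & (ALL u:NB f2. u : T v)"
  by (rule regulus[OF g2(1,2) f(3) f0'(2) n0(3) f(1,2,4,5) g2(3,4) G1(1) G0(1) G1(2) G0(2) G1(4) G0(4) G1(3) G0(3)])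
 then obtain k2 where k2: "k2 ~= 0" "!!t. col (f0 + scl t f1) (G1 + scl (t * k2) G0)" by blast
 have bg: "basis3 B G0 G1 g2"
 proof (rule basis3I[OF B3 G0(1) G1(1) g2(1) G0(2)])
  show n1: "G1 ~: V.span {G0}"
  proof
   assume "G1 : V.span {G0}"
   then obtain k where k: "G1 = scl k G0" by (auto simp: V.span_singleton)
   hence "k ~= 0" using G1(2) by auto
   thus False using G1(5) G0(3) k col_scl2 by simp
  qed
  show "g2 ~: V.span {G0} \<oplus> V.span {G1}"
  proof
   assume "g2 : V.span {G0} \<oplus> V.span {G1}"
   moreover have s: "V.subspace (NB f2)" using NB_subspace[OF f(3) f0'(2)] .
   have "G0 : NB f2" "G1 : NB f2" using G0 G1 by (auto simp: NB_def)
   hence "V.span {G0} \<oplus> V.span {G1} \<subseteq> NB f2" using ssum_least[OF s] span_subset_iff[OF s] by blast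
   ultimately have "g2 : NB f2" by blast
   thus False using n0(3) g2(2) by (simp add: NB_def)
  qed
 qed
 have colspan: "col p u" if u: "u : B" "u ~= 0" and pq: "a : A" "a' : A" "a = 0 | col a u" "a' = 0 | col a' u" "p = a + a'" "p ~= 0" for p u a a'
 proof -
  have "a : NA u" "a' : NA u" using pq by (auto simp: NA_def)
  hence "p : NA u" using V.subspace_add[OF NA_subspace[OF u]] pq by blast
  thus ?thesis using pq by (simp add: NA_def)
 qed
 \<comment> \<open>Consequence of one regulus: the partner of the part on the line of
   \<open>u\<close> and \<open>v\<close> lies on the line dual to \<open>f\<close>, so it is
   collinear with the whole combination. The three instances \<open>E0\<close>, \<open>E1\<close>,
   \<open>E2\<close> produce vectors of \<open>NB\<close> for an arbitrary point of
   \<open>A\<close>.\<close>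
 have edge: "scl b y + scl (c * k) x : NB (scl a f + (scl b u + scl c v))"
  if h: "!!t. col (u + scl t v) (y + scl (t * k) x)" "col v x" "k ~= 0" and f: "f : A" "f ~= 0" "y : NB f" "x : NB f" "u : A" "v : A"
   and p: "scl a f + (scl b u + scl c v) ~= 0" for a b c k f u v x y
 proof (cases "scl b y + scl (c * k) x = 0")
  case True thus ?thesis using V.subspace_0[OF sB] by (simp add: NB_def)
 next
  case False
  let ?w = "scl b y + scl (c * k) x"
  note s = NB_subspace[OF f(1,2)]
  have "?w : NB f" using V.subspace_add[OF s V.subspace_scale[OF s f(3)] V.subspace_scale[OF s f(4)]] .
  hence w: "?w : B" "col f ?w" using False by (auto simp: NB_def)
  have "col (scl b u + scl c v) ?w"
  proof (cases "b = 0")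
   case True
   hence "c ~= 0" using False by auto
   thus ?thesis using True h(2,3) col_scl1[of c v] col_scl2[of "c * k" _ x] by simp
  next
   case False
   have "col (scl b (u + scl (c / b) v)) (scl b (y + scl (c / b * k) x))" using h(1)[of "c / b"] col_scl1[OF False] col_scl2[OF False] by blast
   thus ?thesis using False by (simp add: V.scale_right_distrib)
  qed
  moreover have "scl a f = 0 | col (scl a f) ?w" using w(2) col_scl1[of a f] by (cases "a = 0") auto
  ultimately have "col (scl a f + (scl b u + scl c v)) ?w"
   using colspan[OF w(1) False V.subspace_scale[OF sA f(1)] V.subspace_add[OF sA V.subspace_scale[OF sA f(5)] V.subspace_scale[OF sA f(6)]] _ _ refl p] by blast
  thus ?thesis using w(1) by (simp add: NB_def)
 qed
 have mem: "G1 : NB f0" "g2 : NB f0" "G0 : NB f1" "g2 : NB f1" "G0 : NB f2" "G1 : NB f2" using G0 G1 g2 by (simp_all add: NB_def)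
 have E0: "lc G0 G1 g2 0 (- c) b : NB (lc f0 f1 f2 a b c)" if "lc f0 f1 f2 a b c ~= 0" for a b c
  using edge[OF k1' G1(4) _ f(1,4) mem(2,1) f(2,3), of a b c] that by (simp add: lc_def ac_simps)
 have E1: "lc G0 G1 g2 (- c) 0 a : NB (lc f0 f1 f2 a b c)" if "lc f0 f1 f2 a b c ~= 0" for a b c
  using edge[OF k0' G0(4) _ f(2) f0'(1) mem(4,3) f(1,3), of b a c] that by (simp add: lc_def ac_simps)
 have E2: "lc G0 G1 g2 (b * k2) a 0 : NB (lc f0 f1 f2 a b c)" if "lc f0 f1 f2 a b c ~= 0" for a b c
  using edge[OF k2(2) G0(3) k2(1) f(3) f0'(2) mem(6,5) f(1,2), of c a b] that by (simp add: lc_def ac_simps)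
 have k2m: "k2 = -1"
 proof -
  let ?p = "lc f0 f1 f2 1 1 1"
  have p0: "?p ~= 0" using fz[of 1 1 1] by auto
  have pA: "?p : A" using lc_mem[OF sA] f by blast
  have sN: "V.subspace (NB ?p)" using NB_subspace[OF pA p0] .
  note in1 = E0[OF p0] and in2 = E1[OF p0] and in3 = E2[OF p0, unfolded mult_1]
  have d1: "lc G0 G1 g2 (-1) 1 0 : NB ?p" using V.subspace_diff[OF sN in2 in1] by (simp add: lc_diff)
  have d2: "lc G0 G1 g2 (k2 + 1) 0 0 : NB ?p" using V.subspace_diff[OF sN in3 d1] by (simp add: lc_diff)
  show ?thesis
  proof (rule ccontr)
   assume "k2 ~= -1"
   hence k: "k2 + 1 ~= 0" by (simp add: add_eq_0_iff2)
   have "scl (1 / (k2 + 1)) (lc G0 G1 g2 (k2 + 1) 0 0) : NB ?p" using V.subspace_scale[OF sN d2] .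
   hence e0: "lc G0 G1 g2 1 0 0 : NB ?p" using k by (simp add: lc_scl)
   have e1: "lc G0 G1 g2 0 1 0 : NB ?p" using V.subspace_add[OF sN d1 e0] by (simp add: lc_add)
   have e2: "lc G0 G1 g2 0 0 1 : NB ?p" using V.subspace_add[OF sN in1 e1] by (simp add: lc_add)
   have "G0 : NB ?p" "G1 : NB ?p" "g2 : NB ?p" using e0 e1 e2 by (simp_all add: lc_def)
   hence "B \<subseteq> NB ?p" by (rule basis3_subset[OF bg sN])
   thus False using sub_mono[OF B3 NB_sub[OF pA p0]] by simp
  qed
 qed
 have suff: "lc G0 G1 g2 x y z : NB (lc f0 f1 f2 a b c)" if nz: "lc f0 f1 f2 a b c ~= 0" and dot: "a * x + b * y + c * z = 0" for a b c x y z
 proof -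
  let ?p = "lc f0 f1 f2 a b c"
  have pA: "?p : A" using lc_mem[OF sA] f by blast
  have sN: "V.subspace (NB ?p)" using NB_subspace[OF pA nz] .
  note v0 = E0[OF nz] and v1 = E1[OF nz]
  have v2: "lc G0 G1 g2 (-b) a 0 : NB ?p" using E2[OF nz] k2m by simp
  have abc: "a ~= 0 | b ~= 0 | c ~= 0" using nz by auto
  consider "a ~= 0" | "b ~= 0" | "c ~= 0" using abc by blast
  thus ?thesis
  proof cases
   case 1
   have "scl (y / a) (lc G0 G1 g2 (-b) a 0) + scl (z / a) (lc G0 G1 g2 (-c) 0 a) : NB ?p"
    using V.subspace_add[OF sN V.subspace_scale[OF sN v2] V.subspace_scale[OF sN v1]] .
   moreover have "x = y / a * (-b) + z / a * (-c)" using dot_solve[OF 1 dot] .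
   ultimately show ?thesis using 1 by (simp add: lc_scl lc_add)
  next
   case 2
   have "scl (- x / b) (lc G0 G1 g2 (-b) a 0) + scl (z / b) (lc G0 G1 g2 0 (-c) b) : NB ?p"
    using V.subspace_add[OF sN V.subspace_scale[OF sN v2] V.subspace_scale[OF sN v0]] .
   moreover have "y = - x / b * a + z / b * (-c)" using dot_solve[OF 2, of y a x c z] dot by (simp add: add.commute add.left_commute)
   ultimately show ?thesis using 2 by (simp add: lc_scl lc_add)
  next
   case 3
   have "scl (- x / c) (lc G0 G1 g2 (-c) 0 a) + scl (- y / c) (lc G0 G1 g2 0 (-c) b) : NB ?p"
    using V.subspace_add[OF sN V.subspace_scale[OF sN v1] V.subspace_scale[OF sN v0]] .
   moreover have "z = - x / c * a + - y / c * b" using dot_solve[OF 3, of z a x b y] dot by (simp add: add.commute add.left_commute)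
   ultimately show ?thesis using 3 by (simp add: lc_scl lc_add)
  qed
 qed
 \<comment> \<open>Conversely, a vector of \<open>NB\<close> with nonzero dot product would,
   together with the zeros of the dot product found before, generate all of
   \<open>B\<close>.\<close>
 have "a * x + b * y + c * z = 0" if nz: "lc f0 f1 f2 a b c ~= 0" and m: "lc G0 G1 g2 x y z : NB (lc f0 f1 f2 a b c)" for a b c x y z
 proof (rule ccontr)
  assume d: "a * x + b * y + c * z ~= 0"
  let ?p = "lc f0 f1 f2 a b c"
  have pA: "?p : A" using lc_mem[OF sA] f by blast
  have sN: "V.subspace (NB ?p)" using NB_subspace[OF pA nz] .
  have "B \<subseteq> NB ?p"
  proof
   fix u assume "u : B"
   then obtain x' y' z' where u: "u = lc G0 G1 g2 x' y' z'" using bg unfolding basis3_def by blast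
   define k where "k = (a * x' + b * y' + c * z') / (a * x + b * y + c * z)"
   have "a * (x' - k * x) + b * (y' - k * y) + c * (z' - k * z) = (a * x' + b * y' + c * z') - k * (a * x + b * y + c * z)"
    by (simp add: algebra_simps)
   also have "... = 0" using d by (simp add: k_def)
   finally have "lc G0 G1 g2 (x' - k * x) (y' - k * y) (z' - k * z) : NB ?p" using suff[OF nz] by blast
   hence "lc G0 G1 g2 (x' - k * x) (y' - k * y) (z' - k * z) + scl k (lc G0 G1 g2 x y z) : NB ?p"
    using V.subspace_add[OF sN _ V.subspace_scale[OF sN m]] by blast
   thus "u : NB ?p" using u by (simp add: lc_scl lc_add)
  qed
  thus False using sub_mono[OF B3 NB_sub[OF pA nz]] by simp
 qed
 hence "frame f0 f1 f2 G0 G1 g2" unfolding frame_def using bf bg suff by blast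
 thus ?thesis using that by blast
qed

lemma frame_swap: assumes "frame f0 f1 f2 g0 g1 g2" shows "dualpair.frame L B A g0 g1 g2 f0 f1 f2"
 unfolding dualpair.frame_def[OF swap] NA_swap
proof (intro conjI allI impI)
 show "basis3 B g0 g1 g2" "basis3 A f0 f1 f2" using assms by (auto simp: frame_def)
 fix a b c x y z assume nz: "lc g0 g1 g2 a b c ~= 0"
 have bA: "lc f0 f1 f2 x y z : A" using assms lc_mem[OF sA] unfolding frame_def basis3_def by blast
 have bB: "lc g0 g1 g2 a b c : B" using assms lc_mem[OF sB] unfolding frame_def basis3_def by blast
 show "lc f0 f1 f2 x y z : NA (lc g0 g1 g2 a b c) \<longleftrightarrow> a * x + b * y + c * z = 0"
 proof (cases "lc f0 f1 f2 x y z = 0")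
  case True
  hence "x = 0 & y = 0 & z = 0" using assms unfolding frame_def basis3_def by blast
  thus ?thesis using V.subspace_0[OF NA_subspace[OF bB nz]] by simp
 next
  case False
  have "lc f0 f1 f2 x y z : NA (lc g0 g1 g2 a b c) \<longleftrightarrow> lc g0 g1 g2 a b c : NB (lc f0 f1 f2 x y z)"
   using NA_mem[OF bA False] NB_mem[OF bB nz] by simp
  also have "... \<longleftrightarrow> x * a + y * b + z * c = 0" using assms False unfolding frame_def by blast
  finally show ?thesis by (simp add: mult.commute)
 qed
qed

end

section \<open>Equations of the tangent hyperplanes\<close>

locale framed = dualpair +
 fixes f0 f1 f2 g0 g1 g2
 assumes fr: "frame f0 f1 f2 g0 g1 g2"
begin

abbreviation F where "F \<equiv> lc f0 f1 f2"
abbreviation G where "G \<equiv> lc g0 g1 g2"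

lemma framed_swap: "framed L q H B A g0 g1 g2 f0 f1 f2"
 unfolding framed_def framed_axioms_def using swap frame_swap[OF fr] by blast

lemma FA: "F a b c : A"
 using fr lc_mem[OF sA] unfolding frame_def basis3_def by blast
lemma GB: "G a b c : B"
 using fr lc_mem[OF sB] unfolding frame_def basis3_def by blast
lemma F_0: "F a b c = 0 \<longleftrightarrow> a = 0 & b = 0 & c = 0"
 using fr unfolding frame_def basis3_def by (metis lc_0)
lemma G_0: "G a b c = 0 \<longleftrightarrow> a = 0 & b = 0 & c = 0"
 using fr unfolding frame_def basis3_def by (metis lc_0)
lemma A_F: assumes "u : A" obtains a b c where "u = F a b c"
 using fr assms unfolding frame_def basis3_def by blast
lemma B_G: assumes "u : B" obtains a b c where "u = G a b c"
 using fr assms unfolding frame_def basis3_def by blast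

lemma F_inj: "F a b c = F a' b' c' \<longleftrightarrow> a = a' & b = b' & c = c'"
 using F_0[of "a - a'" "b - b'" "c - c'"] by (simp flip: lc_diff)
lemma G_inj: "G a b c = G a' b' c' \<longleftrightarrow> a = a' & b = b' & c = c'"
 using G_0[of "a - a'" "b - b'" "c - c'"] by (simp flip: lc_diff)

lemma NB_FG: "F a b c ~= 0 ==> G x y z : NB (F a b c) \<longleftrightarrow> a * x + b * y + c * z = 0"
 using fr unfolding frame_def by blast

lemma col_FG: "F a b c ~= 0 ==> G x y z ~= 0 ==> col (F a b c) (G x y z) \<longleftrightarrow> a * x + b * y + c * z = 0"
 using NB_FG[of a b c x y z] NB_mem[OF GB] by simp

lemma NA_FG: "G x y z ~= 0 ==> F a b c : NA (G x y z) \<longleftrightarrow> a * x + b * y + c * z = 0"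
proof (cases "F a b c = 0")
 case True
 assume "G x y z ~= 0"
 thus ?thesis using True F_0 V.subspace_0[OF NA_subspace[OF GB]] by simp
next
 case False
 assume "G x y z ~= 0"
 thus ?thesis using NA_mem[OF FA False] col_FG[OF False] by simp
qed

lemma FG_cancel: "F a b c + G x y z = F a' b' c' + G x' y' z' \<longleftrightarrow> a = a' & b = b' & c = c' & x = x' & y = y' & z = z'"
 using AB_cancel[OF FA FA GB GB, of a b c x y z a' b' c' x' y' z'] F_inj G_inj by metis

lemma H_FG: assumes "v : H" obtains a b c x y z where "v = F a b c + G x y z"
proof -
 obtain u w where uw: "u : A" "w : B" "v = u + w" using assms ABH by (metis ssumE)
 thus ?thesis using that A_F[OF uw(1)] B_G[OF uw(2)] by metis
qed

lemma FGH: "F a b c + G x y z : H"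
 using ABH ssumI[OF FA GB] by blast

lemma VV_e: assumes "e : VV" "e ~: H" "v : VV" obtains h k where "h : H" "v = h + scl k e"
proof -
 have "sub (H \<oplus> V.span {e}) 7" using sub_insert[OF H6 assms(2)] by simp
 moreover have "H \<oplus> V.span {e} \<subseteq> VV"
  using ssum_least[OF VV_subspace] span_subset_iff[OF VV_subspace] assms hyperH hyper_iff by blast
 ultimately have "H \<oplus> V.span {e} = VV" using sub_eq[OF _ VV7] by blast
 hence "v : H \<oplus> V.span {e}" using assms by simp
 then obtain h w where hw: "h : H" "w : V.span {e}" "v = h + w" by (rule ssumE)
 obtain k where "w = scl k e" using hw(2) by (auto simp: V.span_singleton)
 thus ?thesis using that hw by blast
qed

text \<open>The hyperplane \<open>T (F a b c)\<close> contains \<open>A\<close>, and its trace on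
  \<open>B\<close> is the kernel of the dot product with \<open>(a, b, c)\<close>. Its equation is
  therefore known up to the coefficient \<open>s\<close> of \<open>e\<close>.\<close>

lemma T_form:
 assumes e: "e : VV" and nz: "F a b c ~= 0"
 shows "EX s. ALL w:A. ALL x y z k. w + G x y z + scl k e : T (F a b c) \<longleftrightarrow> a * x + b * y + c * z + k * s = 0"
proof -
 have "a ~= 0 | b ~= 0 | c ~= 0" using nz F_0 by blast
 then obtain x0 y0 z0 where d1: "a * x0 + b * y0 + c * z0 = 1"
 proof (elim disjE)
  assume "a ~= 0" thus ?thesis using that[of "1/a" 0 0] by simp
 next
  assume "b ~= 0" thus ?thesis using that[of 0 "1/b" 0] by simp
 next
  assume "c ~= 0" thus ?thesis using that[of 0 0 "1/c"] by simp
 qed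
 let ?u = "G x0 y0 z0" and ?T = "T (F a b c)"
 have X: "F a b c : X0" using A_X0[OF FA nz] .
 have B_T: "G x y z : ?T \<longleftrightarrow> a * x + b * y + c * z = 0" for x y z using A_T(2)[OF FA nz GB] NB_FG[OF nz] by simp
 have uT: "?u ~: ?T" using B_T d1 by simp
 have "sub (?T \<oplus> V.span {?u}) 7" using sub_insert[OF TX[OF X] uT] by simp
 moreover have "?u : VV" using GB BH hyperH hyper_iff by blast
 hence "?T \<oplus> V.span {?u} \<subseteq> VV" using ssum_least[OF VV_subspace T_sub_VV] span_subset_iff[OF VV_subspace] by blast
 ultimately have "?T \<oplus> V.span {?u} = VV" using sub_eq[OF _ VV7] by blast
 then obtain t w where tw: "t : ?T" "w : V.span {?u}" "e = t + w" using e by (metis ssumE)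
 obtain s where s: "w = scl s ?u" using tw(2) by (auto simp: V.span_singleton)
 have "w' + G x y z + scl k e : ?T \<longleftrightarrow> a * x + b * y + c * z + k * s = 0" if w': "w' : A" for w' x y z k
 proof -
  let ?d = "a * x + b * y + c * z"
  \<comment> \<open>Subtracting suitable multiples of \<open>?u\<close> leaves a vector of the
    hyperplane; the rest is a multiple of \<open>?u\<close>, which is outside.\<close>
  let ?v = "w' + G (x - ?d * x0) (y - ?d * y0) (z - ?d * z0) + scl k t"
  have "a * (x - ?d * x0) + b * (y - ?d * y0) + c * (z - ?d * z0) = ?d - ?d * (a * x0 + b * y0 + c * z0)" by (simp add: algebra_simps)
  also have "... = 0" using d1 by simp
  finally have "G (x - ?d * x0) (y - ?d * y0) (z - ?d * z0) : ?T" using B_T by blast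
  moreover have "w' : ?T" using A_T(1)[OF FA nz] w' by blast
  ultimately have vT: "?v : ?T" using V.subspace_add[OF T_subspace] V.subspace_scale[OF T_subspace] tw(1) by blast
  have "w' + G x y z + scl k e = ?v + scl (?d + k * s) ?u"
   unfolding tw(3) s by (rule ext) (simp add: lc_apply scl_def algebra_simps)
  hence "w' + G x y z + scl k e : ?T \<longleftrightarrow> scl (?d + k * s) ?u : ?T"
   using V.span_add_eq[of ?v ?T] vT V.span_eq_iff[of ?T] T_subspace by metis
  also have "... \<longleftrightarrow> ?d + k * s = 0"
   using subspace_scl[OF T_subspace, of "?d + k * s" ?u] uT V.subspace_0[OF T_subspace] by (cases "?d + k * s = 0") simp_all
  finally show ?thesis .
 qed
 thus ?thesis by blast
qed

text \<open>The coefficient \<open>s\<close> is linear in \<open>(a, b, c)\<close>, and subtracting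
  from \<open>e\<close> the vector of \<open>B\<close> that represents this linear form makes it
  vanish. Linearity on a line \<open>NA w\<close> of \<open>A\<close> comes from a single outer
  point: \<open>regulus\<close> provides \<open>v\<close> outside \<open>H\<close> that lies in
  \<open>T u\<close> for all \<open>u\<close> on that line, and the coordinates of \<open>v\<close>
  give \<open>s\<close> there.\<close>

lemma half_e:
 assumes e: "e : VV" "e ~: H"
 shows "EX u0 u1 u2. ALL a b c. F a b c ~= 0 --> (ALL w:A. ALL x y z k. w + G x y z + scl k (e - G u0 u1 u2) : T (F a b c) \<longleftrightarrow> a * x + b * y + c * z = 0)"
proof -
 define s where "s a b c = (SOME s. ALL w:A. ALL x y z k. w + G x y z + scl k e : T (F a b c) \<longleftrightarrow> a * x + b * y + c * z + k * s = 0)" for a b c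
 have s: "w + G x y z + scl k e : T (F a b c) \<longleftrightarrow> a * x + b * y + c * z + k * s a b c = 0" if "F a b c ~= 0" "w : A" for a b c w x y z k
  using someI_ex[OF T_form[OF e(1) that(1)]] that(2) unfolding s_def by blast
 have lin: "EX d0 d1 d2. ALL a b c. F a b c ~= 0 --> a * x + b * y + c * z = 0 --> s a b c = a * d0 + b * d1 + c * d2" if nz: "G x y z ~= 0" for x y z
 proof -
  let ?w = "G x y z"
  have "x ~= 0 | y ~= 0 | z ~= 0" using nz G_0 by blast
  then obtain a b c where d1: "a * x + b * y + c * z = 1"
  proof (elim disjE)
   assume "x ~= 0" thus ?thesis using that[of "1/x" 0 0] by simp
  next
   assume "y ~= 0" thus ?thesis using that[of 0 "1/y" 0] by simp
  next
   assume "z ~= 0" thus ?thesis using that[of 0 0 "1/z"] by simp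
  qed
  let ?z = "F a b c"
  have z0: "?z ~= 0" using d1 F_0[of a b c] by auto
  have nc: "~ col ?z ?w" using col_FG[OF z0 nz] d1 by simp
  obtain p where p: "p : NA ?w" "p ~= 0" using sub_point[OF NA_sub[OF GB nz]] NV_nonzero by (metis one_le_numeral)
  have "~ NA ?w \<subseteq> V.span {p}" using sub_mono[OF NA_sub[OF GB nz] sub_span1[OF p(2)]] by auto
  then obtain p' where p': "p' : NA ?w" "p' ~: V.span {p}" by blast
  have p'0: "p' ~= 0" using p'(2) V.span_zero by blast
  have pA: "p : A" "p' : A" "col p ?w" "col p' ?w" using p p' p'0 NA_A by (auto simp: NA_def)
  obtain b1 where b1: "b1 : B" "b1 ~= 0" "col p b1" "col ?z b1" using NB_Int[OF pA(1) FA p(2) z0] .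
  obtain b2 where b2: "b2 : B" "b2 ~= 0" "col p' b2" "col ?z b2" using NB_Int[OF pA(2) FA p'0 z0] .
  obtain v where v: "v : P" "v ~: H" "ALL u:NA ?w. u : T v"
   using regulus[OF GB nz FA z0 nc pA(1,2) p(2) p'(2) pA(3,4) b1(1) b2(1) b1(2) b2(2) b1(4) b2(4) b1(3) b2(3)] by blast
  obtain h k where hk: "h : H" "v = h + scl k e" using VV_e[OF e VV_P[OF v(1)]] .
  have k0: "k ~= 0" using hk v(2) by auto
  obtain a0 b0 c0 x0 y0 z0' where h: "h = F a0 b0 c0 + G x0 y0 z0'" using H_FG[OF hk(1)] .
  have "s a b c = a * (- x0 / k) + b * (- y0 / k) + c * (- z0' / k)" if ab: "F a b c ~= 0" "a * x + b * y + c * z = 0" for a b c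
  proof -
   have "F a b c : T v" using v(3) NA_FG[OF nz] ab(2) by blast
   hence "v : T (F a b c)" using T_swap[OF A_X0[OF FA ab(1)] P_X0[OF v(1)]] by blast
   hence "a * x0 + b * y0 + c * z0' + k * s a b c = 0" using s[OF ab(1) FA] hk(2) h by simp
   hence "k * s a b c = - (a * x0 + b * y0 + c * z0')" by algebra
   hence "s a b c = - (a * x0 + b * y0 + c * z0') / k" using k0 by (metis nonzero_mult_div_cancel_left)
   thus ?thesis by (simp add: add_divide_distrib diff_divide_distrib)
  qed
  thus ?thesis by blast
 qed
 define u0 where "u0 = s 1 0 0"
 define u1 where "u1 = s 0 1 0"
 define u2 where "u2 = s 0 0 1"
 have Fn: "F a b c ~= 0" if "a ~= 0 | b ~= 0 | c ~= 0" for a b c using that F_0 by blast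
 \<comment> \<open>Linearity on lines suffices: first on the line with last coordinate 0, then on
   the line joining \<open>(a, b, 0)\<close> to \<open>(0, 0, 1)\<close>. The first case treats the
   multiples of \<open>(0, 0, 1)\<close>.\<close>
 have sl: "s a b c = a * u0 + b * u1 + c * u2" if ne: "F a b c ~= 0" for a b c
 proof (cases "a = 0 & b = 0")
  case True
  hence c: "c ~= 0" using ne F_0 by blast
  have "G 1 0 0 ~= 0" using G_0 by simp
  from lin[OF this] obtain d0 d1 d2 where d: "!!a b c. F a b c ~= 0 ==> a * 1 + b * 0 + c * 0 = 0 ==> s a b c = a * d0 + b * d1 + c * d2" by blast
  show ?thesis using d[OF ne] d[OF Fn[of 0 0 1]] True by (simp add: u2_def)
 next
  case False
  have "G 0 0 1 ~= 0" using G_0 by simp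
  from lin[OF this] obtain d0 d1 d2 where d: "!!a b c. F a b c ~= 0 ==> a * 0 + b * 0 + c * 1 = 0 ==> s a b c = a * d0 + b * d1 + c * d2" by blast
  have e1: "s a b 0 = a * u0 + b * u1"
   using d[OF Fn[of a b 0]] d[OF Fn[of 1 0 0]] d[OF Fn[of 0 1 0]] False by (simp add: u0_def u1_def)
  have "G b (-a) 0 ~= 0" using G_0[of b "-a" 0] False by auto
  from lin[OF this] obtain d0 d1 d2 where d: "!!a' b' c'. F a' b' c' ~= 0 ==> a' * b + b' * (-a) + c' * 0 = 0 ==> s a' b' c' = a' * d0 + b' * d1 + c' * d2" by blast
  show ?thesis using d[OF ne] d[OF Fn[of a b 0]] d[OF Fn[of 0 0 1]] e1 False by (simp add: u2_def mult.commute)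
 qed
 have "w + G x y z + scl k (e - G u0 u1 u2) : T (F a b c) \<longleftrightarrow> a * x + b * y + c * z = 0" if ne: "F a b c ~= 0" "w : A" for a b c w x y z k
 proof -
  have "w + G x y z + scl k (e - G u0 u1 u2) = w + G (x - k * u0) (y - k * u1) (z - k * u2) + scl k e"
   by (rule ext) (simp add: lc_apply scl_def algebra_simps)
  moreover have "a * (x - k * u0) + b * (y - k * u1) + c * (z - k * u2) + k * s a b c = a * x + b * y + c * z"
   using sl[OF ne(1)] by (simp add: algebra_simps)
  moreover note s[OF ne, of "x - k * u0" "y - k * u1" "z - k * u2" k]
  ultimately show ?thesis by (simp only:)
 qed
 thus ?thesis by blast
qed

end

text \<open>The vector \<open>e\<close> is normalised so that the equations of the tangent
  hyperplanes at points of \<open>A\<close> and of \<open>B\<close> do not involve its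
  coefficient.\<close>

locale coords = framed +
 fixes e
 assumes eV: "e : VV" and eH: "e ~: H"
  and TF: "F a b c ~= 0 ==> w : A ==> w + G x y z + scl k e : T (F a b c) \<longleftrightarrow> a * x + b * y + c * z = 0"
  and TG: "G x y z ~= 0 ==> w : B ==> w + F a b c + scl k e : T (G x y z) \<longleftrightarrow> x * a + y * b + z * c = 0"

context framed begin

lemma coords_exists:
 assumes e: "e : VV" "e ~: H" shows "EX e3. coords L q H A B f0 f1 f2 g0 g1 g2 e3"
proof -
 obtain u0 u1 u2 where u: "!!a b c w x y z k. F a b c ~= 0 ==> w : A ==> w + G x y z + scl k (e - G u0 u1 u2) : T (F a b c) \<longleftrightarrow> a * x + b * y + c * z = 0"
  using half_e[OF e] by blast
 have HV: "H \<subseteq> VV" using hyperH hyper_iff by blast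
 have GH: "G u0 u1 u2 : H" using GB BH by blast
 let ?e = "e - G u0 u1 u2"
 have e1: "?e : VV" "?e ~: H"
 proof -
  show "?e : VV" using V.subspace_diff[OF VV_subspace e(1)] GH HV by blast
  show "?e ~: H"
  proof
   assume "?e : H"
   hence "?e + G u0 u1 u2 : H" using V.subspace_add[OF sH _ GH] by blast
   thus False using e(2) by simp
  qed
 qed
 obtain w0 w1 w2 where w: "!!a b c w x y z k. G a b c ~= 0 ==> w : B ==> w + F x y z + scl k (?e - F w0 w1 w2) : T (G a b c) \<longleftrightarrow> a * x + b * y + c * z = 0"
  using framed.half_e[OF framed_swap e1] by blast
 let ?e3 = "?e - F w0 w1 w2"
 have FH: "F w0 w1 w2 : H" using FA AH by blast
 have "coords L q H A B f0 f1 f2 g0 g1 g2 ?e3"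
 proof unfold_locales
  show "?e3 : VV" using V.subspace_diff[OF VV_subspace e1(1)] FH HV by blast
  show "?e3 ~: H"
  proof
   assume "?e3 : H"
   hence "?e3 + F w0 w1 w2 : H" using V.subspace_add[OF sH _ FH] by blast
   thus False using e1(2) by simp
  qed
  \<comment> \<open>The second shift is by a vector of \<open>A\<close>, which the first formula
    absorbs into its arbitrary vector of \<open>A\<close>.\<close>
  show "v + G x y z + scl k ?e3 : T (F a b c) \<longleftrightarrow> a * x + b * y + c * z = 0" if "F a b c ~= 0" "v : A" for a b c v x y z k
  proof -
   have "v + G x y z + scl k ?e3 = (v - F (k * w0) (k * w1) (k * w2)) + G x y z + scl k ?e"
    by (rule ext) (simp add: lc_apply scl_def algebra_simps)
   moreover note u[OF that(1) V.subspace_diff[OF sA that(2) FA]]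
   ultimately show ?thesis by (simp only:)
  qed
  show "v + F a b c + scl k ?e3 : T (G x y z) \<longleftrightarrow> x * a + y * b + z * c = 0" if "G x y z ~= 0" "v : B" for a b c v x y z k
   using w[OF that] .
 qed
 thus ?thesis by blast
qed

end

text \<open>The first three hypotheses say that the cross product of \<open>a\<close> and
  \<open>h\<close> vanishes. As \<open>h\<close> is nonzero, \<open>a\<close> is a multiple of
  \<open>h\<close>; being orthogonal to \<open>k\<close> while \<open>h\<close> is not, it is
  zero.\<close>

lemma cross_zero:
 fixes a0 :: "'a::field"
 assumes "a1 * h2 - a2 * h1 = 0" "a2 * h0 - a0 * h2 = 0" "a0 * h1 - a1 * h0 = 0"
  "a0 * k0 + a1 * k1 + a2 * k2 = 0" "h0 * k0 + h1 * k1 + h2 * k2 ~= 0"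
 shows "a0 = 0" "a1 = 0" "a2 = 0"
proof -
 have "a0 * (h0 * k0 + h1 * k1 + h2 * k2) = 0" "a1 * (h0 * k0 + h1 * k1 + h2 * k2) = 0" "a2 * (h0 * k0 + h1 * k1 + h2 * k2) = 0"
  using assms(1-4) by algebra+
 thus "a0 = 0" "a1 = 0" "a2 = 0" using assms(5) by auto
qed

lemma perp_cross:
 fixes a0 :: "'a::field"
 assumes "b0 * a0 + b1 * a1 + b2 * a2 = 0" "b0 * h0 + b1 * h1 + b2 * h2 = 0"
  "a1 * h2 - a2 * h1 ~= 0 | a2 * h0 - a0 * h2 ~= 0 | a0 * h1 - a1 * h0 ~= 0"
 shows "EX l. b0 = l * (a1 * h2 - a2 * h1) & b1 = l * (a2 * h0 - a0 * h2) & b2 = l * (a0 * h1 - a1 * h0)"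
proof -
 let ?c0 = "a1 * h2 - a2 * h1" and ?c1 = "a2 * h0 - a0 * h2" and ?c2 = "a0 * h1 - a1 * h0"
 have e: "b1 * ?c0 = b0 * ?c1" "b2 * ?c0 = b0 * ?c2" "b2 * ?c1 = b1 * ?c2" using assms(1,2) by algebra+
 have d: "y * w = x * z ==> w ~= 0 ==> y = x / w * z" for x y z w :: 'a
  by (metis nonzero_eq_divide_eq times_divide_eq_left)
 consider "?c0 ~= 0" | "?c1 ~= 0" | "?c2 ~= 0" using assms(3) by blast
 thus ?thesis
 proof cases
  case 1 thus ?thesis using d[OF e(1)] d[OF e(2)] by (intro exI[of _ "b0 / ?c0"]) auto
 next
  case 2 thus ?thesis using d[OF e(1)[symmetric]] d[OF e(3)] by (intro exI[of _ "b1 / ?c1"]) auto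
 next
  case 3 thus ?thesis using d[OF e(2)[symmetric]] d[OF e(3)[symmetric]] by (intro exI[of _ "b2 / ?c2"]) auto
 qed
qed

lemma solve2:
 fixes k0 :: "'a::field"
 assumes "k1 * l2 - k2 * l1 ~= 0 | k2 * l0 - k0 * l2 ~= 0 | k0 * l1 - k1 * l0 ~= 0"
 shows "EX f0 f1 f2. f0 * k0 + f1 * k1 + f2 * k2 = c & f0 * l0 + f1 * l1 + f2 * l2 = d"
proof -
 have two: "EX x y. x * p + y * r = c & x * s + y * t = d" if nz: "p * t - r * s ~= 0" for p r s t c d :: 'a
 proof -
  define D where "D = p * t - r * s"
  have "(c * t - d * r) / D * p + (d * p - c * s) / D * r = (c * (p * t - r * s)) / D"
   by (simp add: add_divide_distrib[symmetric]) (simp add: algebra_simps)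
  moreover have "(c * t - d * r) / D * s + (d * p - c * s) / D * t = (d * (p * t - r * s)) / D"
   by (simp add: add_divide_distrib[symmetric]) (simp add: algebra_simps)
  ultimately show ?thesis using nz by (intro exI[of _ "(c * t - d * r) / D"] exI[of _ "(d * p - c * s) / D"]) (simp add: D_def)
 qed
 consider "k1 * l2 - k2 * l1 ~= 0" | "k2 * l0 - k0 * l2 ~= 0" | "k0 * l1 - k1 * l0 ~= 0" using assms by blast
 thus ?thesis
 proof cases
  case 1
  from two[OF this] obtain x y where "x * k1 + y * k2 = c" "x * l1 + y * l2 = d" by blast
  thus ?thesis by (intro exI[of _ 0] exI[of _ x] exI[of _ y]) simp
 next
  case 2
  from two[OF this] obtain x y where "x * k2 + y * k0 = c" "x * l2 + y * l0 = d" by blast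
  thus ?thesis by (intro exI[of _ y] exI[of _ 0] exI[of _ x]) (simp add: add.commute)
 next
  case 3
  from two[OF this] obtain x y where "x * k0 + y * k1 = c" "x * l0 + y * l1 = d" by blast
  thus ?thesis by (intro exI[of _ x] exI[of _ y] exI[of _ 0]) simp
 qed
qed

section \<open>Points outside the hyperplane\<close>

context coords
begin

text \<open>Representative of a point outside \<open>H\<close>, scaled so that \<open>e\<close> has
  coefficient 1, see \<open>outer_vec\<close>.\<close>

definition vec where "vec h0 h1 h2 k0 k1 k2 = F h0 h1 h2 + G k0 k1 k2 + e"

lemma coords_swap: "coords L q H B A g0 g1 g2 f0 f1 f2 e"
 unfolding coords_def coords_axioms_def using framed_swap eV eH TF TG by blast

lemma vec_swap: "coords.vec g0 g1 g2 f0 f1 f2 e k0 k1 k2 h0 h1 h2 = vec h0 h1 h2 k0 k1 k2"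
 unfolding coords.vec_def[OF coords_swap] vec_def by (simp add: add.commute)

lemma vec_notH: "vec h0 h1 h2 k0 k1 k2 ~: H"
proof
 assume "vec h0 h1 h2 k0 k1 k2 : H"
 hence "vec h0 h1 h2 k0 k1 k2 - (F h0 h1 h2 + G k0 k1 k2) : H" using V.subspace_diff[OF sH _ FGH] by blast
 thus False using eH by (simp add: vec_def)
qed

lemma vec_nz: "vec h0 h1 h2 k0 k1 k2 ~= 0" using vec_notH V.subspace_0[OF sH] by metis

lemma vec_diff: "vec h0 h1 h2 k0 k1 k2 - vec h0' h1' h2' k0' k1' k2' = F (h0 - h0') (h1 - h1') (h2 - h2') + G (k0 - k0') (k1 - k1') (k2 - k2')"
 unfolding vec_def by (rule ext) (simp add: lc_apply algebra_simps)

lemma vec_addF: "vec h0 h1 h2 k0 k1 k2 + F a b c = vec (h0 + a) (h1 + b) (h2 + c) k0 k1 k2"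
 unfolding vec_def by (rule ext) (simp add: lc_apply algebra_simps)

lemma vec_addG: "vec h0 h1 h2 k0 k1 k2 + G a b c = vec h0 h1 h2 (k0 + a) (k1 + b) (k2 + c)"
 unfolding vec_def by (rule ext) (simp add: lc_apply algebra_simps)

lemma T_FA_vec: "F a b c ~= 0 ==> vec h0 h1 h2 k0 k1 k2 : T (F a b c) \<longleftrightarrow> a * k0 + b * k1 + c * k2 = 0"
 using TF[OF _ FA, of a b c h0 h1 h2 k0 k1 k2 1] by (simp add: vec_def)

lemma T_GB_vec: "G x y z ~= 0 ==> vec h0 h1 h2 k0 k1 k2 : T (G x y z) \<longleftrightarrow> h0 * x + h1 * y + h2 * z = 0"
 using TG[OF _ GB, of x y z k0 k1 k2 h0 h1 h2 1] by (simp add: vec_def mult.commute add.commute)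

lemma outer_vec: assumes "w : X0" "w ~: H" obtains s h0 h1 h2 k0 k1 k2 where "s ~= 0" "w = scl s (vec h0 h1 h2 k0 k1 k2)"
proof -
 obtain h k where hk: "h : H" "w = h + scl k e" using VV_e[OF eV eH X0_VV[OF assms(1)]] .
 have k0: "k ~= 0" using hk assms(2) by auto
 obtain a b c x y z where h: "h = F a b c + G x y z" using H_FG[OF hk(1)] .
 have "w = scl k (vec (a / k) (b / k) (c / k) (x / k) (y / k) (z / k))"
  unfolding hk(2) h vec_def by (rule ext) (use k0 in \<open>simp add: lc_apply scl_def distrib_left mult.assoc[symmetric]\<close>)
 thus ?thesis using that k0 by blast
qed

text \<open>Let \<open>r\<close> be the vector \<open>F a b c + G x y z\<close>. Its pencil contains
  the outer vector, so \<open>r\<close> is not in \<open>CU H\<close>, and its pencil meets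
  \<open>H\<close> in a single line. That line meets \<open>A\<close> and \<open>B\<close> in the
  two parts of \<open>r\<close>, which are thus collinear with each other and at distance at most
  two from the outer point; the tangent hyperplanes then give the dot products.\<close>

lemma out_FG:
 assumes X: "vec h0 h1 h2 k0 k1 k2 : X0" and FG: "F a b c + G x y z : Pi (vec h0 h1 h2 k0 k1 k2)" "F a b c + G x y z ~= 0"
 shows "F a b c ~= 0" "G x y z ~= 0" "a * x + b * y + c * z = 0" "a * k0 + b * k1 + c * k2 = 0" "h0 * x + h1 * y + h2 * z = 0"
  "Pi (F a b c + G x y z) Int H = V.span {F a b c} \<oplus> V.span {G x y z}"
proof -
 let ?v = "vec h0 h1 h2 k0 k1 k2"
 define r where "r = F a b c + G x y z"
 have r: "r : Pi ?v" "r : H" "r ~= 0" using FG FGH by (simp_all add: r_def)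
 have vr: "col ?v r" using r(1) mem_Pi by blast
 have rX: "r : X0" using Pi_X0[OF r(1,3)] .
 obtain cr where cr: "cr ~= 0" "scl cr r : P" using rep[OF rX] .
 have crH: "scl cr r : H" using subspace_scl[OF sH cr(1)] r(2) by blast
 obtain l where l: "l : LU H" "scl cr r : l" using hyper_line[OF hyperH cr(2) crH] .
 obtain a' b' where ab: "a' : A" "b' : B" "a' ~= 0" "b' ~= 0" "a' : l" "b' : l" "a' : P" "b' : P"
  "l Int CU H = {a', b'}" "l = V.span {a'} \<oplus> V.span {b'}" "col a' b'" using H_line[OF l(1)] .
 have vPr: "?v : Pi r" using vr col_sym mem_Pi by blast
 have nC: "scl cr r ~: CU H"
 proof
  assume "scl cr r : CU H"
  hence "Pi r \<subseteq> H" using Pi_scl[OF cr(1)] by (simp add: CU_def)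
  thus False using vPr vec_notH by blast
 qed
 have lL: "l : L" using LU_L[OF l(1)] .
 have rl: "r : l" using l(2) subspace_scl[OF line_subspace[OF lL] cr(1)] by blast
 then obtain al be where rab: "r = scl al a' + scl be b'" using ab(10) span_pair_mem[of r a' b'] by blast
 have NVs: "a' : NV" "b' : NV" using ab P_NV by blast+
 have al0: "al ~= 0"
 proof
  assume "al = 0"
  hence "scl cr r = scl (cr * be) b'" using rab by simp
  moreover have "scl cr r : NV" using cr P_NV by blast
  ultimately have "scl cr r = b'" using NV_unique[OF NVs(2), of "cr * be"] by simp
  thus False using nC ab(9) by blast
 qed
 have be0: "be ~= 0"
 proof
  assume "be = 0"
  hence "scl cr r = scl (cr * al) a'" using rab by simp
  moreover have "scl cr r : NV" using cr P_NV by blast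
  ultimately have "scl cr r = a'" using NV_unique[OF NVs(1), of "cr * al"] by simp
  thus False using nC ab(9) by blast
 qed
 have a: "scl al a' = F a b c" and b: "scl be b' = G x y z"
  using AB_cancel[OF V.subspace_scale[OF sA ab(1)] FA V.subspace_scale[OF sB ab(2)] GB] rab r_def by metis+
 have nz: "F a b c ~= 0" "G x y z ~= 0"
  unfolding a[symmetric] b[symmetric] using al0 be0 ab(3,4) by (simp_all only: V.scale_eq_0_iff simp_thms)
 have cab: "col (F a b c) (G x y z)" unfolding a[symmetric] b[symmetric] using ab(11) col_scl1[OF al0] col_scl2[OF be0] by blast
 have crv: "col (scl cr r) ?v" using vr col_sym col_scl1[OF cr(1)] by blast
 have "d2 (F a b c) ?v" "d2 (G x y z) ?v"
  unfolding a[symmetric] b[symmetric] using d2I[OF cr(2) _ crv] colI[OF lL _ l(2)] V.subspace_scale[OF line_subspace[OF lL]] ab(5,6) by blast+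
 hence Tv: "?v : T (F a b c)" "?v : T (G x y z)"
  using T_mem_X[OF A_X0[OF FA nz(1)] X] T_mem_X[OF dualpair.A_X0[OF swap GB nz(2)] X] by blast+
 obtain k where k: "sub (Pi r Int H) k" using sub_Int[OF PiX[OF rX] H6] by metis
 have "l \<subseteq> Pi r Int H" using Ln_Pi[OF lL rl] l(1) by (auto simp: LU_def)
 moreover have "k <= 2"
 proof (rule ccontr)
  assume "~ k <= 2"
  hence "Pi r Int H = Pi r" using sub_eq[OF k PiX[OF rX]] by simp
  thus False using vPr vec_notH by blast
 qed
 ultimately have "Pi r Int H = l" using sub_eq[OF line_sub2[OF lL] k] by blast
 also have "l = V.span {F a b c} \<oplus> V.span {G x y z}"
  unfolding ab(10) a[symmetric] b[symmetric] by (simp only: span_scl[OF al0] span_scl[OF be0])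
 finally show "Pi (F a b c + G x y z) Int H = V.span {F a b c} \<oplus> V.span {G x y z}" unfolding r_def .
 show "F a b c ~= 0" "G x y z ~= 0" "a * x + b * y + c * z = 0" "a * k0 + b * k1 + c * k2 = 0" "h0 * x + h1 * y + h2 * z = 0"
  using nz cab col_FG[OF nz] Tv T_FA_vec[OF nz(1)] T_GB_vec[OF nz(2)] by simp_all
qed

lemma out_t: assumes X: "vec h0 h1 h2 k0 k1 k2 : X0" shows "sub (Pi (vec h0 h1 h2 k0 k1 k2) Int H) 2"
proof -
 let ?v = "vec h0 h1 h2 k0 k1 k2"
 have PV: "Pi ?v \<subseteq> VV" using VV_L by (auto simp: Pi_def)
 have HV: "H \<subseteq> VV" using hyperH hyper_iff by blast
 obtain c where c: "sub (Pi ?v Int H) c" "3 + 6 <= 7 + c" using sub_Int_ge[OF PiX[OF X] H6 VV7 PV HV] .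
 have "c <= 2"
 proof (rule ccontr)
  assume "~ c <= 2"
  hence "Pi ?v Int H = Pi ?v" using sub_eq[OF c(1) PiX[OF X]] by simp
  thus False using vec_notH col_reflX[OF X] mem_Pi by blast
 qed
 hence "c = 2" using c(2) by simp
 thus ?thesis using c(1) by simp
qed

text \<open>For \<open>k = 0\<close> the outer point is in \<open>T p\<close> for every
  \<open>p\<close> of \<open>A\<close>. Take \<open>p\<close> collinear with the \<open>B\<close>
  part of some \<open>r\<close> in \<open>Pi ?v \<inter> H\<close> but different from the
  \<open>A\<close> part. Then the outer point is at distance at most two from two points of the line
  \<open>m\<close> through \<open>p\<close> and this \<open>B\<close> part, so it has a neighbour on
  \<open>m\<close>. That neighbour must be \<open>r\<close>, which puts \<open>p\<close> on the line
  of \<open>H\<close> through \<open>r\<close>.\<close>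

lemma out_k_ne: assumes X: "vec h0 h1 h2 k0 k1 k2 : X0" shows "G k0 k1 k2 ~= 0"
proof
 assume k: "G k0 k1 k2 = 0"
 let ?v = "vec h0 h1 h2 k0 k1 k2"
 obtain r where r: "r : Pi ?v Int H" "r : NV" using sub_point[OF out_t[OF X]] by auto
 have rP: "r : P" using r Pi_P by blast
 have r0: "r ~= 0" using NV_nonzero r by blast
 have rr: "r : Pi ?v" "r : H" using r by blast+
 obtain a b c x y z where rFG: "r = F a b c + G x y z" using H_FG[OF rr(2)] .
 note o = rFG out_FG(1-3,6)[OF X rr(1)[unfolded rFG] r0[unfolded rFG], folded rFG]
 have "~ NA (G x y z) \<subseteq> V.span {F a b c}" using sub_mono[OF NA_sub[OF GB o(3)] sub_span1[OF o(2)]] by auto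
 then obtain p where p: "p : NA (G x y z)" "p ~: V.span {F a b c}" by blast
 have pA: "p : A" using p NA_A by blast
 have p0: "p ~= 0" using p V.span_zero by blast
 have pb: "col p (G x y z)" using p p0 by (simp add: NA_def)
 obtain a2 b2 c2 where pF: "p = F a2 b2 c2" using A_F[OF pA] .
 have "?v : T p" using T_FA_vec[of a2 b2 c2 h0 h1 h2 k0 k1 k2] p0 pF k G_0 by simp
 hence dp: "d2 ?v p" using T_mem_X[OF A_X0[OF pA p0] X] d2_sym by blast
 obtain cv where cv: "cv ~= 0" "scl cv ?v : P" using rep[OF X] .
 obtain cp where cp: "cp ~= 0" "scl cp p : A" "scl cp p : P" using A_rep[OF pA p0] by metis
 obtain cb where cb: "cb ~= 0" "scl cb (G x y z) : B" "scl cb (G x y z) : CU H" "scl cb (G x y z) : P" using dualpair.A_rep[OF swap GB o(3)] by metis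
 obtain m where m: "m : L" "p : m" "G x y z : m" using pb by (auto simp: col_def)
 have mm: "scl cp p : m" "scl cb (G x y z) : m" using m subspace_scl[OF line_subspace[OF m(1)]] cp(1) cb(1) by blast+
 have vr: "col ?v r" using r mem_Pi by blast
 have "G x y z : Pi r Int H" unfolding o(5) using ssum_upper2[of "V.span {F a b c}" "V.span {G x y z}"] V.span_base[of "G x y z" "{G x y z}"] by auto
 hence rb: "col r (G x y z)" using mem_Pi by blast
 have ne: "scl cp p ~= scl cb (G x y z)" using cp cb AB0 P_nonzero by (metis IntI singletonD)
 have "d2 (scl cv ?v) (scl cp p)" "d2 (scl cv ?v) (scl cb (G x y z))"
  using dp d2I[OF rP vr rb] d2_scl1[OF cv(1)] d2_scl2[OF cp(1)] d2_scl2[OF cb(1)] by blast+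
 then obtain w where w: "w : P" "w : m" "col (scl cv ?v) w" using two_d2[OF cv(2) m(1) cp(3) cb(4) mm ne] by blast
 have nvb: "~ col (scl cv ?v) (scl cb (G x y z))"
 proof
  assume "col (scl cv ?v) (scl cb (G x y z))"
  hence "scl cv ?v : Pi (scl cb (G x y z))" using col_sym mem_Pi by blast
  hence "scl cv ?v : H" using cb(3) by (auto simp: CU_def)
  thus False using subspace_scl[OF sH cv(1)] vec_notH by blast
 qed
 have "w = r" using common_nbr_unique[OF cv(2) cb(4) w(1) rP nvb w(3) colI[OF m(1) mm(2) w(2)]] vr rb col_sym cv(1) cb(1)
  by (simp add: col_scl1 col_scl2)
 hence "m \<subseteq> Pi r" using Ln_Pi[OF m(1)] w(2) by blast
 moreover have "p : H" using pA AH by blast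
 ultimately have "p : Pi r Int H" using m(2) by blast
 then obtain s t where st: "p = scl s (F a b c) + scl t (G x y z)" using o(5) span_pair_mem[of p] by blast
 have "p = scl s (F a b c)"
  using AB_cancel(1)[OF pA V.subspace_scale[OF sA FA] V.subspace_0[OF sB] V.subspace_scale[OF sB GB], of s a b c t x y z] st by simp
 thus False using p(2) scl_in_span by metis
qed

lemma out_h_ne: assumes X: "vec h0 h1 h2 k0 k1 k2 : X0" shows "F h0 h1 h2 ~= 0"
 using coords.out_k_ne[OF coords_swap, of k0 k1 k2 h0 h1 h2] X vec_swap by simp

lemma out_basis: assumes X: "vec h0 h1 h2 k0 k1 k2 : X0"
 obtains a b c x y z a' b' c' x' y' z' where
  "F a b c + G x y z : Pi (vec h0 h1 h2 k0 k1 k2)" "F a' b' c' + G x' y' z' : Pi (vec h0 h1 h2 k0 k1 k2)"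
  "NA (G k0 k1 k2) = V.span {F a b c} \<oplus> V.span {F a' b' c'}" "F a b c ~= 0" "F a' b' c' ~: V.span {F a b c}"
proof -
 let ?v = "vec h0 h1 h2 k0 k1 k2"
 note t = out_t[OF X]
 obtain r where r: "r : Pi ?v Int H" "r ~= 0" using sub_point[OF t] NV_nonzero by (metis one_le_numeral)
 have "~ Pi ?v Int H \<subseteq> V.span {r}" using sub_mono[OF t sub_span1[OF r(2)]] by auto
 then obtain r' where r': "r' : Pi ?v Int H" "r' ~: V.span {r}" by blast
 have r'0: "r' ~= 0" using r'(2) V.span_zero by blast
 have rr: "r : Pi ?v" "r : H" "r' : Pi ?v" "r' : H" using r r' by blast+
 obtain a b c x y z where rF: "r = F a b c + G x y z" using H_FG[OF rr(2)] .
 obtain a' b' c' x' y' z' where rF': "r' = F a' b' c' + G x' y' z'" using H_FG[OF rr(4)] .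
 note o = rF out_FG(1,4)[OF X rr(1)[unfolded rF] r(2)[unfolded rF]] and o' = rF' out_FG(1,4)[OF X rr(3)[unfolded rF'] r'0[unfolded rF']]
 have k0: "G k0 k1 k2 ~= 0" using out_k_ne[OF X] .
 have ns: "F a' b' c' ~: V.span {F a b c}"
 proof
  assume "F a' b' c' : V.span {F a b c}"
  then obtain s where s: "F a' b' c' = scl s (F a b c)" by (auto simp: V.span_singleton)
  let ?u = "r' - scl s r"
  have uH: "?u : Pi ?v Int H" using V.subspace_diff[OF sub_subspace[OF t]] V.subspace_scale[OF sub_subspace[OF t]] r r' by blast
  have u0: "?u ~= 0" using r'(2) scl_in_span[of s r] by auto
  have "?u = F 0 0 0 + G (x' - s * x) (y' - s * y) (z' - s * z)"
   using s unfolding o(1) o'(1) lc_scl F_inj by (auto simp: lc_scl V.scale_right_distrib lc_diff algebra_simps simp flip: lc_diff)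
  thus False using out_FG(1)[OF X, of 0 0 0 "x' - s * x" "y' - s * y" "z' - s * z"] uH u0 by simp
 qed
 have "NA (G k0 k1 k2) = V.span {F a b c} \<oplus> V.span {F a' b' c'}"
  by (rule sub2_eq_pair[OF NA_sub[OF GB k0] _ _ o(2) ns]) (use NA_FG[OF k0] o o' in simp_all)
 thus ?thesis using that r r' o o' ns by blast
qed

text \<open>If \<open>h\<close> and \<open>k\<close> were orthogonal, some vector of
  \<open>Pi ?v \<inter> H\<close> would have \<open>A\<close> part \<open>F h0 h1 h2\<close>;
  subtracting it from \<open>?v\<close> gives an outer vector with vanishing \<open>A\<close> part,
  against \<open>out_h_ne\<close>.\<close>

lemma out_dot: assumes X: "vec h0 h1 h2 k0 k1 k2 : X0" shows "h0 * k0 + h1 * k1 + h2 * k2 ~= 0"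
proof
 assume d: "h0 * k0 + h1 * k1 + h2 * k2 = 0"
 let ?v = "vec h0 h1 h2 k0 k1 k2"
 obtain a b c x y z a' b' c' x' y' z' where o:
  "F a b c + G x y z : Pi ?v" "F a' b' c' + G x' y' z' : Pi ?v"
  "NA (G k0 k1 k2) = V.span {F a b c} \<oplus> V.span {F a' b' c'}" using out_basis[OF X] by metis
 have sP: "V.subspace (Pi ?v)" using PiX[OF X] sub_subspace by blast
 have "F h0 h1 h2 : NA (G k0 k1 k2)" using NA_FG[OF out_k_ne[OF X]] d by blast
 then obtain s t where st: "F h0 h1 h2 = scl s (F a b c) + scl t (F a' b' c')" using o(3) span_pair_mem by blast
 have "scl s (F a b c + G x y z) + scl t (F a' b' c' + G x' y' z') : Pi ?v"
  using V.subspace_add[OF sP V.subspace_scale[OF sP o(1)] V.subspace_scale[OF sP o(2)]] .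
 moreover have "scl s (F a b c + G x y z) + scl t (F a' b' c' + G x' y' z') = F h0 h1 h2 + G (s * x + t * x') (s * y + t * y') (s * z + t * z')"
  unfolding st by (rule ext) (simp add: lc_apply scl_def algebra_simps)
 ultimately have "F h0 h1 h2 + G (s * x + t * x') (s * y + t * y') (s * z + t * z') : Pi ?v" by simp
 moreover have "?v : Pi ?v" using col_reflX[OF X] mem_Pi by blast
 ultimately have "?v - (F h0 h1 h2 + G (s * x + t * x') (s * y + t * y') (s * z + t * z')) : Pi ?v" using V.subspace_diff[OF sP] by blast
 moreover have "?v - (F h0 h1 h2 + G (s * x + t * x') (s * y + t * y') (s * z + t * z')) = vec 0 0 0 (k0 - (s * x + t * x')) (k1 - (s * y + t * y')) (k2 - (s * z + t * z'))"
  unfolding vec_def by (rule ext) (simp add: lc_apply algebra_simps)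
 ultimately have "vec 0 0 0 (k0 - (s * x + t * x')) (k1 - (s * y + t * y')) (k2 - (s * z + t * z')) : X0" using Pi_X0 vec_nz by metis
 thus False using out_h_ne by fastforce
qed

text \<open>The \<open>B\<close> part is \<open>l\<close> times the cross product of
  \<open>(a, b, c)\<close> with \<open>h\<close>; this scalar is all that remains unknown about the
  pencil.\<close>

definition lamv where "lamv h0 h1 h2 k0 k1 k2 l \<longleftrightarrow> (ALL a b c. a * k0 + b * k1 + c * k2 = 0 -->
  F a b c + G (l * (b * h2 - c * h1)) (l * (c * h0 - a * h2)) (l * (a * h1 - b * h0)) : Pi (vec h0 h1 h2 k0 k1 k2))"

lemma G_unique: assumes X: "vec h0 h1 h2 k0 k1 k2 : X0" and m: "F a b c + G x y z : Pi (vec h0 h1 h2 k0 k1 k2)" "F a b c + G x' y' z' : Pi (vec h0 h1 h2 k0 k1 k2)"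
 shows "x = x' & y = y' & z = z'"
proof (rule ccontr)
 assume n: "~ (x = x' & y = y' & z = z')"
 let ?v = "vec h0 h1 h2 k0 k1 k2"
 have sP: "V.subspace (Pi ?v)" using PiX[OF X] sub_subspace by blast
 have e: "(F a b c + G x y z) - (F a b c + G x' y' z') = F 0 0 0 + G (x - x') (y - y') (z - z')"
  by (rule ext) (simp add: lc_apply algebra_simps)
 have "F 0 0 0 + G (x - x') (y - y') (z - z') : Pi ?v" using V.subspace_diff[OF sP m] e by simp
 moreover have "F 0 0 0 + G (x - x') (y - y') (z - z') ~= 0" using G_0[of "x - x'" "y - y'" "z - z'"] n by simp
 ultimately show False using out_FG(1)[OF X] by fastforce
qed

text \<open>By \<open>out_FG\<close> the \<open>B\<close> part of a vector of
  \<open>Pi ?v \<inter> H\<close> is orthogonal to its \<open>A\<close> part and to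
  \<open>h\<close>, hence a multiple of their cross product. The multiplier could still depend on
  the vector; evaluating it on the sum of two basis vectors shows that it does not.\<close>

lemma out_lam: assumes X: "vec h0 h1 h2 k0 k1 k2 : X0" obtains l where "l ~= 0" "lamv h0 h1 h2 k0 k1 k2 l"
proof -
 let ?v = "vec h0 h1 h2 k0 k1 k2"
 have sP: "V.subspace (Pi ?v)" using PiX[OF X] sub_subspace by blast
 have hk: "h0 * k0 + h1 * k1 + h2 * k2 ~= 0" using out_dot[OF X] .
 obtain a b c x y z a' b' c' x' y' z' where o:
  "F a b c + G x y z : Pi ?v" "F a' b' c' + G x' y' z' : Pi ?v"
  "NA (G k0 k1 k2) = V.span {F a b c} \<oplus> V.span {F a' b' c'}" "F a b c ~= 0" "F a' b' c' ~: V.span {F a b c}" using out_basis[OF X] .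
 have one: "EX l. x = l * (b * h2 - c * h1) & y = l * (c * h0 - a * h2) & z = l * (a * h1 - b * h0) & l ~= 0 & a * k0 + b * k1 + c * k2 = 0"
  if r: "F a b c + G x y z : Pi ?v" "F a b c ~= 0" for a b c x y z
 proof -
  have rn: "F a b c + G x y z ~= 0" using FG_cancel[of a b c x y z 0 0 0 0 0 0] r(2) F_0 by auto
  note q = out_FG[OF X r(1) rn]
  have nz: "b * h2 - c * h1 ~= 0 | c * h0 - a * h2 ~= 0 | a * h1 - b * h0 ~= 0"
   using cross_zero[of b h2 c h1 h0 a k0 k1 k2] q(4) hk r(2) F_0 by blast
  have "EX l. x = l * (b * h2 - c * h1) & y = l * (c * h0 - a * h2) & z = l * (a * h1 - b * h0)"
   by (rule perp_cross[OF _ _ nz]) (use q(3,5) in \<open>simp_all add: mult.commute\<close>)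
  thus ?thesis using q(2,4) G_0 by auto
 qed
 obtain l where l: "x = l * (b * h2 - c * h1)" "y = l * (c * h0 - a * h2)" "z = l * (a * h1 - b * h0)" "l ~= 0" "a * k0 + b * k1 + c * k2 = 0"
  using one[OF o(1,4)] by blast
 have F'0: "F a' b' c' ~= 0" using o(5) V.span_zero by metis
 obtain l' where l': "x' = l' * (b' * h2 - c' * h1)" "y' = l' * (c' * h0 - a' * h2)" "z' = l' * (a' * h1 - b' * h0)" "a' * k0 + b' * k1 + c' * k2 = 0"
  using one[OF o(2) F'0] by blast
 have sum: "F (a + a') (b + b') (c + c') + G (x + x') (y + y') (z + z') : Pi ?v"
 proof -
  have "F (a + a') (b + b') (c + c') + G (x + x') (y + y') (z + z') = (F a b c + G x y z) + (F a' b' c' + G x' y' z')"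
   by (rule ext) (simp add: lc_apply algebra_simps)
  thus ?thesis using V.subspace_add[OF sP o(1,2)] by simp
 qed
 have comb: "s = 0 & t = 0" if "F (s * a + t * a') (s * b + t * b') (s * c + t * c') = 0" for s t
 proof -
  have "scl s (F a b c) + scl t (F a' b' c') = 0" using that by (simp add: lc_scl lc_add)
  thus ?thesis using notin_span_imp[OF o(5), of s t] o(4) by blast
 qed
 have "F (a + a') (b + b') (c + c') ~= 0" using comb[of 1 1] by auto
 then obtain m where m: "x + x' = m * ((b + b') * h2 - (c + c') * h1)" "y + y' = m * ((c + c') * h0 - (a + a') * h2)" "z + z' = m * ((a + a') * h1 - (b + b') * h0)"
  using one[OF sum] by blast
 let ?s = "l - m" and ?t = "l' - m"
 have "(?s * b + ?t * b') * h2 - (?s * c + ?t * c') * h1 = 0" "(?s * c + ?t * c') * h0 - (?s * a + ?t * a') * h2 = 0" "(?s * a + ?t * a') * h1 - (?s * b + ?t * b') * h0 = 0"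
  using m l(1-3) l'(1-3) by algebra+
 moreover have "(?s * a + ?t * a') * k0 + (?s * b + ?t * b') * k1 + (?s * c + ?t * c') * k2 = 0" using l(5) l'(4) by algebra
 ultimately have "?s * a + ?t * a' = 0" "?s * b + ?t * b' = 0" "?s * c + ?t * c' = 0" using cross_zero[OF _ _ _ _ hk] by blast+
 hence "F (?s * a + ?t * a') (?s * b + ?t * b') (?s * c + ?t * c') = 0" by (simp only: lc_0)
 hence "?s = 0 & ?t = 0" by (rule comb)
 hence ll: "l' = l" by simp
 have "lamv h0 h1 h2 k0 k1 k2 l"
  unfolding lamv_def
 proof (intro allI impI)
  fix u v w assume d: "u * k0 + v * k1 + w * k2 = 0"
  have "F u v w : NA (G k0 k1 k2)" using NA_FG[OF out_k_ne[OF X]] d by blast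
  then obtain s t where st: "F u v w = scl s (F a b c) + scl t (F a' b' c')" using o(3) span_pair_mem by blast
  hence uvw: "u = s * a + t * a'" "v = s * b + t * b'" "w = s * c + t * c'" by (simp_all add: lc_scl lc_add F_inj)
  have "scl s (F a b c + G x y z) + scl t (F a' b' c' + G x' y' z') : Pi ?v"
   using V.subspace_add[OF sP V.subspace_scale[OF sP o(1)] V.subspace_scale[OF sP o(2)]] .
  moreover have "scl s (F a b c + G x y z) + scl t (F a' b' c' + G x' y' z') = F u v w + G (l * (v * h2 - w * h1)) (l * (w * h0 - u * h2)) (l * (u * h1 - v * h0))"
   unfolding uvw l l' ll by (rule ext) (simp add: lc_apply scl_def algebra_simps)
  ultimately show "F u v w + G (l * (v * h2 - w * h1)) (l * (w * h0 - u * h2)) (l * (u * h1 - v * h0)) : Pi ?v" by simp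
 qed
 thus ?thesis using that l(4) by blast
qed

end

definition mk :: "'a::field => 'a => 'a => 'a => 'a => 'a => 'a => nat => 'a" where
 "mk x0 x1 x2 x3 x4 x5 x6 = (%i. if i = 0 then x0 else if i = 1 then x1 else if i = 2 then x2 else if i = 3 then x3
   else if i = 4 then x4 else if i = 5 then x5 else if i = 6 then x6 else 0)"

lemma mk_simps [simp]: "mk x0 x1 x2 x3 x4 x5 x6 0 = x0" "mk x0 x1 x2 x3 x4 x5 x6 (Suc 0) = x1" "mk x0 x1 x2 x3 x4 x5 x6 2 = x2"
 "mk x0 x1 x2 x3 x4 x5 x6 3 = x3" "mk x0 x1 x2 x3 x4 x5 x6 4 = x4" "mk x0 x1 x2 x3 x4 x5 x6 5 = x5" "mk x0 x1 x2 x3 x4 x5 x6 6 = x6"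
 by (simp_all add: mk_def)

lemma mk_pvec: "mk x0 x1 x2 x3 x4 x5 x6 : pvec 6"
 by (auto simp: pvec_def mk_def)

lemma pvec_eqI: assumes "u : pvec 6" "v : pvec 6" "u 0 = v 0" "u 1 = v 1" "u 2 = v 2" "u 3 = v 3" "u 4 = v 4" "u 5 = v 5" "u 6 = v 6"
 shows "u = v"
proof
 fix i show "u i = v i"
 proof (cases "i > 6")
  case True thus ?thesis using assms(1,2) by (simp add: pvec_def)
 next
  case False
  hence "i = 0 | i = 1 | i = 2 | i = 3 | i = 4 | i = 5 | i = 6" by arith
  thus ?thesis using assms(3-9) by auto
 qed
qed

lemma span_pair: "V.span {x, y} = V.span {x} \<oplus> V.span {y}"
 using V.span_Un[of "{x}" "{y}"] by (simp add: ssum_def insert_commute)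

lemma hex_lineI:
 fixes x y :: "nat => 'a::{field,finite}"
 assumes "x : pvec 6" "y : pvec 6" "sub (V.span {x, y}) 2" "quad x" "quad y"
  "x 0 * y 4 + x 4 * y 0 + x 1 * y 5 + x 5 * y 1 + x 2 * y 6 + x 6 * y 2 = 2 * x 3 * y 3"
  "gr x y 1 2 = gr x y 3 4" "gr x y 5 4 = gr x y 3 2" "gr x y 2 0 = gr x y 3 5" "gr x y 6 5 = gr x y 3 0"
  "gr x y 0 1 = gr x y 3 6" "gr x y 4 6 = gr x y 3 1"
 shows "V.span {x, y} : hex_lines"
proof -
 have "V.span {x, y} \<subseteq> pvec 6" using V.span_minimal[OF _ subspace_pvec, of "{x, y}" 6] assms(1,2) by blast
 hence "V.span {x, y} : lines 6" using assms(3) by (simp add: psub_iff numeral_2_eq_2)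
 moreover have "quad v" if v: "v : V.span {x, y}" for v
 proof -
  obtain c d where cd: "v = scl c x + scl d y" using v unfolding span_pair span_pair_mem by blast
  have e: "v i = c * x i + d * y i" for i using cd by (simp add: scl_def)
  show ?thesis using assms(4-6) unfolding quad_def e by algebra
 qed
 ultimately show ?thesis unfolding hex_lines_def using assms(7-12) by blast
qed

context coords
begin

text \<open>The point \<open>?r\<close> of the pencil with \<open>A\<close> part
  \<open>(a, b, c)\<close> has that part in its own pencil plane, so the plane contains the shifted
  outer vector as well. The two outer points share \<open>?r\<close> in their pencils, which forces
  equal scalars.\<close>

lemma move_F: assumes X: "vec h0 h1 h2 k0 k1 k2 : X0" and l: "l ~= 0" "lamv h0 h1 h2 k0 k1 k2 l" and d: "a * k0 + b * k1 + c * k2 = 0"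
 shows "vec (h0 + a) (h1 + b) (h2 + c) k0 k1 k2 : X0 & lamv (h0 + a) (h1 + b) (h2 + c) k0 k1 k2 l"
proof (cases "F a b c = 0")
 case True thus ?thesis using F_0 X l by simp
next
 case Fn: False
 let ?v = "vec h0 h1 h2 k0 k1 k2" and ?x = "l * (b * h2 - c * h1)" and ?y = "l * (c * h0 - a * h2)" and ?z = "l * (a * h1 - b * h0)"
 let ?r = "F a b c + G ?x ?y ?z" and ?v' = "vec (h0 + a) (h1 + b) (h2 + c) k0 k1 k2"
 have r: "?r : Pi ?v" using l(2) d unfolding lamv_def by blast
 have rn: "?r ~= 0" using FG_cancel[of a b c ?x ?y ?z 0 0 0 0 0 0] Fn F_0 by auto
 have "F a b c : Pi ?r Int H" unfolding out_FG(6)[OF X r rn] using ssum_upper1[of "V.span {G ?x ?y ?z}" "V.span {F a b c}"] V.span_base[of "F a b c" "{F a b c}"] by auto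
 hence FP: "F a b c : Pi ?r" by blast
 have rX: "?r : X0" using Pi_X0[OF r rn] .
 have vP: "?v : Pi ?r" using r mem_Pi col_sym by blast
 have "?v + F a b c : Pi ?r" using V.subspace_add[OF sub_subspace[OF PiX[OF rX]] vP FP] .
 hence v'P: "?v' : Pi ?r" by (simp only: vec_addF)
 have X': "?v' : X0" using Pi_X0[OF v'P vec_nz] .
 have r': "?r : Pi ?v'" using v'P mem_Pi col_sym by blast
 obtain l' where l': "l' ~= 0" "lamv (h0 + a) (h1 + b) (h2 + c) k0 k1 k2 l'" using out_lam[OF X'] .
 have "F a b c + G (l' * (b * (h2 + c) - c * (h1 + b))) (l' * (c * (h0 + a) - a * (h2 + c))) (l' * (a * (h1 + b) - b * (h0 + a))) : Pi ?v'"
  using l'(2) d unfolding lamv_def by blast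
 from G_unique[OF X' r' this] have "(l - l') * (b * h2 - c * h1) = 0" "(l - l') * (c * h0 - a * h2) = 0" "(l - l') * (a * h1 - b * h0) = 0" by algebra+
 moreover have "b * h2 - c * h1 ~= 0 | c * h0 - a * h2 ~= 0 | a * h1 - b * h0 ~= 0"
  using cross_zero[of b h2 c h1 h0 a k0 k1 k2] d out_dot[OF X] Fn F_0 by blast
 ultimately have "l = l'" by auto
 thus ?thesis using X' l' by simp
qed

lemma move_G: assumes X: "vec h0 h1 h2 k0 k1 k2 : X0" and l: "l ~= 0" "lamv h0 h1 h2 k0 k1 k2 l" and d: "h0 * x + h1 * y + h2 * z = 0"
 shows "vec h0 h1 h2 (k0 + x) (k1 + y) (k2 + z) : X0 & lamv h0 h1 h2 (k0 + x) (k1 + y) (k2 + z) l"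
proof (cases "G x y z = 0")
 case True thus ?thesis using G_0 X l by simp
next
 case Gn: False
 define kp where "kp = h0 * k0 + h1 * k1 + h2 * k2"
 have kp: "kp ~= 0" using out_dot[OF X] by (simp add: kp_def)
 \<comment> \<open>The vector \<open>(a, b, c)\<close> is the cross product of \<open>k\<close> and
   \<open>(x, y, z)\<close> divided by \<open>l * kp\<close>: it is orthogonal to \<open>k\<close>,
   and \<open>l\<close> times its cross product with \<open>h\<close> is
   \<open>(x, y, z)\<close>.\<close>
 define a where "a = (k1 * z - k2 * y) / (l * kp)"
 define b where "b = (k2 * x - k0 * z) / (l * kp)"
 define c where "c = (k0 * y - k1 * x) / (l * kp)"
 have n: "(k2 * x - k0 * z) * h2 - (k0 * y - k1 * x) * h1 = x * kp" "(k0 * y - k1 * x) * h0 - (k1 * z - k2 * y) * h2 = y * kp"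
  "(k1 * z - k2 * y) * h1 - (k2 * x - k0 * z) * h0 = z * kp" unfolding kp_def using d by algebra+
 have bx: "l * (b * h2 - c * h1) = x" "l * (c * h0 - a * h2) = y" "l * (a * h1 - b * h0) = z"
  using n l(1) kp by (simp_all add: a_def b_def c_def diff_divide_distrib[symmetric])
 have ad: "a * k0 + b * k1 + c * k2 = 0" "a * (k0 + x) + b * (k1 + y) + c * (k2 + z) = 0"
  by (simp_all add: a_def b_def c_def add_divide_distrib[symmetric]) (simp_all add: algebra_simps)
 let ?v = "vec h0 h1 h2 k0 k1 k2"
 let ?r = "F a b c + G x y z" and ?v' = "vec h0 h1 h2 (k0 + x) (k1 + y) (k2 + z)"
 have r: "?r : Pi ?v" using l(2) ad(1) bx unfolding lamv_def by metis
 have rn: "?r ~= 0" using FG_cancel[of a b c x y z 0 0 0 0 0 0] Gn G_0 by auto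
 have "G x y z : Pi ?r Int H" unfolding out_FG(6)[OF X r rn] using ssum_upper2[of "V.span {F a b c}" "V.span {G x y z}"] V.span_base[of "G x y z" "{G x y z}"] by auto
 hence GP: "G x y z : Pi ?r" by blast
 have rX: "?r : X0" using Pi_X0[OF r rn] .
 have vP: "?v : Pi ?r" using r mem_Pi col_sym by blast
 have "?v + G x y z : Pi ?r" using V.subspace_add[OF sub_subspace[OF PiX[OF rX]] vP GP] .
 hence v'P: "?v' : Pi ?r" by (simp only: vec_addG)
 have X': "?v' : X0" using Pi_X0[OF v'P vec_nz] .
 have r': "?r : Pi ?v'" using v'P mem_Pi col_sym by blast
 obtain l' where l': "l' ~= 0" "lamv h0 h1 h2 (k0 + x) (k1 + y) (k2 + z) l'" using out_lam[OF X'] .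
 have "F a b c + G (l' * (b * h2 - c * h1)) (l' * (c * h0 - a * h2)) (l' * (a * h1 - b * h0)) : Pi ?v'"
  using l'(2) ad(2) unfolding lamv_def by blast
 from G_unique[OF X' r' this] have "(l - l') * (b * h2 - c * h1) = 0" "(l - l') * (c * h0 - a * h2) = 0" "(l - l') * (a * h1 - b * h0) = 0"
  using bx by algebra+
 moreover have "b * h2 - c * h1 ~= 0 | c * h0 - a * h2 ~= 0 | a * h1 - b * h0 ~= 0"
  using cross_zero[of b h2 c h1 h0 a k0 k1 k2] ad(1) out_dot[OF X] out_FG(1)[OF X r rn] F_0 by blast
 ultimately have "l = l'" by auto
 thus ?thesis using X' l' by simp
qed

definition ok where "ok h0 h1 h2 k0 k1 k2 l \<longleftrightarrow> vec h0 h1 h2 k0 k1 k2 : X0 & l ~= 0 & lamv h0 h1 h2 k0 k1 k2 l"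

lemma ok_F: "ok h0 h1 h2 k0 k1 k2 l ==> t0 * k0 + t1 * k1 + t2 * k2 = h0 * k0 + h1 * k1 + h2 * k2 ==> ok t0 t1 t2 k0 k1 k2 l"
 using move_F[of h0 h1 h2 k0 k1 k2 l "t0 - h0" "t1 - h1" "t2 - h2"] unfolding ok_def by (simp add: algebra_simps)

lemma ok_G: "ok h0 h1 h2 k0 k1 k2 l ==> h0 * t0 + h1 * t1 + h2 * t2 = h0 * k0 + h1 * k1 + h2 * k2 ==> ok h0 h1 h2 t0 t1 t2 l"
 using move_G[of h0 h1 h2 k0 k1 k2 l "t0 - k0" "t1 - k1" "t2 - k2"] unfolding ok_def by (simp add: algebra_simps)

lemma reach1:
 assumes "ok h0 h1 h2 k0 k1 k2 l" "m0 * n0 + m1 * n1 + m2 * n2 = h0 * k0 + h1 * k1 + h2 * k2"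
  "k1 * n2 - k2 * n1 ~= 0 | k2 * n0 - k0 * n2 ~= 0 | k0 * n1 - k1 * n0 ~= 0"
 shows "ok m0 m1 m2 n0 n1 n2 l"
proof -
 let ?k = "h0 * k0 + h1 * k1 + h2 * k2"
 obtain t0 t1 t2 where f: "t0 * k0 + t1 * k1 + t2 * k2 = ?k" "t0 * n0 + t1 * n1 + t2 * n2 = ?k" using solve2[OF assms(3)] by blast
 have "ok t0 t1 t2 k0 k1 k2 l" using ok_F[OF assms(1) f(1)] .
 hence "ok t0 t1 t2 n0 n1 n2 l" using ok_G f by simp
 thus ?thesis using ok_F f(2) assms(2) by simp
qed

text \<open>Moves change \<open>h\<close> or \<open>k\<close> alone and preserve the dot product.
  Two coordinate pairs with the same dot product are joined by \<open>reach1\<close> if their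
  \<open>k\<close> parts are independent, and otherwise through a third vector \<open>p\<close>
  independent of both.\<close>

lemma reach:
 assumes o: "ok h0 h1 h2 k0 k1 k2 l" and d: "m0 * n0 + m1 * n1 + m2 * n2 = h0 * k0 + h1 * k1 + h2 * k2"
 shows "ok m0 m1 m2 n0 n1 n2 l"
proof (cases "k1 * n2 - k2 * n1 ~= 0 | k2 * n0 - k0 * n2 ~= 0 | k0 * n1 - k1 * n0 ~= 0")
 case True thus ?thesis using reach1[OF o d] by blast
next
 case False
 let ?k = "h0 * k0 + h1 * k1 + h2 * k2"
 have k0: "?k ~= 0" using o out_dot unfolding ok_def by blast
 hence kn: "k0 ~= 0 | k1 ~= 0 | k2 ~= 0" by auto
 obtain p0 p1 p2 where p: "k1 * p2 - k2 * p1 ~= 0 | k2 * p0 - k0 * p2 ~= 0 | k0 * p1 - k1 * p0 ~= 0"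
 proof (cases "k0 = 0")
  case True thus ?thesis using that[of 0 1 0] kn that[of 0 0 1] that[of 1 0 0] by auto
 next
  case False thus ?thesis using that[of 1 0 0] by simp
 qed
 obtain t0 t1 t2 where f: "t0 * k0 + t1 * k1 + t2 * k2 = ?k" "t0 * p0 + t1 * p1 + t2 * p2 = ?k" using solve2[OF p] by blast
 have o1: "ok t0 t1 t2 p0 p1 p2 l" using reach1[OF o f(2) p] .
 have z: "k1 * n2 - k2 * n1 = 0" "k2 * n0 - k0 * n2 = 0" "k0 * n1 - k1 * n0 = 0" using False by auto
 have nn: "n0 ~= 0 | n1 ~= 0 | n2 ~= 0" using d k0 by auto
 have "p1 * n2 - p2 * n1 ~= 0 | p2 * n0 - p0 * n2 ~= 0 | p0 * n1 - p1 * n0 ~= 0"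
 proof (rule ccontr)
  assume "~ (p1 * n2 - p2 * n1 ~= 0 | p2 * n0 - p0 * n2 ~= 0 | p0 * n1 - p1 * n0 ~= 0)"
  hence w: "p1 * n2 - p2 * n1 = 0" "p2 * n0 - p0 * n2 = 0" "p0 * n1 - p1 * n0 = 0" by auto
  have "(k1 * p2 - k2 * p1) * n0 = 0" "(k1 * p2 - k2 * p1) * n1 = 0" "(k1 * p2 - k2 * p1) * n2 = 0"
   "(k2 * p0 - k0 * p2) * n0 = 0" "(k2 * p0 - k0 * p2) * n1 = 0" "(k2 * p0 - k0 * p2) * n2 = 0"
   "(k0 * p1 - k1 * p0) * n0 = 0" "(k0 * p1 - k1 * p0) * n1 = 0" "(k0 * p1 - k1 * p0) * n2 = 0"
   using z w by algebra+
  thus False using nn p by auto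
 qed
 thus ?thesis using reach1[OF o1] d f(2) by simp
qed

lemma col_dot:
 assumes X: "vec h0 h1 h2 k0 k1 k2 : X0" and c: "col (vec h0 h1 h2 k0 k1 k2) (vec m0 m1 m2 n0 n1 n2)"
 shows "m0 * n0 + m1 * n1 + m2 * n2 = h0 * k0 + h1 * k1 + h2 * k2"
proof (cases "vec m0 m1 m2 n0 n1 n2 = vec h0 h1 h2 k0 k1 k2")
 case True
 hence "F m0 m1 m2 + G n0 n1 n2 = F h0 h1 h2 + G k0 k1 k2" by (simp add: vec_def)
 hence "m0 = h0 & m1 = h1 & m2 = h2 & n0 = k0 & n1 = k1 & n2 = k2" unfolding FG_cancel by blast
 thus ?thesis by simp
next
 case False
 let ?v = "vec h0 h1 h2 k0 k1 k2" and ?w = "vec m0 m1 m2 n0 n1 n2"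
 let ?r = "F (m0 - h0) (m1 - h1) (m2 - h2) + G (n0 - k0) (n1 - k1) (n2 - k2)"
 have sP: "V.subspace (Pi ?v)" using PiX[OF X] sub_subspace by blast
 have "?w - ?v : Pi ?v" using V.subspace_diff[OF sP] c col_reflX[OF X] mem_Pi by blast
 hence r: "?r : Pi ?v" by (simp only: vec_diff)
 have rn: "?r ~= 0" using False by (metis vec_diff eq_iff_diff_eq_0)
 show ?thesis using out_FG(3-5)[OF X r rn] by algebra
qed

lemma d2_dot:
 assumes X: "vec h0 h1 h2 k0 k1 k2 : X0" and X': "vec m0 m1 m2 n0 n1 n2 : X0" and d: "d2 (vec h0 h1 h2 k0 k1 k2) (vec m0 m1 m2 n0 n1 n2)"
 shows "m0 * n0 + m1 * n1 + m2 * n2 = h0 * k0 + h1 * k1 + h2 * k2"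
proof -
 let ?v = "vec h0 h1 h2 k0 k1 k2" and ?w = "vec m0 m1 m2 n0 n1 n2"
 obtain u where u: "u : P" "col ?v u" "col u ?w" using d by (auto simp: d2_def)
 have uX: "u : X0" using P_X0[OF u(1)] .
 show ?thesis
 proof (cases "u : H")
  case False
  obtain s p0 p1 p2 r0 r1 r2 where s: "s ~= 0" "u = scl s (vec p0 p1 p2 r0 r1 r2)" using outer_vec[OF uX False] .
  have c: "col ?v (vec p0 p1 p2 r0 r1 r2)" "col (vec p0 p1 p2 r0 r1 r2) ?w" using u s col_scl1[OF s(1)] col_scl2[OF s(1)] by simp_all
  have Xp: "vec p0 p1 p2 r0 r1 r2 : X0" using col_X0[OF c(1) vec_nz] .
  show ?thesis using col_dot[OF X c(1)] col_dot[OF Xp c(2)] by simp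
 next
  case True
  have uP: "u : Pi ?v" using u mem_Pi by blast
  obtain a1 b1 c1 x1 y1 z1 where uF: "u = F a1 b1 c1 + G x1 y1 z1" using H_FG[OF True] .
  note q = out_FG(3-6)[OF X uP[unfolded uF] P_nonzero[OF u(1), unfolded uF], folded uF]
  have vw: "?v : Pi u" "?w : Pi u" using u mem_Pi col_sym by blast+
  have "?w - ?v : Pi u" using V.subspace_diff[OF Pi_subspace[OF u(1)] vw(2,1)] .
  moreover have "?w - ?v : H" unfolding vec_diff by (rule FGH)
  ultimately have "?w - ?v : V.span {F a1 b1 c1} \<oplus> V.span {G x1 y1 z1}" using q(4) by blast
  then obtain s t where st: "?w - ?v = scl s (F a1 b1 c1) + scl t (G x1 y1 z1)" unfolding span_pair_mem by blast
  hence "m0 - h0 = s * a1 & m1 - h1 = s * b1 & m2 - h2 = s * c1 & n0 - k0 = t * x1 & n1 - k1 = t * y1 & n2 - k2 = t * z1"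
   unfolding vec_diff lc_scl FG_cancel .
  thus ?thesis using q(1-3) by algebra
 qed
qed

text \<open>Adding to \<open>?v\<close> a vector of \<open>A\<close> orthogonal to \<open>k\<close>
  and a vector of \<open>B\<close> orthogonal to \<open>h\<close> stays in \<open>T ?v\<close>, and
  the dot product changes by the product of the two added vectors, which can be given any value.
  Choosing the value of the second class produces a point of that class at distance at most two from
  \<open>?v\<close>, and \<open>d2_dot\<close> identifies the classes.\<close>

lemma single_class:
 assumes o: "ok h0 h1 h2 k0 k1 k2 l" and o': "ok m0 m1 m2 n0 n1 n2 l'"
 shows "m0 * n0 + m1 * n1 + m2 * n2 = h0 * k0 + h1 * k1 + h2 * k2" "l' = l"
proof -
 let ?v = "vec h0 h1 h2 k0 k1 k2" and ?k = "h0 * k0 + h1 * k1 + h2 * k2" and ?k' = "m0 * n0 + m1 * n1 + m2 * n2"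
 have X: "?v : X0" using o by (simp add: ok_def)
 have k: "?k ~= 0" using out_dot[OF X] .
 have hn: "h0 ~= 0 | h1 ~= 0 | h2 ~= 0" using out_h_ne[OF X] F_0 by blast
 obtain x y z where b: "h0 * x + h1 * y + h2 * z = 0" "x ~= 0 | y ~= 0 | z ~= 0"
 proof (cases "h0 = 0")
  case True thus ?thesis using that[of 1 0 0] by simp
 next
  case False thus ?thesis using that[of "- h1" h0 0] by (simp add: mult.commute)
 qed
 have nz: "k1 * z - k2 * y ~= 0 | k2 * x - k0 * z ~= 0 | k0 * y - k1 * x ~= 0"
 proof (rule ccontr)
  assume "~ ?thesis"
  hence "y * k2 - z * k1 = 0" "z * k0 - x * k2 = 0" "x * k1 - y * k0 = 0" by (auto simp: mult.commute)
  hence "x = 0 & y = 0 & z = 0" using cross_zero[of y k2 z k1 k0 x h0 h1 h2] b(1) k by (simp add: mult.commute)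
  thus False using b(2) by blast
 qed
 obtain a b' c where a: "a * k0 + b' * k1 + c * k2 = 0" "a * x + b' * y + c * z = ?k' - ?k" using solve2[OF nz] by blast
 have dk: "(h0 + a) * (k0 + x) + (h1 + b') * (k1 + y) + (h2 + c) * (k2 + z) = ?k'" using a b(1) by algebra
 have o2: "ok (h0 + a) (h1 + b') (h2 + c) (k0 + x) (k1 + y) (k2 + z) l'" using reach[OF o' dk] .
 let ?w = "vec (h0 + a) (h1 + b') (h2 + c) (k0 + x) (k1 + y) (k2 + z)"
 have X2: "?w : X0" using o2 by (simp add: ok_def)
 have Tv: "?v : T ?v" using T_mem_X[OF X X] d2_def col_reflX[OF X] rep[OF X] col_scl1 col_scl2 by metis
 have TF: "F a b' c : T ?v"
 proof (cases "F a b' c = 0")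
  case True thus ?thesis using V.subspace_0[OF T_subspace] by simp
 next
  case False thus ?thesis using T_FA_vec[OF False] a(1) T_swap[OF X A_X0[OF FA False]] by blast
 qed
 have TG: "G x y z : T ?v"
 proof -
  have n: "G x y z ~= 0" using b(2) G_0 by blast
  show ?thesis using T_GB_vec[OF n] b(1) T_swap[OF X dualpair.A_X0[OF swap GB n]] by blast
 qed
 have "?v + F a b' c + G x y z : T ?v" using V.subspace_add[OF T_subspace] Tv TF TG by blast
 hence "?w : T ?v" by (simp only: vec_addF vec_addG)
 hence "d2 ?v ?w" using T_mem_X[OF X X2] by blast
 hence "(h0 + a) * (k0 + x) + (h1 + b') * (k1 + y) + (h2 + c) * (k2 + z) = ?k" using d2_dot[OF X X2] by blast
 thus kk: "?k' = ?k" using dk by simp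
 have "ok h0 h1 h2 k0 k1 k2 l'" using reach[OF o', of h0 k0 h1 k1 h2 k2] kk by simp
 hence l': "lamv h0 h1 h2 k0 k1 k2 l'" by (simp add: ok_def)
 have l: "lamv h0 h1 h2 k0 k1 k2 l" using o by (simp add: ok_def)
 obtain p q r s where pq: "p * k0 + q * k1 + r * k2 = 0" "p ~= 0 | q ~= 0 | r ~= 0"
 proof (cases "k0 = 0")
  case True thus ?thesis using that[of 1 0 0] by simp
 next
  case False thus ?thesis using that[of "- k1" k0 0] by (simp add: mult.commute)
 qed
 have "l * (q * h2 - r * h1) = l' * (q * h2 - r * h1) & l * (r * h0 - p * h2) = l' * (r * h0 - p * h2) & l * (p * h1 - q * h0) = l' * (p * h1 - q * h0)"
  by (rule G_unique[OF X, of p q r]) (use l l' pq(1) in \<open>auto simp: lamv_def\<close>)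
 moreover have "q * h2 - r * h1 ~= 0 | r * h0 - p * h2 ~= 0 | p * h1 - q * h0 ~= 0"
  using cross_zero[of q h2 r h1 h0 p k0 k1 k2] pq k by blast
 ultimately show "l' = l" by auto
qed

end

section \<open>Identification with the standard line set\<close>

lemma sum_atMost6: "(\<Sum>j\<le>(6::nat). g j) = g 0 + g 1 + g 2 + g 3 + g 4 + g 5 + (g 6 :: 'a::comm_monoid_add)"
 by (simp add: eval_nat_numeral)

lemma finite_hex_lines: "finite (hex_lines :: (nat => 'a::{field,finite}) set set)"
 by (rule finite_subset[of _ "Pow (pvec 6)"]) (auto simp: hex_lines_def psub_def finite_pvec)

context coords
begin

lemma ok_exists: obtains h0 h1 h2 k0 k1 k2 l where "ok h0 h1 h2 k0 k1 k2 l"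
proof -
 obtain m where m: "m : L" "~ m \<subseteq> H" using hyper_not_all[OF hyperH] by blast
 then obtain w where w: "w : m" "w ~: H" by blast
 have "w ~= 0" using w V.subspace_0[OF sH] by blast
 hence wX: "w : X0" using w m by (auto simp: X0_def)
 obtain s h0 h1 h2 k0 k1 k2 where s: "s ~= 0" "w = scl s (vec h0 h1 h2 k0 k1 k2)" using outer_vec[OF wX w(2)] .
 have "vec h0 h1 h2 k0 k1 k2 : m" using w(1) s subspace_scl[OF line_subspace[OF m(1)] s(1)] by blast
 hence X: "vec h0 h1 h2 k0 k1 k2 : X0" using m(1) vec_nz by (auto simp: X0_def)
 obtain l where "l ~= 0" "lamv h0 h1 h2 k0 k1 k2 l" using out_lam[OF X] .
 thus ?thesis using that X by (auto simp: ok_def)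
qed

lemma FGe_cancel:
 assumes "F a b c + G x y z + scl s e = F a' b' c' + G x' y' z' + scl s' e"
 shows "a = a' & b = b' & c = c' & x = x' & y = y' & z = z' & s = s'"
proof -
 have "scl (s - s') e = (F a' b' c' + G x' y' z') - (F a b c + G x y z)"
 proof (rule ext)
  fix i
  show "scl (s - s') e i = ((F a' b' c' + G x' y' z') - (F a b c + G x y z)) i"
   using fun_cong[OF assms, of i] by (simp add: scl_def) algebra
 qed
 hence m: "scl (s - s') e : H" using V.subspace_diff[OF sH FGH FGH] by simp
 have ss: "s = s'"
 proof (rule ccontr)
  assume "s ~= s'"
  hence "s - s' ~= 0" by simp
  thus False using m subspace_scl[OF sH] eH by blast
 qed
 hence "F a b c + G x y z = F a' b' c' + G x' y' z'" using assms by simp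
 thus ?thesis using ss unfolding FG_cancel by blast
qed

text \<open>The dot product \<open>kp\<close> of outer vectors and the scalar \<open>l\<close> are
  the last parameters, and rescaling the basis normalises both. Each line of \<open>L\<close>,
  inside \<open>H\<close> or not, is then the image of a standard line; as the standard set is not
  larger than \<open>L\<close>, the two sets coincide.\<close>

lemma natural_coords:
 assumes LV: "\<Union>L \<subseteq> pvec n" and hc: "card (hex_lines :: (nat => 'a) set set) <= (q^3 + 1) * (q^2 + q + 1)"
 shows "is_natural_hexagon n L"
proof -
 obtain u0 u1 u2 v0 v1 v2 l where ok0: "ok u0 u1 u2 v0 v1 v2 l" using ok_exists .
 define kp where "kp = u0 * v0 + u1 * v1 + u2 * v2"
 have l0: "l ~= 0" using ok0 by (simp add: ok_def)
 have kp0: "kp ~= 0" using ok0 out_dot unfolding ok_def kp_def by blast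
 have cls: "h0 * k0 + h1 * k1 + h2 * k2 = kp" "lamv h0 h1 h2 k0 k1 k2 l" if X: "vec h0 h1 h2 k0 k1 k2 : X0" for h0 h1 h2 k0 k1 k2
 proof -
  obtain l' where l': "l' ~= 0" "lamv h0 h1 h2 k0 k1 k2 l'" using out_lam[OF X] .
  hence o: "ok h0 h1 h2 k0 k1 k2 l'" using X by (simp add: ok_def)
  show "h0 * k0 + h1 * k1 + h2 * k2 = kp" using single_class(1)[OF ok0 o] by (simp add: kp_def)
  show "lamv h0 h1 h2 k0 k1 k2 l" using single_class(2)[OF ok0 o] l' by simp
 qed
 \<comment> \<open>Chosen so that \<open>l * rh = - kp\<close>: scaling \<open>f0\<close> by
   \<open>rh\<close> turns the cross product with factor \<open>l\<close> into the one in the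
   standard equations.\<close>
 define rh where "rh = - kp / l"
 have rh0: "rh ~= 0" using kp0 l0 by (simp add: rh_def)
 define b where "b j = (if j = 0 then scl rh f0 else if j = 1 then f1 else if j = 2 then f2 else if j = 3 then e
  else if j = 4 then scl (kp / rh) g0 else if j = 5 then scl kp g1 else scl kp g2)" for j :: nat
 define J where "J = emb n (%i j. b j i)"
 have VVn: "VV \<subseteq> pvec n" unfolding VV_def using V.span_minimal[OF LV subspace_pvec] .
 have HV: "H \<subseteq> VV" using hyperH hyper_iff by blast
 have fg: "f0 : pvec n" "f1 : pvec n" "f2 : pvec n" "g0 : pvec n" "g1 : pvec n" "g2 : pvec n" "e : pvec n"
  using fr AH BH HV VVn eV unfolding frame_def basis3_def by blast+
 have Jv: "J v = F (rh * v 0) (v 1) (v 2) + G (kp / rh * v 4) (kp * v 5) (kp * v 6) + scl (v 3) e" for v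
 proof (rule ext)
  fix i
  show "J v i = (F (rh * v 0) (v 1) (v 2) + G (kp / rh * v 4) (kp * v 5) (kp * v 6) + scl (v 3) e) i"
  proof (cases "i <= n")
   case True
   thus ?thesis unfolding J_def emb_def sum_atMost6 by (simp add: b_def lc_apply scl_def algebra_simps)
  next
   case False
   hence "f0 i = 0" "f1 i = 0" "f2 i = 0" "g0 i = 0" "g1 i = 0" "g2 i = 0" "e i = 0" using fg by (auto simp: pvec_def)
   thus ?thesis using False by (simp add: J_def emb_def lc_apply scl_def)
  qed
 qed
 have Jlin: "J (scl c x + scl d y) = scl c (J x) + scl d (J y)" for c d x y
  unfolding Jv by (rule ext) (simp add: lc_apply scl_def algebra_simps)
 have Jspan: "J ` V.span {x, y} = V.span {J x, J y}" for x y
 proof (intro equalityI subsetI)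
  fix v assume "v : J ` V.span {x, y}"
  then obtain c d where "v = J (scl c x + scl d y)" unfolding span_pair span_pair_mem[abs_def] by (auto simp: span_pair_mem)
  thus "v : V.span {J x, J y}" unfolding Jlin span_pair span_pair_mem by blast
 next
  fix v assume "v : V.span {J x, J y}"
  then obtain c d where "v = scl c (J x) + scl d (J y)" unfolding span_pair span_pair_mem by blast
  hence "v = J (scl c x + scl d y)" by (simp only: Jlin)
  moreover have "scl c x + scl d y : V.span {x, y}" unfolding span_pair span_pair_mem by blast
  ultimately show "v : J ` V.span {x, y}" by blast
 qed
 have Jinj: "inj_on J (pvec 6)"
 proof (rule inj_onI)
  fix x y :: "nat => 'a" assume xy: "x : pvec 6" "y : pvec 6" "J x = J y"
  from FGe_cancel[OF xy(3)[unfolded Jv]] have "x 0 = y 0" "x 1 = y 1" "x 2 = y 2" "x 3 = y 3" "x 4 = y 4" "x 5 = y 5" "x 6 = y 6"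
   using rh0 kp0 by auto
  thus "x = y" by (rule pvec_eqI[OF xy(1,2)])
 qed
 have span_ne: "sub (V.span {x, y}) 2" if xy: "x : pvec 6" "y : pvec 6" "sub (V.span {J x, J y}) 2" for x y
 proof -
  have sp: "V.span {x, y} \<subseteq> pvec 6" using V.span_minimal[OF _ subspace_pvec, of "{x, y}" 6] xy(1,2) by blast
  hence "card (V.span {x, y}) = card (J ` V.span {x, y})" using card_image[OF inj_on_subset[OF Jinj sp]] by simp
  thus ?thesis using xy(3) unfolding Jspan by (simp add: sub_def)
 qed
 have sub: "m : (%M. J ` M) ` hex_lines" if m: "m : L" for m
 proof (cases "m \<subseteq> H")
  case True
  hence mU: "m : LU H" using m by (simp add: LU_def)
  obtain a' b' where ab: "a' : A" "b' : B" "a' ~= 0" "b' ~= 0" "a' : m" "b' : m" "a' : P" "b' : P"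
   "m Int CU H = {a', b'}" "m = V.span {a'} \<oplus> V.span {b'}" "col a' b'" using H_line[OF mU] .
  obtain a0 a1 a2 where a: "a' = F a0 a1 a2" using A_F[OF ab(1)] .
  obtain c0 c1 c2 where c: "b' = G c0 c1 c2" using B_G[OF ab(2)] .
  have d: "a0 * c0 + a1 * c1 + a2 * c2 = 0" using col_FG[of a0 a1 a2 c0 c1 c2] ab(3,4,11) a c by simp
  define x where "x = mk (a0 / rh) a1 a2 0 0 0 0"
  define y where "y = mk 0 0 0 0 (c0 * rh / kp) (c1 / kp) (c2 / kp)"
  have Jx: "J x = a'" "J y = b'" unfolding Jv x_def y_def a c using rh0 kp0 by simp_all
  have pv: "x : pvec 6" "y : pvec 6" unfolding x_def y_def by (rule mk_pvec)+
  have ms: "m = V.span {J x, J y}" unfolding span_pair Jx by (rule ab(10))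
  have s2: "sub (V.span {x, y}) 2" using span_ne[OF pv] line_sub2[OF m] ms by simp
  have pol: "a0 / rh * (c0 * rh / kp) + a1 * (c1 / kp) + a2 * (c2 / kp) = 0"
   using d rh0 by (simp add: add_divide_distrib[symmetric])
  have "V.span {x, y} : hex_lines"
   by (rule hex_lineI[OF pv s2]) (use pol in \<open>simp_all add: x_def y_def quad_def gr_def\<close>)
  thus ?thesis unfolding ms Jspan[symmetric] by blast
 next
  case False
  then obtain w where w: "w : m" "w ~: H" by blast
  have "w ~= 0" using w V.subspace_0[OF sH] by blast
  hence wX: "w : X0" using w m by (auto simp: X0_def)
  obtain s h0 h1 h2 k0 k1 k2 where s: "s ~= 0" "w = scl s (vec h0 h1 h2 k0 k1 k2)" using outer_vec[OF wX w(2)] .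
  let ?v = "vec h0 h1 h2 k0 k1 k2"
  have vm: "?v : m" using w(1) s subspace_scl[OF line_subspace[OF m] s(1)] by blast
  hence X: "?v : X0" using m vec_nz by (auto simp: X0_def)
  obtain r where r: "r : P" "r : m" "r : H" using hyper_meets[OF hyperH m] .
  have r0: "r ~= 0" using P_nonzero[OF r(1)] .
  have rP: "r : Pi ?v" using Ln_Pi[OF m vm] r(2) by blast
  obtain a b c x' y' z' where rF: "r = F a b c + G x' y' z'" using H_FG[OF r(3)] .
  note ak = out_FG(4)[OF X rP[unfolded rF] r0[unfolded rF]]
  have "F a b c + G (l * (b * h2 - c * h1)) (l * (c * h0 - a * h2)) (l * (a * h1 - b * h0)) : Pi ?v" using cls(2)[OF X] ak unfolding lamv_def by blast
  hence xyz: "x' = l * (b * h2 - c * h1)" "y' = l * (c * h0 - a * h2)" "z' = l * (a * h1 - b * h0)" using G_unique[OF X] rP rF by blast+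
  define H0 where "H0 = h0 / rh"
  define A0 where "A0 = a / rh"
  define K0 where "K0 = k0 * rh / kp"
  define K1 where "K1 = k1 / kp"
  define K2 where "K2 = k2 / kp"
  have bk: "h0 = rh * H0" "a = rh * A0" "k0 = kp / rh * K0" "k1 = kp * K1" "k2 = kp * K2" using rh0 kp0 by (simp_all add: H0_def A0_def K0_def K1_def K2_def)
  have lr: "l * rh = - kp" using l0 by (simp add: rh_def)
  define x where "x = mk H0 h1 h2 1 K0 K1 K2"
  \<comment> \<open>Coordinates 4, 5 and 6 are the negative of the cross product of
    \<open>(A0, b, c)\<close> with \<open>(H0, h1, h2)\<close>.\<close>
  define y where "y = mk A0 b c 0 (c * h1 - b * h2) (A0 * h2 - c * H0) (b * H0 - A0 * h1)"
  have Jx: "J x = ?v" unfolding Jv x_def vec_def by (simp add: bk)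
  have Jy: "J y = r"
  proof -
   have "kp / rh * (c * h1 - b * h2) = x'"
   proof -
    have "rh * x' = kp * (c * h1 - b * h2)" using xyz(1) lr by algebra
    thus ?thesis using rh0 by (simp add: divide_eq_eq mult.commute)
   qed
   moreover have "kp * (A0 * h2 - c * H0) = y'" using xyz(2) lr bk(1,2) by algebra
   moreover have "kp * (b * H0 - A0 * h1) = z'" using xyz(3) lr bk(1,2) by algebra
   ultimately show ?thesis unfolding Jv y_def rF using bk(2) by simp
  qed
  have e1: "H0 * K0 + h1 * K1 + h2 * K2 = 1"
  proof -
   have "kp * (H0 * K0 + h1 * K1 + h2 * K2) = kp" using cls(1)[OF X] bk rh0 by (simp add: distrib_left mult.assoc mult.left_commute)
   thus ?thesis using kp0 by simp
  qed
  have e2: "A0 * K0 + b * K1 + c * K2 = 0"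
  proof -
   have "kp * (A0 * K0 + b * K1 + c * K2) = 0" using ak bk rh0 by (simp add: distrib_left mult.assoc mult.left_commute)
   thus ?thesis using kp0 by simp
  qed
  have pv: "x : pvec 6" "y : pvec 6" unfolding x_def y_def by (rule mk_pvec)+
  have rns: "r ~: V.span {?v}"
  proof
   assume "r : V.span {?v}"
   then obtain k where k: "r = scl k ?v" by (auto simp: V.span_singleton)
   hence "k ~= 0" using r0 by auto
   thus False using k r(3) subspace_scl[OF sH] vec_notH by blast
  qed
  have ms: "m = V.span {J x, J y}" unfolding span_pair Jx Jy using sub2_eq_pair[OF line_sub2[OF m] vm r(2) vec_nz rns] .
  have s2: "sub (V.span {x, y}) 2" using span_ne[OF pv] line_sub2[OF m] ms by simp
  have "V.span {x, y} : hex_lines"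
  proof (rule hex_lineI[OF pv s2])
   show "quad x" using e1 by (simp add: x_def quad_def)
   show "quad y" unfolding quad_def y_def by simp algebra
   show "x 0 * y 4 + x 4 * y 0 + x 1 * y 5 + x 5 * y 1 + x 2 * y 6 + x 6 * y 2 = 2 * x 3 * y 3"
    unfolding x_def y_def using e2 by simp algebra
   show "gr x y 1 2 = gr x y 3 4" "gr x y 2 0 = gr x y 3 5" "gr x y 0 1 = gr x y 3 6"
    unfolding gr_def x_def y_def by (simp_all add: algebra_simps)
   show "gr x y 5 4 = gr x y 3 2" unfolding gr_def x_def y_def using e1 e2 by simp algebra
   show "gr x y 6 5 = gr x y 3 0" unfolding gr_def x_def y_def using e1 e2 by simp algebra
   show "gr x y 4 6 = gr x y 3 1" unfolding gr_def x_def y_def using e1 e2 by simp algebra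
  qed
  thus ?thesis unfolding ms Jspan[symmetric] by blast
 qed
 have fin: "finite ((%M. J ` M) ` hex_lines)" by (rule finite_imageI[OF finite_hex_lines])
 have "card ((%M. J ` M) ` (hex_lines :: (nat => 'a) set set)) <= card L"
  using card_image_le[OF finite_hex_lines, of "%M. J ` M"] hc L_card by linarith
 hence "L = (%M. J ` M) ` hex_lines" using card_seteq[OF fin] sub by blast
 moreover have "V.span (\<Union>L) : psub n 6" using VV7 VVn unfolding VV_def[symmetric] by (simp add: psub_iff)
 ultimately show ?thesis unfolding is_natural_hexagon_def using Jinj unfolding J_def by blast
qed

end

context hex7 begin

lemma natural:
 assumes "\<Union>L \<subseteq> pvec n" "card (hex_lines :: (nat => 'a) set set) <= (q^3 + 1) * (q^2 + q + 1)"
 shows "is_natural_hexagon n L"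
proof -
 obtain H A B where d: "dualpair L q H A B" using dualpair_exists .
 obtain f0 f1 f2 g0 g1 g2 where f: "dualpair.frame L A B f0 f1 f2 g0 g1 g2" using dualpair.frame_exists[OF d] .
 have fr: "framed L q H A B f0 f1 f2 g0 g1 g2" unfolding framed_def framed_axioms_def using d f by blast
 have hH: "hyper H" using dualpair.hyperH[OF d] .
 obtain m where m: "m : L" "~ m \<subseteq> H" using hyper_not_all[OF hH] by blast
 then obtain e where e: "e : m" "e ~: H" by blast
 have "e : VV" using VV_L[OF m(1)] e by blast
 then obtain e3 where "coords L q H A B f0 f1 f2 g0 g1 g2 e3" using framed.coords_exists[OF fr _ e(2)] by blast
 thus ?thesis using coords.natural_coords[OF _ assms] by blast
qed

end

section \<open>The standard hexagon\<close>

definition pol :: "(nat => 'a::field) => (nat => 'a) => 'a" where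
 "pol x y = x 0 * y 4 + x 4 * y 0 + x 1 * y 5 + x 5 * y 1 + x 2 * y 6 + x 6 * y 2 - 2 * x 3 * y 3"

text \<open>Six of the conditions are the Grassmann equations; the seventh,
  \<open>p04 + p15 + p26 = 0\<close>, holds on lines of the hexagon, see
  \<open>hex_line_rep\<close>. At \<open>mk c 0 0 0 0 0 0\<close> the six leave coordinate 4 of
  \<open>y\<close> free, and only all seven cut out the pencil plane. Up to signs they say that the
  product of two trace zero split octonions, written as Zorn matrices, has zero vector entries and
  equal diagonal entries.\<close>

definition sev :: "(nat => 'a::field) => (nat => 'a) => bool" where
 "sev x y \<longleftrightarrow> x 5 * y 6 - x 6 * y 5 + x 3 * y 0 - x 0 * y 3 = 0 & x 6 * y 4 - x 4 * y 6 + x 3 * y 1 - x 1 * y 3 = 0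
  & x 4 * y 5 - x 5 * y 4 + x 3 * y 2 - x 2 * y 3 = 0 & x 1 * y 2 - x 2 * y 1 - x 3 * y 4 + x 4 * y 3 = 0
  & x 2 * y 0 - x 0 * y 2 - x 3 * y 5 + x 5 * y 3 = 0 & x 0 * y 1 - x 1 * y 0 - x 3 * y 6 + x 6 * y 3 = 0
  & x 0 * y 4 - x 4 * y 0 + x 1 * y 5 - x 5 * y 1 + x 2 * y 6 - x 6 * y 2 = 0"

lemma sev_sym: "sev x y ==> sev y x" unfolding sev_def by (auto simp: algebra_simps)
lemma sev_refl: "sev x x" unfolding sev_def by (simp add: algebra_simps)
lemma pol_sym: "pol x y = pol y x" unfolding pol_def by (simp add: algebra_simps)

lemma lcv: "(scl s x + scl t y) i = s * x i + t * y i" by (simp add: scl_def)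

lemma sev_lin: "sev x y ==> sev x z ==> sev x (scl s y + scl t z)"
 unfolding sev_def lcv by (intro conjI) algebra+
lemma sev_scl: "sev x y ==> sev x (scl s y)" using sev_lin[of x y y s 0] by (simp add: scl_def zero_fun_def plus_fun_def)
lemma pol_lin: "pol x (scl s y + scl t z) = s * pol x y + t * pol x z"
 unfolding pol_def lcv by (simp add: algebra_simps)
lemma pol_scl: "pol x (scl s y) = s * pol x y" unfolding pol_def scl_def by (simp add: algebra_simps)

lemma pvec_zero: "0 : pvec 6" by (simp add: pvec_def)

section \<open>Automorphisms of the standard model\<close>

definition aut :: "((nat => 'a::field) => nat => 'a) => bool" where
 "aut g \<longleftrightarrow> bij_betw g (pvec 6) (pvec 6) & (ALL s t u v. g (scl s u + scl t v) = scl s (g u) + scl t (g v))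
   & (ALL v. quad (g v) = quad v) & (ALL u v. sev (g u) (g v) = sev u v) & (ALL u v. pol (g u) (g v) = pol u v)"

lemma autD:
 assumes "aut g"
 shows "bij_betw g (pvec 6) (pvec 6)" "g (scl s u + scl t v) = scl s (g u) + scl t (g v)"
  "quad (g v) = quad v" "sev (g u) (g v) = sev u v" "pol (g u) (g v) = pol u v"
 using assms unfolding aut_def by simp_all

lemma aut_scl: "aut g ==> g (scl s u) = scl s (g u)"
 using autD(2)[of g s u 0 u] by (simp add: scl_def zero_fun_def plus_fun_def)
lemma aut_pvec: "aut g ==> v : pvec 6 ==> g v : pvec 6" using autD(1) bij_betwE by blast
lemma aut_inj: assumes "aut g" "u : pvec 6" "v : pvec 6" "g u = g v" shows "u = v"
 using assms autD(1)[OF assms(1)] unfolding bij_betw_def inj_on_def by blast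

lemma aut_comp: assumes "aut g" "aut h" shows "aut (%v. g (h v))"
 unfolding aut_def using bij_betw_trans[OF autD(1)[OF assms(2)] autD(1)[OF assms(1)]]
 by (simp add: autD[OF assms(1)] autD[OF assms(2)] comp_def)

lemma aut_id: "aut (%v. v)" unfolding aut_def bij_betw_def by simp

lemma autI:
 assumes "!!v. g v : pvec 6" "!!v. h v : pvec 6" "!!v. v : pvec 6 ==> h (g v) = v" "!!v. v : pvec 6 ==> g (h v) = v"
  "!!s t u v. g (scl s u + scl t v) = scl s (g u) + scl t (g v)"
  "!!v. quad (g v) = quad v" "!!u v. sev (g u) (g v) = sev u v" "!!u v. pol (g u) (g v) = pol u v"
 shows "aut g"
 unfolding aut_def using assms(5-8) bij_betw_byWitness[of "pvec 6" h g "pvec 6"] assms(1-4) by blast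

text \<open>\<open>gA\<close> and \<open>gB\<close> are unipotent and keep coordinate 0;
  \<open>gR\<close> and \<open>gD\<close> permute the coordinates up to sign and bring any
  coordinate other than 3 to position 0.\<close>

definition gA :: "'a::field => 'a => (nat => 'a) => nat => 'a" where
 "gA s t v = mk (v 0) (v 1 + s * v 0) (v 2 + t * v 0) (v 3) (v 4 - s * v 5 - t * v 6) (v 5) (v 6)"
definition gB :: "'a::field => (nat => 'a) => nat => 'a" where
 "gB t v = mk (v 0) (v 1 + t * v 6) (v 2 - t * v 5) (v 3 + t * v 0) (v 4 + 2 * t * v 3 + t^2 * v 0) (v 5) (v 6)"
definition gR :: "(nat => 'a::field) => nat => 'a" where
 "gR v = mk (v 1) (v 2) (v 0) (v 3) (v 5) (v 6) (v 4)"
definition gD :: "(nat => 'a::field) => nat => 'a" where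
 "gD v = mk (v 4) (v 5) (v 6) (- v 3) (v 0) (v 1) (v 2)"

lemma mk_lin: "scl s (mk a0 a1 a2 a3 a4 a5 a6) + scl t (mk b0 b1 b2 b3 b4 b5 b6) =
 mk (s * a0 + t * b0) (s * a1 + t * b1) (s * a2 + t * b2) (s * a3 + t * b3) (s * a4 + t * b4) (s * a5 + t * b5) (s * a6 + t * b6)"
 by (rule ext) (simp add: mk_def scl_def)

lemma mk_eq: "a0 = b0 ==> a1 = b1 ==> a2 = b2 ==> a3 = b3 ==> a4 = b4 ==> a5 = b5 ==> a6 = b6 ==>
 mk a0 a1 a2 a3 a4 a5 a6 = mk b0 b1 b2 b3 b4 b5 b6" by simp

lemma sev_gA: "sev u v ==> sev (gA s t u) (gA s t v)" unfolding gA_def sev_def mk_simps One_nat_def by (intro conjI) algebra+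
lemma sev_gB: "sev u v ==> sev (gB t u) (gB t v)" unfolding gB_def sev_def mk_simps One_nat_def by (intro conjI) algebra+
lemma gen_inverse:
 "gA (- s) (- t) (gA s t v) = mk (v 0) (v 1) (v 2) (v 3) (v 4) (v 5) (v 6)" "gB (- t) (gB t v) = mk (v 0) (v 1) (v 2) (v 3) (v 4) (v 5) (v 6)"
 unfolding gA_def gB_def mk_simps One_nat_def by (simp_all add: algebra_simps power2_eq_square)

lemma mk_self: "v : pvec 6 ==> mk (v 0) (v 1) (v 2) (v 3) (v 4) (v 5) (v 6) = v"
 by (rule pvec_eqI[OF mk_pvec]) simp_all
lemma sev_mk: "sev (mk (u 0) (u 1) (u 2) (u 3) (u 4) (u 5) (u 6)) (mk (v 0) (v 1) (v 2) (v 3) (v 4) (v 5) (v 6)) = sev u v"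
 unfolding sev_def by simp

lemma aut_gA: "aut (gA s t)"
proof (rule autI[where h = "gA (- s) (- t)"])
 show "gA (- s) (- t) (gA s t v) = v" if "v : pvec 6" for v using gen_inverse(1)[of s t v] mk_self[OF that] by simp
 show "gA s t (gA (- s) (- t) v) = v" if "v : pvec 6" for v using gen_inverse(1)[of "- s" "- t" v] mk_self[OF that] by simp
 \<comment> \<open>The reverse implication is the forward one for the inverse map.\<close>
 show "sev (gA s t u) (gA s t v) = sev u v" for u v
  using sev_gA[of u v s t] sev_gA[of "gA s t u" "gA s t v" "- s" "- t"] unfolding gen_inverse sev_mk by blast
 show "gA s t (scl c u + scl d v) = scl c (gA s t u) + scl d (gA s t v)" for c d u v
  unfolding gA_def mk_lin lcv by (rule mk_eq; (rule refl | algebra))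
 show "quad (gA s t v) = quad v" for v unfolding gA_def quad_def by (simp add: algebra_simps)
 show "pol (gA s t u) (gA s t v) = pol u v" for u v unfolding gA_def pol_def by (simp add: algebra_simps)
qed (simp_all add: gA_def mk_pvec)

lemma aut_gB: "aut (gB t)"
proof (rule autI[where h = "gB (- t)"])
 show "gB (- t) (gB t v) = v" if "v : pvec 6" for v using gen_inverse(2)[of t v] mk_self[OF that] by simp
 show "gB t (gB (- t) v) = v" if "v : pvec 6" for v using gen_inverse(2)[of "- t" v] mk_self[OF that] by simp
 show "sev (gB t u) (gB t v) = sev u v" for u v
  using sev_gB[of u v t] sev_gB[of "gB t u" "gB t v" "- t"] unfolding gen_inverse sev_mk by blast
 show "gB t (scl c u + scl d v) = scl c (gB t u) + scl d (gB t v)" for c d u v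
  unfolding gB_def mk_lin lcv by (rule mk_eq; (rule refl | algebra))
 show "quad (gB t v) = quad v" for v unfolding gB_def quad_def by (simp add: algebra_simps power2_eq_square)
 show "pol (gB t u) (gB t v) = pol u v" for u v unfolding gB_def pol_def by (simp add: algebra_simps power2_eq_square)
qed (simp_all add: gB_def mk_pvec)

lemma aut_gR: "aut gR"
proof (rule autI[where h = "%v. gR (gR v)"])
 show "gR (gR (gR v)) = v" if "v : pvec 6" for v using mk_self[OF that] by (simp add: gR_def)
 thus "gR (gR (gR v)) = v" if "v : pvec 6" for v using that .
 show "gR (scl c u + scl d v) = scl c (gR u) + scl d (gR v)" for c d u v unfolding gR_def mk_lin lcv ..
 show "quad (gR v) = quad v" for v unfolding gR_def quad_def by (simp add: algebra_simps)
 show "sev (gR u) (gR v) = sev u v" for u v unfolding gR_def sev_def by (auto simp: algebra_simps)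
 show "pol (gR u) (gR v) = pol u v" for u v unfolding gR_def pol_def by (simp add: algebra_simps)
qed (simp_all add: gR_def mk_pvec)

lemma aut_gD: "aut gD"
proof (rule autI[where h = gD])
 show "gD (gD v) = v" if "v : pvec 6" for v using mk_self[OF that] by (simp add: gD_def)
 thus "gD (gD v) = v" if "v : pvec 6" for v using that .
 show "gD (scl c u + scl d v) = scl c (gD u) + scl d (gD v)" for c d u v unfolding gD_def mk_lin lcv by (rule mk_eq; (rule refl | algebra))
 show "quad (gD v) = quad v" for v unfolding gD_def quad_def by (simp add: algebra_simps)
 show "sev (gD u) (gD v) = sev u v" for u v unfolding gD_def sev_def by (auto simp: algebra_simps)
 show "pol (gD u) (gD v) = pol u v" for u v unfolding gD_def pol_def by (simp add: algebra_simps)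
qed (simp_all add: gD_def mk_pvec)

text \<open>These two conjugates of \<open>gB\<close> shift coordinates 5 and 6 respectively by
  multiples of coordinate 0, as needed in \<open>move\<close>.\<close>

lemma conj_gB:
 "gR (gD (gB s (gD (gR (gR v))))) = mk (v 0) (v 1) (v 2 - 2 * s * v 3 + s^2 * v 6) (v 3 - s * v 6) (v 4 + s * v 1) (v 5 - s * v 0) (v 6)"
 "gR (gR (gD (gB s (gD (gR v))))) = mk (v 0) (v 1 - 2 * s * v 3 + s^2 * v 5) (v 2) (v 3 - s * v 5) (v 4 - s * v 2) (v 5) (v 6 + s * v 0)"
 by (simp_all add: gB_def gD_def gR_def)

lemma aut_0: assumes "x : pvec 6" "quad x" "x ~= 0" obtains g where "aut g" "g x 0 ~= 0"
proof -
 have "x 0 ~= 0 | x 1 ~= 0 | x 2 ~= 0 | x 4 ~= 0 | x 5 ~= 0 | x 6 ~= 0"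
 proof (rule ccontr)
  assume h: "~ ?thesis"
  hence "x 3 = 0" using assms(2) by (auto simp: quad_def)
  thus False using h assms(1,3) pvec_eqI[OF assms(1) pvec_zero] by (simp add: zero_fun_def)
 qed
 thus ?thesis using that[OF aut_id] that[OF aut_gR] that[OF aut_comp[OF aut_gR aut_gR]] that[OF aut_gD]
   that[OF aut_comp[OF aut_gR aut_gD]] that[OF aut_comp[OF aut_gR aut_comp[OF aut_gR aut_gD]]]
  by (auto simp: gR_def gD_def)
qed

text \<open>Elimination with coordinate 0 as pivot, which no elimination step changes. Clearing
  coordinate 5 disturbs coordinates 2 and 3, so these are cleared again before coordinate 6;
  coordinate 4 then vanishes by the quadric. Afterwards statements about a singular vector become
  computations at \<open>mk c 0 0 0 0 0 0\<close>.\<close>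

lemma move:
 assumes "x : pvec 6" "quad x" "x ~= 0"
 obtains g c where "aut g" "c ~= 0" "g x = mk c 0 0 0 0 0 0"
proof -
 obtain g where g: "aut g" "g x 0 ~= 0" using aut_0[OF assms] .
 define y where "y = g x"
 define y1 where "y1 = gB (- (y 3 / y 0)) y"
 define y2 where "y2 = gA (- (y1 1 / y1 0)) (- (y1 2 / y1 0)) y1"
 define y3 where "y3 = gR (gD (gB (y2 5 / y2 0) (gD (gR (gR y2)))))"
 define y4 where "y4 = gB (- (y3 3 / y3 0)) y3"
 define y5 where "y5 = gA (- (y4 1 / y4 0)) (- (y4 2 / y4 0)) y4"
 define y6 where "y6 = gR (gR (gD (gB (- (y5 6 / y5 0)) (gD (gR y5)))))"
 have n: "y 0 ~= 0" using g(2) y_def by simp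
 have s1: "y1 0 = y 0" "y1 3 = 0" unfolding y1_def gB_def using n by simp_all
 have s2: "y2 0 = y 0" "y2 1 = 0" "y2 2 = 0" "y2 3 = 0" unfolding y2_def gA_def using n s1 by simp_all
 have s3: "y3 0 = y 0" "y3 1 = 0" "y3 5 = 0" unfolding y3_def conj_gB using n s2 by simp_all
 have s4: "y4 0 = y 0" "y4 3 = 0" "y4 5 = 0" unfolding y4_def gB_def using n s3 by simp_all
 have s5: "y5 0 = y 0" "y5 1 = 0" "y5 2 = 0" "y5 3 = 0" "y5 5 = 0" unfolding y5_def gA_def using n s4 by simp_all
 have s6: "y6 0 = y 0" "y6 1 = 0" "y6 2 = 0" "y6 3 = 0" "y6 5 = 0" "y6 6 = 0" unfolding y6_def conj_gB using n s5 by simp_all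
 have o: "EX h. aut h & f u = h x" if "aut f" "EX h. aut h & u = h x" for f u using that aut_comp by blast
 have "EX h. aut h & y = h x" using g(1) y_def by blast
 hence "EX h. aut h & y2 = h x" unfolding y2_def y1_def by (intro o[OF aut_gA] o[OF aut_gB])
 from o[OF aut_gR o[OF aut_gD o[OF aut_gB o[OF aut_gD o[OF aut_gR o[OF aut_gR this]]]]]]
 have "EX h. aut h & y3 = h x" unfolding y3_def .
 hence "EX h. aut h & y5 = h x" unfolding y5_def y4_def by (intro o[OF aut_gA] o[OF aut_gB])
 from o[OF aut_gR o[OF aut_gR o[OF aut_gD o[OF aut_gB o[OF aut_gD o[OF aut_gR this]]]]]]
 have "EX h. aut h & y6 = h x" unfolding y6_def .
 then obtain h where h: "aut h" "y6 = h x" by blast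
 have "quad y6" using h autD(3)[OF h(1)] assms(2) by simp
 hence "y6 4 = 0" using s6 n by (simp add: quad_def)
 hence "y6 = mk (y 0) 0 0 0 0 0 0" using pvec_eqI[OF _ mk_pvec] aut_pvec[OF h(1) assms(1)] h(2) s6 by simp
 thus ?thesis using that[OF h(1) n] h(2) by simp
qed

lemma sev_base: "c ~= 0 ==> sev (mk c 0 0 0 0 0 0) y \<longleftrightarrow> y 1 = 0 & y 2 = 0 & y 3 = 0 & y 4 = 0"
 unfolding sev_def by auto

lemma Z_quad: assumes "x : pvec 6" "quad x" "x ~= 0" "sev x y" shows "quad y" "pol x y = 0"
proof -
 obtain g c where g: "aut g" "c ~= 0" "g x = mk c 0 0 0 0 0 0" using move[OF assms(1-3)] .
 have "sev (g x) (g y)" using autD(4)[OF g(1)] assms(4) by simp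
 hence s: "g y 1 = 0" "g y 2 = 0" "g y 3 = 0" "g y 4 = 0" unfolding g(3) sev_base[OF g(2)] by auto
 hence "quad (g y)" by (simp add: quad_def)
 thus "quad y" using autD(3)[OF g(1)] by simp
 have "pol (g x) (g y) = 0" unfolding g(3) pol_def using s by simp
 thus "pol x y = 0" using autD(5)[OF g(1)] by simp
qed

lemma Z_pol: assumes "x : pvec 6" "quad x" "x ~= 0" "sev x y" "sev x z" shows "pol y z = 0"
proof -
 obtain g c where g: "aut g" "c ~= 0" "g x = mk c 0 0 0 0 0 0" using move[OF assms(1-3)] .
 have "sev (g x) (g y)" "sev (g x) (g z)" using autD(4)[OF g(1)] assms(4,5) by simp_all
 hence "pol (g y) (g z) = 0" unfolding g(3) sev_base[OF g(2)] pol_def by simp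
 thus ?thesis using autD(5)[OF g(1)] by simp
qed

text \<open>Absence of triangles. At the base vector the pencil consists of coordinates 0, 5 and 6,
  and \<open>sev\<close> restricted to it is the vanishing of the determinant in 5 and 6.\<close>

lemma Z_dep: assumes "x : pvec 6" "quad x" "x ~= 0" "y : pvec 6" "z : pvec 6" "sev x y" "sev x z" "sev y z"
 obtains s t r where "s ~= 0 | t ~= 0" "scl s y + scl t z = scl r x"
proof -
 obtain g c where g: "aut g" "c ~= 0" "g x = mk c 0 0 0 0 0 0" using move[OF assms(1-3)] .
 have "sev (g x) (g y)" "sev (g x) (g z)" and yz: "sev (g y) (g z)" using autD(4)[OF g(1)] assms(6-8) by simp_all
 hence s: "g y 1 = 0" "g y 2 = 0" "g y 3 = 0" "g y 4 = 0" "g z 1 = 0" "g z 2 = 0" "g z 3 = 0" "g z 4 = 0"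
  unfolding g(3) sev_base[OF g(2)] by auto
 have d: "g y 5 * g z 6 = g y 6 * g z 5" using yz s unfolding sev_def by simp
 obtain a b where ab: "a ~= 0 | b ~= 0" "a * g y 5 + b * g z 5 = 0" "a * g y 6 + b * g z 6 = 0"
 proof (cases "g y 5 = 0 & g y 6 = 0")
  case True thus ?thesis using that[of 1 0] by simp
 next
  case False
  show ?thesis
  proof (cases "g y 5 = 0")
   case True thus ?thesis using that[of "- g z 6" "g y 6"] False d by (simp add: algebra_simps)
  next
   case False thus ?thesis using that[of "- g z 5" "g y 5"] d by (simp add: algebra_simps)
  qed
 qed
 define r where "r = (a * g y 0 + b * g z 0) / c"
 have yv: "g y : pvec 6" "g z : pvec 6" using aut_pvec[OF g(1)] assms by auto
 have "scl a (g y) + scl b (g z) = scl r (g x)"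
  unfolding g(3)
 proof (rule pvec_eqI)
  show "scl a (g y) + scl b (g z) : pvec 6" "scl r (mk c 0 0 0 0 0 0) : pvec 6"
   using V.subspace_add[OF subspace_pvec] V.subspace_scale[OF subspace_pvec] yv mk_pvec by blast+
  show "(scl a (g y) + scl b (g z)) 0 = scl r (mk c 0 0 0 0 0 0) 0" using g(2) by (simp add: lcv r_def scl_def)
 qed (use s ab in \<open>simp_all add: scl_def\<close>)
 hence "g (scl a y + scl b z) = g (scl r x)" using autD(2)[OF g(1)] aut_scl[OF g(1)] by simp
 moreover have "scl a y + scl b z : pvec 6" "scl r x : pvec 6"
  using V.subspace_add[OF subspace_pvec] V.subspace_scale[OF subspace_pvec] assms(1,4,5) by blast+
 ultimately show ?thesis using that[OF ab(1)] aut_inj[OF g(1)] by blast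
qed

text \<open>With \<open>c\<close> at the base, orthogonality to \<open>c\<close> and
  \<open>d\<close> says that coordinate 4 of \<open>g w\<close> vanishes and that its coordinates 1
  and 2 form a multiple \<open>m\<close> of \<open>(- g d 6, g d 5)\<close>. The point of the line
  collinear with \<open>w\<close> is then explicit in terms of \<open>m\<close> and
  \<open>g w 3\<close>; if both vanish it is \<open>c\<close> itself.\<close>

lemma O_line: assumes "w : pvec 6" "quad w" "c : pvec 6" "quad c" "c ~= 0" "d : pvec 6" "sev c d"
  "pol w c = 0" "pol w d = 0" "!!r. d ~= scl r c"
 obtains s t where "s ~= 0 | t ~= 0" "sev w (scl s c + scl t d)"
proof -
 obtain g k where g: "aut g" "k ~= 0" "g c = mk k 0 0 0 0 0 0" using move[OF assms(3-5)] .
 have sd: "sev (g c) (g d)" and p: "pol (g w) (g c) = 0" "pol (g w) (g d) = 0" and qw: "quad (g w)"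
  using autD[OF g(1)] assms(2,7-9) by simp_all
 hence s: "g d 1 = 0" "g d 2 = 0" "g d 3 = 0" "g d 4 = 0" unfolding g(3) sev_base[OF g(2)] by auto
 have dn: "g d 5 ~= 0 | g d 6 ~= 0"
 proof (rule ccontr)
  assume h: "~ ?thesis"
  have "g d = scl (g d 0 / k) (g c)" unfolding g(3)
   by (rule pvec_eqI[OF aut_pvec[OF g(1) assms(6)] V.subspace_scale[OF subspace_pvec mk_pvec]]) (use s h g(2) in \<open>simp_all add: scl_def\<close>)
  hence "g d = g (scl (g d 0 / k) c)" using aut_scl[OF g(1)] by simp
  thus False using aut_inj[OF g(1) assms(6) V.subspace_scale[OF subspace_pvec assms(3)]] assms(10) by blast
 qed
 have w4: "g w 4 = 0" using p(1) g(2) unfolding g(3) pol_def by simp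
 have pd: "g w 1 * g d 5 + g w 2 * g d 6 = 0" using p(2) s w4 unfolding pol_def by simp
 obtain m where m: "g w 1 = - m * g d 6" "g w 2 = m * g d 5"
 proof (cases "g d 5 = 0")
  case True thus ?thesis using that[of "- g w 1 / g d 6"] dn pd by simp
 next
  case False
  have "g w 1 = - (g w 2 * g d 6) / g d 5" using pd False by (simp add: field_simps add_eq_0_iff)
  thus ?thesis using that[of "g w 2 / g d 5"] False by simp
 qed
 have q: "g w 1 * g w 5 + g w 2 * g w 6 = g w 3 ^ 2" using qw w4 by (simp add: quad_def)
 have "EX a t. (a ~= 0 | t ~= 0) & sev (g w) (scl a (g c) + scl t (g d))"
 proof (cases "g w 3 = 0 & m = 0")
  case True
  hence "sev (g w) (scl 1 (g c) + scl 0 (g d))" unfolding g(3) sev_def lcv using w4 m by simp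
  thus ?thesis by (metis one_neq_zero)
 next
  case False
  let ?a = "(g w 3 - m * g d 0) / k"
  have ak: "?a * k = g w 3 - m * g d 0" using g(2) by simp
  have "sev (g w) (scl ?a (g c) + scl m (g d))" unfolding g(3) sev_def lcv mk_simps One_nat_def
   using w4 m q s ak unfolding One_nat_def by (simp add: algebra_simps power2_eq_square)
  moreover have "?a ~= 0 | m ~= 0" using False g(2) by auto
  ultimately show ?thesis by blast
 qed
 then obtain a t where at: "a ~= 0 | t ~= 0" "sev (g w) (scl a (g c) + scl t (g d))" by blast
 have "sev (g w) (g (scl a c + scl t d))" using at(2) autD(2)[OF g(1)] by simp
 thus ?thesis using that[OF at(1)] autD(4)[OF g(1)] by simp
qed

text \<open>Absence of quadrangles. With \<open>y\<close> at the base, noncollinearity of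
  \<open>x\<close> and \<open>w\<close> is the nonvanishing of a 2 by 2 determinant, which forces
  all coordinates of \<open>g z\<close> but the first to vanish.\<close>

lemma M_quad: assumes "y : pvec 6" "quad y" "y ~= 0" "z : pvec 6" "sev y x" "sev y w" "sev z x" "sev z w" "~ sev x w"
 obtains r where "z = scl r y"
proof -
 obtain g k where g: "aut g" "k ~= 0" "g y = mk k 0 0 0 0 0 0" using move[OF assms(1-3)] .
 have "sev (g y) (g x)" "sev (g y) (g w)" and z: "sev (g z) (g x)" "sev (g z) (g w)" and n: "~ sev (g x) (g w)"
  using autD(4)[OF g(1)] assms(5-9) by simp_all
 hence s: "g x 1 = 0" "g x 2 = 0" "g x 3 = 0" "g x 4 = 0" "g w 1 = 0" "g w 2 = 0" "g w 3 = 0" "g w 4 = 0"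
  unfolding g(3) sev_base[OF g(2)] by auto
 let ?d = "g x 5 * g w 6 - g x 6 * g w 5"
 have dn: "?d ~= 0" using n s unfolding sev_def by simp
 have zx: "g z 5 * g x 6 - g z 6 * g x 5 + g z 3 * g x 0 = 0" "g z 4 * g x 6 = 0" "g z 4 * g x 5 = 0"
   "g z 2 * g x 0 = g z 3 * g x 5" "g z 1 * g x 0 = - g z 3 * g x 6" "- g z 4 * g x 0 + g z 1 * g x 5 + g z 2 * g x 6 = 0"
  using z(1) s unfolding sev_def by (auto simp: algebra_simps add_eq_0_iff)
 have zw: "g z 5 * g w 6 - g z 6 * g w 5 + g z 3 * g w 0 = 0" "g z 4 * g w 6 = 0" "g z 4 * g w 5 = 0"
   "g z 2 * g w 0 = g z 3 * g w 5" "g z 1 * g w 0 = - g z 3 * g w 6" "- g z 4 * g w 0 + g z 1 * g w 5 + g z 2 * g w 6 = 0"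
  using z(2) s unfolding sev_def by (auto simp: algebra_simps add_eq_0_iff)
 have "g z 4 * ?d = 0" using zx(2,3) by algebra
 hence z4: "g z 4 = 0" using dn by simp
 have "g z 1 * ?d = 0" "g z 2 * ?d = 0" using zx(6) zw(6) z4 by algebra+
 hence z12: "g z 1 = 0" "g z 2 = 0" using dn by simp_all
 have "g z 3 * ?d = 0" using zx(4,5) z12 by algebra
 hence z3: "g z 3 = 0" using dn by simp
 have "g z 5 * ?d = 0" "g z 6 * ?d = 0" using zx(1) zw(1) z3 by algebra+
 hence z56: "g z 5 = 0" "g z 6 = 0" using dn by simp_all
 have "g z = scl (g z 0 / k) (g y)" unfolding g(3)
  by (rule pvec_eqI[OF aut_pvec[OF g(1) assms(4)] V.subspace_scale[OF subspace_pvec mk_pvec]]) (use z4 z12 z3 z56 g(2) in \<open>simp_all add: scl_def\<close>)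
 hence "g z = g (scl (g z 0 / k) y)" using aut_scl[OF g(1)] by simp
 thus ?thesis using aut_inj[OF g(1) assms(4) V.subspace_scale[OF subspace_pvec assms(1)]] that by blast
qed

text \<open>The polar products are those of adapted bases of two skew lines. Joining the
  corresponding vectors produces the further lines of the regulus that \<open>hex_solid\<close>
  needs.\<close>

lemma regulus_line:
 assumes "a : pvec 6" "quad a" "a ~= 0" "sev a b" "sev c d" "pol a c = 0" "pol b d = 0" "pol a d = 1" "pol b c = - 1"
 shows "sev (scl 1 c + scl t a) (scl 1 d + scl t b)"
proof -
 obtain g k where g: "aut g" "k ~= 0" "g a = mk k 0 0 0 0 0 0" using move[OF assms(1-3)] .
 have "sev (g a) (g b)" and cd: "sev (g c) (g d)" and p: "pol (g a) (g c) = 0" "pol (g b) (g d) = 0" "pol (g a) (g d) = 1" "pol (g b) (g c) = - 1"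
  using autD[OF g(1)] assms by simp_all
 hence s: "g b 1 = 0" "g b 2 = 0" "g b 3 = 0" "g b 4 = 0" unfolding g(3) sev_base[OF g(2)] by auto
 have c4: "g c 4 = 0" using p(1) g(2) unfolding g(3) pol_def by simp
 have d4: "k * g d 4 = 1" using p(3) unfolding g(3) pol_def by simp
 have bc: "g b 5 * g c 1 + g b 6 * g c 2 = - 1" using p(4) s c4 unfolding pol_def by simp
 have bd: "g b 0 * g d 4 + g b 5 * g d 1 + g b 6 * g d 2 = 0" using p(2) s unfolding pol_def by simp
 have c: "g c 1 * g d 2 - g c 2 * g d 1 = g c 3 * g d 4" "g c 6 * g d 4 + g c 3 * g d 1 - g d 3 * g c 1 = 0"
   "- g c 5 * g d 4 + g c 3 * g d 2 - g d 3 * g c 2 = 0"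
  using cd c4 unfolding sev_def by (auto simp: algebra_simps add_eq_0_iff)
 have e1: "k * g d 1 = g b 0 * g c 1 + g b 6 * g c 3" using c(1) bc bd d4 by algebra
 have e2: "k * g d 2 = g b 0 * g c 2 - g b 5 * g c 3" using c(1) bc bd d4 by algebra
 have e3: "k * g d 3 = g b 6 * g c 5 - g b 5 * g c 6 + g b 0 * g c 3" using c(2,3) bc bd d4 by algebra
 have "sev (scl 1 (g c) + scl t (g a)) (scl 1 (g d) + scl t (g b))"
  unfolding g(3) sev_def lcv mk_simps One_nat_def using cd e1 e2 e3 s c4 d4 bc unfolding sev_def One_nat_def
  by (simp add: algebra_simps) (intro conjI; algebra)
 hence "sev (g (scl 1 c + scl t a)) (g (scl 1 d + scl t b))" by (simp only: autD(2)[OF g(1)])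
 thus ?thesis using autD(4)[OF g(1)] by simp
qed

section \<open>Lines and pencils of the standard model\<close>

lemma quad_lin: "quad x ==> quad y ==> quad (scl s x + scl t y) \<longleftrightarrow> s * t * pol x y = 0"
proof -
 assume h: "quad x" "quad y"
 have "(s * x 0 + t * y 0) * (s * x 4 + t * y 4) + (s * x 1 + t * y 1) * (s * x 5 + t * y 5) + (s * x 2 + t * y 2) * (s * x 6 + t * y 6)
   - (s * x 3 + t * y 3)^2 = s * t * pol x y"
  using h unfolding quad_def pol_def by algebra
 thus ?thesis unfolding quad_def lcv by (metis eq_iff_diff_eq_0)
qed

lemma span2_mem: "v : V.span {x, y} \<longleftrightarrow> (EX c d. v = scl c x + scl d y)"
 unfolding span_pair span_pair_mem by blast

lemma span1_iff: "v : V.span {x} \<longleftrightarrow> (EX c. v = scl c x)"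
 by (auto simp: V.span_singleton)

lemma sub_span2: fixes x y :: "nat => 'a::{field,finite}"
 assumes "x ~= 0" "y ~: V.span {x}" shows "sub (V.span {x, y}) 2"
 using sub_insert[OF sub_span1[OF assms(1)] assms(2)] by (simp add: span_pair numeral_2_eq_2)

lemma hex_line_rep:
 fixes l :: "(nat => 'a::{field,finite}) set"
 assumes "l : hex_lines"
 obtains x y where "l = V.span {x, y}" "x : pvec 6" "y : pvec 6" "quad x" "quad y" "sev x y" "sub l 2" "x ~= 0" "y ~: V.span {x}"
proof -
 obtain x y where h: "l = V.span {x, y}" "gr x y 1 2 = gr x y 3 4" "gr x y 5 4 = gr x y 3 2"
    "gr x y 2 0 = gr x y 3 5" "gr x y 6 5 = gr x y 3 0" "gr x y 0 1 = gr x y 3 6" "gr x y 4 6 = gr x y 3 1"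
  and q: "ALL v:l. quad v" and l: "l : lines 6" using assms unfolding hex_lines_def by blast
 have s2: "sub l 2" "l \<subseteq> pvec 6" using l by (simp_all add: psub_iff numeral_2_eq_2)
 have xy: "x : l" "y : l" "x + y : l" unfolding h(1) using V.span_base[of _ "{x, y}"] V.span_add[of x "{x, y}" y] by simp_all
 have qs: "quad x" "quad y" "quad (scl 1 x + scl 1 y)" using q xy by simp_all
 have p: "pol x y = 0" using qs(3) quad_lin[OF qs(1,2), of 1 1] by simp
 have yx: "y ~: V.span {x}"
 proof
  assume "y : V.span {x}"
  hence "l \<subseteq> V.span {x}" unfolding h(1) using V.span_minimal[OF _ V.subspace_span, of "{x, y}" "{x}"] V.span_base[of x "{x}"] by simp
  hence "card l <= card (V.span {x})" using card_mono[OF finite_span, of "{x}" l] by simp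
  moreover have "card (V.span {x}) <= CARD('a)" unfolding V.span_singleton by (rule card_image_le) simp
  ultimately have "CARD('a) ^ 2 <= CARD('a)" using sub_card[OF s2(1)] by simp
  thus False using card_field_ge_2[where 'a = 'a] by (simp add: power2_eq_square)
 qed
 have x0: "x ~= 0"
 proof
  assume "x = 0"
  hence e: "l = V.span {y}" using h(1) by (simp add: V.span_insert_0)
  have "card (V.span {y}) <= CARD('a)" unfolding V.span_singleton by (rule card_image_le) simp
  hence "CARD('a) ^ 2 <= CARD('a)" using sub_card[OF s2(1)] e by simp
  thus False using card_field_ge_2[where 'a = 'a] by (simp add: power2_eq_square)
 qed
 \<comment> \<open>The value of the seventh equation. Its product with every coordinate of
   \<open>x\<close> other than coordinate 3 vanishes; if it were nonzero, the quadric equation would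
   give \<open>x = 0\<close>.\<close>
 define c where "c = x 0 * y 4 - x 4 * y 0 + x 1 * y 5 - x 5 * y 1 + x 2 * y 6 - x 6 * y 2"
 have cx: "c * x 0 = 0" "c * x 1 = 0" "c * x 2 = 0" "c * x 4 = 0" "c * x 5 = 0" "c * x 6 = 0"
  using h(2-7) p qs(1) unfolding c_def gr_def pol_def quad_def by algebra+
 have c0: "c = 0"
 proof (rule ccontr)
  assume n: "c ~= 0"
  hence z: "x 0 = 0" "x 1 = 0" "x 2 = 0" "x 4 = 0" "x 5 = 0" "x 6 = 0" using cx by simp_all
  hence "x 3 = 0" using qs(1) by (simp add: quad_def)
  hence "x = 0" using z pvec_eqI[OF _ pvec_zero, of x] s2(2) xy(1) by (auto simp: zero_fun_def)
  thus False using x0 by simp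
 qed
 have "sev x y" unfolding sev_def using h(2-7) c0 unfolding c_def gr_def by (simp add: algebra_simps)
 thus ?thesis using that[OF h(1) _ _ qs(1,2) _ s2(1) x0 yx] s2(2) xy by blast
qed

lemma hex_line_mem:
 fixes l :: "(nat => 'a::{field,finite}) set"
 assumes "l : hex_lines" "u : l" "v : l" shows "u : pvec 6" "quad u" "sev u v"
proof -
 have "l \<subseteq> pvec 6" "ALL v:l. quad v" using assms(1) unfolding hex_lines_def psub_def by auto
 thus "u : pvec 6" "quad u" using assms(2) by auto
 obtain x y where h: "l = V.span {x, y}" "sev x y" using hex_line_rep[OF assms(1)] .
 obtain c d c' d' where e: "u = scl c x + scl d y" "v = scl c' x + scl d' y" using assms(2,3) unfolding h(1) span2_mem by blast
 have "sev x u" "sev y u" unfolding e using sev_lin sev_refl h(2) sev_sym by blast+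
 thus "sev u v" unfolding e(2) using sev_lin sev_sym by blast
qed

lemma hex_line_span:
 fixes u :: "nat => 'a::{field,finite}"
 assumes "u : pvec 6" "v : pvec 6" "quad u" "u ~= 0" "sev u v" "v ~: V.span {u}"
 shows "V.span {u, v} : hex_lines"
proof -
 have z: "quad v" "pol u v = 0" using Z_quad[OF assms(1,3,4,5)] by auto
 have e: "u 0 * v 4 + u 4 * v 0 + u 1 * v 5 + u 5 * v 1 + u 2 * v 6 + u 6 * v 2 = 2 * u 3 * v 3"
  using z(2) by (simp add: pol_def)
 have g: "gr u v 1 2 = gr u v 3 4" "gr u v 5 4 = gr u v 3 2" "gr u v 2 0 = gr u v 3 5" "gr u v 6 5 = gr u v 3 0"
  "gr u v 0 1 = gr u v 3 6" "gr u v 4 6 = gr u v 3 1" using assms(5) unfolding sev_def gr_def by algebra+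
 show ?thesis using hex_lineI[OF assms(1,2) sub_span2[OF assms(4,6)] assms(3) z(1) e g] .
qed

definition Z :: "(nat => 'a::field) => (nat => 'a) set" where "Z x = {y : pvec 6. sev x y}"

lemma Z_iff: "y : Z x \<longleftrightarrow> y : pvec 6 & sev x y" by (simp add: Z_def)

lemma Z_subspace: "V.subspace (Z x)"
proof (rule V.subspaceI)
 show "0 : Z x" unfolding Z_iff using pvec_zero by (simp add: sev_def zero_fun_def)
 show "u + v : Z x" if "u : Z x" "v : Z x" for u v
  using that sev_lin[of x u v 1 1] V.subspace_add[OF subspace_pvec] unfolding Z_iff by (simp only: V.scale_one) blast
 show "scl c u : Z x" if "u : Z x" for c u
  using that sev_scl V.subspace_scale[OF subspace_pvec] unfolding Z_iff by blast
qed

lemma Z_sub: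
 fixes x :: "nat => 'a::{field,finite}"
 assumes "x : pvec 6" "quad x" "x ~= 0" shows "sub (Z x) 3"
proof -
 obtain g c where g: "aut g" "c ~= 0" "g x = mk c 0 0 0 0 0 0" using move[OF assms] .
 let ?f = "%(a, b, d). mk a 0 0 0 0 b d :: nat => 'a"
 have "g ` Z x = range ?f"
 proof
  show "g ` Z x \<subseteq> range ?f"
  proof
   fix z assume "z : g ` Z x"
   then obtain y where y: "z = g y" "y : pvec 6" "sev x y" unfolding Z_def by blast
   have "sev (g x) (g y)" using autD(4)[OF g(1)] y(3) by simp
   hence s: "z 1 = 0" "z 2 = 0" "z 3 = 0" "z 4 = 0" unfolding g(3) sev_base[OF g(2)] y(1) by auto
   have "z = mk (z 0) 0 0 0 0 (z 5) (z 6)" using pvec_eqI[OF _ mk_pvec, of z] aut_pvec[OF g(1) y(2)] y(1) s by simp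
   hence "z = ?f (z 0, z 5, z 6)" by simp
   thus "z : range ?f" by (rule range_eqI)
  qed
  show "range ?f \<subseteq> g ` Z x"
  proof
   fix z assume "z : range ?f"
   then obtain a b d where z: "z = mk a 0 0 0 0 b d" by auto
   then obtain y where y: "y : pvec 6" "z = g y" using autD(1)[OF g(1)] mk_pvec unfolding bij_betw_def by blast
   have "sev (g x) z" unfolding g(3) sev_base[OF g(2)] z by simp
   hence "sev x y" using autD(4)[OF g(1)] y(2) by simp
   thus "z : g ` Z x" using y unfolding Z_def by blast
  qed
 qed
 moreover have "inj_on g (Z x)" using autD(1)[OF g(1)] unfolding bij_betw_def Z_def by (simp add: inj_on_def)
 moreover have "inj ?f"
 proof (rule injI)
  fix p r assume e: "?f p = ?f r"
  obtain a b d a' b' d' where pr: "p = (a, b, d)" "r = (a', b', d')" by (metis prod_cases3)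
  have e': "mk a 0 0 0 0 b d = mk a' 0 0 0 0 b' d'" using e pr by simp
  have "a = a'" using fun_cong[OF e', of 0] by simp
  moreover have "b = b'" using fun_cong[OF e', of 5] by simp
  moreover have "d = d'" using fun_cong[OF e', of 6] by simp
  ultimately show "p = r" using pr by simp
 qed
 ultimately have "card (Z x) = card (UNIV :: ('a \<times> 'a \<times> 'a) set)" using card_image[of g "Z x"] card_image[of ?f UNIV] by simp
 hence "card (Z x) = CARD('a) ^ 3" by (simp add: power3_eq_cube card_cartesian_product UNIV_Times_UNIV[symmetric] del: UNIV_Times_UNIV)
 thus ?thesis using Z_subspace by (simp add: sub_def)
qed

lemma sub_not_subset:
 assumes "sub (A :: (nat => 'a::{field,finite}) set) a" "sub B b" "b < a" obtains v where "v : A" "v ~: B"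
 using sub_mono[OF assms(1,2)] assms(3) by fastforce

text \<open>Any vector of the plane \<open>Z x\<close> independent of \<open>x\<close> spans a
  hexagon line with \<open>x\<close>, so the pencil consists of all lines through \<open>x\<close>
  in that plane.\<close>

lemma hex_lines_at:
 fixes x :: "nat => 'a::{field,finite}"
 assumes "x : pvec 6" "quad x" "x ~= 0"
 shows "{l : hex_lines. x : l} = hyps (Z x) 2 (V.span {x})" "\<Union>{l : hex_lines. x : l} = Z x"
  "card {l : hex_lines. x : l} = CARD('a) + 1"
proof -
 have xx: "x : Z x" using assms sev_refl by (simp add: Z_iff)
 have s: "V.span {x} \<subseteq> Z x" using span_subset_iff[OF Z_subspace] xx by blast
 have mkl: "l : hex_lines" if l: "sub l 2" "x : l" "l \<subseteq> Z x" for l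
 proof -
  obtain v where v: "v : l" "v ~: V.span {x}" using sub_not_subset[OF l(1) sub_span1[OF assms(3)]] by auto
  have "V.span {x, v} \<subseteq> l" using V.span_minimal[OF _ sub_subspace[OF l(1)]] v l(2) by simp
  hence "V.span {x, v} = l" using sub_eq[OF sub_span2[OF assms(3) v(2)] l(1)] by simp
  moreover have "V.span {x, v} : hex_lines" using hex_line_span[OF assms(1) _ assms(2,3) _ v(2)] v(1) l(3) unfolding Z_def by blast
  ultimately show ?thesis by simp
 qed
 show eq: "{l : hex_lines. x : l} = hyps (Z x) 2 (V.span {x})"
 proof (intro set_eqI iffI)
  fix l assume l: "l : {l : hex_lines. x : l}"
  have "sub l 2" using hex_line_rep[of l] l by blast
  moreover have "l \<subseteq> Z x" using l hex_line_mem[of l] unfolding Z_def by blast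
  ultimately show "l : hyps (Z x) 2 (V.span {x})" using l span_subset_iff[OF sub_subspace] unfolding hyps_def by blast
 next
  fix l assume l: "l : hyps (Z x) 2 (V.span {x})"
  hence "sub l 2" "V.span {x} \<subseteq> l" "l \<subseteq> Z x" unfolding hyps_def by auto
  moreover from this have "x : l" using V.span_base[of x "{x}"] by blast
  ultimately show "l : {l : hex_lines. x : l}" using mkl by blast
 qed
 show "card {l : hex_lines. x : l} = CARD('a) + 1"
  unfolding eq using card_hyps[of "Z x" 2 "V.span {x}" 1] Z_sub[OF assms] sub_span1[OF assms(3)] s by (simp add: numeral_3_eq_3 numeral_2_eq_2)
 show "\<Union>{l : hex_lines. x : l} = Z x"
 proof
  show "\<Union>{l : hex_lines. x : l} \<subseteq> Z x" unfolding eq by (auto simp: hyps_def)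
  show "Z x \<subseteq> \<Union>{l : hex_lines. x : l}"
  proof
   fix y assume y: "y : Z x"
   obtain v where v: "v : Z x" "v ~: V.span {x}" "y : V.span {x, v}"
   proof (cases "y : V.span {x}")
    case True
    obtain v where v: "v : Z x" "v ~: V.span {x}" using sub_not_subset[OF Z_sub[OF assms] sub_span1[OF assms(3)]] by auto
    thus ?thesis using that True V.span_mono[of "{x}" "{x, v}"] by blast
   next
    case False thus ?thesis using that[OF y] V.span_base[of y "{x, y}"] by simp
   qed
   have "V.span {x, v} : hex_lines" using hex_line_span[OF assms(1) _ assms(2,3) _ v(2)] v(1) unfolding Z_def by blast
   moreover have "x : V.span {x, v}" using V.span_base[of x "{x, v}"] by simp
   ultimately show "y : \<Union>{l : hex_lines. x : l}" using v(3) by blast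
  qed
 qed
qed

definition sg :: "(nat => 'a::field) => bool" where "sg x \<longleftrightarrow> x : NV & x : pvec 6 & quad x"

lemma sgD: "sg x ==> x : pvec 6" "sg x ==> quad x" "sg x ==> x ~= 0" "sg x ==> x : NV"
 using NV_nonzero by (auto simp: sg_def)

text \<open>Two planes of a solid share a line, so noncollinear \<open>x\<close> and
  \<open>y\<close> would have two common neighbours, against \<open>M_quad\<close>.\<close>

lemma solid_sev:
 fixes x y :: "nat => 'a::{field,finite}"
 assumes "sub S 4" "sg x" "sg y" "Z x \<subseteq> S" "Z y \<subseteq> S" shows "sev x y"
proof (rule ccontr)
 assume n: "~ sev x y"
 obtain c where c: "sub (Z x Int Z y) c" "3 + 3 <= 4 + c"
  using sub_Int_ge[OF Z_sub[OF sgD(1-3)[OF assms(2)]] Z_sub[OF sgD(1-3)[OF assms(3)]] assms(1,4,5)] .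
 have c2: "c >= 2" using c(2) by simp
 obtain z where z: "z : Z x Int Z y" "z : NV" using sub_point[OF c(1)] c2 by auto
 obtain z' where z': "z' : Z x Int Z y" "z' : NV" "z' ~= z" using sub_point2[OF c(1) c2 z(2)] .
 have "quad z" using Z_quad(1)[OF sgD(1-3)[OF assms(2)]] z(1) unfolding Z_def by blast
 then obtain r where r: "z' = scl r z"
  using M_quad[of z z' x y] z z' n NV_nonzero[OF z(2)] sev_sym unfolding Z_def by blast
 hence "r = 1" using NV_unique[OF z(2)] z'(2) by simp
 thus False using z'(3) r by simp
qed

lemma span_swap: fixes x y :: "nat => 'a::{field,finite}"
 assumes "x : NV" "y : NV" "x ~= y" "u : NV" "u : V.span {x, y}" "u ~= x" shows "V.span {x, u} = V.span {x, y}"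
proof (rule sub_eq)
 show "sub (V.span {x, u}) 2" "sub (V.span {x, y}) 2" using span2 assms by blast+
 show "V.span {x, u} \<subseteq> V.span {x, y}" using V.span_minimal[OF _ V.subspace_span, of "{x, u}" "{x, y}"] assms(5) V.span_base[of x "{x, y}"] by simp
qed simp

lemma not_sev:
 fixes x y :: "nat => 'a::{field,finite}"
 assumes "sg x" "sg y" "x ~= y" "sev x y" "w : Z x" "w ~: V.span {x, y}" shows "~ sev y w"
proof
 assume h: "sev y w"
 obtain s t r where st: "s ~= 0 | t ~= 0" "scl s y + scl t w = scl r x"
  using Z_dep[OF sgD(1-3)[OF assms(1)] sgD(1)[OF assms(2)] _ assms(4) _ h] assms(5) unfolding Z_def by blast
 show False
 proof (cases "t = 0")
  case True
  hence "scl s y = scl r x" using st(2) by simp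
  thus False using NV_inj(1)[OF sgD(4)[OF assms(2)] sgD(4)[OF assms(1)]] st(1) True assms(3) by blast
 next
  case False
  have "scl t w = scl r x + scl (- s) y" using st(2) by (simp add: algebra_simps)
  hence "scl t w : V.span {x, y}" unfolding span2_mem by blast
  thus False using subspace_scl[OF V.subspace_span False] assms(6) by blast
 qed
qed

text \<open>By \<open>solid_sev\<close> the three points lie on one line \<open>?l\<close>. Vectors
  \<open>w2\<close> of \<open>Z y\<close> and \<open>w3\<close> of \<open>Z u\<close> off that line
  satisfy \<open>w3 = z + scl b w2\<close> with \<open>z\<close> in \<open>Z x\<close>. All three
  being singular, \<open>w2\<close> is orthogonal to the line of \<open>x\<close> and
  \<open>z\<close>, hence collinear with a point of it. That point and \<open>y\<close> are both
  common neighbours of \<open>x\<close> and \<open>w2\<close>, so they agree and \<open>z\<close>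
  falls on \<open>?l\<close>, a contradiction.\<close>

lemma three_Z:
 fixes x y u :: "nat => 'a::{field,finite}"
 assumes "sub S 4" "sg x" "sg y" "sg u" "Z x \<subseteq> S" "Z y \<subseteq> S" "Z u \<subseteq> S" shows "x = y | x = u | y = u"
proof (rule ccontr)
 assume "~ ?thesis"
 hence n: "x ~= y" "x ~= u" "y ~= u" by auto
 have sv: "sev x y" "sev u x" "sev u y" using solid_sev[OF assms(1)] assms by blast+
 let ?l = "V.span {x, y}"
 have ul: "u : ?l" using not_sev[OF assms(3,2) n(1)[symmetric] sev_sym[OF sv(1)], of u] sgD(1)[OF assms(4)] sev_sym[OF sv(3)] sev_sym[OF sv(2)]
  unfolding Z_iff by (auto simp: insert_commute)
 have xu: "V.span {x, u} = ?l" using span_swap[of x y u] n ul assms sgD by blast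
 have l2: "sub ?l 2" using span2[OF sgD(4)[OF assms(2)] sgD(4)[OF assms(3)] n(1)] .
 obtain w2 where w2: "w2 : Z y" "w2 ~: ?l" using sub_not_subset[OF Z_sub[OF sgD(1-3)[OF assms(3)]] l2] by auto
 obtain w3 where w3: "w3 : Z u" "w3 ~: ?l" using sub_not_subset[OF Z_sub[OF sgD(1-3)[OF assms(4)]] l2] by auto
 have yu: "V.span {y, u} = ?l" using span_swap[of y x u] n ul assms sgD by (metis insert_commute)
 have nx2: "~ sev x w2" using not_sev[OF assms(3,2) _ sev_sym[OF sv(1)] w2(1)] n(1) w2(2) by (simp add: insert_commute)
 have nx3: "~ sev x w3" using not_sev[OF assms(4,2) _ sv(2) w3(1)] n(2) w3(2) xu by (simp add: insert_commute)
 have ny3: "~ sev y w3" using not_sev[OF assms(4,3) _ sv(3) w3(1)] n(3) w3(2) yu by (simp add: insert_commute)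
 have "w2 ~: Z x" using nx2 by (simp add: Z_iff)
 hence s4: "sub (Z x \<oplus> V.span {w2}) 4" using sub_insert[OF Z_sub[OF sgD(1-3)[OF assms(2)]]] by (simp add: eval_nat_numeral)
 have "Z x \<oplus> V.span {w2} \<subseteq> S" using ssum_least[OF sub_subspace[OF assms(1)] assms(5)] span_subset_iff[OF sub_subspace[OF assms(1)]] w2(1) assms(6) by blast
 hence "Z x \<oplus> V.span {w2} = S" using sub_eq[OF s4 assms(1)] by simp
 hence "w3 : Z x \<oplus> V.span {w2}" using w3(1) assms(7) by blast
 then obtain z b where z: "z : Z x" "w3 = z + scl b w2" using ssumE[of w3 "Z x" "V.span {w2}"] span1_iff by metis
 have b: "b ~= 0" using z nx3 by (auto simp: Z_iff)
 have qz: "quad z" "quad w2" "quad w3" using Z_quad(1)[OF sgD(1-3)[OF assms(2)]] Z_quad(1)[OF sgD(1-3)[OF assms(3)]]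
  Z_quad(1)[OF sgD(1-3)[OF assms(4)]] z(1) w2(1) w3(1) unfolding Z_iff by blast+
 have "quad (scl 1 z + scl b w2)" using qz(3) z(2) by simp
 hence pz: "pol w2 z = 0" using quad_lin[OF qz(1,2), of 1 b] b pol_sym[of z w2] by simp
 have zl: "z ~: ?l"
 proof
  assume "z : ?l"
  moreover have "?l \<subseteq> Z y" using V.span_minimal[OF _ Z_subspace, of "{x, y}" y] sgD(1)[OF assms(2)] sgD(1)[OF assms(3)] sev_sym[OF sv(1)]
   by (simp add: Z_iff sev_refl)
  ultimately have "z : Z y" by blast
  hence "w3 : Z y" unfolding z(2) using V.subspace_add[OF Z_subspace] V.subspace_scale[OF Z_subspace w2(1)] by blast
  thus False using ny3 by (simp add: Z_iff)
 qed
 have p2: "pol w2 x = 0" using Z_pol[OF sgD(1-3)[OF assms(3)], of w2 x] w2(1) sev_sym[OF sv(1)] by (simp add: Z_iff)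
 have zr: "z ~= scl r x" for r
 proof
  assume "z = scl r x"
  hence "z = scl r x + scl 0 y" by simp
  thus False using zl unfolding span2_mem by blast
 qed
 obtain s t where st: "s ~= 0 | t ~= 0" "sev w2 (scl s x + scl t z)"
  using O_line[of w2 x z] w2(1) qz(2) sgD(1-3)[OF assms(2)] z(1) p2 pz zr unfolding Z_iff by blast
 have t: "t ~= 0"
 proof
  assume t: "t = 0"
  hence s: "s ~= 0" "sev w2 (scl s x)" using st by simp_all
  have "sev w2 (scl (inverse s) (scl s x))" using sev_scl[OF s(2)] .
  thus False using s(1) nx2 sev_sym by (auto simp: V.scale_scale)
 qed
 let ?v = "scl s x + scl t z"
 have vZ: "?v : Z x" using V.subspace_add[OF Z_subspace] V.subspace_scale[OF Z_subspace] z(1) sgD(1)[OF assms(2)] sev_refl unfolding Z_iff by (metis Z_iff)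
 obtain r where "?v = scl r y"
  using M_quad[OF sgD(1-3)[OF assms(3)], of ?v x w2] vZ w2(1) sev_sym sv(1) st(2) nx2 unfolding Z_iff by blast
 hence "scl t z = scl (- s) x + scl r y" by (simp add: algebra_simps)
 hence "scl t z : ?l" unfolding span2_mem by blast
 thus False using subspace_scl[OF V.subspace_span t] zl by blast
qed

lemma flat_hex_lines: "flat (hex_lines :: (nat => 'a::{field,finite}) set set) CARD('a)"
proof
 let ?K = "hex_lines :: (nat => 'a) set set"
 have sgI: "sg x" if "x : NV" "l : ?K" "x : l" for x l using hex_line_mem[OF that(2,3,3)] that(1) by (simp add: sg_def)
 show "finite ?K" by (rule finite_hex_lines)
 show "?K ~= {}"
 proof -
  have "mk 1 0 0 0 0 0 0 ~= (0 :: nat => 'a)"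
  proof
   assume "mk 1 0 0 0 0 0 0 = (0 :: nat => 'a)"
   from fun_cong[OF this, of 0] show False by simp
  qed
  hence "card {l : ?K. mk 1 0 0 0 0 0 0 : l} = CARD('a) + 1" using hex_lines_at(3)[OF mk_pvec, of 1 0 0 0 0 0 0] by (simp add: quad_def)
  thus ?thesis by fastforce
 qed
 show "sub l 2" if "l : ?K" for l using hex_line_rep[OF that] .
 show "card {l : ?K. x : l} = CARD('a) + 1" if "x : NV" "l : ?K" "x : l" for x l
  using hex_lines_at(3)[OF sgD(1-3)[OF sgI[OF that]]] .
 show "sub (\<Union>{l : ?K. x : l}) 3" if "x : NV" "l : ?K" "x : l" for x l
  unfolding hex_lines_at(2)[OF sgD(1-3)[OF sgI[OF that]]] by (rule Z_sub[OF sgD(1-3)[OF sgI[OF that]]])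
 show "x : m" if h: "x : NV" "l : ?K" "x : l" "m : ?K" "m \<subseteq> \<Union>{l : ?K. x : l}" for x l m
 proof -
  have mZ: "m \<subseteq> Z x" using h(5) unfolding hex_lines_at(2)[OF sgD(1-3)[OF sgI[OF h(1-3)]]] .
  obtain y z where yz: "m = V.span {y, z}" "y : pvec 6" "z : pvec 6" "sev y z" "y ~= 0" "z ~: V.span {y}" using hex_line_rep[OF h(4)] .
  have "y : m" "z : m" unfolding yz(1) using V.span_base[of _ "{y, z}"] by simp_all
  hence "sev x y" "sev x z" using mZ unfolding Z_def by blast+
  then obtain s t r where st: "s ~= 0 | t ~= 0" "scl s y + scl t z = scl r x"
   using Z_dep[OF sgD(1-3)[OF sgI[OF h(1-3)]] yz(2,3) _ _ yz(4)] by blast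
  have "scl r x : m" unfolding yz(1) span2_mem st(2)[symmetric] by blast
  moreover have "r ~= 0"
  proof
   assume r: "r = 0"
   have t: "t ~= 0" using st r yz(5) by (auto simp: V.scale_eq_0_iff)
   have "scl t z = scl (- s) y" using st(2) r by (simp add: add_eq_0_iff)
   hence "scl t z : V.span {y}" unfolding span1_iff by blast
   thus False using subspace_scl[OF V.subspace_span t] yz(6) by blast
  qed
  ultimately show ?thesis using subspace_scl[OF V.subspace_span, of r x] yz(1) by blast
 qed
 show "x = y | x = z | y = z" if h: "sub S 4" "x : NV" "y : NV" "z : NV" "x : \<Union>?K" "y : \<Union>?K" "z : \<Union>?K"
   "\<Union>{l : ?K. x : l} \<subseteq> S" "\<Union>{l : ?K. y : l} \<subseteq> S" "\<Union>{l : ?K. z : l} \<subseteq> S" for S x y z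
 proof -
  have s: "sg x" "sg y" "sg z" using h sgI by blast+
  show ?thesis using three_Z[OF h(1) s] h(8-10) hex_lines_at(2)[OF sgD(1-3)[OF s(1)]] hex_lines_at(2)[OF sgD(1-3)[OF s(2)]] hex_lines_at(2)[OF sgD(1-3)[OF s(3)]] by simp
 qed
qed simp

text \<open>The map \<open>f\<close> omits the coordinate that the quadric equation determines: the
  partner of the first nonzero one among coordinates 0, 1 and 2, with leading zeros recording the
  case. If all three vanish, coordinate 3 does as well.\<close>

lemma card_quad: "card {v : pvec 6. quad (v :: nat => 'a::{field,finite})} <= CARD('a) ^ 6"
proof -
 define f where "f v = (if v 0 ~= 0 then (v 0, v 1, v 2, v 3, v 5, v 6) else if v 1 ~= 0 then (0, v 1, v 2, v 3, v 4, v 6)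
  else if v 2 ~= 0 then (0, 0, v 2, v 3, v 4, v 5) else (0, 0, 0, v 4, v 5, v 6))" for v :: "nat => 'a"
 have "inj_on f {v : pvec 6. quad v}"
 proof (rule inj_onI)
  fix u v assume u: "u : {v : pvec 6. quad v}" and v: "v : {v : pvec 6. quad v}" and e: "f u = f v"
  have uv: "u : pvec 6" "v : pvec 6" and qu: "u 0 * u 4 + u 1 * u 5 + u 2 * u 6 = u 3 ^ 2" and qv: "v 0 * v 4 + v 1 * v 5 + v 2 * v 6 = v 3 ^ 2"
   using u v unfolding quad_def by auto
  have e0: "u 0 = v 0" using e by (auto simp: f_def split: if_splits)
  have e1: "u 1 = v 1" using e e0 by (auto simp: f_def split: if_splits)
  have e2: "u 2 = v 2" using e e0 e1 by (auto simp: f_def split: if_splits)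
  consider "v 0 ~= 0" | "v 0 = 0" "v 1 ~= 0" | "v 0 = 0" "v 1 = 0" "v 2 ~= 0" | "v 0 = 0" "v 1 = 0" "v 2 = 0" by blast
  thus "u = v"
  proof cases
   case 1
   hence c: "u 3 = v 3" "u 5 = v 5" "u 6 = v 6" using e e0 e1 e2 by (auto simp: f_def)
   have "u 0 * u 4 + u 1 * u 5 + u 2 * u 6 = v 0 * v 4 + v 1 * v 5 + v 2 * v 6" using qu qv c(1) by simp
   hence "v 0 * u 4 = v 0 * v 4" unfolding e0 e1 e2 c by simp
   hence d: "u 4 = v 4" using 1 by simp
   show ?thesis using pvec_eqI[OF uv e0 e1 e2 c(1) d c(2,3)] .
  next
   case 2
   hence c: "u 3 = v 3" "u 4 = v 4" "u 6 = v 6" using e e0 e1 e2 by (auto simp: f_def)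
   have "u 0 * u 4 + u 1 * u 5 + u 2 * u 6 = v 0 * v 4 + v 1 * v 5 + v 2 * v 6" using qu qv c(1) by simp
   hence "v 1 * u 5 = v 1 * v 5" unfolding e0 e1 e2 c by simp
   hence d: "u 5 = v 5" using 2 by simp
   show ?thesis using pvec_eqI[OF uv e0 e1 e2 c(1,2) d c(3)] .
  next
   case 3
   hence c: "u 3 = v 3" "u 4 = v 4" "u 5 = v 5" using e e0 e1 e2 by (auto simp: f_def)
   have "u 0 * u 4 + u 1 * u 5 + u 2 * u 6 = v 0 * v 4 + v 1 * v 5 + v 2 * v 6" using qu qv c(1) by simp
   hence "v 2 * u 6 = v 2 * v 6" unfolding e0 e1 e2 c by simp
   hence d: "u 6 = v 6" using 3 by simp
   show ?thesis using pvec_eqI[OF uv e0 e1 e2 c(1-3) d] .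
  next
   case 4
   hence c: "u 4 = v 4" "u 5 = v 5" "u 6 = v 6" using e e0 e1 e2 by (auto simp: f_def)
   have "u 3 = 0" "v 3 = 0" using qu qv e0 e1 e2 4 by simp_all
   thus ?thesis using pvec_eqI[OF uv e0 e1 e2 _ c] by simp
  qed
 qed
 hence "card {v : pvec 6. quad (v :: nat => 'a)} <= card (UNIV :: ('a \<times> 'a \<times> 'a \<times> 'a \<times> 'a \<times> 'a) set)"
  by (intro card_inj_on_le[of f]) simp_all
 also have "... = CARD('a) ^ 6"
  by (simp add: card_cartesian_product UNIV_Times_UNIV[symmetric] eval_nat_numeral del: UNIV_Times_UNIV)
 finally show ?thesis .
qed

lemma pol_linl: "pol (scl s y + scl t z) x = s * pol y x + t * pol z x"
 using pol_lin[of x s y t z] by (simp add: pol_sym)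

lemma lin_zero: assumes "x ~= 0" "y ~: V.span {x}" "s ~= 0 | t ~= 0" shows "scl s x + scl t y ~= 0"
proof
 assume h: "scl s x + scl t y = 0"
 show False
 proof (cases "t = 0")
  case True thus False using h assms(1,3) by (auto simp: V.scale_eq_0_iff)
 next
  case False
  have "scl t y = scl (- s) x" using h by (simp add: add_eq_0_iff)
  hence "scl t y : V.span {x}" unfolding span1_iff by blast
  thus False using subspace_scl[OF V.subspace_span False] assms(2) by blast
 qed
qed

lemma O_hex:
 fixes w :: "nat => 'a::{field,finite}"
 assumes "w : pvec 6" "quad w" "m : hex_lines" "!!v. v : m ==> pol w v = 0"
 obtains u where "u : m" "u ~= 0" "sev w u"
proof -
 obtain c d where cd: "m = V.span {c, d}" "c : pvec 6" "d : pvec 6" "quad c" "sev c d" "c ~= 0" "d ~: V.span {c}" using hex_line_rep[OF assms(3)] .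
 have m: "c : m" "d : m" unfolding cd(1) using V.span_base[of _ "{c, d}"] by simp_all
 obtain s t where st: "s ~= 0 | t ~= 0" "sev w (scl s c + scl t d)"
  using O_line[OF assms(1,2) cd(2,4,6,3,5) assms(4)[OF m(1)] assms(4)[OF m(2)]] cd(7) unfolding span1_iff by blast
 show ?thesis using that[OF _ lin_zero[OF cd(6,7) st(1)] st(2)] unfolding cd(1) span2_mem by blast
qed

text \<open>Points at distance two are orthogonal, by \<open>Z_pol\<close> at the middle point. So a
  point with two points of \<open>m\<close> at distance two is orthogonal to all of
  \<open>m\<close>, and \<open>O_hex\<close> supplies a neighbour on \<open>m\<close>. The bound on
  the number of lines comes from counting singular vectors.\<close>

lemma hexagon_hex_lines: "hexagon (hex_lines :: (nat => 'a::{field,finite}) set set) CARD('a)"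
proof -
 let ?K = "hex_lines :: (nat => 'a) set set" and ?q = "CARD('a)"
 interpret F: flat ?K ?q by (rule flat_hex_lines)
 have PL: "sg x" if "x : F.P" for x using that hex_line_mem unfolding F.P_def sg_def by blast
 have cs: "sev x u" if "F.col x u" for x u using that hex_line_mem(3) unfolding F.col_def by blast
 show ?thesis
 proof
  fix x m y z
  assume h: "x : F.P" "m : ?K" "!!u. u : F.P ==> u : m ==> ~ F.col x u" "y : F.P" "z : F.P" "y : m" "z : m" "F.d2 x y" "F.d2 x z"
  have p: "pol x v = 0" if v: "F.d2 x v" for v
  proof -
   obtain w where w: "w : F.P" "F.col x w" "F.col w v" using v unfolding F.d2_def by blast
   show ?thesis using Z_pol[OF sgD(1-3)[OF PL[OF w(1)]] sev_sym[OF cs[OF w(2)]] cs[OF w(3)]] .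
  qed
  show "y = z"
  proof (rule ccontr)
   assume n: "y ~= z"
   have m: "m = V.span {y, z}"
    using sub_eq[OF span2[OF F.P_NV[OF h(4)] F.P_NV[OF h(5)] n] F.line_sub2[OF h(2)]]
     V.span_minimal[OF _ F.line_subspace[OF h(2)], of "{y, z}"] h(6,7) by simp
   have pm: "pol x v = 0" if "v : m" for v
    using that p[OF h(8)] p[OF h(9)] unfolding m span2_mem by (auto simp: pol_lin)
   obtain u where u: "u : m" "u ~= 0" "sev x u" using O_hex[OF sgD(1,2)[OF PL[OF h(1)]] h(2) pm] .
   obtain c where c: "c ~= 0" "scl c u : NV" using NV_exists[OF u(2)] .
   have um: "scl c u : m" using V.subspace_scale[OF F.line_subspace[OF h(2)] u(1)] .
   have uP: "scl c u : F.P" using F.LP[OF h(2) um c(2)] .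
   have "sev x (scl c u)" using sev_scl[OF u(3)] .
   hence "scl c u : Z x" using sgD(1)[OF PL[OF uP]] by (simp add: Z_iff)
   hence "F.col x (scl c u)" unfolding hex_lines_at(2)[OF sgD(1-3)[OF PL[OF h(1)]], symmetric] F.col_def by blast
   thus False using h(3)[OF uP um] by blast
  qed
 next
  let ?Q = "{v : pvec 6. quad (v :: nat => 'a)}"
  let ?f = "%(x, c). scl c x :: nat => 'a"
  have fQ: "finite ?Q" using finite_pvec finite_subset[of ?Q "pvec 6"] by blast
  have "inj_on ?f (F.P \<times> (UNIV - {0}))"
  proof (rule inj_onI)
   fix a b assume h: "a : F.P \<times> (UNIV - {0})" "b : F.P \<times> (UNIV - {0})" "?f a = ?f b"
   obtain x c y d where ab: "a = (x, c)" "b = (y, d)" by (metis surj_pair)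
   thus "a = b" using h NV_inj[of x y c d] F.P_NV by auto
  qed
  moreover have "?f ` (F.P \<times> (UNIV - {0})) \<subseteq> ?Q - {0}"
  proof
   fix v assume "v : ?f ` (F.P \<times> (UNIV - {0}))"
   then obtain x c where x: "x : F.P" "c ~= 0" "v = scl c x" by auto
   have "v : pvec 6" using V.subspace_scale[OF subspace_pvec sgD(1)[OF PL[OF x(1)]]] x(3) by blast
   moreover have "quad v" using sgD(2)[OF PL[OF x(1)]] unfolding x(3) quad_def scl_def by algebra
   moreover have "v ~= 0" using x(2,3) F.P_nonzero[OF x(1)] by (simp add: V.scale_eq_0_iff)
   ultimately show "v : ?Q - {0}" by simp
  qed
  ultimately have "card (F.P \<times> (UNIV - {0 :: 'a})) <= card (?Q - {0})" using card_inj_on_le fQ by blast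
  moreover have "card (F.P \<times> (UNIV - {0 :: 'a})) = card F.P * (?q - 1)" by (simp add: card_cartesian_product card_Diff_subset)
  moreover have "card (?Q - {0}) <= ?q ^ 6 - 1"
  proof -
   have "(0 :: nat => 'a) : ?Q" using pvec_zero by (simp add: quad_def zero_fun_def)
   hence "card (?Q - {0}) = card ?Q - 1" by (rule card_Diff_singleton)
   thus ?thesis using card_quad[where 'a = 'a] by simp
  qed
  ultimately have le: "card F.P * (?q - 1) <= ?q ^ 6 - 1" by simp
  obtain r where r: "?q = Suc r" "r >= 1" using F.q_ge2 by (cases ?q) auto
  have "?q ^ 6 - 1 = ((?q^3 + 1) * (?q^2 + ?q + 1)) * (?q - 1)"
   unfolding r(1) by (simp add: algebra_simps eval_nat_numeral)
  hence "card F.P <= (?q^3 + 1) * (?q^2 + ?q + 1)" using le r by (metis diff_Suc_1 mult_le_cancel2 not_one_le_zero zero_less_iff_neq_zero)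
  thus "card ?K <= (?q^3 + 1) * (?q^2 + ?q + 1)" unfolding F.card_P .
 qed
qed

section \<open>Lines in planes and solids\<close>

context flat
begin

lemma lines_meet:
 assumes "l : L" "m : L" "l ~= m" "l Int m ~= {0}" obtains x where "x : P" "x : l" "x : m"
proof -
 have "0 : l Int m" using V.subspace_0[OF line_subspace] assms(1,2) by blast
 then obtain v where v: "v : l" "v : m" "v ~= 0" using assms(4) by blast
 obtain c where c: "c ~= 0" "scl c v : NV" using NV_exists[OF v(3)] .
 have "scl c v : l" "scl c v : m" using V.subspace_scale[OF line_subspace[OF assms(1)] v(1)] V.subspace_scale[OF line_subspace[OF assms(2)] v(2)] by auto
 thus ?thesis using that[of "scl c v"] LP[OF assms(1) _ c(2)] by blast
qed

lemma LU_plane: assumes "sub W k" "k <= 3" shows "card (LU W) : {0, 1, q + 1}"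
proof (cases "EX l:LU W. EX m:LU W. l ~= m")
 case False
 hence "card (LU W) <= 1" using card_le_Suc0_iff_eq[OF LU_finite, of W] by simp
 thus ?thesis by auto
next
 case True
 then obtain l m where lm: "l : L" "l \<subseteq> W" "m : L" "m \<subseteq> W" "l ~= m" unfolding LU_def by blast
 obtain c where c: "sub (l Int m) c" "2 + 2 <= k + c" using sub_Int_ge[OF line_sub2[OF lm(1)] line_sub2[OF lm(3)] assms(1) lm(2,4)] .
 have "l Int m ~= {0}"
 proof
  assume "l Int m = {0}"
  hence "c = 0" using sub_unique[OF c(1)] sub_0_zero by simp
  thus False using c(2) assms(2) by simp
 qed
 then obtain x where x: "x : P" "x : l" "x : m" using lines_meet[OF lm(1,3,5)] by blast
 have "Pi x \<subseteq> W" using Pi_subset[OF x(1) lm(1,3,5) x(2,3) sub_subspace[OF assms(1)] lm(2,4)] .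
 hence "Pi x = W" using sub_eq[OF Pi_sub[OF x(1)] assms(1)] assms(2) by blast
 hence "LU W = Ln x" unfolding LU_def Ln_def using Pi_lines[OF x(1)] Ln_Pi by blast
 thus ?thesis using Ln_card[OF x(1)] by simp
qed

text \<open>If two lines of the solid meet in \<open>x\<close>, then \<open>Pi x\<close> lies in it,
  every line off \<open>x\<close> meets this plane in a point of \<open>CU W\<close>, and besides
  \<open>x\<close> there is at most one such point. The alternative of pairwise skew lines is left
  open here and settled for the standard model in \<open>hex_solid\<close>.\<close>

lemma LU_solid: assumes "sub W k" "k <= 4"
 shows "card (LU W) : {0, 1, q + 1, 2 * q + 1} |
  (k = 4 & (EX l:LU W. EX m:LU W. l ~= m) & (ALL l:LU W. ALL m:LU W. l ~= m --> l Int m = {0}))"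
proof (cases "k = 4 & (EX l:LU W. EX m:LU W. l ~= m)")
 case False
 show ?thesis
 proof (cases "k = 4")
  case True
  hence "card (LU W) <= 1" using False card_le_Suc0_iff_eq[OF LU_finite, of W] by simp
  thus ?thesis by auto
 next
  case False
  thus ?thesis using LU_plane[OF assms(1)] assms(2) by auto
 qed
next
 case t: True
 show ?thesis
 proof (cases "ALL l:LU W. ALL m:LU W. l ~= m --> l Int m = {0}")
  case True thus ?thesis using t by blast
 next
  case False
  then obtain l m where lm: "l : LU W" "m : LU W" "l ~= m" "l Int m ~= {0}" by blast
  obtain x where x: "x : P" "x : l" "x : m" using lines_meet[OF LU_L[OF lm(1)] LU_L[OF lm(2)] lm(3,4)] .
  have W4: "sub W 4" using assms t by simp
  have xC: "x : CU W" using CU_I[OF x(1) lm(1-3) x(2,3) sub_subspace[OF assms(1)]] .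
  have LnW: "Ln z \<subseteq> LU W" if "z : CU W" for z using CU_line[OF that] unfolding Ln_def by blast
  have foot: "EX y. y : CU W & y : k & y ~= x & col x y" if k: "k : LU W" "x ~: k" for k
  proof -
   have kk: "k : L" "k \<subseteq> W" using k(1) by (auto simp: LU_def)
   obtain c where c: "sub (Pi x Int k) c" "3 + 2 <= 4 + c"
    using sub_Int_ge[OF Pi_sub[OF x(1)] line_sub2[OF kk(1)] W4 _ kk(2)] xC unfolding CU_def by blast
   then obtain y where y: "y : Pi x Int k" "y : NV" using sub_point[OF c(1)] by auto
   have yP: "y : P" using LP[OF kk(1) _ y(2)] y(1) by blast
   have cxy: "col x y" using y(1) mem_Pi by blast
   then obtain n where n: "n : L" "x : n" "y : n" unfolding col_def by blast
   have "n : LU W" using CU_line[OF xC n(1,2)] .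
   moreover have "n ~= k" using n(2) k(2) by blast
   ultimately have "y : CU W" using CU_I[OF yP _ k(1) _ n(3) _ sub_subspace[OF W4]] y(1) by blast
   thus ?thesis using y(1) k(2) cxy by blast
  qed
  show ?thesis
  proof (cases "EX k:LU W. x ~: k")
   case False
   hence "LU W = Ln x" using LnW[OF xC] unfolding LU_def Ln_def by blast
   thus ?thesis using Ln_card[OF x(1)] by simp
  next
   case True
   then obtain y where y: "y : CU W" "y ~= x" "col x y" using foot by blast
   have yP: "y : P" using CU_P[OF y(1)] .
   have "LU W = Ln x Un Ln y"
   proof
    show "Ln x Un Ln y \<subseteq> LU W" using LnW[OF xC] LnW[OF y(1)] by blast
    show "LU W \<subseteq> Ln x Un Ln y"
    proof
     fix k assume k: "k : LU W"
     show "k : Ln x Un Ln y"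
     proof (cases "x : k")
      case True thus ?thesis using LU_L[OF k] by (simp add: Ln_def)
     next
      case False
      obtain z where z: "z : CU W" "z : k" "z ~= x" using foot[OF k False] by blast
      have "z = y" using three_Pi[OF W4 x(1) yP CU_P[OF z(1)]] xC y z unfolding CU_def by blast
      thus ?thesis using LU_L[OF k] z(2) by (simp add: Ln_def)
     qed
    qed
   qed
   moreover obtain n where n: "n : L" "x : n" "y : n" using y(3) unfolding col_def by blast
   have "Ln x Int Ln y = {n}" using n line_unique[OF _ n(1) x(1) yP y(2)[symmetric]] unfolding Ln_def by blast
   ultimately have "card (LU W) + 1 = (q + 1) + (q + 1)" using card_Un_Int[OF Ln_finite Ln_finite, of x y] Ln_card[OF x(1)] Ln_card[OF yP] by simp
   thus ?thesis by simp
  qed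
 qed
qed

end

text \<open>Pairwise skew lines of a solid form a regulus. Bases of \<open>l\<close> and
  \<open>m\<close> are adapted to the polar form, so that \<open>regulus_line\<close> gives the
  lines \<open>f t\<close>. A line other than \<open>l\<close> is skew to \<open>l\<close>, hence
  has a vector in each of the cosets \<open>c + l\<close> and \<open>d + l\<close>; that these
  vectors are singular and mutually orthogonal makes them the generators of some
  \<open>f t\<close>.\<close>

lemma hex_solid:
 fixes W :: "(nat => 'a::{field,finite}) set"
 assumes W: "sub W 4" and l: "l : hex_lines" "l \<subseteq> W" and m: "m : hex_lines" "m \<subseteq> W" and lm: "l ~= m"
  and disj: "!!k k'. k : hex_lines ==> k \<subseteq> W ==> k' : hex_lines ==> k' \<subseteq> W ==> k ~= k' ==> k Int k' = {0}"
 shows "card {k : hex_lines. k \<subseteq> W} = CARD('a) + 1"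
proof -
 interpret F: flat "hex_lines :: (nat => 'a) set set" "CARD('a)" by (rule flat_hex_lines)
 have sl: "V.subspace l" "V.subspace m" "V.subspace W" using F.line_subspace l m sub_subspace[OF W] by auto
 \<comment> \<open>Otherwise \<open>O_hex\<close> produces a second line of \<open>W\<close> through
   \<open>a\<close>, against skewness.\<close>
 have nondeg: "EX v:m'. pol a v ~= 0" if h: "l' : hex_lines" "l' \<subseteq> W" "m' : hex_lines" "m' \<subseteq> W" "l' ~= m'" "a : l'" "a ~= 0" for l' m' a
 proof (rule ccontr)
  assume "~ ?thesis"
  hence "!!v. v : m' ==> pol a v = 0" by blast
  then obtain u where u: "u : m'" "u ~= 0" "sev a u" using O_hex[OF hex_line_mem(1,2)[OF h(1,6,6)] h(3)] by blast
  have ul: "u ~: l'" using disj[OF h(1-5)] u(1,2) by blast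
  hence us: "u ~: V.span {a}" using span_subset_iff[OF F.line_subspace[OF h(1)], of a] h(6) by blast
  have k: "V.span {a, u} : hex_lines" using hex_line_span[OF hex_line_mem(1)[OF h(1,6,6)] hex_line_mem(1)[OF h(3) u(1,1)] hex_line_mem(2)[OF h(1,6,6)] h(7) u(3) us] .
  have "V.span {a, u} \<subseteq> W" using V.span_minimal[OF _ sl(3), of "{a, u}"] h(2,4,6) u(1) by blast
  moreover have "V.span {a, u} ~= l'" using ul V.span_base[of u "{a, u}"] by blast
  ultimately have "V.span {a, u} Int l' = {0}" using disj[OF k _ h(1,2)] by blast
  thus False using h(6,7) V.span_base[of a "{a, u}"] by blast
 qed
 obtain a where a: "a : l" "a ~= 0" using sub_point[OF F.line_sub2[OF l(1)]] NV_nonzero by auto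
 obtain d0 where d0: "d0 : m" "pol a d0 ~= 0" using nondeg[OF l m lm a] by blast
 define d where "d = scl (inverse (pol a d0)) d0"
 have d: "d : m" "pol a d = 1" unfolding d_def using V.subspace_scale[OF sl(2) d0(1)] d0(2) by (simp_all add: pol_scl)
 have dn: "d ~= 0" using d(2) by (auto simp: pol_def)
 obtain v where v: "v : m" "v ~: V.span {d}" using sub_not_subset[OF F.line_sub2[OF m(1)] sub_span1[OF dn]] by auto
 define c where "c = scl 1 v + scl (- pol a v) d"
 have c: "c : m" unfolding c_def using V.subspace_add[OF sl(2)] V.subspace_scale[OF sl(2)] v(1) d(1) by blast
 have ac: "pol a c = 0" unfolding c_def pol_lin using d(2) by simp
 have cn: "c ~= 0" unfolding c_def using lin_zero[OF dn v(2), of "- pol a v" 1] by (simp add: add.commute)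
 obtain b0 where b0: "b0 : l" "pol c b0 ~= 0" using nondeg[OF m l lm[symmetric] c cn] by blast
 \<comment> \<open>Corrected by a multiple of \<open>a\<close> so that \<open>pol c b = -1\<close>
   and \<open>pol d b = 0\<close>, the normal form required by \<open>regulus_line\<close>.\<close>
 define b where "b = scl (- inverse (pol c b0)) b0 + scl (inverse (pol c b0) * pol d b0) a"
 have b: "b : l" unfolding b_def using V.subspace_add[OF sl(1)] V.subspace_scale[OF sl(1)] b0(1) a(1) by blast
 have bc: "pol c b = - 1" unfolding b_def pol_lin using ac b0(2) by (simp add: pol_sym[of c a])
 have bd: "pol d b = 0" unfolding b_def pol_lin using d(2) by (simp add: pol_sym[of d a])
 have va: "a : pvec 6" "quad a" "sev a b" "sev a a" using hex_line_mem[OF l(1) a(1)] b a(1) by auto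
 have vb: "b : pvec 6" "quad b" using hex_line_mem[OF l(1) b b] by auto
 have vc: "c : pvec 6" "quad c" "sev c d" using hex_line_mem[OF m(1) c d(1)] by auto
 have vd: "d : pvec 6" "quad d" using hex_line_mem[OF m(1) d(1,1)] by auto
 have bn: "b ~= 0" using bc by (auto simp: pol_def)
 have ab: "pol a b = 0" "pol a a = 0" "pol b b = 0" "pol c d = 0" "pol d d = 0" "pol c c = 0"
  using Z_quad(2)[OF va(1,2) a(2)] va(3,4) Z_quad(2)[OF vb bn sev_refl] Z_quad(2)[OF vc(1,2) cn] vc(3) sev_refl
   Z_quad(2)[OF vd dn sev_refl] by blast+
 note ps = pol_lin pol_linl ab ac bc bd d(2) pol_sym[of b a] pol_sym[of c a] pol_sym[of d a] pol_sym[of b c] pol_sym[of b d] pol_sym[of d c]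
 let ?u = "%t. scl 1 c + scl t a" and ?v = "%t. scl 1 d + scl t b"
 define f where "f t = V.span {?u t, ?v t}" for t
 have un: "?u t ~= 0" for t
 proof
  assume h: "?u t = 0"
  have "pol b (?u t) = - 1" by (simp only: ps) simp
  thus False unfolding h by (simp add: pol_def)
 qed
 have vn: "?v t ~: V.span {?u t}" for t
 proof
  assume "?v t : V.span {?u t}"
  then obtain r where r: "?v t = scl r (?u t)" unfolding span1_iff by blast
  have "pol a (?v t) = 1" by (simp only: ps) simp
  moreover have "pol a (scl r (?u t)) = 0" by (simp only: pol_scl ps) simp
  ultimately show False using r by simp
 qed
 have uv: "?u t : pvec 6" "?v t : pvec 6" "?u t : W" "?v t : W" for t
  using V.subspace_add[OF subspace_pvec V.subspace_scale[OF subspace_pvec vc(1)] V.subspace_scale[OF subspace_pvec va(1)]]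
   V.subspace_add[OF subspace_pvec V.subspace_scale[OF subspace_pvec vd(1)] V.subspace_scale[OF subspace_pvec vb(1)]]
   V.subspace_add[OF sl(3) V.subspace_scale[OF sl(3) subsetD[OF m(2) c]] V.subspace_scale[OF sl(3) subsetD[OF l(2) a(1)]]]
   V.subspace_add[OF sl(3) V.subspace_scale[OF sl(3) subsetD[OF m(2) d(1)]] V.subspace_scale[OF sl(3) subsetD[OF l(2) b]]] .
 have fK: "f t : hex_lines" for t unfolding f_def
 proof (rule hex_line_span[OF uv(1,2) _ un _ vn])
  show "quad (?u t)" using quad_lin[OF vc(2) va(2), of 1 t] ac pol_sym[of c a] by simp
  show "sev (?u t) (?v t)" using regulus_line[OF va(1,2) a(2) va(3) vc(3) ac _ d(2)] bc bd pol_sym[of b c] pol_sym[of b d] by simp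
 qed
 have fW: "f t \<subseteq> W" for t unfolding f_def using V.span_minimal[OF _ sl(3)] uv(3,4) by simp
 have uf: "?u t : f t" for t unfolding f_def using V.span_base[of "?u t" "{?u t, ?v t}"] by simp
 have inj: "inj f"
 proof (rule injI)
  fix t t' assume "f t = f t'"
  hence "?u t : f t'" using uf[of t] by simp
  then obtain r s where rs: "?u t = scl r (?u t') + scl s (?v t')" unfolding f_def span2_mem by blast
  have "pol a (?u t) = pol a (scl r (?u t') + scl s (?v t'))" "pol b (?u t) = pol b (scl r (?u t') + scl s (?v t'))"
   "pol d (?u t) = pol d (scl r (?u t') + scl s (?v t'))" using rs by simp_all
  thus "t = t'" by (simp only: ps) simp
 qed
 have bspan: "b ~: V.span {a}"
 proof
  assume "b : V.span {a}"
  then obtain r where "b = scl r a" unfolding span1_iff by blast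
  thus False using bc ac by (simp add: pol_scl pol_sym[of c a])
 qed
 have lab: "l = V.span {a, b}"
  using sub_eq[OF sub_span2[OF a(2) bspan] F.line_sub2[OF l(1)]] V.span_minimal[OF _ sl(1), of "{a, b}"] a(1) b by simp
 have conv: "k : insert l (range f)" if k: "k : hex_lines" "k \<subseteq> W" for k
 proof (cases "k = l")
  case True thus ?thesis by simp
 next
  case False
  have kl: "k Int l = {0}" using disj[OF k l False] .
  have kl0: "sub (k Int l) 0" using kl sub_0_zero by simp
  obtain e where e: "sub (k Int l) e" "sub (k \<oplus> l) (2 + 2 - e)" using sub_Int[OF F.line_sub2[OF k(1)] F.line_sub2[OF l(1)]] .
  have e0: "e = 0" using sub_unique[OF e(1) kl0] .
  have "k \<oplus> l = W" using sub_eq[OF e(2) W ssum_least[OF sl(3) k(2) l(2)]] e0 by simp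
  have dec: "EX al be. z + (scl al a + scl be b) : k" if z: "z : W" for z
  proof -
   have "z : k \<oplus> l" using z \<open>k \<oplus> l = W\<close> by simp
   then obtain x y where xy: "x : k" "y : l" "z = x + y" by (rule ssumE)
   obtain al be where "- y = scl al a + scl be b" using V.subspace_neg[OF sl(1) xy(2)] unfolding lab span2_mem by blast
   hence e: "scl al a + scl be b = - y" by simp
   have "z + (scl al a + scl be b) = x" unfolding e xy(3) by simp
   thus ?thesis using xy(1) by metis
  qed
  obtain al be where u: "c + (scl al a + scl be b) : k" using dec c m(2) by blast
  obtain ga de where w: "d + (scl ga a + scl de b) : k" using dec d(1) m(2) by blast
  let ?x = "scl al a + scl be b" and ?y = "scl ga a + scl de b"
  have qx: "quad ?x" "quad ?y" using quad_lin[OF va(2) vb(2)] ab(1) by simp_all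
  have "quad (scl 1 c + scl 1 ?x)" using hex_line_mem(2)[OF k(1) u u] by simp
  hence "pol c ?x = 0" using quad_lin[OF vc(2) qx(1), of 1 1] by simp
  hence be: "be = 0" by (simp only: ps) simp
  have "quad (scl 1 d + scl 1 ?y)" using hex_line_mem(2)[OF k(1) w w] by simp
  hence "pol d ?y = 0" using quad_lin[OF vd(2) qx(2), of 1 1] by simp
  hence ga: "ga = 0" by (simp only: ps) simp
  have u': "?u al : k" using u be by simp
  have w': "?v de : k" using w ga by simp
  have "pol (?u al) (?v de) = 0"
   using Z_quad(2)[OF uv(1) hex_line_mem(2)[OF k(1) u' u'] un hex_line_mem(3)[OF k(1) u' w']] .
  hence "al = de" by (simp only: ps) simp
  hence "f al \<subseteq> k" unfolding f_def using V.span_minimal[OF _ F.line_subspace[OF k(1)]] u' w' by simp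
  hence "f al = k" using sub_eq[OF F.line_sub2[OF fK] F.line_sub2[OF k(1)]] by simp
  thus ?thesis by blast
 qed
 have "{k : hex_lines. k \<subseteq> W} = insert l (range f)" using conv l fK fW by blast
 moreover have "l ~: range f"
 proof
  assume "l : range f"
  then obtain t where "l = f t" by blast
  hence "?u t : l" using uf[of t] by simp
  hence "?u t - scl t a : l" using V.subspace_diff[OF sl(1)] V.subspace_scale[OF sl(1) a(1)] by blast
  hence "c : l" by simp
  thus False using disj[OF l m lm] c cn by blast
 qed
 ultimately show ?thesis using card_image[OF inj] by simp
qed

section \<open>Transfer along the embedding\<close>

lemma emb_lin: "emb n A (scl s u + scl t v) = scl s (emb n A u) + scl t (emb n A v)"
 by (rule ext) (simp add: emb_def scl_def algebra_simps sum.distrib sum_distrib_left)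

text \<open>Each count in the ambient space is pulled back to the model along the embedding:
  \<open>pre W\<close> has dimension at most that of \<open>W\<close>, which is why the plane and
  solid counts were stated for smaller dimensions as well.\<close>

lemma natural_conditions:
 fixes L :: "(nat => 'a::{field,finite}) set set"
 assumes nat: "is_natural_hexagon n L" and q: "q = CARD('a)"
 shows "P : points n ==> card {l : L. P \<subseteq> l} : {0, q + 1}"
  "W : planes n ==> card {l : L. l \<subseteq> W} : {0, 1, q + 1}"
  "W : solids n ==> card {l : L. l \<subseteq> W} : {0, 1, q + 1, 2 * q + 1}"
  "W : psub n 5 ==> card {l : L. l \<subseteq> W} <= q^4 - q^3 + 3 * q^2 + 2 * q"
  "card L <= q^5 + q^4 + q^3 + q^2 + q + 1"
proof -
 let ?K = "hex_lines :: (nat => 'a) set set"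
 interpret F: hexagon ?K "CARD('a)" by (rule hexagon_hex_lines)
 obtain A where A: "inj_on (emb n A) (pvec 6)" "L = (%M. emb n A ` M) ` ?K" and sp: "V.span (\<Union>L) : psub n 6"
  using nat unfolding is_natural_hexagon_def by blast
 define J where "J = emb n A"
 have inj: "inj_on J (pvec 6)" and L: "L = (%M. J ` M) ` ?K" using A by (simp_all add: J_def)
 have J0: "J 0 = 0" unfolding J_def using emb_lin[of n A 0 0 0 0] by simp
 have Jadd: "J (u + v) = J u + J v" for u v unfolding J_def using emb_lin[of n A 1 u 1 v] by simp
 have Jscl: "J (scl c u) = scl c (J u)" for c u unfolding J_def using emb_lin[of n A c u 0 u] by simp
 have K6: "k \<subseteq> pvec 6" if "k : ?K" for k using hex_line_mem(1)[OF that] by blast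
 have injP: "inj_on (%M. J ` M) ?K"
 proof (rule inj_onI)
  fix k k' assume "k : ?K" "k' : ?K" "J ` k = J ` k'"
  thus "k = k'" using inj_on_image_eq_iff[OF inj K6 K6] by blast
 qed
 define pre where "pre W = {v : pvec 6. J v : W}" for W
 have cnt: "card {l : L. l \<subseteq> W} = card {k : ?K. k \<subseteq> pre W}" for W
 proof -
  have "{l : L. l \<subseteq> W} = (%M. J ` M) ` {k : ?K. k \<subseteq> pre W}"
   unfolding L pre_def using K6 by blast
  thus ?thesis using card_image[OF inj_on_subset[OF injP], of "{k : ?K. k \<subseteq> pre W}"] by simp
 qed
 have presub: "EX j<=k. sub (pre W) j" if W: "sub W k" for W k
 proof -
  have s: "V.subspace (pre W)"
   unfolding pre_def using sub_subspace[OF W] subspace_pvec[of 6] J0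
   by (auto intro!: V.subspaceI simp: Jadd Jscl intro: V.subspace_0 V.subspace_add V.subspace_scale)
  have f: "finite (pre W)" using finite_subset[OF _ finite_pvec, of "pre W" 6] by (auto simp: pre_def)
  obtain j where j: "sub (pre W) j" using sub_exists[OF s f] by blast
  have "card (pre W) <= card W"
   by (rule card_inj_on_le[of J]) (use inj sub_finite[OF W] in \<open>auto simp: pre_def inj_on_def\<close>)
  hence "CARD('a) ^ j <= CARD('a) ^ k" using sub_card[OF j] sub_card[OF W] by simp
  hence "j <= k" using power_le_imp_le_exp[OF card_field_gt_1[where 'a = 'a, unfolded One_nat_def[symmetric]]] by blast
  thus ?thesis using j by blast
 qed
 have LU: "{k : ?K. k \<subseteq> W} = F.LU W" for W by (simp add: F.LU_def)
 show "card {l : L. P \<subseteq> l} : {0, q + 1}" if P: "P : points n"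
 proof -
  have P1: "sub P 1" using P by (simp add: psub_iff)
  then obtain p where p: "p : P" "p : NV" using sub_point[OF P1] by auto
  have Pp: "P = V.span {p}" using sub_1_eq[OF P1 p(1) NV_nonzero[OF p(2)]] .
  have sL: "V.subspace l" if "l : L" for l
  proof -
   obtain k where k: "k : ?K" "l = J ` k" using \<open>l : L\<close> unfolding L by blast
   note sk = F.line_subspace[OF k(1)]
   show ?thesis unfolding k(2)
   proof (rule V.subspaceI)
    show "0 : J ` k" using V.subspace_0[OF sk] J0 by (metis image_eqI)
    show "x + y : J ` k" if "x : J ` k" "y : J ` k" for x y using that V.subspace_add[OF sk] by (metis (no_types, lifting) Jadd imageE imageI)
    show "scl c x : J ` k" if "x : J ` k" for c x using that V.subspace_scale[OF sk] by (metis (no_types, lifting) Jscl imageE imageI)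
   qed
  qed
  have e: "{l : L. P \<subseteq> l} = {l : L. p : l}" using span_subset_iff[OF sL] unfolding Pp by blast
  show ?thesis
  proof (cases "EX v:pvec 6. p = J v & quad v")
   case True
   then obtain v where v: "v : pvec 6" "p = J v" "quad v" by blast
   have "v ~= 0" using v(2) J0 NV_nonzero[OF p(2)] by auto
   moreover have "{l : L. p : l} = (%M. J ` M) ` {k : ?K. v : k}"
   proof
    show "{l : L. p : l} \<subseteq> (%M. J ` M) ` {k : ?K. v : k}"
    proof
     fix l assume "l : {l : L. p : l}"
     then obtain k w where k: "k : ?K" "l = J ` k" "w : k" "p = J w" unfolding L by blast
     have "w = v" using inj_onD[OF inj _ _ v(1), of w] k(4) v(2) K6[OF k(1)] k(3) by auto
     thus "l : (%M. J ` M) ` {k : ?K. v : k}" using k by blast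
    qed
    show "(%M. J ` M) ` {k : ?K. v : k} \<subseteq> {l : L. p : l}" unfolding L v(2) by blast
   qed
   ultimately show ?thesis using hex_lines_at(3)[OF v(1,3)] card_image[OF inj_on_subset[OF injP], of "{k : ?K. v : k}"] e q by simp
  next
   case False
   have z: "{l : L. p : l} = {}" using False hex_line_mem(1,2) unfolding L by blast
   show ?thesis unfolding e z by simp
  qed
 qed
 show "card {l : L. l \<subseteq> W} : {0, 1, q + 1}" if W: "W : planes n"
 proof -
  have "sub W 3" using W by (simp add: psub_iff numeral_3_eq_3 numeral_2_eq_2)
  then obtain j where "j <= 3" "sub (pre W) j" using presub by blast
  thus ?thesis unfolding cnt LU q by (intro F.LU_plane)
 qed
 show "card {l : L. l \<subseteq> W} : {0, 1, q + 1, 2 * q + 1}" if W: "W : solids n"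
 proof -
  have "sub W 4" using W by (simp add: psub_iff eval_nat_numeral)
  then obtain j where j: "j <= 4" "sub (pre W) j" using presub by blast
  have h: "card (F.LU (pre W)) : {0, 1, q + 1, 2 * q + 1} |
   (j = 4 & (EX l:F.LU (pre W). EX m:F.LU (pre W). l ~= m) & (ALL l:F.LU (pre W). ALL m:F.LU (pre W). l ~= m --> l Int m = {0}))"
   using F.LU_solid[OF j(2,1)] unfolding q .
  show ?thesis
  proof (cases "card (F.LU (pre W)) : {0, 1, q + 1, 2 * q + 1}")
   case True thus ?thesis unfolding cnt LU .
  next
   case False
   hence j4: "sub (pre W) 4" and d: "ALL l:F.LU (pre W). ALL m:F.LU (pre W). l ~= m --> l Int m = {0}" using h j(2) by auto
   obtain l m where lm: "l : F.LU (pre W)" "m : F.LU (pre W)" "l ~= m" using h False by blast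
   have "card {k : ?K. k \<subseteq> pre W} = CARD('a) + 1"
    by (rule hex_solid[OF j4 _ _ _ _ lm(3)]) (use lm d in \<open>auto simp: F.LU_def\<close>)
   thus ?thesis unfolding cnt q by simp
  qed
 qed
 have VVs: "V.subspace (J ` F.VV)"
 proof (rule V.subspaceI)
  show "0 : J ` F.VV" using V.subspace_0[OF F.VV_subspace] J0 by (metis image_eqI)
  show "x + y : J ` F.VV" if "x : J ` F.VV" "y : J ` F.VV" for x y using that V.subspace_add[OF F.VV_subspace] by (metis (no_types, lifting) Jadd imageE imageI)
  show "scl c x : J ` F.VV" if "x : J ` F.VV" for c x using that V.subspace_scale[OF F.VV_subspace] by (metis (no_types, lifting) Jscl imageE imageI)
 qed
 \<comment> \<open>The span of \<open>L\<close> has dimension 7 by hypothesis and is contained in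
   the image of \<open>F.VV\<close>.\<close>
 have VV7: "sub F.VV 7"
 proof (rule ccontr)
  assume n: "~ sub F.VV 7"
  have s7: "sub (V.span (\<Union>L)) 7" using sp by (simp add: psub_iff)
  have "sub F.VV 6" using n F.VV_dim by blast
  have "\<Union>L \<subseteq> J ` F.VV" unfolding L using F.VV_L by blast
  hence "V.span (\<Union>L) \<subseteq> J ` F.VV" by (rule V.span_minimal[OF _ VVs])
  hence "card (V.span (\<Union>L)) <= card (J ` F.VV)" using card_mono finite_imageI[OF F.VV_finite] by blast
  also have "... <= card F.VV" by (rule card_image_le[OF F.VV_finite])
  also have "... = CARD('a) ^ 6" using sub_card[OF \<open>sub F.VV 6\<close>] .
  finally have "CARD('a) ^ 7 <= CARD('a) ^ 6" unfolding sub_card[OF s7] .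
  thus False using power_le_imp_le_exp[OF card_field_gt_1[where 'a = 'a, unfolded One_nat_def[symmetric]], of 7 6] by simp
 qed
 show "card {l : L. l \<subseteq> W} <= q^4 - q^3 + 3 * q^2 + 2 * q" if W: "W : psub n 5"
 proof -
  have "sub W 6" using W by (simp add: psub_iff eval_nat_numeral)
  then obtain j where j: "j <= 6" "sub (pre W) j" using presub by blast
  obtain i where i: "sub (pre W Int F.VV) i" "i <= j" using sub_Int[OF j(2) VV7] .
  have VVS: "sub F.VV (Suc 6)" using VV7 by (simp add: eval_nat_numeral)
  \<comment> \<open>A subspace that may be too small is enlarged to a hyperplane of
    \<open>F.VV\<close>, to which \<open>hyper_bound\<close> applies.\<close>
  obtain H where H: "sub H 6" "pre W Int F.VV \<subseteq> H" "H \<subseteq> F.VV"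
   using hyps_exists[OF VVS i(1)] i(2) j(1) by (metis Int_lower2 order_trans)
  have "F.LU (pre W) \<subseteq> F.LU H" unfolding F.LU_def using F.VV_L H(2) by blast
  hence "card (F.LU (pre W)) <= card (F.LU H)" using card_mono[OF F.LU_finite] by blast
  also have "... <= q^3 + 2 * q^2 + 2 * q + 1" unfolding q using F.hyper_bound[of H] H VVS unfolding F.hyper_def by blast
  also have "... <= q^4 - q^3 + 3 * q^2 + 2 * q"
  proof -
   have q2: "q >= 2" using F.q_ge2 q by simp
   have "2 * q^3 <= q * q^3" using q2 by (rule mult_right_mono) simp
   hence "2 * q^3 <= q^4" by (simp add: eval_nat_numeral)
   moreover have "1 <= q^2" using q2 by simp
   ultimately show ?thesis by linarith
  qed
  finally show ?thesis unfolding cnt LU .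
 qed
 show "card L <= q^5 + q^4 + q^3 + q^2 + q + 1"
 proof -
  have "card L = card ?K" unfolding L by (rule card_image[OF injP])
  also have "... <= (q^3 + 1) * (q^2 + q + 1)" unfolding q by (rule F.total)
  also have "... = q^5 + q^4 + q^3 + q^2 + q + 1" by (simp add: algebra_simps eval_nat_numeral)
  finally show ?thesis .
 qed
qed

section \<open>Excluding pentagons\<close>

context flat
begin

definition dis where "dis a W = {l : LU W. l Int a = {0}}"

lemma dis_finite: "finite (dis a W)" using LU_finite by (simp add: dis_def)

text \<open>A line of \<open>W\<close> other than \<open>a\<close> is skew to \<open>a\<close> or
  meets it in a point of \<open>CU W\<close>, and each such point lies on \<open>q\<close> further
  lines, all in \<open>W\<close>.\<close>

lemma meet_count:
 assumes W: "V.subspace W" and a: "a : LU W"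
 shows "card (LU W) = 1 + q * card (a Int CU W) + card (dis a W)"
proof -
 have aL: "a : L" using LU_L[OF a] .
 let ?M = "\<Union>v\<in>a Int CU W. Ln v - {a}"
 have fC: "finite (a Int CU W)" using CU_finite by simp
 have cM: "card ?M = (\<Sum>v\<in>a Int CU W. q)"
 proof -
  have "card ?M = (\<Sum>v\<in>a Int CU W. card (Ln v - {a}))"
  proof (rule card_UN_disjoint[OF fC])
   show "ALL v:a Int CU W. finite (Ln v - {a})" using Ln_finite by blast
   show "ALL v:a Int CU W. ALL w:a Int CU W. v ~= w --> (Ln v - {a}) Int (Ln w - {a}) = {}"
   proof (intro ballI impI)
    fix v w assume h: "v : a Int CU W" "w : a Int CU W" "v ~= w"
    have "l = a" if "l : L" "v : l" "w : l" for l
     using line_unique[OF that(1) aL CU_P CU_P h(3) that(2,3)] h by blast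
    thus "(Ln v - {a}) Int (Ln w - {a}) = {}" unfolding Ln_def by blast
   qed
  qed
  also have "... = (\<Sum>v\<in>a Int CU W. q)"
  proof (rule sum.cong[OF refl])
   fix v assume v: "v : a Int CU W"
   hence "a : Ln v" using aL by (simp add: Ln_def)
   thus "card (Ln v - {a}) = q" using Ln_card[OF CU_P[of v W]] v by (simp add: Ln_finite)
  qed
  finally show ?thesis .
 qed
 have split: "LU W = ({a} Un ?M) Un dis a W"
 proof
  show "LU W \<subseteq> ({a} Un ?M) Un dis a W"
  proof
   fix l assume l: "l : LU W"
   show "l : ({a} Un ?M) Un dis a W"
   proof (cases "l = a | l Int a = {0}")
    case True thus ?thesis using l by (auto simp: dis_def)
   next
    case False
    obtain v where v: "v : P" "v : l" "v : a" using lines_meet[OF LU_L[OF l] aL] False by blast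
    have "v : CU W" using CU_I[OF v(1) l a _ v(2,3) W] False by blast
    thus ?thesis using v False LU_L[OF l] by (auto simp: Ln_def)
   qed
  qed
  show "({a} Un ?M) Un dis a W \<subseteq> LU W" using a CU_line by (auto simp: dis_def Ln_def)
 qed
 have ex0: "v ~: l" if "l : dis a W" "v : a Int CU W" for l v
  using that P_nonzero[OF CU_P] unfolding dis_def by blast
 have "a ~= {0}" using line_card[OF aL] by auto
 hence an: "a ~: dis a W" by (auto simp: dis_def)
 have d1: "({a} Un ?M) Int dis a W = {}" using an ex0 unfolding Ln_def by blast
 have fM: "finite ?M" using fC Ln_finite by blast
 have "card (LU W) = card ({a} Un ?M) + card (dis a W)"
  unfolding split using card_Un_disjoint[OF _ dis_finite d1] fM split by simp
 also have "card ({a} Un ?M) = 1 + card ?M" using card_Un_disjoint[of "{a}" ?M] fM by simp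
 finally show ?thesis using cM by (simp add: mult.commute)
qed

end

section \<open>Counting lines in a subspace of vector dimension five\<close>

locale five = flat +
 fixes U :: "(nat => 'a::{field,finite}) set"
 assumes U5: "sub U 5"
  and solid: "sub S 4 ==> S \<subseteq> U ==> card (LU S) : {0, 1, q + 1, 2 * q + 1}"
begin

abbreviation "C \<equiv> CU U"
definition D where "D v = card (nbr v Int C)"

lemma Us: "V.subspace U" using sub_subspace[OF U5] .
lemma D_le: "v : C ==> D v <= q + 1" unfolding D_def using D_bound[OF U5] by simp

text \<open>The line \<open>a\<close> rules out the count 0, and all other values allowed by (Sd)
  are 1 modulo \<open>q\<close>; so is the number of lines equal to or meeting
  \<open>a\<close>.\<close>

lemma dis_solid: assumes "a : LU U" "S : hyps U 4 a" shows "q dvd card (dis a S)"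
proof -
 have S: "sub S 4" "a \<subseteq> S" "S \<subseteq> U" using assms(2) by (auto simp: hyps_def)
 have aS: "a : LU S" using assms(1) S(2) by (simp add: LU_def)
 have e: "card (LU S) = 1 + q * card (a Int CU S) + card (dis a S)" using meet_count[OF sub_subspace[OF S(1)] aS] .
 have "card (LU S) = 1 | card (LU S) = q + 1 | card (LU S) = 2 * q + 1" using solid[OF S(1,3)] e by auto
 hence "q dvd q * card (a Int CU S) + card (dis a S)"
  unfolding e by (elim disjE) simp_all
 thus ?thesis using dvd_add_right_iff[of q "q * card (a Int CU S)"] by simp
qed

text \<open>A line skew to \<open>a\<close> lies in exactly one solid through \<open>a\<close>, the
  span of both.\<close>

lemma dis_U: assumes "a : LU U" shows "card (dis a U) = (\<Sum>S\<in>hyps U 4 a. card (dis a S))"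
proof -
 have a: "a : L" "a \<subseteq> U" using assms by (auto simp: LU_def)
 have sm: "sub (l \<oplus> a) 4" if h: "l : L" "l Int a = {0}" for l
 proof -
  obtain c where c: "sub (l Int a) c" "sub (l \<oplus> a) (2 + 2 - c)" using sub_Int[OF line_sub2[OF h(1)] line_sub2[OF a(1)]] .
  have "c = 0" using sub_unique[OF c(1)] h(2) sub_0_zero by simp
  thus ?thesis using c(2) by simp
 qed
 have u: "l \<oplus> a = S" if h: "l : L" "l Int a = {0}" "l \<subseteq> S" "S : hyps U 4 a" for l S
  using sub_eq[OF sm[OF h(1,2)], of S 4] ssum_least[of S l a] h(3,4) sub_subspace unfolding hyps_def by blast
 have "dis a U = (\<Union>S\<in>hyps U 4 a. dis a S)"
 proof
  show "dis a U \<subseteq> (\<Union>S\<in>hyps U 4 a. dis a S)"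
  proof
   fix l assume l: "l : dis a U"
   hence l': "l : L" "l \<subseteq> U" "l Int a = {0}" by (auto simp: dis_def LU_def)
   have i: "l \<subseteq> l \<oplus> a" "a \<subseteq> l \<oplus> a" using ssum_upper1[OF line_subspace[OF a(1)]] ssum_upper2[OF line_subspace[OF l'(1)]] by auto
   have "l \<oplus> a : hyps U 4 a" using sm[OF l'(1,3)] i(2) ssum_least[OF Us l'(2) a(2)] by (simp add: hyps_def)
   moreover have "l : dis a (l \<oplus> a)" using l' i(1) by (simp add: dis_def LU_def)
   ultimately show "l : (\<Union>S\<in>hyps U 4 a. dis a S)" by blast
  qed
  show "(\<Union>S\<in>hyps U 4 a. dis a S) \<subseteq> dis a U" by (auto simp: dis_def LU_def hyps_def)
 qed
 moreover have "card (\<Union>S\<in>hyps U 4 a. dis a S) = (\<Sum>S\<in>hyps U 4 a. card (dis a S))"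
 proof (rule card_UN_disjoint)
  show "finite (hyps U 4 a)" using finite_hyps[OF sub_finite[OF U5]] .
  show "ALL S:hyps U 4 a. finite (dis a S)" using dis_finite by blast
  show "ALL S:hyps U 4 a. ALL T:hyps U 4 a. S ~= T --> dis a S Int dis a T = {}"
  proof (intro ballI impI)
   fix S T assume h: "S : hyps U 4 a" "T : hyps U 4 a" "S ~= T"
   have "False" if l: "l : L" "l Int a = {0}" "l \<subseteq> S" "l \<subseteq> T" for l
    using u[OF l(1-3) h(1)] u[OF l(1,2,4) h(2)] h(3) by simp
   thus "dis a S Int dis a T = {}" unfolding dis_def LU_def by blast
  qed
 qed
 ultimately show ?thesis by simp
qed

lemma LU_mod: assumes "a : LU U" obtains k where "card (LU U) = 1 + q * k" "k >= card (a Int C)"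
proof -
 have "q dvd card (dis a U)" unfolding dis_U[OF assms] by (rule dvd_sum) (rule dis_solid[OF assms])
 then obtain j where j: "card (dis a U) = q * j" by (rule dvdE)
 have "card (LU U) = 1 + q * (card (a Int C) + j)" using meet_count[OF Us assms] j by (simp add: algebra_simps)
 thus ?thesis using that[of "card (a Int C) + j"] by simp
qed

text \<open>Two pencil planes in dimension 5 share a point, and this common neighbour has two lines
  in \<open>U\<close>.\<close>

lemma C_diam: assumes "u : C" "v : C" "~ col u v" shows "EX w:nbr u Int C. v : nbr w"
proof -
 have P: "u : P" "v : P" using CU_P assms by auto
 obtain c where c: "sub (Pi u Int Pi v) c" "3 + 3 <= 5 + c"
  using sub_Int_ge[OF Pi_sub[OF P(1)] Pi_sub[OF P(2)] U5] assms unfolding CU_def by blast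
 obtain w where w: "w : Pi u Int Pi v" "w : NV" using sub_point[OF c(1)] c(2) by auto
 have cw: "col u w" "col v w" using w(1) mem_Pi by auto
 have wP: "w : P" using Pi_P[of w u] w by blast
 obtain l k where l: "l : L" "u : l" "w : l" and k: "k : L" "v : k" "w : k" using cw unfolding col_def by blast
 have "l ~= k" using l k assms(3) colI by blast
 hence "w : C" using CU_I[OF wP CU_line[OF assms(1) l(1,2)] CU_line[OF assms(2) k(1,2)] _ l(3) k(3) Us] by blast
 moreover have "w ~= u" "v ~= w" using cw assms(3) col_sym col_refl by blast+
 ultimately show ?thesis using wP cw P col_sym unfolding nbr_def by blast
qed

lemma nbr_sym: "u : P ==> v : nbr u ==> u : nbr v" unfolding nbr_def using col_sym by blast

text \<open>By \<open>C_diam\<close> the set is covered by \<open>u\<close>, its neighbours and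
  theirs; the term \<open>D v - 1\<close> takes into account that \<open>u\<close> is among the
  neighbours of \<open>v\<close>.\<close>

lemma C_bound: assumes u: "u : C" shows "card C <= 1 + D u + (\<Sum>v\<in>nbr u Int C. D v - 1)"
proof -
 let ?N = "nbr u Int C"
 have fN: "finite ?N" using nbr_finite by simp
 have "C \<subseteq> insert u (?N Un (\<Union>v\<in>?N. (nbr v Int C) - {u}))"
 proof
  fix v assume v: "v : C"
  show "v : insert u (?N Un (\<Union>v\<in>?N. (nbr v Int C) - {u}))"
  proof (cases "v = u | col u v")
   case True thus ?thesis using v CU_P[OF v] unfolding nbr_def by blast
  next
   case False thus ?thesis using C_diam[OF u v] v by blast
  qed
 qed
 moreover have fin: "finite (insert u (?N Un (\<Union>v\<in>?N. (nbr v Int C) - {u})))" using fN nbr_finite by auto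
 ultimately have "card C <= card (insert u (?N Un (\<Union>v\<in>?N. (nbr v Int C) - {u})))" by (rule card_mono[rotated])
 also have "... <= Suc (card (?N Un (\<Union>v\<in>?N. (nbr v Int C) - {u})))" by (rule card_insert_le_m1) simp_all
 also have "card (?N Un (\<Union>v\<in>?N. (nbr v Int C) - {u})) <= card ?N + card (\<Union>v\<in>?N. (nbr v Int C) - {u})" by (rule card_Un_le)
 also have "card (\<Union>v\<in>?N. (nbr v Int C) - {u}) <= (\<Sum>v\<in>?N. card ((nbr v Int C) - {u}))" by (rule card_UN_le[OF fN])
 also have "... = (\<Sum>v\<in>?N. D v - 1)"
 proof (rule sum.cong[OF refl])
  fix v assume "v : ?N"
  hence "u : nbr v Int C" using nbr_sym[OF CU_P[OF u]] u by blast
  thus "card ((nbr v Int C) - {u}) = D v - 1" unfolding D_def by (rule card_Diff_singleton)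
 qed
 finally show ?thesis unfolding D_def by simp
qed

lemma solids_card: "card (hyps U 4 {0}) = q^4 + q^3 + q^2 + q + 1"
 using card_hyps[of U 4 "{0}" 0, OF _ sub_0_zero] U5 V.subspace_0[OF Us] q_card by (simp add: eval_nat_numeral ac_simps)

lemma solids_line: assumes "l : LU U" shows "card (hyps U 4 l) = q^2 + q + 1"
 using card_hyps[of U 4 l 2] U5 line_sub2[OF LU_L[OF assms]] assms q_card by (simp add: eval_nat_numeral LU_def)

text \<open>The span of the two lines has dimension 2, 3 or 4, which decides the number of solids
  through it. These numbers give the second moment in \<open>sum_lines2\<close>.\<close>

lemma solids_pair: assumes "l : LU U" "k : LU U"
 shows "card (hyps U 4 (l \<oplus> k)) = 1 + (if l = k then q^2 + q else if l Int k ~= {0} then q else 0)"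
proof -
 have lk: "l : L" "k : L" "l \<oplus> k \<subseteq> U" using assms ssum_least[OF Us] by (auto simp: LU_def)
 obtain c where c: "sub (l Int k) c" "sub (l \<oplus> k) (2 + 2 - c)" "c <= 2" using sub_Int[OF line_sub2[OF lk(1)] line_sub2[OF lk(2)]] .
 have h: "card (hyps U 4 (l \<oplus> k)) = (\<Sum>i<Suc 4 - (4 - c). q ^ i)" using card_hyps[OF _ _ lk(3), of 4 "4 - c"] U5 c(2) q_card by simp
 have c0: "c = 0 \<longleftrightarrow> l Int k = {0}" using sub_0 c(1) sub_unique[OF c(1)] sub_0_zero by metis
 have c2: "c = 2 \<longleftrightarrow> l = k"
 proof
  assume "c = 2"
  hence "l Int k = l" "l Int k = k" using sub_eq[OF c(1) line_sub2[OF lk(1)]] sub_eq[OF c(1) line_sub2[OF lk(2)]] by auto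
  thus "l = k" by blast
 next
  assume "l = k" thus "c = 2" using sub_unique[OF c(1)] line_sub2[OF lk(1)] by simp
 qed
 consider "c = 0" | "c = 1" | "c = 2" using c(3) by linarith
 thus ?thesis
 proof cases
  case 1 thus ?thesis using h c0 c2 by (simp add: eval_nat_numeral)
 next
  case 2 thus ?thesis using h c0 c2 by (simp add: eval_nat_numeral)
 next
  case 3 thus ?thesis using h c0 c2 by (simp add: eval_nat_numeral)
 qed
qed

lemma meeting_pairs: "card {(l, k). l : LU U & k : LU U & l ~= k & l Int k ~= {0}} = card C * (q * (q + 1))"
proof -
 let ?B = "%v. SIGMA l:Ln v. (Ln v - {l})"
 have "{(l, k). l : LU U & k : LU U & l ~= k & l Int k ~= {0}} = (\<Union>v\<in>C. ?B v)"
 proof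
  show "{(l, k). l : LU U & k : LU U & l ~= k & l Int k ~= {0}} \<subseteq> (\<Union>v\<in>C. ?B v)"
  proof
   fix p assume "p : {(l, k). l : LU U & k : LU U & l ~= k & l Int k ~= {0}}"
   then obtain l k where p: "p = (l, k)" "l : LU U" "k : LU U" "l ~= k" "l Int k ~= {0}" by blast
   obtain v where v: "v : P" "v : l" "v : k" using lines_meet[OF LU_L[OF p(2)] LU_L[OF p(3)] p(4,5)] .
   have "v : C" using CU_I[OF v(1) p(2-4) v(2,3) Us] .
   moreover have "p : ?B v" using p v LU_L by (simp add: Ln_def)
   ultimately show "p : (\<Union>v\<in>C. ?B v)" by blast
  qed
  show "(\<Union>v\<in>C. ?B v) \<subseteq> {(l, k). l : LU U & k : LU U & l ~= k & l Int k ~= {0}}"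
  proof
   fix p assume "p : (\<Union>v\<in>C. ?B v)"
   then obtain v l k where p: "v : C" "p = (l, k)" "l : L" "k : L" "v : l" "v : k" "l ~= k" unfolding Ln_def by blast
   have "l Int k ~= {0}" using p(5,6) P_nonzero[OF CU_P[OF p(1)]] by blast
   thus "p : {(l, k). l : LU U & k : LU U & l ~= k & l Int k ~= {0}}" using p CU_line[OF p(1)] by blast
  qed
 qed
 moreover have "card (\<Union>v\<in>C. ?B v) = (\<Sum>v\<in>C. card (?B v))"
 proof (rule card_UN_disjoint[OF CU_finite])
  show "ALL v:C. finite (?B v)" using Ln_finite by simp
  show "ALL v:C. ALL w:C. v ~= w --> ?B v Int ?B w = {}"
  proof (intro ballI impI)
   fix v w assume vw: "v : C" "w : C" "v ~= w"
   have "l = k" if "l : L" "k : L" "v : l" "v : k" "w : l" "w : k" for l k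
    using line_unique[OF that(1,2) CU_P[OF vw(1)] CU_P[OF vw(2)] vw(3)] that by blast
   thus "?B v Int ?B w = {}" unfolding Ln_def by blast
  qed
 qed
 moreover have "card (?B v) = q * (q + 1)" if "v : C" for v
  using Ln_card[OF CU_P[OF that]] Ln_finite[of v] by (simp add: card_SigmaI card_Diff_singleton mult.commute)
 ultimately show ?thesis by simp
qed

lemma sum_lines: "(\<Sum>S\<in>hyps U 4 {0}. card (LU S)) = card (LU U) * (q^2 + q + 1)"
proof -
 have fH: "finite (hyps U 4 {0})" using finite_hyps[OF sub_finite[OF U5]] .
 have "(\<Sum>S\<in>hyps U 4 {0}. card (LU S)) = (\<Sum>S\<in>hyps U 4 {0}. \<Sum>l\<in>LU U. if l \<subseteq> S then 1 else 0)"
 proof (rule sum.cong[OF refl])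
  fix S assume "S : hyps U 4 {0}"
  hence "LU S = {l : LU U. l \<subseteq> S}" by (auto simp: hyps_def LU_def)
  thus "card (LU S) = (\<Sum>l\<in>LU U. if l \<subseteq> S then 1 else 0)" using LU_finite by (simp add: sum.If_cases Int_def)
 qed
 also have "... = (\<Sum>l\<in>LU U. \<Sum>S\<in>hyps U 4 {0}. if l \<subseteq> S then 1 else 0)" by (rule sum.swap)
 also have "... = (\<Sum>l\<in>LU U. q^2 + q + 1)"
 proof (rule sum.cong[OF refl])
  fix l assume l: "l : LU U"
  have "{S : hyps U 4 {0}. l \<subseteq> S} = hyps U 4 l" using V.subspace_0[OF sub_subspace] by (auto simp: hyps_def)
  thus "(\<Sum>S\<in>hyps U 4 {0}. if l \<subseteq> S then 1 else 0) = q^2 + q + 1" using solids_line[OF l] fH by (simp add: sum.If_cases Int_def)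
 qed
 finally show ?thesis by simp
qed

lemma sum_lines2: "(\<Sum>S\<in>hyps U 4 {0}. card (LU S) ^ 2) = card (LU U) ^ 2 + card (LU U) * (q^2 + q) + q * (card C * (q * (q + 1)))"
proof -
 let ?H = "hyps U 4 {0}" and ?X = "LU U \<times> LU U"
 have fH: "finite ?H" using finite_hyps[OF sub_finite[OF U5]] .
 have fX: "finite ?X" using LU_finite by simp
 have "(\<Sum>S\<in>?H. card (LU S) ^ 2) = (\<Sum>S\<in>?H. \<Sum>p\<in>?X. if fst p \<subseteq> S & snd p \<subseteq> S then 1 else 0)"
 proof (rule sum.cong[OF refl])
  fix S assume "S : ?H"
  hence "LU S \<times> LU S = {p : ?X. fst p \<subseteq> S & snd p \<subseteq> S}" by (auto simp: hyps_def LU_def)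
  hence "card {p : ?X. fst p \<subseteq> S & snd p \<subseteq> S} = card (LU S) ^ 2" by (metis card_cartesian_product power2_eq_square)
  thus "card (LU S) ^ 2 = (\<Sum>p\<in>?X. if fst p \<subseteq> S & snd p \<subseteq> S then 1 else 0)" using fX by (simp add: sum.If_cases Int_def)
 qed
 also have "... = (\<Sum>p\<in>?X. \<Sum>S\<in>?H. if fst p \<subseteq> S & snd p \<subseteq> S then 1 else 0)" by (rule sum.swap)
 also have "... = (\<Sum>p\<in>?X. 1 + ((if fst p = snd p then q^2 + q else 0) + (if fst p ~= snd p & fst p Int snd p ~= {0} then q else 0)))"
 proof (rule sum.cong[OF refl])
  fix p assume p: "p : ?X"
  hence lk: "fst p : LU U" "snd p : LU U" by auto
  have "{S : ?H. fst p \<subseteq> S & snd p \<subseteq> S} = hyps U 4 (fst p \<oplus> snd p)"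
  proof (intro set_eqI iffI)
   fix S assume "S : {S : ?H. fst p \<subseteq> S & snd p \<subseteq> S}"
   hence s: "sub S 4" "S \<subseteq> U" "fst p \<subseteq> S" "snd p \<subseteq> S" by (auto simp: hyps_def)
   show "S : hyps U 4 (fst p \<oplus> snd p)" using ssum_least[OF sub_subspace[OF s(1)] s(3,4)] s(1,2) by (simp add: hyps_def)
  next
   fix S assume "S : hyps U 4 (fst p \<oplus> snd p)"
   hence s: "sub S 4" "S \<subseteq> U" "fst p \<oplus> snd p \<subseteq> S" by (auto simp: hyps_def)
   show "S : {S : ?H. fst p \<subseteq> S & snd p \<subseteq> S}"
    using ssum_subset_iff[OF line_subspace[OF LU_L[OF lk(1)]] line_subspace[OF LU_L[OF lk(2)]] sub_subspace[OF s(1)]]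
     V.subspace_0[OF sub_subspace[OF s(1)]] s by (simp add: hyps_def)
  qed
  hence "(\<Sum>S\<in>?H. if fst p \<subseteq> S & snd p \<subseteq> S then 1 else 0) = card (hyps U 4 (fst p \<oplus> snd p))" using fH by (simp add: sum.If_cases Int_def)
  thus "(\<Sum>S\<in>?H. if fst p \<subseteq> S & snd p \<subseteq> S then 1 else 0) = 1 + ((if fst p = snd p then q^2 + q else 0) + (if fst p ~= snd p & fst p Int snd p ~= {0} then q else 0))"
   using solids_pair[OF lk] by simp
 qed
 also have "... = card ?X + (card {p : ?X. fst p = snd p} * (q^2 + q) + card {p : ?X. fst p ~= snd p & fst p Int snd p ~= {0}} * q)"
  unfolding sum.distrib sum.inter_filter[OF fX, symmetric] by (simp add: distrib_left)
 also have "{p : ?X. fst p ~= snd p & fst p Int snd p ~= {0}} = {(l, k). l : LU U & k : LU U & l ~= k & l Int k ~= {0}}" (is "?Y = ?Y'")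
 proof (rule set_eqI)
  fix p show "p : ?Y \<longleftrightarrow> p : ?Y'" by (cases p) simp
 qed
 also have "card {p : ?X. fst p = snd p} = card (LU U)"
 proof -
  have "{p : ?X. fst p = snd p} = (%l. (l, l)) ` LU U" by auto
  thus ?thesis by (simp add: card_image inj_on_def)
 qed
 finally have e: "(\<Sum>S\<in>?H. card (LU S) ^ 2) = card ?X + (card (LU U) * (q^2 + q) + card C * (q * (q + 1)) * q)" unfolding meeting_pairs .
 show ?thesis unfolding e by (simp add: card_cartesian_product power2_eq_square)
qed

text \<open>Adjacent points of \<open>C\<close> span a solid with two full pencils, thus with
  \<open>2 * q + 1\<close> lines; conversely a solid has at most two pencils, hence accounts for at
  most two ordered pairs.\<close>

lemma adj_pairs: "(\<Sum>v\<in>C. D v) <= 2 * card {S : hyps U 4 {0}. card (LU S) = 2 * q + 1}"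
proof -
 let ?Q = "{S : hyps U 4 {0}. card (LU S) = 2 * q + 1}" and ?X = "SIGMA u:C. nbr u Int C"
 let ?f = "%S. {p : ?X. Pi (fst p) \<oplus> Pi (snd p) = S}"
 have fQ: "finite ?Q" using finite_hyps[OF sub_finite[OF U5]] by simp
 have fX: "finite ?X" using CU_finite nbr_finite by simp
 have S: "sub (Pi u \<oplus> Pi v) 4" "Pi u \<subseteq> Pi u \<oplus> Pi v" "Pi v \<subseteq> Pi u \<oplus> Pi v" "Pi u \<oplus> Pi v \<subseteq> U" if "u : C" "v : nbr u Int C" for u v
 proof -
  have P: "u : P" "v : P" "v : nbr u" using that CU_P by auto
  show "sub (Pi u \<oplus> Pi v) 4" using adj_solid[OF P(1,3)] .
  show "Pi u \<subseteq> Pi u \<oplus> Pi v" "Pi v \<subseteq> Pi u \<oplus> Pi v" using ssum_upper1[OF Pi_subspace[OF P(2)]] ssum_upper2[OF Pi_subspace[OF P(1)]] by auto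
  show "Pi u \<oplus> Pi v \<subseteq> U" using ssum_least[OF Us] that unfolding CU_def by blast
 qed
 have "?X \<subseteq> (\<Union>S\<in>?Q. ?f S)"
 proof
  fix p assume p: "p : ?X"
  obtain u v where uv: "p = (u, v)" "u : C" "v : nbr u Int C" using p by auto
  note S' = S[OF uv(2,3)]
  have P: "u : P" "v : P" "u ~= v" "col u v" using uv CU_P by (auto simp: nbr_def)
  obtain n where n: "n : L" "u : n" "v : n" using P(4) unfolding col_def by blast
  have "Ln u Int Ln v = {n}" using n line_unique[OF _ n(1) P(1,2,3)] unfolding Ln_def by blast
  hence "card (Ln u Un Ln v) = 2 * q + 1" using card_Un_Int[OF Ln_finite Ln_finite, of u v] Ln_card[OF P(1)] Ln_card[OF P(2)] by simp
  moreover have "Ln u Un Ln v \<subseteq> LU (Pi u \<oplus> Pi v)" using S'(2,3) Ln_Pi unfolding Ln_def LU_def by blast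
  ultimately have "card (LU (Pi u \<oplus> Pi v)) >= 2 * q + 1" using card_mono[OF LU_finite] by metis
  hence "card (LU (Pi u \<oplus> Pi v)) = 2 * q + 1" using solid[OF S'(1,4)] q_ge2 by auto
  hence "Pi u \<oplus> Pi v : ?Q" using S' V.subspace_0[OF sub_subspace[OF S'(1)]] by (simp add: hyps_def)
  moreover have "p : ?f (Pi u \<oplus> Pi v)" using p uv(1) by simp
  ultimately show "p : (\<Union>S\<in>?Q. ?f S)" by blast
 qed
 hence "card ?X <= card (\<Union>S\<in>?Q. ?f S)" by (rule card_mono[rotated]) (use fQ fX in auto)
 also have "... <= (\<Sum>S\<in>?Q. card (?f S))" by (rule card_UN_le[OF fQ])
 also have "... <= (\<Sum>S\<in>?Q. 2)"
 proof (rule sum_mono)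
  fix S assume "S : ?Q"
  show "card (?f S) <= 2"
  proof (cases "?f S = {}")
   case True show ?thesis unfolding True by simp
  next
   case False
   then obtain p where "p : ?f S" by blast
   then obtain u v where uv: "u : C" "v : nbr u Int C" "Pi u \<oplus> Pi v = S" by auto
   have "?f S \<subseteq> {(u, v), (v, u)}"
   proof
    fix r assume "r : ?f S"
    then obtain u' v' where r: "r = (u', v')" "u' : C" "v' : nbr u' Int C" "Pi u' \<oplus> Pi v' = S" by auto
    have "w = u | w = v" if "w : C" "Pi w \<subseteq> S" for w
     using three_Pi[OF S(1)[OF uv(1,2)], of u v w] S(2,3)[OF uv(1,2)] that uv CU_P unfolding nbr_def by blast
    hence "u' = u | u' = v" "v' = u | v' = v" using S(2,3)[OF r(2,3)] r by blast+
    moreover have "u' ~= v'" using r(3) by (auto simp: nbr_def)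
    ultimately show "r : {(u, v), (v, u)}" using r(1) by auto
   qed
   hence "card (?f S) <= card {(u, v), (v, u)}" by (rule card_mono[rotated]) simp
   also have "... <= 2" using card_length[of "[(u, v), (v, u)]"] by simp
   finally show ?thesis .
  qed
 qed
 finally have "card ?X <= 2 * card ?Q" by (simp add: mult.commute)
 moreover have "card ?X = (\<Sum>v\<in>C. D v)" unfolding D_def by (rule card_SigmaI) (use CU_finite nbr_finite in auto)
 ultimately show ?thesis by simp
qed

text \<open>For a solid with \<open>i\<close> lines the product \<open>(i - 1) * (i - q - 1)\<close>
  is nonnegative: it is 0 at 1 and \<open>q + 1\<close>, it is \<open>q + 1\<close> at 0, and
  \<open>2 * q^2\<close> at \<open>2 * q + 1\<close>. Its sum over all solids is evaluated by the
  two moments and bounded below by the solids from \<open>adj_pairs\<close>.\<close>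

lemma F_ineq: "int (card (LU U)) * (int q^3 + 2 * int q^2 + 2 * int q + 2 - int (card (LU U)))
  <= (int q + 1) * (int q^4 + int q^3 + int q^2 + int q + 1) + int q^2 * (\<Sum>v\<in>C. int q + 1 - int (D v))"
proof -
 let ?H = "hyps U 4 {0}" and ?i = "%S. int (card (LU S))" and ?Q = "{S : hyps U 4 {0}. card (LU S) = 2 * q + 1}"
 let ?m = "int (card (LU U))" and ?c = "int (card C)" and ?q = "int q"
 have fH: "finite ?H" using finite_hyps[OF sub_finite[OF U5]] .
 have "(\<Sum>S\<in>?H. (if S : ?Q then 2 * ?q^2 else 0)) <= (\<Sum>S\<in>?H. ?i S ^ 2 - (?q + 2) * ?i S + (?q + 1))"
 proof (rule sum_mono)
  fix S assume S: "S : ?H"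
  hence "card (LU S) : {0, 1, q + 1, 2 * q + 1}" using solid unfolding hyps_def by blast
  moreover have "?i S ^ 2 - (?q + 2) * ?i S + (?q + 1) = (?i S - 1) * (?i S - ?q - 1)" by (simp add: algebra_simps power2_eq_square)
  ultimately show "(if S : ?Q then 2 * ?q^2 else 0) <= ?i S ^ 2 - (?q + 2) * ?i S + (?q + 1)"
   using S q_ge2 by (auto simp: power2_eq_square)
 qed
 moreover have "(\<Sum>S\<in>?H. (if S : ?Q then 2 * ?q^2 else 0)) = int (2 * card ?Q) * ?q^2"
 proof -
  have "(\<Sum>S\<in>?H. (if S : ?Q then 2 * ?q^2 else 0)) = (\<Sum>S\<in>{S : ?H. S : ?Q}. 2 * ?q^2)" by (rule sum.inter_filter[OF fH, symmetric])
  also have "{S : ?H. S : ?Q} = ?Q" by blast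
  also have "(\<Sum>S\<in>?Q. 2 * ?q^2) = int (2 * card ?Q) * ?q^2" by simp
  finally show ?thesis .
 qed
 moreover have "int (\<Sum>v\<in>C. D v) * ?q^2 <= int (2 * card ?Q) * ?q^2"
 proof (rule mult_right_mono)
  show "int (\<Sum>v\<in>C. D v) <= int (2 * card ?Q)" using adj_pairs by (simp only: of_nat_le_iff)
 qed simp
 moreover have "(\<Sum>S\<in>?H. ?i S ^ 2 - (?q + 2) * ?i S + (?q + 1)) =
   (?m^2 + ?m * (?q^2 + ?q) + ?q * (?c * (?q * (?q + 1)))) - (?q + 2) * (?m * (?q^2 + ?q + 1)) + (?q^4 + ?q^3 + ?q^2 + ?q + 1) * (?q + 1)"
 proof -
  have 1: "(\<Sum>S\<in>?H. ?i S) = ?m * (?q^2 + ?q + 1)" using arg_cong[OF sum_lines, of int] by (simp only: of_nat_sum of_nat_mult of_nat_add of_nat_power of_nat_1)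
  have 2: "(\<Sum>S\<in>?H. ?i S ^ 2) = ?m^2 + ?m * (?q^2 + ?q) + ?q * (?c * (?q * (?q + 1)))" using arg_cong[OF sum_lines2, of int] by (simp only: of_nat_sum of_nat_mult of_nat_add of_nat_power of_nat_1)
  show ?thesis using solids_card 1 2 by (simp add: sum.distrib sum_subtractf sum_distrib_left[symmetric])
 qed
 moreover have "(\<Sum>v\<in>C. ?q + 1 - int (D v)) = ?c * (?q + 1) - int (\<Sum>v\<in>C. D v)" by (simp add: sum_subtractf)
 ultimately have "int (\<Sum>v\<in>C. D v) * ?q^2 <= (?m^2 + ?m * (?q^2 + ?q) + ?q * (?c * (?q * (?q + 1)))) - (?q + 2) * (?m * (?q^2 + ?q + 1)) + (?q^4 + ?q^3 + ?q^2 + ?q + 1) * (?q + 1)"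
  and e: "(\<Sum>v\<in>C. ?q + 1 - int (D v)) = ?c * (?q + 1) - int (\<Sum>v\<in>C. D v)" by linarith+
 thus ?thesis unfolding e by (simp add: algebra_simps eval_nat_numeral)
qed

end

text \<open>The left side of \<open>F\<close> is a concave quadratic in \<open>m\<close>, so it
  exceeds the right side on a whole interval once it does so at both ends. At the lower end this is
  the condition \<open>d < q^3 - q\<close>, at the upper end it is the hypothesis
  \<open>M\<close>.\<close>

lemma no_fit:
 fixes q m M d :: int
 assumes F: "m * (q^3 + 2 * q^2 + 2 * q + 2 - m) <= (q + 1) * (q^4 + q^3 + q^2 + q + 1) + q^2 * d"
  and q: "q >= 2" and m: "2 * q^2 + 2 * q + 1 <= m" "m <= M" and d: "d < q^3 - q"
  and M: "(q + 1) * (q^4 + q^3 + q^2 + q + 1) + q^2 * d < M * (q^3 + 2 * q^2 + 2 * q + 2 - M)"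
 shows False
proof -
 let ?B = "q^3 + 2 * q^2 + 2 * q + 2" and ?m = "2 * q^2 + 2 * q + 1"
 let ?K = "(q + 1) * (q^4 + q^3 + q^2 + q + 1) + q^2 * d"
 have "q^2 * d < q^2 * (q^3 - q)" using d q by simp
 moreover have "?m * (?B - ?m) = (q + 1) * (q^4 + q^3 + q^2 + q + 1) + q^2 * (q^3 - q)" by algebra
 ultimately have l: "?K < ?m * (?B - ?m)" by linarith
 show False
 proof (cases "?B - m - ?m >= 0")
  case True
  have "m * (?B - m) - ?m * (?B - ?m) = (m - ?m) * (?B - m - ?m)" by algebra
  moreover have "(m - ?m) * (?B - m - ?m) >= 0" using True m(1) by simp
  ultimately show False using l F by linarith
 next
  case False
  have "m * (?B - m) - M * (?B - M) = (M - m) * (m + M - ?B)" by algebra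
  moreover have "m + M - ?B >= 0" using False m by linarith
  moreover from this have "(M - m) * (m + M - ?B) >= 0" using m(2) by simp
  ultimately show False using M F by linarith
 qed
qed

lemma quarter: "4 * (a * (b - a)) <= (b :: int)^2"
proof -
 have "b^2 - 4 * (a * (b - a)) = (b - 2 * a)^2" by algebra
 moreover have "(b - 2 * a)^2 >= 0" by simp
 ultimately show ?thesis by linarith
qed

text \<open>All degrees are at most \<open>q\<close>: \<open>d\<close> is the least of them,
  \<open>c\<close> the size of \<open>C\<close> and \<open>e\<close> the total defect.
  \<open>T\<close> caps \<open>m\<close> at \<open>q^3 + 1 + q * d\<close>, where the quadratic
  still exceeds the right side, so \<open>no_fit\<close> applies.\<close>

lemma case_small:
 fixes q m c d e :: int
 assumes F: "m * (q^3 + 2 * q^2 + 2 * q + 2 - m) <= (q + 1) * (q^4 + q^3 + q^2 + q + 1) + q^2 * e"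
  and T: "m * (q^2 + q + 1) <= (q^3 + 1) * (q^2 + q + 1) + q * (q + 1) * c"
  and q: "q >= 2" and m: "2 * q^2 + 2 * q + 1 <= m" and c: "5 <= c" "c <= 1 + q * d" and d: "0 <= d" "d <= q"
  and e: "e <= (1 + q * d) * (q + 1 - d)"
 shows False
proof -
 have q0: "q >= 0" using q by simp
 have p: "0 <= q * d" using q0 d(1) by simp
 have qq: "q^2 >= 2 * q" using mult_right_mono[OF q q0] by (simp add: power2_eq_square)
 have mM: "m <= q^3 + 1 + q * d"
 proof (rule ccontr)
  assume "~ ?thesis"
  hence "q^3 + 2 + q * d <= m" by simp
  hence "(q^3 + 2 + q * d) * (q^2 + q + 1) <= m * (q^2 + q + 1)" using q0 by (intro mult_right_mono) simp_all
  also have "... <= (q^3 + 1) * (q^2 + q + 1) + q * (q + 1) * (1 + q * d)" using T mult_left_mono[OF c(2), of "q * (q + 1)"] q0 by simp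
  finally have "1 + q * d <= 0" by (simp add: algebra_simps power2_eq_square)
  thus False using p by simp
 qed
 have dl: "(1 + q * d) * (q + 1 - d) < q^3 - q"
 proof (cases "q = 2")
  case True
  hence "d = 2" using c d by simp
  thus ?thesis using True by simp
 next
  case False
  hence q3: "q >= 3" using q by simp
  have "q * (4 * (d * (q + 1 - d))) <= q * (q + 1)^2" using quarter[of d "q + 1"] q0 by (rule mult_left_mono)
  moreover have "4 * ((1 + q * d) * (q + 1 - d)) = q * (4 * (d * (q + 1 - d))) + 4 * (q + 1 - d)" by algebra
  ultimately have "4 * ((1 + q * d) * (q + 1 - d)) <= q * (q + 1)^2 + 4 * (q + 1 - d)" by (simp only: add_le_cancel_right)
  also have "... <= q * (q + 1)^2 + 4 * (q + 1)" using d(1) by simp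
  also have "q * (q + 1)^2 + 4 * (q + 1) < 4 * (q^3 - q)"
  proof -
   have "q^2 >= 3 * q" using mult_right_mono[OF q3 q0] by (simp add: power2_eq_square)
   hence "3 * q^2 - 5 * q - 4 > 0" using q3 by linarith
   hence "(q + 1) * (3 * q^2 - 5 * q - 4) > 0" using q0 by simp
   moreover have "4 * (q^3 - q) - (q * (q + 1)^2 + 4 * (q + 1)) = (q + 1) * (3 * q^2 - 5 * q - 4)" by algebra
   ultimately show ?thesis by linarith
  qed
  finally show ?thesis by simp
 qed
 let ?M = "q^3 + 1 + q * d" and ?E = "(1 + q * d) * (q + 1 - d)"
 have "?M * (q^3 + 2 * q^2 + 2 * q + 2 - ?M) - ((q + 1) * (q^4 + q^3 + q^2 + q + 1) + q^2 * ?E)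
   = q^2 * ((q - 2) * ((q - d)^2 + (q - d) + 1) + ((q - d)^2 - (q - d) + 1))" by algebra
 moreover have "(q - 2) * ((q - d)^2 + (q - d) + 1) >= 0" using q d by simp
 moreover have "(q - d)^2 - (q - d) + 1 > 0"
 proof -
  have e: "4 * ((q - d)^2 - (q - d) + 1) = (2 * (q - d) - 1)^2 + 3" by algebra
  have "4 * ((q - d)^2 - (q - d) + 1) > 0" unfolding e by (rule add_nonneg_pos) simp_all
  thus ?thesis by (rule zero_less_mult_pos) simp
 qed
 ultimately have hi: "(q + 1) * (q^4 + q^3 + q^2 + q + 1) + q^2 * ?E < ?M * (q^3 + 2 * q^2 + 2 * q + 2 - ?M)"
  using q by (smt (verit, best) mult_pos_pos zero_less_power)
 have "q^2 * e <= q^2 * ?E" using e by (rule mult_left_mono) simp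
 hence "m * (q^3 + 2 * q^2 + 2 * q + 2 - m) <= (q + 1) * (q^4 + q^3 + q^2 + q + 1) + q^2 * ?E" using F by linarith
 thus False using no_fit[OF _ q m mM dl hi] by blast
qed

text \<open>Here \<open>j\<close> is the defect of the least degree. The congruence
  \<open>m = 1 + q * k\<close> is used to round down the cap that \<open>T\<close> puts on
  \<open>m\<close>, and \<open>no_fit\<close> excludes everything up to it.\<close>

lemma case_large:
 fixes q m c j e k :: int
 assumes F: "m * (q^3 + 2 * q^2 + 2 * q + 2 - m) <= (q + 1) * (q^4 + q^3 + q^2 + q + 1) + q^2 * e"
  and T: "m * (q^2 + q + 1) <= (q^3 + 1) * (q^2 + q + 1) + q * (q + 1) * c"
  and q: "q >= 2" and m: "2 * q^2 + 2 * q + 1 <= m" and k: "m = 1 + q * k" and c: "5 <= c" "c <= 1 + (q + 1 - j) * (q + 1)"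
  and j: "2 <= j" "j <= q + 1" and e: "e <= (c - 1) * j"
 shows False
proof -
 have q0: "q >= 0" using q by simp
 have mM: "k <= q^2 + q + 1 - j"
 proof (rule ccontr)
  assume "~ ?thesis"
  hence "q^2 + q + 2 - j <= k" by simp
  hence "q * (q^2 + q + 2 - j) <= q * k" using q0 by (rule mult_left_mono)
  hence "1 + q * (q^2 + q + 2 - j) <= m" using k by simp
  hence "(1 + q * (q^2 + q + 2 - j)) * (q^2 + q + 1) <= m * (q^2 + q + 1)" using q0 by (intro mult_right_mono) simp_all
  also have "... <= (q^3 + 1) * (q^2 + q + 1) + q * (q + 1) * (1 + (q + 1 - j) * (q + 1))" using T mult_left_mono[OF c(2), of "q * (q + 1)"] q0 by simp
  finally have "(1 + q * (q^2 + q + 2 - j)) * (q^2 + q + 1) - ((q^3 + 1) * (q^2 + q + 1) + q * (q + 1) * (1 + (q + 1 - j) * (q + 1))) <= 0" by simp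
  moreover have "(1 + q * (q^2 + q + 2 - j)) * (q^2 + q + 1) - ((q^3 + 1) * (q^2 + q + 1) + q * (q + 1) * (1 + (q + 1 - j) * (q + 1))) = q^2 * (j - 1)"
   by algebra
  moreover have "q^2 * (j - 1) > 0" using q j(1) by simp
  ultimately show False by linarith
 qed
 hence mM: "m <= q^3 + q^2 + q + 1 - q * j"
  using mult_left_mono[OF mM q0] k by (simp add: algebra_simps eval_nat_numeral)
 let ?E = "(q + 1) * (q + 1 - j) * j"
 have eE: "e <= ?E"
 proof -
  have "(c - 1) * j <= ((q + 1 - j) * (q + 1)) * j" using c(2) j(1) by (intro mult_right_mono) simp_all
  also have "... = ?E" by algebra
  finally show ?thesis using e by simp
 qed
 have dl: "?E < q^3 - q"
 proof (cases "q = 2")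
  case True
  have "(3 - j) * 3 >= 4" using c True by simp
  thus ?thesis using j(1) by simp
 next
  case False
  hence q3: "q >= 3" using q by simp
  have "(q + 1) * (4 * (j * (q + 1 - j))) <= (q + 1) * (q + 1)^2" using quarter[of j "q + 1"] q0 by (intro mult_left_mono) simp_all
  moreover have "4 * ?E = (q + 1) * (4 * (j * (q + 1 - j)))" by algebra
  ultimately have "4 * ?E <= (q + 1) * (q + 1)^2" by (simp only:)
  also have "(q + 1) * (q + 1)^2 < 4 * (q^3 - q)"
  proof -
   have "q^2 >= 3 * q" using mult_right_mono[OF q3 q0] by (simp add: power2_eq_square)
   hence "3 * q^2 - 6 * q - 1 > 0" using q3 by linarith
   hence "(q + 1) * (3 * q^2 - 6 * q - 1) > 0" using q0 by simp
   moreover have "4 * (q^3 - q) - (q + 1) * (q + 1)^2 = (q + 1) * (3 * q^2 - 6 * q - 1)" by algebra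
   ultimately show ?thesis by linarith
  qed
  finally show ?thesis by (rule mult_less_cancel_left_pos[THEN iffD1, rotated]) simp
 qed
 let ?M = "q^3 + q^2 + q + 1 - q * j"
 have "?M * (q^3 + 2 * q^2 + 2 * q + 2 - ?M) - ((q + 1) * (q^4 + q^3 + q^2 + q + 1) + q^2 * ?E) = q^2 * ((j - 2) * (j * q - 1) + (q - 1))" by algebra
 moreover have "j * q >= 1" using mult_mono[of 1 j 1 q] q j by simp
 moreover from this have "(j - 2) * (j * q - 1) >= 0" using j(1) by simp
 ultimately have hi: "(q + 1) * (q^4 + q^3 + q^2 + q + 1) + q^2 * ?E < ?M * (q^3 + 2 * q^2 + 2 * q + 2 - ?M)"
  using q by (smt (verit, best) mult_pos_pos zero_less_power)
 have "q^2 * e <= q^2 * ?E" using eE by (rule mult_left_mono) simp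
 hence "m * (q^3 + 2 * q^2 + 2 * q + 2 - m) <= (q + 1) * (q^4 + q^3 + q^2 + q + 1) + q^2 * ?E" using F by linarith
 thus False using no_fit[OF _ q m mM dl hi] by blast
qed

text \<open>The least degree is \<open>q\<close>. \<open>T\<close> caps \<open>m\<close> at
  \<open>q^3 + q^2 + q + 1\<close>. A smaller value congruent to 1 modulo \<open>q\<close> is
  excluded by \<open>no_fit\<close>, so the cap is attained, and then \<open>T\<close> forces the
  maximal \<open>c\<close>.\<close>

lemma case_one:
 fixes q m c e k :: int
 assumes F: "m * (q^3 + 2 * q^2 + 2 * q + 2 - m) <= (q + 1) * (q^4 + q^3 + q^2 + q + 1) + q^2 * e"
  and T: "m * (q^2 + q + 1) <= (q^3 + 1) * (q^2 + q + 1) + q * (q + 1) * c"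
  and q: "q >= 2" and m: "2 * q^2 + 2 * q + 1 <= m" and k: "m = 1 + q * k" and c: "c <= q^2 + q + 1" and e: "e <= 1 + q^2"
 shows "m = q^3 + q^2 + q + 1 & c = q^2 + q + 1"
proof -
 have q0: "q >= 0" using q by simp
 have th: "q^2 + q + 1 > 0" using q by (simp add: add_pos_pos)
 have qq: "q^2 >= 2 * q" using mult_right_mono[OF q q0] by (simp add: power2_eq_square)
 have "m * (q^2 + q + 1) <= (q^3 + q^2 + q + 1) * (q^2 + q + 1)"
  using T mult_left_mono[OF c, of "q * (q + 1)"] q0 by (simp add: algebra_simps power2_eq_square)
 hence m1: "m <= q^3 + q^2 + q + 1" using th by simp
 have m2: "m = q^3 + q^2 + q + 1"
 proof (rule ccontr)
  assume n: "m ~= q^3 + q^2 + q + 1"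
  have "k <= q^2 + q"
  proof (rule ccontr)
   assume "~ ?thesis"
   hence "q * (q^2 + q + 1) <= q * k" using q0 by (intro mult_left_mono) simp_all
   moreover have "q * (q^2 + q + 1) = q^3 + q^2 + q" by algebra
   ultimately show False using n k m1 by linarith
  qed
  hence "q * k <= q * (q^2 + q)" using q0 by (rule mult_left_mono)
  moreover have "q * (q^2 + q) = q^3 + q^2" by algebra
  ultimately have mM: "m <= q^3 + q^2 + 1" using k by linarith
  have q3: "q^3 >= 2 * q^2" using mult_right_mono[OF q, of "q^2"] by (simp add: eval_nat_numeral)
  have dl: "1 + q^2 < q^3 - q" using q3 qq q by linarith
  let ?M = "q^3 + q^2 + 1"
  have "?M * (q^3 + 2 * q^2 + 2 * q + 2 - ?M) - ((q + 1) * (q^4 + q^3 + q^2 + q + 1) + q^2 * (1 + q^2)) = q^2 * (q - 1)" by algebra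
  moreover have "q^2 * (q - 1) > 0" using q by simp
  ultimately have hi: "(q + 1) * (q^4 + q^3 + q^2 + q + 1) + q^2 * (1 + q^2) < ?M * (q^3 + 2 * q^2 + 2 * q + 2 - ?M)" by linarith
  have "q^2 * e <= q^2 * (1 + q^2)" using e by (rule mult_left_mono) simp
  hence "m * (q^3 + 2 * q^2 + 2 * q + 2 - m) <= (q + 1) * (q^4 + q^3 + q^2 + q + 1) + q^2 * (1 + q^2)" using F by linarith
  thus False using no_fit[OF _ q m mM dl hi] by blast
 qed
 have "q * (q + 1) * (q^2 + q + 1) <= q * (q + 1) * c" using T unfolding m2 by (simp add: algebra_simps power2_eq_square)
 hence "q^2 + q + 1 <= c" using q by simp
 thus ?thesis using m2 c by simp
qed

text \<open>All degrees equal \<open>q + 1\<close>, so the defect term disappears. Again only the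
  largest value of \<open>m\<close> in its residue class survives, and \<open>T\<close> with this
  value forces the maximal \<open>c\<close>.\<close>

lemma case_zero:
 fixes q m c e k :: int
 assumes F: "m * (q^3 + 2 * q^2 + 2 * q + 2 - m) <= (q + 1) * (q^4 + q^3 + q^2 + q + 1) + q^2 * e"
  and T: "m * (q^2 + q + 1) <= (q^3 + 1) * (q^2 + q + 1) + q * (q + 1) * c"
  and q: "q >= 2" and m: "2 * q^2 + 2 * q + 1 <= m" and k: "m = 1 + q * k" and c: "c <= q^2 + 2 * q + 2" and e: "e <= 0"
 shows "m = q^3 + q^2 + 2 * q + 1 & c = q^2 + 2 * q + 2"
proof -
 have q0: "q >= 0" using q by simp
 have q20: "q^2 > 0" using q by simp
 have qq: "q^2 >= 2 * q" using mult_right_mono[OF q q0] by (simp add: power2_eq_square)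
 have k1: "k <= q^2 + q + 2"
 proof (rule ccontr)
  assume "~ ?thesis"
  hence "q * (q^2 + q + 3) <= q * k" using q0 by (intro mult_left_mono) simp_all
  hence "1 + q * (q^2 + q + 3) <= m" using k by simp
  hence "(1 + q * (q^2 + q + 3)) * (q^2 + q + 1) <= m * (q^2 + q + 1)" using q0 by (intro mult_right_mono) simp_all
  also have "... <= (q^3 + 1) * (q^2 + q + 1) + q * (q + 1) * (q^2 + 2 * q + 2)" using T mult_left_mono[OF c, of "q * (q + 1)"] q0 by simp
  finally have h: "(1 + q * (q^2 + q + 3)) * (q^2 + q + 1) <= (q^3 + 1) * (q^2 + q + 1) + q * (q + 1) * (q^2 + 2 * q + 2)" .
  have "(1 + q * (q^2 + q + 3)) * (q^2 + q + 1) - ((q^3 + 1) * (q^2 + q + 1) + q * (q + 1) * (q^2 + 2 * q + 2)) = q * (q^2 + 1)" by algebra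
  moreover have "q * (q^2 + 1) > 0" using q q20 by simp
  ultimately show False using h by linarith
 qed
 have k2: "k = q^2 + q + 2"
 proof (rule ccontr)
  assume "k ~= q^2 + q + 2"
  hence "q * k <= q * (q^2 + q + 1)" using k1 q0 by (intro mult_left_mono) simp_all
  moreover have "q * (q^2 + q + 1) = q^3 + q^2 + q" by algebra
  ultimately have mM: "m <= q^3 + q^2 + q + 1" using k by linarith
  have q3: "q^3 >= 2 * q^2" using mult_right_mono[OF q, of "q^2"] by (simp add: eval_nat_numeral)
  have dl: "0 < q^3 - q" using q3 qq q by linarith
  let ?M = "q^3 + q^2 + q + 1"
  have "?M * (q^3 + 2 * q^2 + 2 * q + 2 - ?M) - ((q + 1) * (q^4 + q^3 + q^2 + q + 1) + q^2 * 0) = q^2 * (q + 1)" by algebra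
  moreover have "q^2 * (q + 1) > 0" using q by simp
  ultimately have hi: "(q + 1) * (q^4 + q^3 + q^2 + q + 1) + q^2 * 0 < ?M * (q^3 + 2 * q^2 + 2 * q + 2 - ?M)" by linarith
  have "q^2 * e <= q^2 * 0" using e by (rule mult_left_mono) simp
  hence "m * (q^3 + 2 * q^2 + 2 * q + 2 - m) <= (q + 1) * (q^4 + q^3 + q^2 + q + 1) + q^2 * 0" using F by linarith
  thus False using no_fit[OF _ q m mM dl hi] by blast
 qed
 have m2: "m = q^3 + q^2 + 2 * q + 1" using k k2 by algebra
 have "q^2 + 2 * q + 2 <= c"
 proof (rule ccontr)
  assume "~ ?thesis"
  hence "q * (q + 1) * c <= q * (q + 1) * (q^2 + 2 * q + 1)" using q0 by (intro mult_left_mono) simp_all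
  hence h: "m * (q^2 + q + 1) <= (q^3 + 1) * (q^2 + q + 1) + q * (q + 1) * (q^2 + 2 * q + 1)" using T by linarith
  have "(q^3 + q^2 + 2 * q + 1) * (q^2 + q + 1) - ((q^3 + 1) * (q^2 + q + 1) + q * (q + 1) * (q^2 + 2 * q + 1)) = q" by (simp add: algebra_simps eval_nat_numeral)
  thus False using h q unfolding m2 by linarith
 qed
 thus ?thesis using m2 c by simp
qed

text \<open>The consequences of a pentagon on which the counting relies: five interior points and
  the lower bound on lines, both derived in \<open>pentagon_free\<close>.\<close>

locale heavy = five +
 assumes c5: "5 <= card C" and low: "2 * q^2 + 2 * q + 1 <= card (LU U)" and total: "card L <= (q^3 + 1) * (q^2 + q + 1)"
begin

lemma T_ineq: "card (LU U) * (q^2 + q + 1) <= (q^3 + 1) * (q^2 + q + 1) + q * (q + 1) * card C"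
proof -
 have "q * (card (LU U) * (q + 1)) = q * card (BU U) + q * ((q + 1) * card C)" using flags_U[OF Us] by (simp add: distrib_left)
 moreover have "card (LU U) * (q^2 + q + 1) = card (LU U) + q * (card (LU U) * (q + 1))" by (simp add: algebra_simps power2_eq_square)
 moreover have "q * (q + 1) * card C = q * ((q + 1) * card C)" by (rule mult.assoc)
 ultimately show ?thesis using total_ge[OF Us] total by linarith
qed

text \<open>The point \<open>u\<close> of least degree decides. If no degree reaches
  \<open>q + 1\<close>, \<open>case_small\<close> gives a contradiction; otherwise some point has no
  defect, and the defect \<open>j\<close> of \<open>u\<close> separates the remaining cases.\<close>

lemma extremal: "(card (LU U) = q^3 + q^2 + q + 1 & card C = q^2 + q + 1) | (card (LU U) = q^3 + q^2 + 2 * q + 1 & card C = q^2 + 2 * q + 2)"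
proof -
 let ?m = "int (card (LU U))" and ?c = "int (card C)" and ?q = "int q"
 define e where "e = (\<Sum>v\<in>C. ?q + 1 - int (D v))"
 note F = F_ineq[folded e_def]
 have T: "?m * (?q^2 + ?q + 1) <= (?q^3 + 1) * (?q^2 + ?q + 1) + ?q * (?q + 1) * ?c"
 proof -
  have "int (card (LU U) * (q^2 + q + 1)) <= int ((q^3 + 1) * (q^2 + q + 1) + q * (q + 1) * card C)" using T_ineq by (simp only: of_nat_le_iff)
  thus ?thesis by (simp only: of_nat_mult of_nat_add of_nat_power of_nat_1)
 qed
 have q: "?q >= 2" using q_ge2 by simp
 have m: "2 * ?q^2 + 2 * ?q + 1 <= ?m"
 proof -
  have "int (2 * q^2 + 2 * q + 1) <= ?m" using low by (simp only: of_nat_le_iff)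
  thus ?thesis by simp
 qed
 have c: "5 <= ?c" using c5 by simp
 have Cn: "C ~= {}" using c5 by auto
 obtain a where a: "a : LU U" using low by fastforce
 obtain k' where k': "card (LU U) = 1 + q * k'" using LU_mod[OF a] .
 have k: "?m = 1 + ?q * int k'" using k' by simp
 obtain u where u: "u : C" "!!v. v : C ==> D u <= D v"
  using ex_has_least_nat[of "%v. v : C" _ D] Cn by blast
 have fN: "finite (nbr u Int C)" using nbr_finite by simp
 show ?thesis
 proof (cases "ALL v:C. D v <= q")
  case True
  have "(\<Sum>v\<in>nbr u Int C. D v - 1) <= (\<Sum>v\<in>nbr u Int C. q - 1)" using True by (intro sum_mono) auto
  also have "... = D u * (q - 1)" by (simp add: D_def)
  finally have "card C <= 1 + D u + D u * (q - 1)" using C_bound[OF u(1)] by simp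
  also have "... = 1 + q * D u" using q_ge2 by (cases q) (simp_all add: algebra_simps)
  finally have "int (card C) <= int (1 + q * D u)" by (simp only: of_nat_le_iff)
  hence c2: "?c <= 1 + ?q * int (D u)" by simp
  have d: "0 <= int (D u)" "int (D u) <= ?q" using True u(1) by simp_all
  have "e <= (\<Sum>v\<in>C. ?q + 1 - int (D u))" unfolding e_def using u(2) by (intro sum_mono) simp
  also have "... = ?c * (?q + 1 - int (D u))" by simp
  also have "... <= (1 + ?q * int (D u)) * (?q + 1 - int (D u))" using c2 d(2) by (intro mult_right_mono) simp_all
  finally have "e <= (1 + ?q * int (D u)) * (?q + 1 - int (D u))" .
  thus ?thesis using case_small[OF F T q m c c2 d] by blast
 next
  case False
  then obtain w where w: "w : C" "D w = q + 1" using D_le by (metis le_Suc_eq Suc_eq_plus1)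
  define j where "j = ?q + 1 - int (D u)"
  have j1: "0 <= j" "j <= ?q + 1" using D_le[OF u(1)] by (simp_all add: j_def)
  have "(\<Sum>v\<in>nbr u Int C. D v - 1) <= (\<Sum>v\<in>nbr u Int C. q)" using D_le by (intro sum_mono) fastforce
  hence "card C <= 1 + D u + D u * q" using C_bound[OF u(1)] by (simp add: D_def)
  hence "int (card C) <= int (1 + D u + D u * q)" by (simp only: of_nat_le_iff)
  hence c2: "?c <= 1 + (?q + 1 - j) * (?q + 1)" by (simp add: j_def algebra_simps)
  have e2: "e <= (?c - 1) * j"
  proof -
   \<comment> \<open>The point \<open>w\<close> of full degree contributes no defect, which saves
     one term.\<close>
   have "e = (?q + 1 - int (D w)) + (\<Sum>v\<in>C - {w}. ?q + 1 - int (D v))" unfolding e_def by (rule sum.remove[OF CU_finite w(1)])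
   also have "... <= 0 + (\<Sum>v\<in>C - {w}. j)" using w(2) u(2) by (intro add_mono sum_mono) (simp_all add: j_def)
   also have "... = (?c - 1) * j" using w(1) c by (simp add: CU_finite of_nat_diff)
   finally show ?thesis .
  qed
  consider "2 <= j" | "j = 1" | "j = 0" using j1 by linarith
  thus ?thesis
  proof cases
   case 1 thus ?thesis using case_large[OF F T q m k c c2 1 j1(2) e2] by blast
  next
   case 2
   hence Du: "D u = q" unfolding j_def by simp
   let ?t = "%v. if v : nbr u & D v = q + 1 then 1 else (0 :: nat)"
   \<comment> \<open>Number of neighbours of \<open>u\<close> in \<open>C\<close> with full degree.
     They raise the bound on \<open>card C\<close> by \<open>tau\<close> and lower the bound on the
     total defect by as much, so \<open>e\<close> is at most \<open>1 + q^2\<close> in any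
     case.\<close>
   define tau where "tau = (\<Sum>v\<in>nbr u Int C. ?t v)"
   have "(\<Sum>v\<in>nbr u Int C. D v - 1) <= (\<Sum>v\<in>nbr u Int C. (q - 1) + ?t v)"
   proof (rule sum_mono)
    fix v assume v: "v : nbr u Int C"
    have "D v = q | D v = q + 1" using D_le[of v] u(2)[of v] Du v by fastforce
    thus "D v - 1 <= (q - 1) + ?t v" using v q_ge2 by auto
   qed
   also have "... = q * (q - 1) + tau" using Du by (simp add: sum.distrib tau_def D_def)
   finally have "card C <= 1 + q + (q * (q - 1) + tau)" using C_bound[OF u(1)] Du by simp
   hence c1: "card C <= 1 + q^2 + tau" using q_ge2 by (cases q) (simp_all add: power2_eq_square algebra_simps)
   have "tau <= (\<Sum>v\<in>nbr u Int C. 1)" unfolding tau_def by (intro sum_mono) simp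
   hence tq: "tau <= q" using Du by (simp add: D_def)
   have "e + int tau <= ?c"
   proof -
    have "int tau = (\<Sum>v\<in>nbr u Int C. int (?t v))" unfolding tau_def by (simp only: of_nat_sum)
    also have "... <= (\<Sum>v\<in>C. int (?t v))" by (rule sum_mono2[OF CU_finite]) simp_all
    finally have "e + int tau <= (\<Sum>v\<in>C. (?q + 1 - int (D v)) + int (?t v))" by (simp add: e_def sum.distrib)
    also have "... <= (\<Sum>v\<in>C. 1)"
    proof (rule sum_mono)
     fix v assume v: "v : C"
     have "D v = q | D v = q + 1" using D_le[OF v] u(2)[OF v] Du by fastforce
     thus "(?q + 1 - int (D v)) + int (?t v) <= 1" by auto
    qed
    finally show ?thesis by simp
   qed
   moreover have c3: "?c <= 1 + ?q^2 + int tau"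
   proof -
    have "int (card C) <= int (1 + q^2 + tau)" using c1 by (simp only: of_nat_le_iff)
    thus ?thesis by simp
   qed
   ultimately have "e <= 1 + ?q^2" by linarith
   moreover have "?c <= ?q^2 + ?q + 1" using c3 tq by linarith
   ultimately have "?m = ?q^3 + ?q^2 + ?q + 1 & ?c = ?q^2 + ?q + 1" using case_one[OF F T q m k] by blast
   hence "int (card (LU U)) = int (q^3 + q^2 + q + 1)" "int (card C) = int (q^2 + q + 1)" by simp_all
   hence "card (LU U) = q^3 + q^2 + q + 1 & card C = q^2 + q + 1" unfolding of_nat_eq_iff by blast
   thus ?thesis by blast
  next
   case 3
   have "e <= 0" using e2 3 by simp
   moreover have "?c <= ?q^2 + 2 * ?q + 2" using c2 3 by (simp add: power2_eq_square algebra_simps)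
   ultimately have "?m = ?q^3 + ?q^2 + 2 * ?q + 1 & ?c = ?q^2 + 2 * ?q + 2" using case_zero[OF F T q m k] by blast
   hence "int (card (LU U)) = int (q^3 + q^2 + 2 * q + 1)" "int (card C) = int (q^2 + 2 * q + 2)" by simp_all
   hence "card (LU U) = q^3 + q^2 + 2 * q + 1 & card C = q^2 + 2 * q + 2" unfolding of_nat_eq_iff by blast
   thus ?thesis by blast
  qed
 qed
qed

end

section \<open>Points outside the span\<close>

locale heavy6 = heavy +
 assumes hp: "sub H 6 ==> H \<subseteq> VV ==> card (LU H) <= q^4 - q^3 + 3 * q^2 + 2 * q" and UV: "U \<subseteq> VV"
begin

definition Out where "Out = {y : P. y ~: U}"
definition miss where "miss = {l : L. l Int U = {0}}"
definition bad where "bad = {y : Out. EX l:miss. y : l}"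
definition A where "A v = Pi v Int NV - U"

lemma fin: "finite Out" "finite miss" "finite bad"
 using finite_P finite_L by (simp_all add: Out_def miss_def bad_def)

lemma BU_card: "card (BU U) + (q + 1) * card C = (q + 1) * card (LU U)" using flags_U[OF Us] by (simp add: mult.commute)

text \<open>In both extremal cases \<open>C\<close> and \<open>BU U\<close> together have as many
  points as \<open>U\<close>. The number \<open>b\<close> is the gap left below (To), hence a bound
  for the lines that miss \<open>U\<close>.\<close>

lemma sizes:
 obtains b where "card (LU U) + q * card (BU U) + b = (q^3 + 1) * (q^2 + q + 1)" "b = 0 | b = q^2"
  "card (BU U) + card C = q^4 + q^3 + q^2 + q + 1" "card (LU U) >= q^3 + q^2 + q + 1" "b = q^2 ==> card (LU U) = q^3 + q^2 + 2 * q + 1"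
proof -
 have q3: "q^3 >= 1" using q_ge2 by simp
 consider "card (LU U) = q^3 + q^2 + q + 1" "card C = q^2 + q + 1" | "card (LU U) = q^3 + q^2 + 2 * q + 1" "card C = q^2 + 2 * q + 2" using extremal by blast
 thus ?thesis
 proof cases
  case 1
  have b: "card (BU U) = (q + 1) * q^3" using BU_card 1 by (simp add: algebra_simps eval_nat_numeral)
  show ?thesis by (rule that[of 0]) (use 1 b q_ge2 in \<open>simp_all add: algebra_simps eval_nat_numeral\<close>)
 next
  case 2
  have b: "card (BU U) + (q + 1) = (q + 1) * q^3" using BU_card 2 by (simp add: algebra_simps eval_nat_numeral)
  hence b1: "q * card (BU U) + q * (q + 1) = q * ((q + 1) * q^3)" by (metis distrib_left)
  show ?thesis
  proof (rule that[of "q^2"])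
   show "card (LU U) + q * card (BU U) + q^2 = (q^3 + 1) * (q^2 + q + 1)" using b1 2(1) by (simp add: algebra_simps eval_nat_numeral)
   show "card (BU U) + card C = q^4 + q^3 + q^2 + q + 1" using b 2(2) by (simp add: algebra_simps eval_nat_numeral)
  qed (use 2 in simp_all)
 qed
qed

lemma U_points: "U Int NV = C Un BU U"
proof -
 obtain b where b: "card (BU U) + card C = q^4 + q^3 + q^2 + q + 1" using sizes .
 have "C Int BU U = {}"
 proof (rule ccontr)
  assume "~ ?thesis"
  then obtain x where x: "x : C" "x : BU U" by blast
  obtain l where "l : LU U" "x : l" using BU_line[OF x(2)] .
  thus False using LU_degree(2)[OF CU_P[OF x(1)] _ _ Us] x by blast
 qed
 hence "card (C Un BU U) = card C + card (BU U)" by (rule card_Un_disjoint[OF CU_finite BU_finite])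
 moreover have "card (U Int NV) = q^4 + q^3 + q^2 + q + 1" using card_sub_NV[OF U5] q_card by (simp add: eval_nat_numeral ac_simps)
 moreover have "C Un BU U \<subseteq> U Int NV" using CU_mem CU_P BU_mem P_NV by blast
 ultimately show ?thesis using card_subset_eq[of "U Int NV" "C Un BU U"] b sub_finite[OF U5] by simp
qed

lemma U_P: "x : U ==> x : NV ==> x : P" using U_points CU_P BU_mem by blast

lemma line_U: assumes "l : L" "l ~: miss" obtains u where "u : P" "u : l" "u : U"
proof -
 have "0 : l Int U" using V.subspace_0[OF line_subspace[OF assms(1)]] V.subspace_0[OF Us] by blast
 then obtain v where v: "v : l" "v : U" "v ~= 0" using assms unfolding miss_def by blast
 obtain c where c: "c ~= 0" "scl c v : NV" using NV_exists[OF v(3)] .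
 have "scl c v : l" "scl c v : U" using V.subspace_scale[OF line_subspace[OF assms(1)] v(1)] V.subspace_scale[OF Us v(2)] by auto
 thus ?thesis using that[of "scl c v"] LP[OF assms(1) _ c(2)] by blast
qed

lemma miss_P: "l : miss ==> x : P ==> x : l ==> x ~: U" using P_nonzero unfolding miss_def by blast

lemma miss_card: "card (LU U) + q * card (BU U) + card miss <= card L"
proof -
 have n0: "l ~= {0}" if "l : L" for l using line_card[OF that] by auto
 have d1: "LU U Int hit U = {}" by (auto simp: hit_def LU_def)
 have "l ~: miss" if "l : LU U" for l using that n0 unfolding miss_def LU_def by blast
 moreover have "l ~: miss" if "l : hit U" for l using that BU_mem miss_P unfolding hit_def by blast
 ultimately have d2: "(LU U Un hit U) Int miss = {}" by blast
 have fh: "finite (hit U)" using finite_L by (simp add: hit_def)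
 have "card ((LU U Un hit U) Un miss) = card (LU U) + q * card (BU U) + card miss"
  using card_Un_disjoint[OF _ fin(2) d2] card_Un_disjoint[OF LU_finite fh d1] hit_card[OF Us] LU_finite fh by simp
 moreover have "(LU U Un hit U) Un miss \<subseteq> L" by (auto simp: hit_def LU_def miss_def)
 ultimately show ?thesis using card_mono[OF finite_L] by metis
qed

lemma Out_card: "card Out + (q^4 + q^3 + q^2 + q + 1) = card L"
proof -
 have "Out = P - U Int NV" using P_NV by (auto simp: Out_def)
 moreover have "U Int NV \<subseteq> P" using U_P by blast
 ultimately have "card Out = card P - card (U Int NV)" using card_Diff_subset[of "U Int NV" P] sub_finite[OF U5] by simp
 moreover have "card (U Int NV) = q^4 + q^3 + q^2 + q + 1" using card_sub_NV[OF U5] q_card by (simp add: eval_nat_numeral ac_simps)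
 moreover have "card (U Int NV) <= card P" using card_mono[OF finite_P \<open>U Int NV \<subseteq> P\<close>] .
 ultimately show ?thesis using card_P by simp
qed

text \<open>Two lines through \<open>y\<close> that meet \<open>U\<close> give two points of
  \<open>Pi y\<close> in \<open>U\<close>; the plane then meets \<open>U\<close> in a line, and no
  line of the pencil can miss it.\<close>

lemma two_hits:
 assumes "y : Out" "l : L" "k : L" "l ~= k" "y : l" "y : k" "l ~: miss" "k ~: miss"
 shows "y ~: bad" "sub (Pi y Int U) 2"
proof -
 have yP: "y : P" "y ~: U" using assms(1) by (auto simp: Out_def)
 obtain u where u: "u : P" "u : l" "u : U" using line_U[OF assms(2,7)] .
 obtain v where v: "v : P" "v : k" "v : U" using line_U[OF assms(3,8)] .
 have "u ~= v"
 proof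
  assume "u = v"
  moreover have "u ~= y" using u yP by blast
  ultimately show False using line_unique[OF assms(2,3) u(1) yP(1)] u v assms by blast
 qed
 obtain c where c: "sub (Pi y Int U) c" "c <= 3" using sub_Int[OF Pi_sub[OF yP(1)] U5] .
 have "u : Pi y Int U" "v : Pi y Int U" using Ln_Pi[OF assms(2,5)] Ln_Pi[OF assms(3,6)] u v by auto
 hence "c >= 2" using two_points_ge2[OF c(1) _ _ P_NV[OF u(1)] P_NV[OF v(1)]] \<open>u ~= v\<close> by blast
 moreover have "c ~= 3"
 proof
  assume "c = 3"
  hence "Pi y Int U = Pi y" using sub_eq[OF c(1) Pi_sub[OF yP(1)]] by blast
  thus False using Pi_self[OF yP(1)] yP(2) by blast
 qed
 ultimately have "c = 2" using c(2) by simp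
 thus s2: "sub (Pi y Int U) 2" using c(1) by simp
 show "y ~: bad"
 proof
  assume "y : bad"
  then obtain n where n: "n : miss" "y : n" unfolding bad_def by blast
  have nL: "n : L" using n(1) by (simp add: miss_def)
  obtain d where d: "sub (n Int (Pi y Int U)) d" "2 + 2 <= 3 + d"
   using sub_Int_ge[OF line_sub2[OF nL] s2 Pi_sub[OF yP(1)] Ln_Pi[OF nL n(2)]] by blast
  obtain w where "w : n Int (Pi y Int U)" "w : NV" using sub_point[OF d(1)] d(2) by auto
  thus False using n(1) NV_nonzero unfolding miss_def by blast
 qed
qed

lemma good: assumes "y : Out" "y ~: bad" shows "!!l. l : L ==> y : l ==> l ~: miss" "sub (Pi y Int U) 2" "finite (A y)" "card (A y) = q^2" "y : A y"
proof -
 have yP: "y : P" "y ~: U" using assms(1) by (auto simp: Out_def)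
 show g: "l ~: miss" if "l : L" "y : l" for l using that assms unfolding bad_def by blast
 obtain l k where lk: "l : L" "k : L" "l ~= k" "y : l" "y : k" using two_lines[OF yP(1)] .
 show s2: "sub (Pi y Int U) 2" using two_hits(2)[OF assms(1) lk] g lk by blast
 show "finite (A y)" using Pi_finite[OF yP(1)] by (simp add: A_def)
 show "y : A y" using Pi_self[OF yP(1)] P_NV[OF yP(1)] yP(2) by (simp add: A_def)
 have "A y = (Pi y Int NV) - (Pi y Int U) Int NV" by (auto simp: A_def)
 moreover have "card ((Pi y Int U) Int NV) = q + 1" using card_sub_NV[OF s2] q_card by (simp add: numeral_2_eq_2)
 moreover have "card ((Pi y Int NV) - (Pi y Int U) Int NV) = card (Pi y Int NV) - card ((Pi y Int U) Int NV)"
  by (rule card_Diff_subset) (use sub_finite[OF s2] in auto)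
 ultimately show "card (A y) = q^2" using Pi_card[OF yP(1)] by simp
qed

lemma A_Out: "A v \<subseteq> Out" unfolding A_def Out_def using Pi_P by blast

lemma outer_on: assumes "l : L" "~ l \<subseteq> U" "l ~: miss" shows "card (l Int NV - U) = q"
proof -
 obtain u where u: "u : P" "u : l" "u : U" using line_U[OF assms(1,3)] .
 have "v = u" if "v : l" "v : NV" "v : U" for v
  using line_meets_once[OF assms(1,2) Us LP[OF assms(1) that(1,2)] u(1) that(1) u(2) that(3) u(3)] .
 hence "l Int NV - U = (l Int NV) - {u}" using u by blast
 thus ?thesis using line_card[OF assms(1)] u P_NV[OF u(1)] by simp
qed

text \<open>By \<open>two_hits\<close> a bad point is on at most one line meeting \<open>U\<close>,
  so on at least \<open>q\<close> lines that miss it.\<close>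

lemma bad_card: "card bad * q <= card miss * (q + 1)"
proof -
 have "card bad * q <= (\<Sum>y\<in>bad. card {l : miss. y : l})"
 proof -
  have "q <= card {l : miss. y : l}" if y: "y : bad" for y
  proof (rule ccontr)
   assume n: "~ ?thesis"
   have yO: "y : Out" "y : P" using y by (auto simp: bad_def Out_def)
   have "Ln y Int miss = {l : miss. y : l}" by (auto simp: Ln_def miss_def)
   hence "card (Ln y - miss) = q + 1 - card {l : miss. y : l}" using Ln_card[OF yO(2)] card_Diff_subset_Int[of "Ln y" miss] Ln_finite fin(2) by simp
   hence "card (Ln y - miss) >= 2" using n by simp
   then obtain l k where "l : Ln y - miss" "k : Ln y - miss" "l ~= k"
    by (metis card_le_Suc0_iff_eq Ln_finite finite_Diff not_less_eq_eq numeral_2_eq_2)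
   thus False using two_hits(1)[OF yO(1), of l k] y unfolding Ln_def by blast
  qed
  hence "(\<Sum>y\<in>bad. q) <= (\<Sum>y\<in>bad. card {l : miss. y : l})" by (rule sum_mono)
  thus ?thesis by simp
 qed
 also have "... = (\<Sum>y\<in>bad. \<Sum>l\<in>miss. if y : l then 1 else 0)" using fin(2) by (simp add: sum.If_cases Int_def)
 also have "... = (\<Sum>l\<in>miss. \<Sum>y\<in>bad. if y : l then 1 else 0)" by (rule sum.swap)
 also have "... = (\<Sum>l\<in>miss. card {y : bad. y : l})" using fin(3) by (simp add: sum.If_cases Int_def)
 also have "... <= (\<Sum>l\<in>miss. q + 1)"
 proof (rule sum_mono)
  fix l assume l: "l : miss"
  have lL: "l : L" using l by (simp add: miss_def)
  have "{y : bad. y : l} \<subseteq> l Int NV" using P_NV by (auto simp: bad_def Out_def)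
  thus "card {y : bad. y : l} <= q + 1" using card_mono[OF finite_Int[OF disjI1[OF line_finite[OF lL]]]] line_card[OF lL] by metis
 qed
 finally show ?thesis by simp
qed

text \<open>Suppose every good outer point has a bad point in its set \<open>A\<close>. The line
  joining the two meets \<open>U\<close>, is the only such line through the bad point, and has
  \<open>q\<close> outer points. So a bad point accounts for at most \<open>q\<close> outer points,
  itself included; in total these are at most \<open>q^2 * (q + 1)\<close>, fewer than there
  are.\<close>

lemma pick: assumes "card miss <= q^2" "card Out >= q^5 - q^2"
 obtains y where "y : Out" "y ~: bad" "!!v. v : A y ==> v ~: bad"
proof -
 have "EX y:Out. y ~: bad & (ALL v:A y. v ~: bad)"
 proof (rule ccontr)
  assume n: "~ ?thesis"
  let ?f = "%z. insert z {v : Out. EX l:L - miss. z : l & v : l}"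
  have sub: "Out \<subseteq> (\<Union>z\<in>bad. ?f z)"
  proof
   fix v assume v: "v : Out"
   show "v : (\<Union>z\<in>bad. ?f z)"
   proof (cases "v : bad")
    case True thus ?thesis by blast
   next
    case False
    then obtain z where z: "z : A v" "z : bad" using n v by blast
    have "col v z" using z(1) mem_Pi by (auto simp: A_def)
    then obtain l where l: "l : L" "v : l" "z : l" unfolding col_def by blast
    have "l ~: miss" using good(1)[OF v False l(1,2)] .
    thus ?thesis using l z(2) v by blast
   qed
  qed
  have f1: "finite (?f z)" for z using fin(1) by simp
  have "card Out <= card (\<Union>z\<in>bad. ?f z)" by (rule card_mono[OF finite_UN_I[OF fin(3) f1] sub])
  also have "... <= (\<Sum>z\<in>bad. card (?f z))" by (rule card_UN_le[OF fin(3)])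
  also have "... <= (\<Sum>z\<in>bad. q)"
  proof (rule sum_mono)
   fix z assume z: "z : bad"
   have zO: "z : Out" "z : P" "z ~: U" using z by (auto simp: bad_def Out_def)
   show "card (?f z) <= q"
   proof (cases "EX l:L - miss. z : l")
    case False
    hence e: "?f z = {z}" by blast
    show ?thesis unfolding e using q_ge2 by simp
   next
    case True
    then obtain l where l: "l : L" "l ~: miss" "z : l" by blast
    have fl: "?f z \<subseteq> l Int NV - U"
    proof
     fix v assume v: "v : ?f z"
     show "v : l Int NV - U"
     proof (cases "v = z")
      case True thus ?thesis using l zO P_NV by blast
     next
      case False
      then obtain k where k: "k : L" "k ~: miss" "z : k" "v : k" "v : Out" using v by blast
      have "k = l" using two_hits(1)[OF zO(1) k(1) l(1) _ k(3) l(3) k(2) l(2)] z by blast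
      thus ?thesis using k P_NV by (auto simp: Out_def)
     qed
    qed
    have "finite (l Int NV - U)" using line_finite[OF l(1)] by simp
    from card_mono[OF this fl] show ?thesis using outer_on[OF l(1) _ l(2)] l(3) zO(3) by auto
   qed
  qed
  also have "... <= q^2 * (q + 1)"
  proof -
   have "card bad * q <= q^2 * (q + 1)" using bad_card mult_right_mono[OF assms(1), of "q + 1"] by linarith
   thus ?thesis by simp
  qed
  finally have "q^5 - q^2 <= q^2 * (q + 1)" using assms(2) by linarith
  hence h: "q^5 <= q^3 + 2 * q^2" by (simp add: algebra_simps eval_nat_numeral)
  have "q^3 * 4 <= q^3 * q^2" using q_ge2 power_mono[of 2 q 2] by (intro mult_left_mono) simp_all
  hence "4 * q^3 <= q^5" by (simp add: eval_nat_numeral)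
  moreover have "q^2 * 2 <= q^2 * q" using q_ge2 by (intro mult_left_mono) simp_all
  hence "2 * q^2 <= q^3" by (simp add: eval_nat_numeral)
  moreover have "q^3 > 0" using q_ge2 by simp
  ultimately show False using h by linarith
 qed
 thus ?thesis using that by blast
qed

text \<open>The count concerns lines of the span \<open>H\<close> of \<open>U\<close> and
  \<open>y\<close> that are not in \<open>U\<close>. A good point of \<open>H\<close> outside
  \<open>U\<close> has its whole pencil in \<open>H\<close>, so all outer points within two steps of
  \<open>y\<close> lie there. A good one is on \<open>q + 1\<close> such lines, a bad one on at
  least one, while each line has only \<open>q\<close> outer points.\<close>

lemma spread:
 assumes y: "y : Out" "y ~: bad" "!!v. v : A y ==> v ~: bad"
 shows "(q + 1) * (q^2 + (q^2 - 1) * (q^2 - q)) + q * card (LU U) <= q * (q^4 - q^3 + 3 * q^2 + 2 * q) + q * card bad"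
proof -
 have yP: "y : P" "y ~: U" using y(1) by (auto simp: Out_def)
 define H where "H = U \<oplus> V.span {y}"
 have H6: "sub H 6" using sub_insert[OF U5 yP(2)] by (simp add: H_def)
 have Hs: "V.subspace H" using sub_subspace[OF H6] .
 have UH: "U \<subseteq> H" unfolding H_def using ssum_upper1[OF V.subspace_span] .
 have yH: "y : H" unfolding H_def using ssum_upper2[OF Us, of "V.span {y}"] V.span_base[of y "{y}"] by blast
 have VVs: "V.subspace VV" unfolding VV_def by (rule V.subspace_span)
 have yV: "y : VV" using yP(1) V.span_base[of y "\<Union>L"] unfolding VV_def P_def by blast
 have HV: "H \<subseteq> VV" unfolding H_def using ssum_least[OF VVs UV] span_subset_iff[OF VVs] yV by blast
 have PiH: "Pi v \<subseteq> H" if v: "v : Out" "v ~: bad" "v : H" for v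
 proof -
  have vP: "v : P" "v ~: U" using v(1) by (auto simp: Out_def)
  have "sub ((Pi v Int U) \<oplus> V.span {v}) 3" using sub_insert[OF good(2)[OF v(1,2)], of v] vP(2) by (simp add: numeral_3_eq_3 numeral_2_eq_2)
  moreover have "(Pi v Int U) \<oplus> V.span {v} \<subseteq> Pi v"
   using ssum_least[OF Pi_subspace[OF vP(1)]] span_subset_iff[OF Pi_subspace[OF vP(1)]] Pi_self[OF vP(1)] by blast
  ultimately have "(Pi v Int U) \<oplus> V.span {v} = Pi v" using sub_eq[OF _ Pi_sub[OF vP(1)]] by blast
  moreover have "(Pi v Int U) \<oplus> V.span {v} \<subseteq> H" using ssum_least[OF Hs, of "Pi v Int U" "V.span {v}"] span_subset_iff[OF Hs, of v] v(3) UH by blast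
  ultimately show ?thesis by simp
 qed
 \<comment> \<open>\<open>?E2 v\<close> collects the outer points at distance two from
   \<open>y\<close> through \<open>v\<close>; different \<open>v\<close> give disjoint sets because
   a common neighbour is unique. Its size is \<open>q^2 - q\<close>, as \<open>A v\<close> meets
   \<open>Pi y\<close> in the \<open>q\<close> outer points of the line through \<open>y\<close> and
   \<open>v\<close>.\<close>
 let ?N = "A y - {y}" and ?E2 = "%v. A v - Pi y"
 let ?E = "A y Un (\<Union>v\<in>?N. ?E2 v)"
 have N: "v : Out" "v ~: bad" "v : H" "v : P" "v ~= y" "col y v" if "v : ?N" for v
  using that A_Out y(3) PiH[OF y(1,2) yH] mem_Pi[of v y] unfolding A_def Out_def by blast+
 have fN: "finite ?N" using good(3)[OF y(1,2)] by simp
 have cN: "card ?N = q^2 - 1" using good(3-5)[OF y(1,2)] by simp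
 have cE2: "card (?E2 v) = q^2 - q" if v: "v : ?N" for v
 proof -
  obtain l where l: "l : L" "y : l" "v : l" using N(6)[OF v] unfolding col_def by blast
  have "A v Int Pi y = l Int NV - U"
  proof
   show "A v Int Pi y \<subseteq> l Int NV - U"
   proof
    fix w assume w: "w : A v Int Pi y"
    hence w': "w : NV" "w ~: U" "col v w" "col y w" using mem_Pi unfolding A_def by blast+
    have wP: "w : P" using w A_Out by (auto simp: Out_def)
    have "w : l"
    proof (cases "w = v")
     case True thus ?thesis using l by simp
    next
     case False
     obtain k where k: "k : L" "y : k" "v : k" "w : k"
      using triangle[OF yP(1) N(4)[OF v] wP N(6)[OF v] w'(4,3)] False by blast
     thus ?thesis using line_unique[OF k(1) l(1) yP(1) N(4)[OF v]] N(5)[OF v] l by blast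
    qed
    thus "w : l Int NV - U" using w' by blast
   qed
   show "l Int NV - U \<subseteq> A v Int Pi y" using Ln_Pi[OF l(1,3)] Ln_Pi[OF l(1,2)] by (auto simp: A_def)
  qed
  moreover have "card (l Int NV - U) = q" using outer_on[OF l(1)] l(2) yP(2) good(1)[OF y(1,2) l(1,2)] by blast
  ultimately show ?thesis using card_Diff_subset_Int[of "A v" "Pi y"] good(3,4)[OF N(1,2)[OF v]] line_finite[OF l(1)] by simp
 qed
 have cE: "card ?E = q^2 + (q^2 - 1) * (q^2 - q)"
 proof -
  have fE2: "finite (?E2 v)" if "v : ?N" for v using good(3)[OF N(1,2)[OF that]] by simp
  have "card (\<Union>v\<in>?N. ?E2 v) = (\<Sum>v\<in>?N. card (?E2 v))"
  proof (rule card_UN_disjoint[OF fN])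
   show "ALL v:?N. finite (?E2 v)" using fE2 by blast
   show "ALL v:?N. ALL v':?N. v ~= v' --> ?E2 v Int ?E2 v' = {}"
   proof (intro ballI impI)
    fix v v' assume h: "v : ?N" "v' : ?N" "v ~= v'"
    have "False" if w: "w : ?E2 v" "w : ?E2 v'" for w
    proof -
     have wP: "w : P" using w A_Out by (auto simp: Out_def)
     have "~ col y w" using w(1) mem_Pi by blast
     moreover have "col w v" "col w v'" using w mem_Pi col_sym unfolding A_def by blast+
     ultimately show False using common_nbr_unique[OF yP(1) wP N(4)[OF h(1)] N(4)[OF h(2)]] N(6)[OF h(1)] N(6)[OF h(2)] h(3) by blast
    qed
    thus "?E2 v Int ?E2 v' = {}" by blast
   qed
  qed
  hence c2: "card (\<Union>v\<in>?N. ?E2 v) = (q^2 - 1) * (q^2 - q)" using cE2 cN by simp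
  have "A y Int (\<Union>v\<in>?N. ?E2 v) = {}" by (auto simp: A_def)
  moreover have "finite (\<Union>v\<in>?N. ?E2 v)" using fN fE2 by blast
  ultimately have "card ?E = card (A y) + card (\<Union>v\<in>?N. ?E2 v)" by (intro card_Un_disjoint good(3)[OF y(1,2)])
  thus ?thesis using c2 good(4)[OF y(1,2)] by simp
 qed
 have fE: "finite ?E" using cE fin(1) A_Out finite_subset[of ?E Out] by blast
 let ?X = "LU H - LU U - miss"
 let ?d = "%w. card {l : ?X. w : l}"
 have fX: "finite ?X" using LU_finite by simp
 have near: "EX v. v : Out & v ~: bad & v : H & w : Pi v" if w: "w : ?E" for w
 proof (cases "w : A y")
  case True thus ?thesis using y yH by (auto simp: A_def)
 next
  case False
  then obtain v where "v : ?N" "w : A v" using w by blast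
  thus ?thesis using N(1-3)[of v] unfolding A_def by blast
 qed
 have lX: "l : ?X" if h: "v : Out" "v ~: bad" "v : H" "l : L" "v : l" for v l
  using PiH[OF h(1-3)] Ln_Pi[OF h(4,5)] good(1)[OF h(1,2,4,5)] h unfolding LU_def Out_def by blast
 have d1: "?d w >= 1" if w: "w : ?E" for w
 proof -
  obtain v where v: "v : Out" "v ~: bad" "v : H" "w : Pi v" using near[OF w] by blast
  obtain l where l: "l : L" "v : l" "w : l" using v(4) unfolding Pi_def by blast
  have "l : {l : ?X. w : l}" using lX[OF v(1-3) l(1,2)] l(3) by blast
  moreover have "finite {l : ?X. w : l}" by (rule finite_subset[OF _ fX]) blast
  ultimately have "card {l : ?X. w : l} > 0" using card_gt_0_iff by blast
  thus ?thesis by simp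
 qed
 have d2: "?d w >= q + 1" if w: "w : ?E" "w ~: bad" for w
 proof -
  have wO: "w : Out" using w(1) A_Out by blast
  have wH: "w : H" using near[OF w(1)] PiH by blast
  have wP: "w : P" using wO by (simp add: Out_def)
  have "Ln w \<subseteq> {l : ?X. w : l}"
  proof
   fix l assume "l : Ln w"
   hence "l : L" "w : l" by (simp_all add: Ln_def)
   thus "l : {l : ?X. w : l}" using lX[OF wO w(2) wH] by blast
  qed
  moreover have "finite {l : ?X. w : l}" by (rule finite_subset[OF _ fX]) blast
  ultimately show ?thesis using card_mono Ln_card[OF wP] by metis
 qed
 have "(q + 1) * card ?E <= (\<Sum>w\<in>?E. ?d w) + q * card bad"
 proof -
  have "(\<Sum>w\<in>?E. q + 1) <= (\<Sum>w\<in>?E. ?d w + (if w : bad then q else 0))"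
  proof (rule sum_mono)
   fix w assume w: "w : ?E"
   show "q + 1 <= ?d w + (if w : bad then q else 0)"
   proof (cases "w : bad")
    case True thus ?thesis using d1[OF w] by simp
   next
    case False thus ?thesis using d2[OF w] by simp
   qed
  qed
  also have "... = (\<Sum>w\<in>?E. ?d w) + (\<Sum>w\<in>?E. if w : bad then q else 0)" by (rule sum.distrib)
  also have "(\<Sum>w\<in>?E. if w : bad then q else 0) <= q * card bad"
  proof -
   have "(\<Sum>w\<in>?E. if w : bad then q else 0) = (\<Sum>w\<in>?E Int bad. q)" by (rule sum.inter_restrict[OF fE, symmetric])
   also have "... = q * card (?E Int bad)" by simp
   also have "... <= q * card bad" using card_mono[OF fin(3), of "?E Int bad"] by simp
   finally show ?thesis .
  qed
  finally show ?thesis by (simp add: mult.commute)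
 qed
 also have "(\<Sum>w\<in>?E. ?d w) <= q * card ?X"
 proof -
  have "(\<Sum>w\<in>?E. ?d w) = (\<Sum>w\<in>?E. \<Sum>l\<in>?X. if w : l then 1 else 0)" using fX by (simp add: sum.If_cases Int_def)
  also have "... = (\<Sum>l\<in>?X. \<Sum>w\<in>?E. if w : l then 1 else 0)" by (rule sum.swap)
  also have "... = (\<Sum>l\<in>?X. card {w : ?E. w : l})" using fE by (simp add: sum.inter_filter[symmetric])
  also have "... <= (\<Sum>l\<in>?X. q)"
  proof (rule sum_mono)
   fix l assume l: "l : ?X"
   hence l': "l : L" "~ l \<subseteq> U" "l ~: miss" unfolding LU_def by blast+
   have fl: "{w : ?E. w : l} \<subseteq> l Int NV - U" by (auto simp: A_def)
   have "finite (l Int NV - U)" using line_finite[OF l'(1)] by simp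
   from card_mono[OF this fl] show "card {w : ?E. w : l} <= q" unfolding outer_on[OF l'] .
  qed
  finally show ?thesis by (simp add: mult.commute)
 qed
 finally have "(q + 1) * card ?E <= q * card ?X + q * card bad" by simp
 moreover have "card ?X + card (LU U) <= q^4 - q^3 + 3 * q^2 + 2 * q"
 proof -
  have "LU U \<subseteq> LU H" using UH by (auto simp: LU_def)
  have "card ?X + card (LU U) = card (?X Un LU U)" by (rule card_Un_disjoint[symmetric]) (use fX LU_finite in auto)
  also have "... <= card (LU H)" by (rule card_mono[OF LU_finite]) (use \<open>LU U \<subseteq> LU H\<close> in blast)
  also have "... <= q^4 - q^3 + 3 * q^2 + 2 * q" using hp[OF H6 HV] .
  finally show ?thesis .
 qed
 hence "q * (card ?X + card (LU U)) <= q * (q^4 - q^3 + 3 * q^2 + 2 * q)" by (rule mult_left_mono) simp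
 ultimately show ?thesis unfolding cE by (simp only: distrib_left)
qed

text \<open>For both values of \<open>b\<close> the count from \<open>spread\<close> exceeds what
  (Hp') permits. The difference is a nonnegative multiple of \<open>q - 2\<close> plus a positive
  remainder, so that \<open>q = 2\<close> is contradictory too.\<close>

lemma impossible: False
proof -
 obtain b where b: "card (LU U) + q * card (BU U) + b = (q^3 + 1) * (q^2 + q + 1)" "b = 0 | b = q^2"
  "card (LU U) >= q^3 + q^2 + q + 1" "b = q^2 ==> card (LU U) = q^3 + q^2 + 2 * q + 1" using sizes by metis
 have mb: "card miss <= b" using miss_card total b(1) by linarith
 have N: "(q^3 + 1) * (q^2 + q + 1) = q^5 + (q^4 + q^3 + q^2 + q + 1)" by (simp add: algebra_simps eval_nat_numeral)
 have "card Out + b >= q^5" using miss_card Out_card b(1) N by linarith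
 hence "card Out >= q^5 - q^2" using b(2) by auto
 moreover have "card miss <= q^2" using mb b(2) by auto
 ultimately obtain y where y: "y : Out" "y ~: bad" "!!v. v : A y ==> v ~: bad" using pick by blast
 note S = spread[OF y]
 have q2: "int q >= 2" using q_ge2 by simp
 have le: "q <= q^2" "1 <= q^2" "q^3 <= q^4" using q_ge2 by (simp_all add: power2_eq_square eval_nat_numeral)
 have "int ((q + 1) * (q^2 + (q^2 - 1) * (q^2 - q)) + q * card (LU U)) <= int (q * (q^4 - q^3 + 3 * q^2 + 2 * q) + q * card bad)"
  using S by (simp only: of_nat_le_iff)
 hence I: "(int q + 1) * (int q^2 + (int q^2 - 1) * (int q^2 - int q)) + int q * int (card (LU U)) <= int q * (int q^4 - int q^3 + 3 * int q^2 + 2 * int q) + int q * int (card bad)"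
  by (simp only: of_nat_mult of_nat_add of_nat_diff[OF le(1)] of_nat_diff[OF le(2)] of_nat_diff[OF le(3)] of_nat_power of_nat_1 of_nat_numeral)
 have qp: "int q * (int q^2 * (int q - 2)) >= 0" using q2 by simp
 show False using b(2)
 proof
  assume "b = 0"
  hence "card bad * q <= 0" using mb bad_card by simp
  hence "int (card bad) = 0" using q_ge2 by simp
  moreover have "int q * int (card (LU U)) >= int q * (int q^3 + int q^2 + int q + 1)"
  proof (rule mult_left_mono)
   have "int (card (LU U)) >= int (q^3 + q^2 + q + 1)" using b(3) by (simp only: of_nat_le_iff)
   thus "int (card (LU U)) >= int q^3 + int q^2 + int q + 1" by simp
  qed simp
  ultimately have "(int q + 1) * (int q^2 + (int q^2 - 1) * (int q^2 - int q)) + int q * (int q^3 + int q^2 + int q + 1) <= int q * (int q^4 - int q^3 + 3 * int q^2 + 2 * int q)"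
   using I by simp
  moreover have "(int q + 1) * (int q^2 + (int q^2 - 1) * (int q^2 - int q)) + int q * (int q^3 + int q^2 + int q + 1) - int q * (int q^4 - int q^3 + 3 * int q^2 + 2 * int q)
   = 2 * (int q * (int q^2 * (int q - 2))) + int q ^ 3 + 2 * int q" by algebra
  moreover have "int q ^ 3 > 0" using q2 by simp
  ultimately show False using qp q2 by linarith
 next
  assume bq: "b = q^2"
  have "card bad * q <= q^2 * (q + 1)" using bad_card mult_right_mono[OF mb, of "q + 1"] bq by simp
  hence "q * card bad <= q^2 * (q + 1)" by (simp add: mult.commute)
  hence "int (q * card bad) <= int (q^2 * (q + 1))" by (simp only: of_nat_le_iff)
  hence B: "int q * int (card bad) <= int q^2 * (int q + 1)" by (simp only: of_nat_mult of_nat_add of_nat_power of_nat_1)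
  have m: "int (card (LU U)) = int q^3 + int q^2 + 2 * int q + 1" using b(4)[OF bq] by simp
  have "(int q + 1) * (int q^2 + (int q^2 - 1) * (int q^2 - int q)) + int q * (int q^3 + int q^2 + 2 * int q + 1) - int q * (int q^4 - int q^3 + 3 * int q^2 + 2 * int q) - int q^2 * (int q + 1)
   = 2 * (int q * (int q^2 * (int q - 2))) + 2 * int q" by algebra
  thus False using I B qp q2 unfolding m by linarith
 qed
qed

end

section \<open>The characterization\<close>

lemma card_three:
 assumes "finite A" "finite B" "finite C" "card (A Int B) <= 1" "card (A Int C) <= 1" "card (B Int C) <= 1"
 shows "card A + card B + card C <= card (A Un B Un C) + 3"
proof -
 have "card A + card B = card (A Un B) + card (A Int B)" using card_Un_Int[OF assms(1,2)] .
 moreover have "card (A Un B) + card C = card (A Un B Un C) + card ((A Un B) Int C)" using card_Un_Int[of "A Un B" C] assms(1-3) by simp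
 moreover have "card ((A Un B) Int C) <= card (A Int C) + card (B Int C)" unfolding Int_Un_distrib2 by (rule card_Un_le)
 ultimately show ?thesis using assms(4-6) by linarith
qed

lemma two_distinct: assumes "finite A" "card A >= 2" obtains a b where "a : A" "b : A" "a ~= b"
proof -
 have "~ card A <= Suc 0" using assms(2) by simp
 thus ?thesis using card_le_Suc0_iff_eq[OF assms(1)] that by blast
qed

text \<open>The condition on solids enters through one estimate: three families of
  \<open>q + 1\<close> lines, any two with at most one common line, make at least
  \<open>3 * q\<close> lines, more than the \<open>2 * q + 1\<close> that a solid may have.\<close>

lemma flat_of_counts:
 fixes L :: "(nat => 'a::{field,finite}) set set"
 assumes q: "q = CARD('a)" and L: "L \<subseteq> lines n" "L ~= {}"
  and Pt: "!!X. X : points n ==> card {l : L. X \<subseteq> l} : {0, q + 1}"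
  and Pl: "!!W. W : planes n ==> card {l : L. l \<subseteq> W} : {0, 1, q + 1}"
  and Sd: "!!S. S : solids n ==> card {l : L. l \<subseteq> S} : {0, 1, q + 1, 2 * q + 1}"
 shows "flat L q"
proof -
 have q2: "q >= 2" using card_field_ge_2[where 'a = 'a] q by simp
 have l2: "sub l 2" "l \<subseteq> pvec n" if "l : L" for l
 proof -
  have "l : lines n" using that L(1) by blast
  thus "sub l 2" "l \<subseteq> pvec n" by (simp_all add: psub_iff numeral_2_eq_2)
 qed
 have fL: "finite L" by (rule finite_subset[of _ "Pow (pvec n)"]) (use l2 finite_pvec in auto)
 define Lx where "Lx x = {l : L. x : l}" for x
 define F where "F W = {l : L. l \<subseteq> W}" for W
 have fF: "finite (F W)" for W using fL by (simp add: F_def)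
 have fLx: "finite (Lx x)" for x using fL by (simp add: Lx_def)
 have deg: "card (Lx x) = q + 1" if x: "x : NV" "l : L" "x : l" for x l
 proof -
  have "V.span {x} \<subseteq> pvec n" using span_subset_iff[OF subspace_pvec] l2(2)[OF x(2)] x(3) by blast
  hence "V.span {x} : points n" using sub_span1[OF NV_nonzero[OF x(1)]] by (simp add: psub_iff)
  moreover have "{l : L. V.span {x} \<subseteq> l} = Lx x" unfolding Lx_def using span_subset_iff[OF sub_subspace[OF l2(1)]] by blast
  ultimately have "card (Lx x) : {0, q + 1}" using Pt by metis
  moreover have "card (Lx x) ~= 0" using x fLx by (auto simp: Lx_def)
  ultimately show ?thesis by simp
 qed
 have plane: "sub (l \<oplus> m) 3 & l \<oplus> m \<subseteq> pvec n & l \<subseteq> l \<oplus> m & m \<subseteq> l \<oplus> m & card (F (l \<oplus> m)) = q + 1"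
  if h: "x : NV" "l : L" "m : L" "l ~= m" "x : l" "x : m" for x l m
 proof -
  obtain c where c: "sub (l Int m) c" "sub (l \<oplus> m) (2 + 2 - c)" "c <= 2" using sub_Int[OF l2(1)[OF h(2)] l2(1)[OF h(3)]] .
  have "c ~= 0"
  proof
   assume "c = 0"
   hence "l Int m = {0}" using sub_0 c(1) by simp
   thus False using h(5,6) NV_nonzero[OF h(1)] by blast
  qed
  moreover have "c ~= 2"
  proof
   assume "c = 2"
   hence "l Int m = l" "l Int m = m" using sub_eq[OF c(1) l2(1)[OF h(2)]] sub_eq[OF c(1) l2(1)[OF h(3)]] by auto
   thus False using h(4) by blast
  qed
  ultimately have "c = 1" using c(3) by simp
  hence s: "sub (l \<oplus> m) 3" using c(2) by (simp add: numeral_3_eq_3)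
  have p: "l \<oplus> m \<subseteq> pvec n" using ssum_least[OF subspace_pvec l2(2)[OF h(2)] l2(2)[OF h(3)]] .
  have i: "l \<subseteq> l \<oplus> m" "m \<subseteq> l \<oplus> m" using ssum_upper1[OF sub_subspace[OF l2(1)[OF h(3)]]] ssum_upper2[OF sub_subspace[OF l2(1)[OF h(2)]]] by auto
  have "card (F (l \<oplus> m)) : {0, 1, q + 1}" unfolding F_def by (rule Pl) (use s p in \<open>simp add: psub_iff numeral_3_eq_3 numeral_2_eq_2\<close>)
  moreover have "~ card (F (l \<oplus> m)) <= Suc 0"
  proof
   assume "card (F (l \<oplus> m)) <= Suc 0"
   hence "ALL a:F (l \<oplus> m). ALL b:F (l \<oplus> m). a = b" using card_le_Suc0_iff_eq[OF fF] by blast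
   thus False using h(2-4) i by (simp add: F_def)
  qed
  ultimately have "card (F (l \<oplus> m)) = q + 1" by auto
  thus ?thesis using s p i by blast
 qed
 have meet: "card (F W Int F W') <= 1" if h: "sub W 3" "sub W' 3" "W ~= W'" for W W'
 proof -
  obtain c where c: "sub (W Int W') c" "c <= 3" using sub_Int[OF h(1,2)] .
  have "c ~= 3"
  proof
   assume "c = 3"
   hence "W Int W' = W" "W Int W' = W'" using sub_eq[OF c(1) h(1)] sub_eq[OF c(1) h(2)] by auto
   thus False using h(3) by blast
  qed
  hence "c <= 2" using c(2) by simp
  hence "l = W Int W'" if "l : F W Int F W'" for l using that sub_eq[OF l2(1) c(1)] by (auto simp: F_def)
  hence "F W Int F W' \<subseteq> {W Int W'}" by blast
  thus ?thesis using card_mono[of "{W Int W'}"] by simp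
 qed
 \<comment> \<open>A third line through \<open>x\<close> off the plane of \<open>l\<close> and
   \<open>m\<close> would give three planes in a solid, each with \<open>q + 1\<close> lines by
   (Pl).\<close>
 have cop: "k \<subseteq> l \<oplus> m" if h: "x : NV" "l : L" "m : L" "l ~= m" "x : l" "x : m" "k : L" "x : k" for x l m k
 proof (rule ccontr)
  assume n: "~ k \<subseteq> l \<oplus> m"
  note A = plane[OF h(1-6)]
  have kl: "k ~= l" "k ~= m" using n A by blast+
  note B = plane[OF h(1,2,7) _ h(5,8)] and C = plane[OF h(1,3,7) _ h(6,8)]
  have B': "sub (l \<oplus> k) 3" "l \<subseteq> l \<oplus> k" "k \<subseteq> l \<oplus> k" "card (F (l \<oplus> k)) = q + 1"
   and C': "sub (m \<oplus> k) 3" "m \<subseteq> m \<oplus> k" "k \<subseteq> m \<oplus> k" "card (F (m \<oplus> k)) = q + 1" using B C kl by auto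
  have ne: "l \<oplus> m ~= l \<oplus> k" "l \<oplus> m ~= m \<oplus> k" using n B'(3) C'(3) by auto
  have ne2: "l \<oplus> k ~= m \<oplus> k"
  proof
   assume e: "l \<oplus> k = m \<oplus> k"
   have "l \<oplus> m \<subseteq> l \<oplus> k" using ssum_least[OF sub_subspace[OF B'(1)] B'(2)] C'(2) e by blast
   thus False using sub_eq[OF _ B'(1)] A ne(1) by blast
  qed
  obtain c where c: "sub ((l \<oplus> m) Int k) c" "sub ((l \<oplus> m) \<oplus> k) (3 + 2 - c)" "c <= 2" using sub_Int[OF conjunct1[OF A] l2(1)[OF h(7)]] .
  have xk: "x : (l \<oplus> m) Int k" using h(5,8) A by blast
  have "c ~= 0"
  proof
   assume "c = 0"
   hence "(l \<oplus> m) Int k = {0}" using sub_0 c(1) by simp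
   thus False using xk NV_nonzero[OF h(1)] by blast
  qed
  moreover have "c ~= 2"
  proof
   assume "c = 2"
   hence "(l \<oplus> m) Int k = k" using sub_eq[OF c(1) l2(1)[OF h(7)]] by auto
   thus False using n by blast
  qed
  ultimately have "c = 1" using c(3) by simp
  hence s: "sub ((l \<oplus> m) \<oplus> k) 4" using c(2) by simp
  define S where "S = (l \<oplus> m) \<oplus> k"
  have Ss: "V.subspace S" using sub_subspace[OF s] by (simp add: S_def)
  have "S \<subseteq> pvec n" unfolding S_def using ssum_least[OF subspace_pvec _ l2(2)[OF h(7)]] A by blast
  hence "S : solids n" using s by (simp add: psub_iff S_def eval_nat_numeral)
  hence up: "card (F S) <= 2 * q + 1" using Sd[of S] unfolding F_def by auto
  have i: "l \<oplus> m \<subseteq> S" "k \<subseteq> S" unfolding S_def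
   using ssum_upper1[OF sub_subspace[OF l2(1)[OF h(7)]]] ssum_upper2[OF sub_subspace, of "l \<oplus> m" 3 k] A by blast+
  have "l \<oplus> k \<subseteq> S" "m \<oplus> k \<subseteq> S" using ssum_least[OF Ss, of l k] ssum_least[OF Ss, of m k] i A by blast+
  hence "F (l \<oplus> m) Un F (l \<oplus> k) Un F (m \<oplus> k) \<subseteq> F S" using i unfolding F_def by blast
  hence "card (F (l \<oplus> m) Un F (l \<oplus> k) Un F (m \<oplus> k)) <= card (F S)" by (rule card_mono[OF fF])
  moreover have "card (F (l \<oplus> m)) + card (F (l \<oplus> k)) + card (F (m \<oplus> k)) <= card (F (l \<oplus> m) Un F (l \<oplus> k) Un F (m \<oplus> k)) + 3"
   using card_three[OF fF fF fF meet meet meet] A B'(1) C'(1) ne ne2 by blast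
  ultimately show False using up A B'(4) C'(4) q2 by linarith
 qed
 have pen: "sub (\<Union>(Lx x)) 3 & \<Union>(Lx x) \<subseteq> pvec n & F (\<Union>(Lx x)) = Lx x" if x: "x : NV" "l0 : L" "x : l0" for x l0
 proof -
  have "card (Lx x) >= 2" using deg[OF x] q2 by simp
  then obtain l m where lm: "l : Lx x" "m : Lx x" "l ~= m" using two_distinct[OF fLx] by blast
  hence h: "l : L" "m : L" "x : l" "x : m" by (auto simp: Lx_def)
  note A = plane[OF x(1) h(1,2) lm(3) h(3,4)]
  have FW: "Lx x = F (l \<oplus> m)"
  proof (rule card_subset_eq[OF fF])
   show "Lx x \<subseteq> F (l \<oplus> m)" using cop[OF x(1) h(1,2) lm(3) h(3,4)] by (auto simp: Lx_def F_def)
   show "card (Lx x) = card (F (l \<oplus> m))" using deg[OF x] A by simp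
  qed
  have sx: "sub (V.span {x}) 1" using sub_span1[OF NV_nonzero[OF x(1)]] .
  have xW: "x : l \<oplus> m" using A h(3) by blast
  have W3: "sub (l \<oplus> m) (Suc 2)" using A by (simp add: numeral_3_eq_3 numeral_2_eq_2)
  \<comment> \<open>The \<open>q + 1\<close> lines of \<open>L\<close> through \<open>x\<close> are
    all the lines through \<open>x\<close> in the plane, so they cover it.\<close>
  have LH: "Lx x = hyps (l \<oplus> m) 2 (V.span {x})"
  proof (rule card_subset_eq)
   show "finite (hyps (l \<oplus> m) 2 (V.span {x}))" using finite_hyps[OF sub_finite[OF W3]] .
   show "Lx x \<subseteq> hyps (l \<oplus> m) 2 (V.span {x})"
   proof
    fix k assume k: "k : Lx x"
    hence k': "k : L" "x : k" "k : F (l \<oplus> m)" using FW by (auto simp: Lx_def)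
    show "k : hyps (l \<oplus> m) 2 (V.span {x})"
     using l2(1)[OF k'(1)] span_subset_iff[OF sub_subspace[OF l2(1)[OF k'(1)]], of x] k' by (simp add: hyps_def F_def)
   qed
   have "V.span {x} \<subseteq> l \<oplus> m" using span_subset_iff[OF sub_subspace[OF W3]] xW by blast
   thus "card (Lx x) = card (hyps (l \<oplus> m) 2 (V.span {x}))" using card_hyps[OF W3 sx] deg[OF x] q by (simp add: numeral_2_eq_2)
  qed
  have "\<Union>(Lx x) = l \<oplus> m"
  proof
   show "\<Union>(Lx x) \<subseteq> l \<oplus> m" unfolding FW by (auto simp: F_def)
   show "l \<oplus> m \<subseteq> \<Union>(Lx x)"
   proof
    fix v assume v: "v : l \<oplus> m"
    show "v : \<Union>(Lx x)"
    proof (cases "v : V.span {x}")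
     case True
     hence "v : l" using span_subset_iff[OF sub_subspace[OF l2(1)[OF h(1)]], of x] h(3) by blast
     thus ?thesis using lm(1) by blast
    next
     case False
     have "V.span {x, v} \<subseteq> l \<oplus> m" using V.span_minimal[OF _ sub_subspace[OF W3], of "{x, v}"] xW v by simp
     moreover have "V.span {x} \<subseteq> V.span {x, v}" by (rule V.span_mono) blast
     ultimately have "V.span {x, v} : Lx x" unfolding LH hyps_def using sub_span2[OF NV_nonzero[OF x(1)] False] by blast
     moreover have "v : V.span {x, v}" using V.span_base[of v "{x, v}"] by simp
     ultimately show ?thesis by blast
    qed
   qed
  qed
  thus ?thesis using A FW by simp
 qed
 show ?thesis
 proof
  show "q = CARD('a)" by (rule q)
  show "finite L" by (rule fL)
  show "L ~= {}" by (rule L(2))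
  show "sub l 2" if "l : L" for l using l2(1)[OF that] .
  show "card {l : L. x : l} = q + 1" if "x : NV" "l : L" "x : l" for x l using deg[OF that] unfolding Lx_def .
  show "sub (\<Union>{l : L. x : l}) 3" if "x : NV" "l : L" "x : l" for x l using pen[OF that] unfolding Lx_def by blast
  show "x : m" if h: "x : NV" "l : L" "x : l" "m : L" "m \<subseteq> \<Union>{l : L. x : l}" for x l m
  proof -
   have "m : F (\<Union>(Lx x))" using h(4,5) by (simp add: F_def Lx_def)
   hence "m : Lx x" using pen[OF h(1-3)] by simp
   thus ?thesis by (simp add: Lx_def)
  qed
  show "x = y | x = z | y = z" if h: "sub S 4" "x : NV" "y : NV" "z : NV" "x : \<Union>L" "y : \<Union>L" "z : \<Union>L"
    "\<Union>{l : L. x : l} \<subseteq> S" "\<Union>{l : L. y : l} \<subseteq> S" "\<Union>{l : L. z : l} \<subseteq> S" for S x y z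
  proof (rule ccontr)
   assume "~ ?thesis"
   hence ne: "x ~= y" "x ~= z" "y ~= z" by auto
   obtain lx ly lz where l: "lx : L" "x : lx" "ly : L" "y : ly" "lz : L" "z : lz" using h(5-7) by blast
   have i: "card (Lx u Int Lx v) <= 1" if uv: "u : NV" "v : NV" "u ~= v" for u v
   proof -
    have "ALL a:Lx u Int Lx v. ALL b:Lx u Int Lx v. a = b"
     using line_eq[OF l2(1) l2(1) _ _ _ _ uv(1,2,3)] by (auto simp: Lx_def)
    thus ?thesis using card_le_Suc0_iff_eq[of "Lx u Int Lx v"] fLx by simp
   qed
   have p: "sub (\<Union>(Lx x)) 3" "\<Union>(Lx x) \<subseteq> pvec n" "F (\<Union>(Lx x)) = Lx x" "sub (\<Union>(Lx y)) 3" "\<Union>(Lx y) \<subseteq> pvec n" "F (\<Union>(Lx y)) = Lx y"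
    using pen[OF h(2) l(1,2)] pen[OF h(3) l(3,4)] by auto
   have "\<Union>(Lx x) ~= \<Union>(Lx y)"
   proof
    assume "\<Union>(Lx x) = \<Union>(Lx y)"
    hence "Lx x = Lx y" using p(3,6) by metis
    thus False using i[OF h(2,3) ne(1)] deg[OF h(2) l(1,2)] q2 by simp
   qed
   obtain c where c: "sub (\<Union>(Lx x) Int \<Union>(Lx y)) c" "sub (\<Union>(Lx x) \<oplus> \<Union>(Lx y)) (3 + 3 - c)" "c <= 3" using sub_Int[OF p(1,4)] .
   have "c ~= 3"
   proof
    assume c3: "c = 3"
    have "\<Union>(Lx x) Int \<Union>(Lx y) = \<Union>(Lx x)" by (rule sub_eq[OF c(1) p(1) Int_lower1]) (simp add: c3)
    moreover have "\<Union>(Lx x) Int \<Union>(Lx y) = \<Union>(Lx y)" by (rule sub_eq[OF c(1) p(4) Int_lower2]) (simp add: c3)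
    ultimately show False using \<open>\<Union>(Lx x) ~= \<Union>(Lx y)\<close> by blast
   qed
   hence "4 <= 3 + 3 - c" using c(3) by simp
   moreover have "\<Union>(Lx x) \<oplus> \<Union>(Lx y) \<subseteq> S" using ssum_least[OF sub_subspace[OF h(1)]] h(8,9) unfolding Lx_def by blast
   ultimately have "\<Union>(Lx x) \<oplus> \<Union>(Lx y) = S" using sub_eq[OF c(2) h(1)] by blast
   hence "S \<subseteq> pvec n" using ssum_least[OF subspace_pvec p(2,5)] by simp
   hence "S : solids n" using h(1) by (simp add: psub_iff eval_nat_numeral)
   hence up: "card (F S) <= 2 * q + 1" using Sd[of S] unfolding F_def by auto
   have "Lx x Un Lx y Un Lx z \<subseteq> F S" using h(8-10) by (auto simp: Lx_def F_def)
   hence "card (Lx x Un Lx y Un Lx z) <= card (F S)" by (rule card_mono[OF fF])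
   moreover have "card (Lx x) + card (Lx y) + card (Lx z) <= card (Lx x Un Lx y Un Lx z) + 3"
    using card_three[OF fLx fLx fLx i[OF h(2,3) ne(1)] i[OF h(2,4) ne(2)] i[OF h(3,4) ne(3)]] .
   ultimately show False using up deg[OF h(2) l(1,2)] deg[OF h(3) l(3,4)] deg[OF h(4) l(5,6)] q2 by linarith
  qed
 qed
qed

text \<open>The span \<open>U\<close> of the pencil of \<open>x\<close> and the line
  \<open>m\<close> has dimension 5, as \<open>m\<close> contains no neighbour of \<open>x\<close>,
  and all five vertices are interior to it. The lower bound on lines comes from a third line
  \<open>a\<close> through \<open>x\<close>: at least \<open>2 * q + 1\<close> solids of
  \<open>U\<close> through \<open>a\<close> contain \<open>y\<close> or \<open>z\<close>, each with
  at least \<open>q\<close> lines skew to \<open>a\<close>.\<close>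

lemma (in flat) pentagon_free:
 assumes solV: "!!S. sub S 4 ==> S \<subseteq> VV ==> card (LU S) : {0, 1, q + 1, 2 * q + 1}"
  and hpV: "!!H. sub H 6 ==> H \<subseteq> VV ==> card (LU H) <= q^4 - q^3 + 3 * q^2 + 2 * q"
  and tot: "card L <= (q^3 + 1) * (q^2 + q + 1)"
  and x: "x : P" and m: "m : L" and far: "!!u. u : P ==> u : m ==> ~ col x u"
  and y: "y : P" "y : m" "d2 x y" and z: "z : P" "z : m" "d2 x z"
 shows "y = z"
proof (rule ccontr)
 assume yz: "y ~= z"
 define U where "U = Pi x \<oplus> m"
 have VVs: "V.subspace VV" unfolding VV_def by (rule V.subspace_span)
 have VVL: "l \<subseteq> VV" if "l : L" for l unfolding VV_def using V.span_superset[of "\<Union>L"] that by blast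
 have PxV: "Pi x \<subseteq> VV" unfolding Pi_def using VVL by blast
 have UV: "U \<subseteq> VV" unfolding U_def using ssum_least[OF VVs PxV VVL[OF m]] .
 obtain c where c: "sub (Pi x Int m) c" "sub U (3 + 2 - c)" unfolding U_def using sub_Int[OF Pi_sub[OF x] line_sub2[OF m]] .
 have "c = 0"
 proof (rule ccontr)
  assume "c ~= 0"
  then obtain u where "u : Pi x Int m" "u : NV" using sub_point[OF c(1)] by auto
  thus False using far[of u] LP[OF m] mem_Pi by blast
 qed
 hence U5: "sub U 5" using c(2) by simp
 have Us: "V.subspace U" using sub_subspace[OF U5] .
 interpret five L q U
  by unfold_locales (use U5 solV UV in blast)+
 have PxU: "Pi x \<subseteq> U" and mU: "m \<subseteq> U" unfolding U_def
  using ssum_upper1[OF line_subspace[OF m]] ssum_upper2[OF Pi_subspace[OF x]] by auto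
 have xC: "x : C" using x PxU by (simp add: CU_def)
 have mLU: "m : LU U" using m mU by (simp add: LU_def)
 have mid: "EX w. w : C & v : C & col x w & col w v & w ~= x & w ~= v" if v: "v : P" "v : m" "d2 x v" for v
 proof -
  obtain w where w: "w : P" "col x w" "col w v" using v(3) unfolding d2_def by blast
  obtain l k where l: "l : L" "x : l" "w : l" and k: "k : L" "w : k" "v : k" using w(2,3) unfolding col_def by blast
  have nxv: "~ col x v" using far[OF v(1,2)] .
  have wm: "w ~: m" using far[OF w(1)] w(2) by blast
  have wv: "w ~= v" "w ~= x" using nxv w(2,3) by blast+
  have lU: "l : LU U" using CU_line[OF xC l(1,2)] .
  have "k \<subseteq> U" using line_subset[OF k(1) Us w(1) v(1) wv(1) k(2,3)] l(3) lU v(2) mU unfolding LU_def by blast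
  hence kU: "k : LU U" using k(1) by (simp add: LU_def)
  have "l ~= k" using nxv l k colI by blast
  hence "w : C" using CU_I[OF w(1) lU kU _ l(3) k(2) Us] by blast
  moreover have "k ~= m" using wm k(2) by blast
  hence "v : C" using CU_I[OF v(1) kU mLU _ k(3) v(2) Us] by blast
  ultimately show ?thesis using w wv by blast
 qed
 obtain w where w: "w : C" "y : C" "col x w" "col w y" "w ~= x" "w ~= y" using mid[OF y] by blast
 obtain w' where w': "w' : C" "z : C" "col x w'" "col w' z" "w' ~= x" "w' ~= z" using mid[OF z] by blast
 have wP: "w : P" "w' : P" using w(1) w'(1) CU_P by auto
 have wm: "w ~: m" "w' ~: m" using far[OF wP(1)] far[OF wP(2)] w(3) w'(3) by auto
 have xm: "x ~: m" using far[OF x] col_refl[OF x] by blast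
 have ww: "w ~= w'"
 proof
  assume e: "w = w'"
  have "EX l:L. w : l & y : l & z : l" using triangle[OF wP(1) y(1) z(1) w(4) _ colI[OF m y(2) z(2)] yz] w'(4) e by blast
  then obtain l where l: "l : L" "w : l" "y : l" "z : l" by blast
  thus False using line_unique[OF l(1) m y(1) z(1) yz l(3,4) y(2) z(2)] wm(1) by blast
 qed
 have c5: "5 <= card C"
 proof -
  have "card {x, w, w', y, z} = 5" using w w' ww wm xm y(2) z(2) yz by (auto simp: card_insert_if)
  moreover have "{x, w, w', y, z} \<subseteq> C" using xC w w' by blast
  ultimately show ?thesis using card_mono[OF CU_finite] by metis
 qed
 obtain lw where lw: "lw : L" "x : lw" "w : lw" using w(3) unfolding col_def by blast
 obtain lw' where lw': "lw' : L" "x : lw'" "w' : lw'" using w'(3) unfolding col_def by blast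
 \<comment> \<open>There are \<open>q + 1\<close> lines through \<open>x\<close>, hence at least
   three; the two that lead to \<open>w\<close> and \<open>w'\<close> are avoided.\<close>
 have "card {lw, lw'} <= q" using card_length[of "[lw, lw']"] q_ge2 by simp
 then obtain a where a: "a : L" "x : a" "a ~: {lw, lw'}" using other_line[OF x, of "{lw, lw'}"] by blast
 have aw: "w ~: a" using line_unique[OF a(1) lw(1) x wP(1) w(5)[symmetric] a(2) _ lw(2,3)] a(3) by blast
 have aw': "w' ~: a" using line_unique[OF a(1) lw'(1) x wP(2) w'(5)[symmetric] a(2) _ lw'(2,3)] a(3) by blast
 have aU: "a : LU U" using CU_line[OF xC a(1,2)] .
 have aPx: "a \<subseteq> Pi x" using Ln_Pi[OF a(1,2)] .
 \<comment> \<open>Some line through \<open>v\<close> lies in \<open>S\<close>, and it is skew to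
   \<open>a\<close>, since a point of \<open>a\<close> on it would be the common neighbour
   \<open>u\<close> of \<open>x\<close> and \<open>v\<close>. One skew line suffices, as their
   number is divisible by \<open>q\<close>.\<close>
 have big: "card (dis a S) >= q" if h: "S : hyps U 4 a" "v : S" "v : P" "v : m" "v : C" "u : P" "col x u" "col u v" "u ~: a" for S v u
 proof -
  have S: "sub S 4" "a \<subseteq> S" "S \<subseteq> U" using h(1) by (auto simp: hyps_def)
  have nxv: "~ col x v" using far[OF h(3,4)] .
  obtain e where e: "sub (Pi v Int S) e" "3 + 4 <= 5 + e" using sub_Int_ge[OF Pi_sub[OF h(3)] S(1) U5 _ S(3)] h(5) unfolding CU_def by blast
  obtain p where p: "p : Pi v Int S" "p : NV" "p ~= v" using sub_point2[OF e(1) _ P_NV[OF h(3)]] e(2) by auto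
  obtain k where k: "k : L" "v : k" "p : k" using p(1) unfolding Pi_def by blast
  have kS: "k \<subseteq> S" using line_subset[OF k(1) sub_subspace[OF S(1)] LP[OF k(1,3) p(2)] h(3) p(3) k(3,2)] p(1) h(2) by blast
  have "k Int a = {0}"
  proof (rule ccontr)
   assume n: "k Int a ~= {0}"
   have "k ~= a" using k(2) nxv a(1,2) colI by blast
   then obtain t where t: "t : P" "t : k" "t : a" using lines_meet[OF k(1) a(1) _ n] by blast
   have "t = u" using common_nbr_unique[OF x h(3) t(1) h(6) nxv colI[OF a(1,2) t(3)] colI[OF k(1,2) t(2)] h(7) col_sym[OF h(8)]] .
   thus False using t(3) h(9) by blast
  qed
  hence "k : dis a S" using k(1) kS by (simp add: dis_def LU_def)
  hence "card (dis a S) > 0" using card_gt_0_iff dis_finite by blast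
  thus ?thesis using dvd_imp_le[OF dis_solid[OF aU h(1)]] by blast
 qed
 have plane: "sub (a \<oplus> V.span {v}) 3" "a \<oplus> V.span {v} \<subseteq> U" "card (hyps U 4 (a \<oplus> V.span {v})) = q + 1"
  "!!S. S : hyps U 4 (a \<oplus> V.span {v}) ==> S : hyps U 4 a & v : S" if v: "v : P" "v : m" for v
 proof -
  have "v ~: a" using far[OF v] aPx mem_Pi by blast
  thus s: "sub (a \<oplus> V.span {v}) 3" using sub_insert[OF line_sub2[OF a(1)]] by (simp add: numeral_3_eq_3 numeral_2_eq_2)
  show i: "a \<oplus> V.span {v} \<subseteq> U" using ssum_least[OF Us] aU span_subset_iff[OF Us, of v] v(2) mU unfolding LU_def by blast
  show "card (hyps U 4 (a \<oplus> V.span {v})) = q + 1" using card_hyps[of U 4 "a \<oplus> V.span {v}" 3] U5 s i q_card by (simp add: numeral_2_eq_2)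
  show "S : hyps U 4 a & v : S" if S: "S : hyps U 4 (a \<oplus> V.span {v})" for S
  proof -
   have S': "sub S 4" "a \<oplus> V.span {v} \<subseteq> S" "S \<subseteq> U" using S by (auto simp: hyps_def)
   have "a \<subseteq> S & V.span {v} \<subseteq> S" using ssum_subset_iff[OF line_subspace[OF a(1)] V.subspace_span sub_subspace[OF S'(1)]] S'(2) by blast
   thus ?thesis using S' V.span_base[of v "{v}"] by (auto simp: hyps_def)
  qed
 qed
 let ?A = "hyps U 4 (a \<oplus> V.span {y})" and ?B = "hyps U 4 (a \<oplus> V.span {z})"
 have fh: "finite (hyps U 4 W)" for W using finite_hyps[OF sub_finite[OF U5]] .
 have low: "2 * q^2 + 2 * q + 1 <= card (LU U)"
 proof -
  have am: "a Int m = {0}"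
  proof (rule ccontr)
   assume n: "a Int m ~= {0}"
   have "a ~= m" using a(2) xm by blast
   then obtain t where t: "t : P" "t : a" "t : m" using lines_meet[OF a(1) m _ n] by blast
   thus False using far[OF t(1,3)] colI[OF a(1,2) t(2)] by blast
  qed
  obtain e where e: "sub (a Int m) e" "sub (a \<oplus> m) (2 + 2 - e)" using sub_Int[OF line_sub2[OF a(1)] line_sub2[OF m]] .
  have "e = 0" using sub_unique[OF e(1)] am sub_0_zero by simp
  hence s4: "sub (a \<oplus> m) 4" using e(2) by simp
  \<comment> \<open>A solid through \<open>a\<close>, \<open>y\<close> and \<open>z\<close> contains
    the line \<open>m\<close>, so only the span of \<open>a\<close> and \<open>m\<close> belongs to
    both families.\<close>
  have "?A Int ?B \<subseteq> {a \<oplus> m}"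
  proof
   fix S assume S: "S : ?A Int ?B"
   hence S': "S : hyps U 4 a" "y : S" "z : S" using plane(4)[OF y(1,2)] plane(4)[OF z(1,2)] by blast+
   hence s: "sub S 4" "a \<subseteq> S" by (auto simp: hyps_def)
   have "m \<subseteq> S" using line_subset[OF m sub_subspace[OF s(1)] y(1) z(1) yz y(2) z(2) S'(2,3)] .
   hence "a \<oplus> m \<subseteq> S" using ssum_least[OF sub_subspace[OF s(1)] s(2)] by blast
   thus "S : {a \<oplus> m}" using sub_eq[OF s4 s(1)] by simp
  qed
  hence "card (?A Int ?B) <= 1" using card_mono[of "{a \<oplus> m}"] by simp
  hence cAB: "card (?A Un ?B) >= 2 * q + 1" using card_Un_Int[OF fh fh, of "a \<oplus> V.span {y}" "a \<oplus> V.span {z}"] plane(3)[OF y(1,2)] plane(3)[OF z(1,2)] by linarith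
  have "(2 * q + 1) * q <= card (?A Un ?B) * q" using cAB by (rule mult_right_mono) simp
  also have "... = (\<Sum>S\<in>?A Un ?B. q)" by simp
  also have "... <= (\<Sum>S\<in>?A Un ?B. card (dis a S))"
  proof (rule sum_mono)
   fix S assume S: "S : ?A Un ?B"
   thus "q <= card (dis a S)"
   proof
    assume "S : ?A"
    thus ?thesis using big[of S y w] plane(4)[OF y(1,2)] y w wP(1) aw by blast
   next
    assume "S : ?B"
    thus ?thesis using big[of S z w'] plane(4)[OF z(1,2)] z w' wP(2) aw' by blast
   qed
  qed
  also have "... <= (\<Sum>S\<in>hyps U 4 a. card (dis a S))"
   by (rule sum_mono2[OF fh]) (use plane(4)[OF y(1,2)] plane(4)[OF z(1,2)] in blast, simp)
  also have "... = card (dis a U)" using dis_U[OF aU] by simp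
  finally have 1: "(2 * q + 1) * q <= card (dis a U)" .
  have "x : a Int C" using a(2) xC by blast
  hence "card (a Int C) > 0" using card_gt_0_iff[of "a Int C"] CU_finite[of U] by blast
  hence "q * 1 <= q * card (a Int C)" by (intro mult_left_mono) simp_all
  hence "1 + q + (2 * q + 1) * q <= card (LU U)" using meet_count[OF Us aU] 1 by linarith
  thus ?thesis by (simp add: algebra_simps power2_eq_square)
 qed
 interpret heavy6 L q U
  by unfold_locales (use c5 low tot hpV UV in blast)+
 show False by (rule impossible)
qed

theorem theorem2:
  fixes L :: "(nat \<Rightarrow> 'a::{field,finite}) set set" and n q :: nat
  assumes "q = card (UNIV :: 'a set)" and "n \<ge> 2"
    and "L \<subseteq> lines n" and "L \<noteq> {}"
  shows "is_natural_hexagon n L \<longleftrightarrow>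
    ((\<forall>P\<in>points n. card {l\<in>L. P \<subseteq> l} \<in> {0, q + 1}) \<and>
     (\<forall>\<pi>\<in>planes n. card {l\<in>L. l \<subseteq> \<pi>} \<in> {0, 1, q + 1}) \<and>
     (\<forall>S\<in>solids n. card {l\<in>L. l \<subseteq> S} \<in> {0, 1, q + 1, 2 * q + 1}) \<and>
     (\<forall>H\<in>psub n 5. card {l\<in>L. l \<subseteq> H} \<le> q^4 - q^3 + 3 * q^2 + 2 * q) \<and>
     card L \<le> q^5 + q^4 + q^3 + q^2 + q + 1)" (is "_ \<longleftrightarrow> ?pt \<and> ?pl \<and> ?sd \<and> ?hp \<and> ?to")
proof
 assume "is_natural_hexagon n L"
 note c = natural_conditions[OF this assms(1)]
 show "?pt & ?pl & ?sd & ?hp & ?to" using c(1-5) by blast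
next
 assume h: "?pt & ?pl & ?sd & ?hp & ?to"
 have N: "q^5 + q^4 + q^3 + q^2 + q + 1 = (q^3 + 1) * (q^2 + q + 1)" by (simp add: algebra_simps eval_nat_numeral)
 interpret F: flat L q
  by (rule flat_of_counts[OF assms(1,3,4)]) (use h in blast)+
 have Ln: "\<Union>L \<subseteq> pvec n" using assms(3) by (auto simp: psub_def)
 have VVn: "F.VV \<subseteq> pvec n" unfolding F.VV_def by (rule V.span_minimal[OF Ln subspace_pvec])
 have sol: "card (F.LU S) : {0, 1, q + 1, 2 * q + 1}" if "sub S 4" "S \<subseteq> F.VV" for S
 proof -
  have "S : solids n" using that VVn by (auto simp: psub_iff eval_nat_numeral)
  thus ?thesis using h unfolding F.LU_def by blast
 qed
 have hp: "card (F.LU H) <= q^4 - q^3 + 3 * q^2 + 2 * q" if "sub H 6" "H \<subseteq> F.VV" for H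
 proof -
  have "H : psub n 5" using that VVn by (auto simp: psub_iff eval_nat_numeral)
  thus ?thesis using h unfolding F.LU_def by blast
 qed
 have tot: "card L <= (q^3 + 1) * (q^2 + q + 1)" using h N by simp
 interpret X: hexagon L q
 proof
  show "card L <= (q^3 + 1) * (q^2 + q + 1)" by (rule tot)
  fix x m y z
  assume g: "x : F.P" "m : L" "!!u. u : F.P ==> u : m ==> ~ F.col x u" "y : F.P" "z : F.P" "y : m" "z : m" "F.d2 x y" "F.d2 x z"
  show "y = z" using F.pentagon_free[OF sol hp tot g(1,2,3,4,6,8,5,7,9)] by blast
 qed
 \<comment> \<open>In dimension 6 all of \<open>L\<close> would lie in one subspace governed by
   (Hp'), but the exact value of \<open>card L\<close> from \<open>X.L_card\<close> is larger than
   that bound.\<close>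
 have "~ sub F.VV 6"
 proof
  assume "sub F.VV 6"
  hence "card (F.LU F.VV) <= q^4 - q^3 + 3 * q^2 + 2 * q" using hp by blast
  moreover have "F.LU F.VV = L" unfolding F.LU_def using X.VV_L by blast
  ultimately have "q^5 + q^4 + q^3 + q^2 + q + 1 <= q^4 - q^3 + 3 * q^2 + 2 * q" using X.L_card N by simp
  moreover have "8 * q^2 <= q^5"
  proof -
   have "q^2 * 8 <= q^2 * q^3" using power_mono[OF F.q_ge2, of 3] by (intro mult_left_mono) simp_all
   thus ?thesis by (simp add: eval_nat_numeral)
  qed
  moreover have "2 * q <= q^2" using F.q_ge2 by (simp add: power2_eq_square)
  ultimately show False by linarith
 qed
 hence "hex7 L q" using X.VV_dim by unfold_locales blast
 moreover have "card (hex_lines :: (nat => 'a) set set) <= (q^3 + 1) * (q^2 + q + 1)"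
  using hexagon.total[OF hexagon_hex_lines] assms(1) by simp
 ultimately show "is_natural_hexagon n L" using hex7.natural Ln by blast
qed

end
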